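(* (i) Assume that $q$ is not a root of unity. The nonzero finite dimensional representations of $\mathcal H\!\mathcal H$ other than those of the half-integral case (the case $t=q^{\pm(m+1/2)}$, $m\in\mathbb Z_+$) exist only for $t=-q^{\pm n/2}$ with an integer $n>0$. Given such $q,t$, such a representation is unique, has dimension $2n$, and is irreducible. For $t=-q^{-n/2}$ it is isomorphic to $V_{2n}=\mathcal P/(e_{-n})$. The automorphisms $\varsigma_x$ and $\varsigma_y$ do not change its isomorphism class; the representation $\iota(V_{2n})$, corresponding to $t=-q^{n/2}$, is not a quotient of $\mathcal P$ for such $t$. (ii) Let $t=-q^{-n/2}$. The series $\mu_k^0$ and the pairing $\langle f,g\rangle$ on $\mathcal P$ are well defined for such $t$. The values $e_m(t^{-1/2})$ of $e_m$ at $X=t^{-1/2}$ and the scalar squares $\langle e_m,e_m\rangle$ are nonzero precisely for $m=0,1,-1,\ldots,-n+1,n$. The radical $Rad_0$ of the pairing $\langle f,g\rangle$ coincides with the ideal $(e_{-n})$, so its restriction to $V_{2n}$ is well defined. (iii) For $t=-q^{-n/2}$, the discretization map (restriction of Laurent polynomials in $X$ to the set below) identifies $V_{2n}$ with the space of functions on the set of values of $X$ $$\Bigl\{t^{-1/2}q^{\frac{1-n}{2}},\ldots,t^{-1/2},\ t^{1/2}q^{1/2},\ldots,t^{1/2}q^{\frac n2}\Bigr\}.$$ Its kernel coincides with $(e_{-n})$ and is the radical $Rad$ of the pairing $\{f,g\}=f(Y^{-1})(g)\big|_{X\mapsto t^{-1/2}}$.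
   Context: The double affine Hecke algebra $\mathcal H\!\mathcal H$ (type $A_1$, parameters $q^{1/2},t^{1/2}\in\mathbb C^*$) is generated by $X^{\pm1},Y^{\pm1},T$ with relations $TXT=X^{-1}$, $TY^{-1}T=Y$, $Y^{-1}X^{-1}YXT^2q^{1/2}=1$, $(T-t^{1/2})(T+t^{-1/2})=0$. Powers $q^{m/2}$ mean $(q^{1/2})^m$. Polynomial representation $\mathcal P=\mathbb C[X^{\pm1}]$: $X$ acts by multiplication, $T=t^{1/2}s+\frac{t^{1/2}-t^{-1/2}}{X^2-1}(s-1)$, $Y=\pi T$, with $s(X)=X^{-1}$, $\pi(X)=q^{1/2}X^{-1}$. (Auto)morphisms: $\iota$: $T\mapsto -T$, $X\mapsto X$, $Y\mapsto Y$, $q^{1/2}\mapsto q^{1/2}$, $t^{1/2}\mapsto t^{-1/2}$ (it turns representations for $t^{1/2}$ into representations for $t^{-1/2}$); $\varsigma_y$: $Y\mapsto -Y$, fixing $T,X,q^{1/2},t^{1/2}$; $\varsigma_x$: $X\mapsto -X$, fixing $T,Y,q^{1/2},t^{1/2}$. $\mu_k=\prod_{j\ge0}\frac{(1-q^{j}X^2)(1-q^{j+1}X^{-2})}{(1-tq^{j}X^2)(1-tq^{j+1}X^{-2})}$, $\langle\cdot\rangle$ is the constant term of a Laurent series in $X$, $\mu_k^0=\mu_k/\langle\mu_k\rangle$ (a Laurent series whose coefficients are rational functions of $q,t$). The pairing is $\langle f,g\rangle=\langle f\bar g\mu_k^0\rangle$, where the bar inverts $X,q,t$ and their fractional powers (in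 statements involving this pairing $q$ is treated as a formal parameter over $\mathbb C$). Order: $X^m\prec X^n$ if $|m|<|n|$ or $m=-n>0$. The nonsymmetric polynomials $e_n$ are determined for generic $q,t$ by $e_n=X^n+(\text{lower terms with respect to }\prec)$ and $\langle e_nX^{-m}\mu_k^0\rangle=0$ for $X^m\prec X^n$; their coefficients are rational functions of $q,t$ which are then specialized to the given $q,t$. In $f(Y^{-1})$, the operator $Y^{-1}$ is substituted for $X$ in $f$. $(g)$ denotes the ideal of $\mathcal P$ generated by $g$.
   Formalization: Uniqueness, dimension 2n and irreducibility are stated for indecomposable (in particular irreducible) finite dimensional representations, since for arbitrary ones they fail: V_{2n}⊕V_{2n} is finite dimensional for the same q,t, has dimension 4n and is reducible. *)

theory Defs
  imports
    "HOL-Library.Poly_Mapping"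
    "HOL-Computational_Algebra.Computational_Algebra"
    "HOL-Analysis.Infinite_Products"
    "HOL-Algebra.AbelCoset"
    "Jordan_Normal_Form.VS_Connect"
begin

text \<open>
  Throughout, \<open>qh\<close> and \<open>th\<close> stand for \<open>q\<^sup>1\<^sup>/\<^sup>2\<close> and \<open>t\<^sup>1\<^sup>/\<^sup>2\<close>;
  thus \<open>q = qh\<^sup>2\<close>, \<open>t = th\<^sup>2\<close>, and \<open>q\<close> to the power \<open>m/2\<close> is \<open>qh\<close> to the power \<open>m\<close>.
\<close>


section \<open>Laurent polynomials\<close>

text \<open>The monoid algebra of \<open>(\<int>, +)\<close>, with the convolution product of \<^theory>\<open>HOL-Library.Poly_Mapping\<close>.\<close>

type_synonym 'k laurent = "int \<Rightarrow>\<^sub>0 'k"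

abbreviation lcoeff :: "'k::zero laurent \<Rightarrow> int \<Rightarrow> 'k" where
  "lcoeff \<equiv> Poly_Mapping.lookup"

abbreviation lmonom :: "'k::zero \<Rightarrow> int \<Rightarrow> 'k laurent" where
  "lmonom c m \<equiv> Poly_Mapping.single m c"

definition leval :: "'k::field laurent \<Rightarrow> 'k \<Rightarrow> 'k" where
  "leval f x = (\<Sum>m\<in>Poly_Mapping.keys f. lcoeff f m * x powi m)"

definition principal_ideal :: "'k::field laurent \<Rightarrow> 'k laurent set" where
  "principal_ideal g = {f. g dvd f}"

text \<open>The substitution \<open>X \<mapsto> c X\<inverse>\<close>: for \<open>c = 1\<close> it is \<open>s\<close>, for \<open>c = q\<^sup>1\<^sup>/\<^sup>2\<close> it is \<open>\<pi>\<close>.\<close>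

definition subst_inv :: "'k::field \<Rightarrow> 'k laurent \<Rightarrow> 'k laurent" where
  "subst_inv c f = (\<Sum>m\<in>Poly_Mapping.keys f. lmonom (lcoeff f m * c powi m) (- m))"

definition opT_poly :: "'k::field \<Rightarrow> 'k laurent \<Rightarrow> 'k laurent" where
  "opT_poly th f = lmonom th 0 * subst_inv 1 f
     + lmonom (th - inverse th) 0 * (THE g. (lmonom 1 2 - 1) * g = subst_inv 1 f - f)"

definition opY_poly :: "'k::field \<Rightarrow> 'k \<Rightarrow> 'k laurent \<Rightarrow> 'k laurent" where
  "opY_poly qh th f = subst_inv qh (opT_poly th f)"


section \<open>Representations of the double affine Hecke algebra\<close>

text \<open>
  The algebra is given by generators and relations, so a representation is a complex vector space
  with operators \<open>X\<close>, \<open>Y\<close> (invertible) and \<open>T\<close> satisfying the relations.  The fields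
  \<^const>\<open>monoid.mult\<close> and \<^const>\<open>monoid.one\<close>, inherited from HOL-Algebra's record of modules, are not used.
\<close>

record 'v hh_module = "(complex, 'v) module" +
  opX :: "'v \<Rightarrow> 'v"
  opY :: "'v \<Rightarrow> 'v"
  opT :: "'v \<Rightarrow> 'v"

definition opXinv :: "'v hh_module \<Rightarrow> 'v \<Rightarrow> 'v" where
  "opXinv M = inv_into (carrier M) (opX M)"

definition opYinv :: "'v hh_module \<Rightarrow> 'v \<Rightarrow> 'v" where
  "opYinv M = inv_into (carrier M) (opY M)"

locale hh_rep = vectorspace "class_ring :: complex ring" M
  for qh th :: complex and M :: "'v hh_module" (structure) +
  assumes opX_hom: "opX M \<in> module_hom class_ring M M"
    and opY_hom: "opY M \<in> module_hom class_ring M M"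
    and opT_hom: "opT M \<in> module_hom class_ring M M"
    and opX_bij: "bij_betw (opX M) (carrier M) (carrier M)"
    and opY_bij: "bij_betw (opY M) (carrier M) (carrier M)"
    and TXT: "v \<in> carrier M \<Longrightarrow> opT M (opX M (opT M v)) = opXinv M v"
    and TYT: "v \<in> carrier M \<Longrightarrow> opT M (opYinv M (opT M v)) = opY M v"
    and YXYX: "v \<in> carrier M \<Longrightarrow>
          opYinv M (opXinv M (opY M (opX M (opT M (opT M (qh \<odot> v)))))) = v"
    and T_quadratic: "v \<in> carrier M \<Longrightarrow>
          (let w = opT M v \<oplus> inverse th \<odot> v in opT M w \<ominus> th \<odot> w) = \<zero>"

definition hh_submodule :: "'v set \<Rightarrow> 'v hh_module \<Rightarrow> bool" where
  "hh_submodule N M \<longleftrightarrow> VectorSpace.subspace class_ring N M \<and>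
     (\<forall>F \<in> {opX M, opXinv M, opY M, opYinv M, opT M}. F ` N \<subseteq> N)"

definition hh_irreducible :: "'v hh_module \<Rightarrow> bool" where
  "hh_irreducible M \<longleftrightarrow> carrier M \<noteq> {\<zero>\<^bsub>M\<^esub>} \<and>
     (\<forall>N. hh_submodule N M \<longrightarrow> N = {\<zero>\<^bsub>M\<^esub>} \<or> N = carrier M)"

definition hh_indecomposable :: "'v hh_module \<Rightarrow> bool" where
  "hh_indecomposable M \<longleftrightarrow> carrier M \<noteq> {\<zero>\<^bsub>M\<^esub>} \<and>
     (\<forall>A B. hh_submodule A M \<and> hh_submodule B M \<and> A \<inter> B = {\<zero>\<^bsub>M\<^esub>} \<and> A <+>\<^bsub>M\<^esub> B = carrier M
        \<longrightarrow> A = {\<zero>\<^bsub>M\<^esub>} \<or> B = {\<zero>\<^bsub>M\<^esub>})"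

definition hh_iso :: "'v hh_module \<Rightarrow> 'w hh_module \<Rightarrow> bool" where
  "hh_iso M N \<longleftrightarrow> (\<exists>\<phi> \<in> module_hom class_ring M N. bij_betw \<phi> (carrier M) (carrier N) \<and>
     (\<forall>v \<in> carrier M. \<phi> (opX M v) = opX N (\<phi> v) \<and> \<phi> (opY M v) = opY N (\<phi> v) \<and>
                      \<phi> (opT M v) = opT N (\<phi> v)))"

abbreviation hh_fin_dim :: "'v hh_module \<Rightarrow> bool" where
  "hh_fin_dim M \<equiv> vectorspace.fin_dim class_ring M"

abbreviation hh_dim :: "'v hh_module \<Rightarrow> nat" where
  "hh_dim M \<equiv> vectorspace.dim class_ring M"

text \<open>
  \<open>M \<oplus> M\<close> is again a finite dimensional representation, so a classification up to isomorphism has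
  to be about indecomposable ones.
\<close>

definition fd_indecomposable_rep :: "complex \<Rightarrow> complex \<Rightarrow> 'v hh_module \<Rightarrow> bool" where
  "fd_indecomposable_rep qh th M \<longleftrightarrow> hh_rep qh th M \<and> hh_fin_dim M \<and> hh_indecomposable M"

text \<open>The quotient on cosets; meaningful when \<open>N\<close> is an \<^const>\<open>hh_submodule\<close>.\<close>

definition hh_quot :: "'v hh_module \<Rightarrow> 'v set \<Rightarrow> 'v set hh_module" where
  "hh_quot M N = \<lparr> carrier = a_rcosets\<^bsub>M\<^esub> N, mult = undefined, one = undefined,
     zero = N, add = (\<lambda>A B. A <+>\<^bsub>M\<^esub> B), smult = (\<lambda>c A. \<Union>v\<in>A. N +>\<^bsub>M\<^esub> (c \<odot>\<^bsub>M\<^esub> v)),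
     opX = (\<lambda>A. \<Union>v\<in>A. N +>\<^bsub>M\<^esub> opX M v),
     opY = (\<lambda>A. \<Union>v\<in>A. N +>\<^bsub>M\<^esub> opY M v),
     opT = (\<lambda>A. \<Union>v\<in>A. N +>\<^bsub>M\<^esub> opT M v) \<rparr>"

text \<open>
  Representations twisted by \<open>\<varsigma>\<^sub>x\<close>, \<open>\<varsigma>\<^sub>y\<close> and \<open>\<iota>\<close>.  The last one turns a representation for \<open>th\<close>
  into one for \<open>inverse th\<close>.
\<close>

definition twist_x :: "'v hh_module \<Rightarrow> 'v hh_module" where
  "twist_x M = M \<lparr> opX := \<lambda>v. \<ominus>\<^bsub>M\<^esub> opX M v \<rparr>"

definition twist_y :: "'v hh_module \<Rightarrow> 'v hh_module" where
  "twist_y M = M \<lparr> opY := \<lambda>v. \<ominus>\<^bsub>M\<^esub> opY M v \<rparr>"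

definition twist_iota :: "'v hh_module \<Rightarrow> 'v hh_module" where
  "twist_iota M = M \<lparr> opT := \<lambda>v. \<ominus>\<^bsub>M\<^esub> opT M v \<rparr>"

definition poly_rep :: "complex \<Rightarrow> complex \<Rightarrow> complex laurent hh_module" where
  "poly_rep qh th = \<lparr> carrier = UNIV, mult = (*), one = 1, zero = 0, add = (+),
     smult = (\<lambda>c f. lmonom c 0 * f),
     opX = (\<lambda>f. lmonom 1 1 * f), opY = opY_poly qh th, opT = opT_poly th \<rparr>"


section \<open>Rational functions of \<open>q\<close> and \<open>t\<close> and their specialization\<close>

text \<open>
  All the rational functions that occur have coefficients in \<open>\<rat>\<close>.  They live in \<open>\<rat>(q,t)\<close>, the
  fraction field of \<open>\<int>[t][q]\<close> (the outer polynomial variable is \<open>q\<close>), and this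
  allows one to specialize them to elements of an arbitrary field of characteristic zero.
\<close>

type_synonym ratfun = "int poly poly fract"

definition poly_qt :: "'k::field \<Rightarrow> 'k \<Rightarrow> int poly poly \<Rightarrow> 'k" where
  "poly_qt q t a = poly (map_poly (\<lambda>c. poly (map_poly of_int c) t) a) q"

definition regular_at :: "'k::field \<Rightarrow> 'k \<Rightarrow> ratfun \<Rightarrow> bool" where
  "regular_at q t r \<longleftrightarrow> (\<exists>a b. r = Fraction_Field.Fract a b \<and> poly_qt q t b \<noteq> 0)"

definition specialize :: "'k::field \<Rightarrow> 'k \<Rightarrow> ratfun \<Rightarrow> 'k" where
  "specialize q t r = (THE y. \<exists>a b. r = Fraction_Field.Fract a b \<and> poly_qt q t b \<noteq> 0 \<and>
                         y = poly_qt q t a / poly_qt q t b)"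


section \<open>The series \<open>\<mu>\<close>, the polynomials \<open>e\<^sub>n\<close> and the pairings\<close>

text \<open>
  The infinite product converges in the ring of power series in \<open>q\<close> whose coefficients are
  Laurent series in \<open>X\<close> over \<open>\<rat>(t)\<close>: at each power of \<open>q\<close> only finitely many negative powers
  of \<open>X\<close> occur.  This is the expansion of all the factors
  \<open>(1 - t q\<^sup>j X\<^sup>2)\<inverse>\<close> and \<open>(1 - t q\<^sup>j\<^sup>+\<^sup>1 X\<inverse>\<^sup>2)\<inverse>\<close> as geometric series.
\<close>

definition mu_series :: "int poly fract fls fps" where
  "mu_series =
    (let x = fps_const (fls_X ^ 2); x' = fps_const (inverse fls_X ^ 2);
         t = fps_const (fls_const (to_fract [:0, 1:])); q = fps_X
     in prodinf (\<lambda>j. ((1 - q ^ j * x) * (1 - q ^ (j + 1) * x')) /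
                     ((1 - t * q ^ j * x) * (1 - t * q ^ (j + 1) * x'))))"

text \<open>The coefficient of \<open>X\<^sup>k\<close> in \<open>\<mu>\<close>, a power series in \<open>q\<close>.\<close>

definition mu_coeff :: "int \<Rightarrow> int poly fract fps" where
  "mu_coeff k = Abs_fps (\<lambda>i. fls_nth (fps_nth mu_series i) k)"

text \<open>
  The coefficient of \<open>X\<^sup>k\<close> in \<open>\<mu>\<^sup>0 = \<mu> / \<langle>\<mu>\<rangle>\<close>: the rational function whose expansion in powers of
  \<open>q\<close> is \<open>mu_coeff k / mu_coeff 0\<close>.
\<close>

definition mu0 :: "int \<Rightarrow> ratfun" where
  "mu0 k = (THE r. \<exists>a b. b \<noteq> 0 \<and> r = Fraction_Field.Fract a b \<and>
     fps_of_poly (map_poly to_fract b) * mu_coeff k =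
     fps_of_poly (map_poly to_fract a) * mu_coeff 0)"

text \<open>The constant term of the product of a Laurent polynomial with the series
  \<open>\<Sum>\<^sub>k w\<^sub>k X\<^sup>k\<close>.\<close>

definition const_term :: "(int \<Rightarrow> 'k::field) \<Rightarrow> 'k laurent \<Rightarrow> 'k" where
  "const_term w f = (\<Sum>m\<in>Poly_Mapping.keys f. lcoeff f m * w (- m))"

definition prec :: "int \<Rightarrow> int \<Rightarrow> bool" where
  "prec m n \<longleftrightarrow> \<bar>m\<bar> < \<bar>n\<bar> \<or> (m = - n \<and> m > 0)"

definition e_generic :: "int \<Rightarrow> ratfun laurent" where
  "e_generic n = (THE e. lcoeff e n = 1 \<and> (\<forall>m. lcoeff e m \<noteq> 0 \<longrightarrow> m = n \<or> prec m n) \<and>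
     (\<forall>m. prec m n \<longrightarrow> const_term mu0 (e * lmonom 1 (- m)) = 0))"

definition e_regular :: "'k::field \<Rightarrow> 'k \<Rightarrow> int \<Rightarrow> bool" where
  "e_regular q t n \<longleftrightarrow> (\<forall>m. regular_at q t (lcoeff (e_generic n) m))"

definition e_poly :: "'k::field \<Rightarrow> 'k \<Rightarrow> int \<Rightarrow> 'k laurent" where
  "e_poly q t n = Poly_Mapping.map (specialize q t) (e_generic n)"

definition V2n :: "complex \<Rightarrow> complex \<Rightarrow> nat \<Rightarrow> complex laurent set hh_module" where
  "V2n qh th n = hh_quot (poly_rep qh th) (principal_ideal (e_poly (qh\<^sup>2) (th\<^sup>2) (- int n)))"

text \<open>
  The bar on scalars is a field involution inverting \<open>q\<^sup>1\<^sup>/\<^sup>2\<close>.  When \<open>t\<close> is specialized to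
  \<open>- q\<close> to the power \<open>- n/2\<close> this forces it to invert \<open>t\<close>, but, as \<open>t\<^sup>1\<^sup>/\<^sup>2\<close> then involves \<open>\<i>\<close>, a
  \<open>\<complex>\<close>-linear involution with \<open>q\<^sup>1\<^sup>/\<^sup>4 \<mapsto> q\<^sup>-\<^sup>1\<^sup>/\<^sup>4\<close> sends \<open>t\<^sup>1\<^sup>/\<^sup>2\<close> to \<open>- t\<^sup>-\<^sup>1\<^sup>/\<^sup>2\<close>, and the one that
  also conjugates the constants sends it to \<open>t\<^sup>-\<^sup>1\<^sup>/\<^sup>2\<close>.  The definition admits both.
\<close>

definition is_bar :: "'k::field \<Rightarrow> ('k \<Rightarrow> 'k) \<Rightarrow> bool" where
  "is_bar qh \<sigma> \<longleftrightarrow> \<sigma> 1 = 1 \<and> (\<forall>a b. \<sigma> (a + b) = \<sigma> a + \<sigma> b) \<and> (\<forall>a b. \<sigma> (a * b) = \<sigma> a * \<sigma> b) \<and>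
     (\<forall>a. \<sigma> (\<sigma> a) = a) \<and> \<sigma> qh = inverse qh"

definition lbar :: "('k::field \<Rightarrow> 'k) \<Rightarrow> 'k laurent \<Rightarrow> 'k laurent" where
  "lbar \<sigma> f = (\<Sum>m\<in>Poly_Mapping.keys f. lmonom (\<sigma> (lcoeff f m)) (- m))"

definition mu_pairing :: "('k::field \<Rightarrow> 'k) \<Rightarrow> 'k \<Rightarrow> 'k \<Rightarrow> 'k laurent \<Rightarrow> 'k laurent \<Rightarrow> 'k" where
  "mu_pairing \<sigma> q t f g = const_term (\<lambda>k. specialize q t (mu0 k)) (f * lbar \<sigma> g)"

text \<open>\<open>eval_Yinv qh th f g\<close> is \<open>f(Y\<inverse>)(g)\<close>.\<close>

definition eval_Yinv :: "'k::field \<Rightarrow> 'k \<Rightarrow> 'k laurent \<Rightarrow> 'k laurent \<Rightarrow> 'k laurent" where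
  "eval_Yinv qh th f g = (\<Sum>m\<in>Poly_Mapping.keys f. lmonom (lcoeff f m) 0 *
     (if m \<ge> 0 then (inv_into UNIV (opY_poly qh th) ^^ nat m) g else (opY_poly qh th ^^ nat (- m)) g))"

definition ev_pairing :: "'k::field \<Rightarrow> 'k \<Rightarrow> 'k laurent \<Rightarrow> 'k laurent \<Rightarrow> 'k" where
  "ev_pairing qh th f g = leval (eval_Yinv qh th f g) (inverse th)"

definition left_radical :: "('a \<Rightarrow> 'a \<Rightarrow> 'k::zero) \<Rightarrow> 'a set" where
  "left_radical B = {f. \<forall>g. B f g = 0}"

definition right_radical :: "('a \<Rightarrow> 'a \<Rightarrow> 'k::zero) \<Rightarrow> 'a set" where
  "right_radical B = {g. \<forall>f. B f g = 0}"

definition disc_set :: "'k::field \<Rightarrow> 'k \<Rightarrow> nat \<Rightarrow> 'k set" where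
  "disc_set qh th n = {inverse th * qh powi (- int j) | j. j < n} \<union> {th * qh ^ j | j. 1 \<le> j \<and> j \<le> n}"

definition discretize :: "'k::field set \<Rightarrow> 'k laurent \<Rightarrow> 'k \<Rightarrow> 'k" where
  "discretize S f = restrict (leval f) S"

text \<open>The field \<open>\<complex>(q\<^sup>1\<^sup>/\<^sup>4)\<close> of the statements where \<open>q\<close> is a formal parameter; it contains
  a square root of \<open>t = - q\<close> to the power \<open>- n/2\<close>.\<close>

type_synonym formal_field = "complex poly fract"

definition formal_qh :: formal_field where
  "formal_qh = (to_fract [:0, 1:])\<^sup>2"

end

theory Submission
  imports Defs "Jordan_Normal_Form.Char_Poly"
begin

text \<open>
The theorem has a computational half, about \<open>\<mu>\<^sup>0\<close> and the polynomials \<open>e\<^sub>m\<close>, and a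
representation theoretic half.  They meet in the ideal of Laurent polynomials that vanish on the
set \<open>S\<close> of part (iii).

\<^bold>\<open>Computation.\<close> The functional equations of the two factors of \<open>\<mu>\<close> make its coefficients satisfy a
recursion of first order, so that \<open>\<langle>X\<^sup>-\<^sup>2\<^sup>k \<mu>\<^sup>0\<rangle>\<close> is a product of factors
\<open>(t - q\<^sup>j) / (1 - t q\<^sup>j\<^sup>+\<^sup>1)\<close> (lemma \<open>mu0_eq\<close>).  The polynomials \<open>e\<^sub>m\<close> are then explicit
\<open>q\<close>-hypergeometric sums; orthogonality is a telescoping identity (\<open>psum_rec\<close>), and a two-term
recursion of Szego type between consecutive levels expresses values at \<open>t\<^sup>-\<^sup>1\<^sup>/\<^sup>2\<close> and scalar squares
as products of factors \<open>1 - t\<^sup>2 q\<^sup>j\<close>.  For \<open>t = - q\<^sup>-\<^sup>n\<^sup>/\<^sup>2\<close> one such factor, \<open>j = n\<close>, vanishes, which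
explains the range of \<open>m\<close> in (ii).  The \<open>q\<close>-binomial theorem turns \<open>e\<^sub>-\<^sub>n\<close> into the product of
\<open>X - x\<close> over \<open>x \<in> S\<close>, up to a unit, and turns the functional \<open>\<langle>f \<mu>\<^sup>0\<rangle>\<close> into a sum
of \<open>f(x)\<close> over \<open>S\<close> with nonzero masses (\<open>const_term_S\<close>).  Hence \<open>(e\<^sub>-\<^sub>n)\<close> is the ideal of \<open>S\<close>, and it is the
radical of the pairing.

\<^bold>\<open>Representations.\<close> A representation is given by \<open>X\<close>, \<open>T\<close> and the involution \<open>P = Y T\<inverse>\<close>.  This
description is self-dual: \<open>Y\<inverse>\<close>, \<open>T\<close> and \<open>X T\<close> satisfy the same relations (\<open>dual\<close>).  In finite
dimension the Laurent polynomials that act by zero form a nonzero ideal.  It is stable under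
\<open>X \<mapsto> q\<^sup>1\<^sup>/\<^sup>2 X\<inverse>\<close>, and under \<open>X \<mapsto> X\<inverse>\<close> away from the zeros of the squared intertwiner.  So its zeros form
chains \<open>x, x q\<^sup>1\<^sup>/\<^sup>2, x q, \<dots>\<close> that can end only where \<open>x\<^sup>2 = t\<^sup>\<plusminus>\<^sup>1\<close>.  Comparing the two ends of a chain
leaves the parameters in the theorem (\<open>parameter_cases\<close>), and for \<open>t = - q\<^sup>-\<^sup>n\<^sup>/\<^sup>2\<close> it shows that the
ideal is that of \<open>S\<close> (\<open>annihilator_eq\<close>).  By duality the same holds for \<open>Y\<inverse>\<close>.

The value \<open>t\<^sup>-\<^sup>1\<^sup>/\<^sup>2\<close> therefore occurs as an eigenvalue of \<open>Y\<inverse>\<close>, and the corresponding spectral projection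
commutes with \<open>T\<close>.  It yields a vector \<open>w\<close> with \<open>T w = t\<^sup>1\<^sup>/\<^sup>2 w\<close> and \<open>P w = w\<close>, so that
\<open>f \<mapsto> f(X) w\<close> is a homomorphism from the polynomial representation, and, dually, an invariant functional
that is nonzero at \<open>w\<close>.  As \<open>\<P>\<close> modulo the ideal of \<open>S\<close> is irreducible (\<open>poly_quotient_irreducible\<close>),
the functional is nondegenerate on the submodule generated by \<open>w\<close>, which therefore splits off
(\<open>cyclic_splitting\<close>).  An indecomposable representation is thus isomorphic to \<open>\<P> / (e\<^sub>-\<^sub>n)\<close>, and uniqueness
gives the invariance under the sign automorphisms.  Irreducibility also identifies both radicals of
the evaluation pairing, each being a proper stable subspace that contains the ideal of \<open>S\<close>.
\<close>

section \<open>Laurent polynomials and evaluation\<close>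

abbreviation cst :: "'k::zero \<Rightarrow> 'k laurent" where "cst c \<equiv> lmonom c 0"
abbreviation XX :: "'k::zero_neq_one laurent" where "XX \<equiv> lmonom 1 1"

lemma laurent_expand: "(f :: 'k::comm_monoid_add laurent) = (\<Sum>m\<in>Poly_Mapping.keys f. lmonom (lcoeff f m) m)"
proof (rule poly_mapping_eqI)
  fix k
  have "lcoeff (\<Sum>m\<in>Poly_Mapping.keys f. lmonom (lcoeff f m) m) k
      = (\<Sum>m\<in>Poly_Mapping.keys f. if m = k then lcoeff f k else 0)"
    unfolding lookup_sum by (intro sum.cong refl) (auto simp: lookup_single)
  also have "\<dots> = lcoeff f k"
    by (simp add: in_keys_iff)
  finally show "lcoeff f k = lcoeff (\<Sum>m\<in>Poly_Mapping.keys f. lmonom (lcoeff f m) m) k" ..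
qed

text \<open>Linear statements about Laurent polynomials need only be checked on monomials.\<close>

lemma laurent_induct [case_names add monom]:
  assumes add: "\<And>f g. P f \<Longrightarrow> P g \<Longrightarrow> P (f + g)" and mon: "\<And>c m. P (lmonom c m)"
  shows "P (f :: 'k::comm_monoid_add laurent)"
proof -
  have "P (\<Sum>m\<in>A. lmonom (lcoeff f m) m)" if "finite A" for A
    using that by (induction A) (use mon[of 0 0] in \<open>auto intro: add mon\<close>)
  then show ?thesis using laurent_expand[of f] by (metis finite_keys)
qed

lemma single_power: "lmonom (a::'k::comm_semiring_1) m ^ k = lmonom (a ^ k) (int k * m)"
  by (induction k) (auto simp: mult_single algebra_simps)

lemma leval_add: "leval (f + g) x = leval f x + leval g x"
  unfolding leval_def
  by (rule setsum_keys_plus_distrib) (auto simp: algebra_simps)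

lemma leval_single [simp]: "leval (lmonom c m) x = c * x powi m"
  unfolding leval_def by (cases "c = 0") auto

lemma leval_0 [simp]: "leval 0 x = 0" by (simp add: leval_def)
lemma leval_1 [simp]: "leval 1 x = 1"
  by (metis leval_single single_one power_int_0_right mult_1)

lemma leval_uminus: "leval (- f) x = - leval f x"
  using leval_add[of f "- f" x] by (simp add: eq_neg_iff_add_eq_0 add.commute)

lemma leval_diff: "leval (f - g) x = leval f x - leval g x"
  using leval_add[of f "- g" x] by (simp add: leval_uminus)

lemma leval_mult: "x \<noteq> 0 \<Longrightarrow> leval (f * g) x = leval f x * leval g x"
proof (induction f rule: laurent_induct)
  case (monom c m)
  then show ?case
  proof (induction g rule: laurent_induct)
    case (monom d k)
    then show ?case by (simp add: mult_single power_int_add algebra_simps)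
  qed (auto simp: leval_add algebra_simps)
qed (auto simp: leval_add algebra_simps)

lemma leval_sum: "leval (sum f A) x = (\<Sum>i\<in>A. leval (f i) x)"
  by (induction A rule: infinite_finite_induct) (auto simp: leval_add)

lemma leval_prod: "x \<noteq> 0 \<Longrightarrow> leval (prod f A) x = (\<Prod>i\<in>A. leval (f i) x)"
  by (induction A rule: infinite_finite_induct) (auto simp: leval_mult)

lemmas leval_hom = leval_add leval_diff leval_uminus leval_mult leval_sum leval_prod

lemma subst_inv_add: "subst_inv c (f + g) = subst_inv c f + subst_inv c g"
  unfolding subst_inv_def
  by (rule setsum_keys_plus_distrib) (auto simp: single_add algebra_simps)

lemma subst_inv_single [simp]: "subst_inv c (lmonom a m) = lmonom (a * c powi m) (- m)"
  unfolding subst_inv_def by (cases "a = 0") auto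

lemma subst_inv_0 [simp]: "subst_inv c 0 = 0" by (simp add: subst_inv_def)
lemma subst_inv_1 [simp]: "subst_inv c 1 = 1"
  by (metis subst_inv_single single_one power_int_0_right mult_1 minus_zero)

lemma subst_inv_uminus: "subst_inv c (- f) = - subst_inv c f"
  using subst_inv_add[of c f "- f"] by (simp add: eq_neg_iff_add_eq_0 add.commute)

lemma subst_inv_diff: "subst_inv c (f - g) = subst_inv c f - subst_inv c g"
  using subst_inv_add[of c f "- g"] by (simp add: subst_inv_uminus)

lemma subst_inv_mult: "c \<noteq> 0 \<Longrightarrow> subst_inv c (f * g) = subst_inv c f * subst_inv c g"
proof (induction f rule: laurent_induct)
  case (monom a m)
  then show ?case
  proof (induction g rule: laurent_induct)
    case (monom d k)
    then show ?case by (simp add: mult_single power_int_add algebra_simps)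
  qed (auto simp: subst_inv_add algebra_simps)
qed (auto simp: subst_inv_add algebra_simps)

lemma subst_inv_subst_inv [simp]: "c \<noteq> 0 \<Longrightarrow> subst_inv c (subst_inv c f) = f"
proof (induction f rule: laurent_induct)
  case (monom a m)
  then show ?case by (simp add: power_int_minus mult.assoc)
qed (auto simp: subst_inv_add)

lemma leval_subst_inv: "c \<noteq> 0 \<Longrightarrow> x \<noteq> 0 \<Longrightarrow> leval (subst_inv c f) x = leval f (c / x)"
proof (induction f rule: laurent_induct)
  case (monom a m)
  then show ?case by (simp add: power_int_minus power_int_divide_distrib field_simps)
qed (auto simp: subst_inv_add leval_add)

lemmas subst_inv_hom = subst_inv_add subst_inv_diff subst_inv_uminus subst_inv_mult

text \<open>The divided difference in the Demazure--Lusztig operator \<^const>\<open>opT_poly\<close>.\<close>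

definition divdiff :: "'k::field laurent \<Rightarrow> 'k laurent" where
  "divdiff f = (THE g. (lmonom 1 2 - 1) * g = subst_inv 1 f - f)"

lemma X_pow_minus_dvd:
  fixes x :: "'k::field"
  assumes "x \<noteq> 0" shows "(lmonom 1 k - cst x) dvd lmonom 1 (k * m) - cst (x powi m)"
proof -
  have nat: "(lmonom 1 k - cst x) dvd lmonom 1 (k * int n) - cst (x ^ n)" for n
  proof -
    have "(lmonom 1 k - cst x) dvd lmonom 1 k ^ n - cst x ^ n"
      by (rule dvdI[OF power_diff_sumr2])
    then show ?thesis by (simp add: single_power mult.commute)
  qed
  show ?thesis
  proof (cases "m \<ge> 0")
    case True
    then show ?thesis using nat[of "nat m"] by (simp add: power_int_def)
  next
    case False
    define n where "n = nat (- m)"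
    have m: "m = - int n" using False by (simp add: n_def)
    have "lmonom 1 (k * m) - cst (x powi m)
      = (lmonom 1 (k * int n) - cst (x ^ n)) * (- lmonom (x powi m) (k * m))"
      using assms by (simp add: m algebra_simps mult_single power_int_minus)
    then show ?thesis using nat[of n] by (metis dvd_mult2)
  qed
qed

lemma XX2_ne: "(lmonom (1::'k::field) 2 - 1 :: 'k laurent) \<noteq> 0"
proof
  assume "(lmonom (1::'k) 2 - 1 :: 'k laurent) = 0"
  then have "lcoeff (lmonom (1::'k) 2 - 1 :: 'k laurent) 2 = 0" by simp
  then show False by (simp add: lookup_minus lookup_single lookup_one)
qed

lemma divdiff_ex: "\<exists>g. (lmonom (1::'k::field) 2 - 1) * g = subst_inv 1 f - f"
proof (induction f rule: laurent_induct)
  case (add f g)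
  then obtain a b where "(lmonom (1::'k) 2 - 1) * a = subst_inv 1 f - f"
     "(lmonom (1::'k) 2 - 1) * b = subst_inv 1 g - g" by blast
  then have "(lmonom (1::'k) 2 - 1) * (a + b) = subst_inv 1 (f + g) - (f + g)"
    by (simp only: distrib_left subst_inv_add) simp
  then show ?case by blast
next
  case (monom c m)
  have "(lmonom (1::'k) 2 - cst 1) dvd lmonom 1 (2 * m) - cst (1 powi m)"
    by (rule X_pow_minus_dvd) auto
  then obtain g where g: "lmonom 1 (2 * m) - 1 = (lmonom (1::'k) 2 - 1) * g"
    by (auto elim: dvdE)
  have "subst_inv 1 (lmonom c m) - lmonom c m = - lmonom c (- m) * (lmonom 1 (2 * m) - 1)"
    by (simp add: algebra_simps mult_single)
  also have "\<dots> = (lmonom (1::'k) 2 - 1) * (- lmonom c (- m) * g)"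
    unfolding g by (simp only: mult.left_commute)
  finally show ?case by metis
qed

lemma divdiff_eq: "(lmonom 1 2 - 1) * divdiff f = subst_inv 1 f - f"
  unfolding divdiff_def
  by (rule theI') (metis divdiff_ex XX2_ne mult_left_cancel)

lemma divdiff_unique: "(lmonom 1 2 - 1) * g = subst_inv 1 f - f \<Longrightarrow> divdiff f = g"
  using divdiff_eq[of f] XX2_ne by (metis mult_left_cancel)

lemma opT_poly_eq: "opT_poly th f = cst th * subst_inv 1 f + cst (th - inverse th) * divdiff f"
  by (simp add: opT_poly_def divdiff_def)

lemma divdiff_add: "divdiff (f + g) = divdiff f + divdiff g"
  by (rule divdiff_unique) (simp only: distrib_left divdiff_eq subst_inv_add, simp)

lemma divdiff_cst_mult: "divdiff (cst a * f) = cst a * divdiff f"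
proof (rule divdiff_unique)
  show "(lmonom 1 2 - 1) * (cst a * divdiff f) = subst_inv 1 (cst a * f) - cst a * f"
    using divdiff_eq[of f] by (simp add: subst_inv_mult mult.left_commute right_diff_distrib)
qed

text \<open>The twisted Leibniz rule. It is the reason why the commutation rule between \<open>T\<close> and \<open>X\<close> extends from generators to all Laurent polynomials.\<close>

lemma divdiff_mult: "divdiff (f * g) = subst_inv 1 f * divdiff g + divdiff f * g"
proof (rule divdiff_unique)
  have "(lmonom 1 2 - 1) * (subst_inv 1 f * divdiff g + divdiff f * g)
    = subst_inv 1 f * ((lmonom 1 2 - 1) * divdiff g) + ((lmonom 1 2 - 1) * divdiff f) * g"
    by (simp add: algebra_simps)
  also have "\<dots> = subst_inv 1 (f * g) - f * g"
    unfolding divdiff_eq by (simp add: subst_inv_mult algebra_simps)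
  finally show "(lmonom 1 2 - 1) * (subst_inv 1 f * divdiff g + divdiff f * g)
      = subst_inv 1 (f * g) - f * g" .
qed

lemma divdiff_subst_inv: "divdiff (subst_inv 1 f) = - divdiff f"
  by (rule divdiff_unique) (simp add: divdiff_eq)

lemma divdiff_cst [simp]: "divdiff (cst a) = 0" by (rule divdiff_unique) simp
lemma divdiff_1 [simp]: "divdiff 1 = 0" by (rule divdiff_unique) simp
lemma divdiff_XX: "divdiff XX = - lmonom 1 (- 1)"
  by (rule divdiff_unique) (simp add: mult_single algebra_simps)

lemma leval_divdiff: "x \<noteq> 0 \<Longrightarrow> (x\<^sup>2 - 1) * leval (divdiff f) x = leval f (inverse x) - leval f x"
  using arg_cong[OF divdiff_eq[of f], of "\<lambda>h. leval h x"]
  by (simp add: leval_hom leval_subst_inv divide_inverse)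

section \<open>Ideals of functions vanishing on a finite set\<close>

definition vpoly :: "'k::field set \<Rightarrow> 'k laurent" where
  "vpoly S = (\<Prod>x\<in>S. XX - cst x)"

lemma leval_vpoly: "y \<noteq> 0 \<Longrightarrow> leval (vpoly S) y = (\<Prod>x\<in>S. y - x)"
  by (simp add: vpoly_def leval_hom)

lemma root_imp_dvd: 
  assumes "x \<noteq> (0::'k::field)" shows "(XX - cst x) dvd f - cst (leval f x)"
proof (induction f rule: laurent_induct)
  case (add f g)
  then show ?case using dvd_add[OF add] by (simp add: leval_add single_add algebra_simps)
next
  case (monom c m)
  have "lmonom c m - cst (leval (lmonom c m) x) = cst c * (lmonom 1 m - cst (x powi m))"
    by (simp add: algebra_simps mult_single)
  then show ?case using X_pow_minus_dvd[OF assms, of 1 m] by simp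
qed

lemma root_iff_dvd: "x \<noteq> (0::'k::field) \<Longrightarrow> (XX - cst x) dvd f \<longleftrightarrow> leval f x = 0"
  using root_imp_dvd[of x f] by (auto elim!: dvdE simp: leval_hom)

text \<open>Laurent polynomials over a field form a principal ideal domain in which \<open>X\<close> is a unit; so distinct nonzero roots contribute coprime linear factors.\<close>

lemma vpoly_dvd_iff:
  assumes "finite S" "0 \<notin> S"
  shows "vpoly S dvd f \<longleftrightarrow> (\<forall>x\<in>S. leval f x = 0)"
  using assms
proof (induction S arbitrary: f)
  case empty
  then show ?case by (simp add: vpoly_def)
next
  case (insert y S)
  then have y: "y \<noteq> 0" and S: "0 \<notin> S" by auto
  have vins: "vpoly (insert y S) = (XX - cst y) * vpoly S"
    using insert by (simp add: vpoly_def)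
  show ?case
  proof
    assume "vpoly (insert y S) dvd f"
    then obtain g where f: "f = vpoly (insert y S) * g" by (auto elim: dvdE)
    show "\<forall>x\<in>insert y S. leval f x = 0"
    proof
      fix x assume "x \<in> insert y S"
      moreover from this have "x \<noteq> 0" using y S by auto
      ultimately show "leval f x = 0" using insert.hyps
        by (auto simp: f leval_mult leval_vpoly)
    qed
  next
    assume *: "\<forall>x\<in>insert y S. leval f x = 0"
    then have "vpoly S dvd f" using insert.IH[OF S] by auto
    then obtain g where f: "f = vpoly S * g" by (auto elim: dvdE)
    have "leval (vpoly S) y \<noteq> 0" using y insert.hyps by (auto simp: leval_vpoly)
    then have "leval g y = 0" using * y by (auto simp: f leval_mult)
    then have "(XX - cst y) dvd g" using root_iff_dvd[OF y] by blast
    then show "vpoly (insert y S) dvd f" unfolding vins f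
      by (metis mult.commute mult_dvd_mono dvd_refl)
  qed
qed

text \<open>Lagrange interpolation: the function that is \<open>1\<close> at \<open>x\<close> and \<open>0\<close> at the other points of \<open>S\<close>.\<close>

definition delta :: "'k::field set \<Rightarrow> 'k \<Rightarrow> 'k laurent" where
  "delta S x = cst (inverse (\<Prod>y\<in>S - {x}. x - y)) * vpoly (S - {x})"

lemma leval_delta:
  assumes "finite S" "0 \<notin> S" "x \<in> S" "y \<in> S"
  shows "leval (delta S x) y = (if x = y then 1 else 0)"
proof -
  have "y \<noteq> 0" using assms by auto
  moreover have "(\<Prod>z\<in>S - {x}. x - z) \<noteq> 0" using assms by auto
  moreover have "x \<noteq> y \<Longrightarrow> (\<Prod>z\<in>S - {x}. y - z) = 0" using assms by auto
  ultimately show ?thesis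
    by (cases "x = y") (simp_all add: delta_def leval_hom leval_vpoly)
qed

lemma leval_interpolate:
  assumes "finite S" "0 \<notin> S" "y \<in> S"
  shows "leval (\<Sum>x\<in>S. cst (a x) * delta S x) y = a y"
proof -
  have "y \<noteq> 0" using assms by auto
  have "leval (\<Sum>x\<in>S. cst (a x) * delta S x) y = (\<Sum>x\<in>S. a x * leval (delta S x) y)"
    using \<open>y \<noteq> 0\<close> by (simp add: leval_hom)
  also have "\<dots> = (\<Sum>x\<in>S. if x = y then a x else 0)"
    using assms by (intro sum.cong) (auto simp: leval_delta)
  also have "\<dots> = a y" using assms by simp
  finally show ?thesis .
qed

section \<open>The nonsymmetric polynomials\<close>

text \<open>The shifted factorial \<open>(a; q)\<^sub>m\<close>.\<close>

definition poch :: "'k::field \<Rightarrow> 'k \<Rightarrow> nat \<Rightarrow> 'k" where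
  "poch a q m = (\<Prod>i<m. 1 - a * q ^ i)"

lemma poch_0 [simp]: "poch a q 0 = 1" by (simp add: poch_def)
lemma poch_Suc: "poch a q (Suc m) = poch a q m * (1 - a * q ^ m)" by (simp add: poch_def)

text \<open>The \<open>q\<close>-binomial coefficient times \<open>(t)\<^sub>j (tq)\<^sub>N\<^sub>-\<^sub>j / (tq)\<^sub>N\<close>: the coefficients of a family of Rogers--Szego type, normalized to be \<open>1\<close> at \<open>j = 0\<close>.\<close>

definition psi :: "'k::field \<Rightarrow> 'k \<Rightarrow> nat \<Rightarrow> nat \<Rightarrow> 'k" where
  "psi q t N j = poch q q N / (poch q q j * poch q q (N - j)) *
     (poch t q j * poch (t * q) q (N - j) / poch (t * q) q N)"

definition cpos :: "'k::field \<Rightarrow> 'k \<Rightarrow> nat \<Rightarrow> 'k" where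
  "cpos q t n = (\<Prod>j<n. (t - q ^ j) / (1 - t * q ^ Suc j))"

text \<open>The coefficient of \<open>X\<^sup>2\<^sup>k\<close> in \<open>\<mu>\<^sup>0\<close>; the case \<open>k < 0\<close> encodes the symmetry \<open>c\<^sub>-\<^sub>k = q\<^sup>k c\<^sub>k\<close>.\<close>

definition cc :: "'k::field \<Rightarrow> 'k \<Rightarrow> int \<Rightarrow> 'k" where
  "cc q t k = (if k \<ge> 0 then cpos q t (nat k) else q powi (- k) * cpos q t (nat (- k)))"

definition mu_weight :: "'k::field \<Rightarrow> 'k \<Rightarrow> int \<Rightarrow> 'k" where
  "mu_weight q t k = (if even k then cc q t (k div 2) else 0)"

definition e_neg :: "'k::field \<Rightarrow> 'k \<Rightarrow> nat \<Rightarrow> 'k laurent" where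
  "e_neg q t N = (\<Sum>j\<le>N. lmonom (psi q t N j) (2 * int j - int N))"

definition e_pos :: "'k::field \<Rightarrow> 'k \<Rightarrow> nat \<Rightarrow> 'k laurent" where
  "e_pos q t N = (\<Sum>j\<le>N. lmonom (psi q t N j * q ^ j) (int N + 1 - 2 * int j))"

definition e_explicit :: "'k::field \<Rightarrow> 'k \<Rightarrow> int \<Rightarrow> 'k laurent" where
  "e_explicit q t m = (if m \<le> 0 then e_neg q t (nat (- m)) else e_pos q t (nat (m - 1)))"

lemma const_term_add: "const_term w (f + g) = const_term w f + const_term w g"
  unfolding const_term_def
  by (rule setsum_keys_plus_distrib) (auto simp: algebra_simps)

lemma const_term_single [simp]: "const_term w (lmonom c m) = c * w (- m)"
  unfolding const_term_def by (cases "c = 0") auto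

lemma const_term_0 [simp]: "const_term w 0 = 0" by (simp add: const_term_def)

lemma const_term_sum: "const_term w (sum f A) = (\<Sum>i\<in>A. const_term w (f i))"
  by (induction A rule: infinite_finite_induct) (auto simp: const_term_add)

lemma const_term_uminus: "const_term w (- f) = - const_term w f"
  using const_term_add[of w f "- f"] by (simp add: eq_neg_iff_add_eq_0 add.commute)

lemma const_term_diff: "const_term w (f - g) = const_term w f - const_term w g"
  using const_term_add[of w f "- g"] by (simp add: const_term_uminus)

lemma const_term_cst_mult: "const_term w (cst a * f) = a * const_term w f"
proof (induction f rule: laurent_induct)
  case (monom c m)
  then show ?case by (simp add: mult_single)
qed (auto simp: const_term_add algebra_simps)

text \<open>The conditions under which the formulas below have no zero denominators. They hold both for the generic parameters and for \<open>t = - q\<^sup>-\<^sup>n\<^sup>/\<^sup>2\<close>, so everything is proved once.\<close>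

locale qt_params =
  fixes q t :: "'k::field"
  assumes q_nz: "q \<noteq> 0" and q_pow: "\<And>i. i > 0 \<Longrightarrow> q ^ i \<noteq> 1" and t_pow: "\<And>i. t * q ^ i \<noteq> 1"
begin

lemma qSuc: "q * q ^ i \<noteq> 1" using q_pow[of "Suc i"] by simp
lemma tqSuc: "t * (q * q ^ i) \<noteq> 1" using t_pow[of "Suc i"] by simp

lemma poch_q_nz: "poch q q m \<noteq> 0" 
  by (induction m) (use qSuc in \<open>auto simp: poch_Suc\<close>)

lemma poch_tq_nz: "poch (t * q) q m \<noteq> 0" 
  by (induction m) (use tqSuc in \<open>auto simp: poch_Suc mult.assoc\<close>)

lemma poch_tq: "poch (t * q) q m * (1 - t) = poch t q m * (1 - t * q ^ m)"
proof (induction m)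
  case (Suc m)
  have "poch (t * q) q (Suc m) * (1 - t) = poch (t * q) q m * (1 - t) * (1 - t * q * q ^ m)"
    by (simp add: poch_Suc mult_ac)
  then show ?case unfolding Suc.IH by (simp add: poch_Suc mult_ac)
qed simp

lemma psi_0 [simp]: "psi q t N 0 = 1"
  using poch_q_nz poch_tq_nz by (simp add: psi_def)

text \<open>Ratios of consecutive coefficients are stated without division, so that they can be fed into polynomial identities.\<close>

lemma psi_Suc:
  assumes "j < N"
  shows "psi q t N (Suc j) * ((1 - q ^ Suc j) * (1 - t * q ^ (N - j)))
       = psi q t N j * ((1 - q ^ (N - j)) * (1 - t * q ^ j))"
proof -
  obtain M where N: "N = j + Suc M" using assms less_imp_Suc_add by auto
  have [simp]: "N - j = Suc M" "N - Suc j = M" using N by auto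
  have nz: "poch q q N \<noteq> 0" "poch q q j \<noteq> 0" "poch q q M \<noteq> 0" "poch (t * q) q N \<noteq> 0"
    "poch (t * q) q M \<noteq> 0" "1 - q * q ^ j \<noteq> 0" "1 - q * q ^ M \<noteq> 0"
    using poch_q_nz poch_tq_nz qSuc by auto
  show ?thesis unfolding psi_def
    by (simp add: poch_Suc) (use nz in \<open>simp add: field_simps\<close>)
qed

lemma cpos_Suc: "cpos q t (Suc n) * (1 - t * q ^ Suc n) = (t - q ^ n) * cpos q t n"
  using tqSuc[of n] by (simp add: cpos_def)

lemma cc_minus: "cc q t (- k) = q powi k * cc q t k"
  using q_nz by (simp add: cc_def power_int_minus)

lemma cc_0 [simp]: "cc q t 0 = 1" by (simp add: cc_def cpos_def)

text \<open>The first order recursion holds for all integers, including the step across \<open>k = 0\<close>.\<close>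

lemma cc_rec: "cc q t (k + 1) * (1 - t * q powi (k + 1)) = (t - q powi k) * cc q t k"
proof (cases "k \<ge> 0")
  case True
  then obtain n where k: "k = int n" by (metis nonneg_int_cases)
  have "nat (int n + 1) = Suc n" by simp
  moreover have "int n + 1 = int (Suc n)" by simp
  ultimately show ?thesis using cpos_Suc[of n] by (simp only: k cc_def power_int_of_nat) simp
next
  case False
  then obtain n where k: "k = - int (Suc n)" using nonpos_int_cases[of k]
    by (metis int_cases linorder_not_le of_nat_0_le_iff)
  have k1: "k + 1 = - int n" by (simp add: k)
  have c: "cc q t (k + 1) = q ^ n * cpos q t n" "cc q t k = q ^ Suc n * cpos q t (Suc n)"
    unfolding k1 unfolding k by (auto simp: cc_def nat_add_distrib simp del: of_nat_Suc)
  have p: "q powi (k + 1) = inverse (q ^ n)" "q powi k = inverse (q ^ Suc n)"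
    unfolding k1 unfolding k by (auto simp: power_int_minus simp del: of_nat_Suc)
  have "q ^ n * cpos q t n * (1 - t * inverse (q ^ n)) = - ((t - q ^ n) * cpos q t n)"
    using q_nz by (simp add: field_simps)
  also have "\<dots> = - (cpos q t (Suc n) * (1 - t * q ^ Suc n))" using cpos_Suc[of n] by simp
  also have "\<dots> = (t - inverse (q ^ Suc n)) * (q ^ Suc n * cpos q t (Suc n))"
    using q_nz by (simp add: field_simps)
  finally show ?thesis unfolding c p .
qed

text \<open>The moment of the \<open>N\<close>-th polynomial in \<open>X\<^sup>2\<close> against \<open>X\<^sup>-\<^sup>2\<^sup>l\<close>.\<close>

definition psum :: "nat \<Rightarrow> nat \<Rightarrow> 'k" where
  "psum N l = (\<Sum>j\<le>N. psi q t N j * cc q t (int l - int j))"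

text \<open>Both sides are combinations of the same products \<open>\<psi>\<^sub>j c\<^sub>l\<^sub>-\<^sub>j\<close>; their difference telescopes in \<open>j\<close>, with the certificate \<open>\<psi>\<^sub>j c\<^sub>l\<^sub>+\<^sub>1\<^sub>-\<^sub>j (1 - q\<^sup>j)(1 - t q\<^sup>N\<^sup>+\<^sup>1\<^sup>-\<^sup>j)\<close>.\<close>

lemma psum_rec:
  assumes "l < N"
  shows "(q ^ (N - l) - 1) * (1 - t * q ^ Suc l) * psum N (Suc l)
       = (1 - q ^ l) * (t * q ^ (N - l) - 1) * psum N l"
proof -
  define A where "A j = (1 - q ^ (N - j)) * (1 - t * q ^ j)" for j
  define B where "B j = (1 - q ^ j) * (1 - t * q ^ (N + 1 - j))" for j
  define c where "c j = cc q t (int l - int j)" for j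
  define c' where "c' j = cc q t (int (Suc l) - int j)" for j
  have c'Suc: "c' (Suc j) = c j" for j by (simp add: c_def c'_def)
  have pw: "(q ^ (N - l) - 1) * (1 - t * q ^ Suc l) * c' j - (1 - q ^ l) * (t * q ^ (N - l) - 1) * c j
     = A j * c j - B j * c' j" if "j \<le> N" for j
  proof -
    define u where "u = q ^ j"
    define w where "w = q ^ (N - j)"
    define p where "p = q ^ (N - l)"
    define r where "r = q ^ l"
    define v where "v = q powi (int l - int j)"
    have u: "u \<noteq> 0" using q_nz by (simp add: u_def)
    have vu: "v * u = r" unfolding v_def u_def r_def 
      using q_nz by (simp add: power_int_diff)
    have rp: "r * p = u * w" unfolding r_def p_def u_def w_def
      using that assms by (simp flip: power_add)
    have vp: "v * p = w" using vu rp u 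
      by (metis mult.assoc mult.commute mult_left_cancel)
    have e1: "(int (Suc l) - int j) = (int l - int j) + 1" by simp
    have rc: "c' j * (1 - t * (q * v)) = (t - v) * c j"
      unfolding c'_def c_def e1 using cc_rec[of "int l - int j"] q_nz
      by (simp add: v_def power_int_add mult.commute)
    have "N + 1 - j = Suc (N - j)" using that by simp
    then have B: "B j = (1 - u) * (1 - t * (q * w))" by (simp add: B_def u_def w_def)
    have A: "A j = (1 - w) * (1 - t * u)" by (simp add: A_def u_def w_def)
    have "(p - 1) * (1 - t * (q * r)) + (1 - u) * (1 - t * (q * w)) = (p - u) * (1 - t * (q * v))"
    proof -
      have "(p - 1) * (1 - t * (q * r)) + (1 - u) * (1 - t * (q * w))
         = p - u + t * q * r - t * q * w - t * q * (r * p) + t * q * (u * w)"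
        by (simp add: algebra_simps)
      also have "\<dots> = p - u + t * q * (v * u) - t * q * (v * p)" by (simp add: rp vu vp)
      finally show ?thesis by (simp add: algebra_simps)
    qed
    moreover have "(1 - r) * (t * p - 1) + (1 - w) * (1 - t * u) = (p - u) * (t - v)"
    proof -
      have "(1 - r) * (t * p - 1) + (1 - w) * (1 - t * u)
         = t * p + r - t * u - w - t * (r * p) + t * (u * w)"
        by (simp add: algebra_simps)
      also have "\<dots> = t * p + v * u - t * u - v * p" by (simp add: rp vu vp)
      finally show ?thesis by (simp add: algebra_simps)
    qed
    ultimately have "((p - 1) * (1 - t * (q * r)) + (1 - u) * (1 - t * (q * w))) * c' j
        = ((1 - r) * (t * p - 1) + (1 - w) * (1 - t * u)) * c j"
      using rc by (simp add: mult.assoc mult.commute mult.left_commute)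
    then show ?thesis unfolding A B p_def[symmetric] r_def[symmetric] power_Suc
      by (simp add: algebra_simps)
  qed
  have "(\<Sum>j\<le>N. psi q t N j * (B j * c' j)) = (\<Sum>j\<le>N. psi q t N j * (A j * c j))"
  proof (cases N)
    case 0
    then show ?thesis by (simp add: A_def B_def)
  next
    case (Suc N')
    have "(\<Sum>j\<le>N. psi q t N j * (B j * c' j)) = (\<Sum>j\<le>N'. psi q t N (Suc j) * (B (Suc j) * c' (Suc j)))"
      unfolding Suc by (subst sum.atMost_Suc_shift) (simp add: B_def)
    also have "\<dots> = (\<Sum>j\<le>N'. psi q t N j * (A j * c j))"
    proof (intro sum.cong refl)
      fix j assume "j \<in> {..N'}"
      then have "j < N" using Suc by auto
      then show "psi q t N (Suc j) * (B (Suc j) * c' (Suc j)) = psi q t N j * (A j * c j)"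
        using psi_Suc[of j N] by (simp add: A_def B_def c'Suc mult.assoc[symmetric])
    qed
    also have "\<dots> = (\<Sum>j\<le>N. psi q t N j * (A j * c j))" by (simp add: Suc A_def)
    finally show ?thesis .
  qed
  then have "(\<Sum>j\<le>N. psi q t N j * (A j * c j - B j * c' j)) = 0"
    by (simp add: right_diff_distrib sum_subtractf)
  also have "(\<Sum>j\<le>N. psi q t N j * (A j * c j - B j * c' j))
     = (\<Sum>j\<le>N. psi q t N j * ((q ^ (N - l) - 1) * (1 - t * q ^ Suc l) * c' j 
          - (1 - q ^ l) * (t * q ^ (N - l) - 1) * c j))"
    using pw by (intro sum.cong refl) auto
  also have "\<dots> = (q ^ (N - l) - 1) * (1 - t * q ^ Suc l) * psum N (Suc l)
       - (1 - q ^ l) * (t * q ^ (N - l) - 1) * psum N l"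
    unfolding psum_def c_def c'_def sum_distrib_left sum_subtractf[symmetric]
    by (intro sum.cong refl) (simp only: right_diff_distrib mult.left_commute mult.assoc)
  finally show ?thesis by simp
qed

text \<open>The factor \<open>1 - q\<^sup>l\<close> of the recursion vanishes at \<open>l = 0\<close>. This starts the induction, and the remaining factors on the left are nonzero up to \<open>l = N\<close>.\<close>

lemma psum_0:
  assumes "0 < l" "l \<le> N" shows "psum N l = 0"
  using assms
proof (induction l)
  case (Suc l)
  have "(1 - q ^ l) * (t * q ^ (N - l) - 1) * psum N l = 0"
    using Suc by (cases "l = 0") auto
  then have "(q ^ (N - l) - 1) * (1 - t * q ^ Suc l) * psum N (Suc l) = 0"
    using psum_rec[of l N] Suc.prems by simp
  moreover have "q ^ (N - l) \<noteq> 1" using Suc.prems by (intro q_pow) auto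
  ultimately show ?case using t_pow[of "Suc l"] by auto
qed simp

text \<open>The reflection coefficient of the recursion between levels \<open>N\<close> and \<open>N + 1\<close>.\<close>

definition szego :: "nat \<Rightarrow> 'k" where "szego N = (1 - t) / (1 - t * q ^ Suc N)"

lemma psi_rev:
  assumes "0 < j" "j \<le> N"
  shows "psi q t N (N + 1 - j) * (1 - q ^ (N + 1 - j)) = psi q t N j * (1 - q ^ j)"
proof -
  obtain i where j: "j = Suc i" using assms by (cases j) auto
  obtain M where N: "N = i + Suc M" using assms less_imp_Suc_add[of i N] j by auto
  have [simp]: "N + 1 - j = Suc M" "N - Suc M = i" "N - j = M" using N j by auto
  have 1: "poch (t * q) q m = poch t q m * (1 - t * q ^ m) / (1 - t)" for m
    using poch_tq[of m] t_pow[of 0] by (simp add: field_simps)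
  have nz: "poch q q N \<noteq> 0" "poch q q i \<noteq> 0" "poch q q M \<noteq> 0"
    "1 - q * q ^ i \<noteq> 0" "1 - q * q ^ M \<noteq> 0" "1 - t \<noteq> 0"
    using poch_q_nz qSuc t_pow[of 0] by auto
  have 2: "poch t q (Suc M) * poch (t * q) q i = poch t q (Suc i) * poch (t * q) q M"
    using nz unfolding 1 poch_Suc by (simp add: field_simps)
  have 3: "psi q t N (Suc M) * (1 - q ^ Suc M) 
     = poch q q N / (poch q q M * poch q q i) * (poch t q (Suc M) * poch (t * q) q i) / poch (t * q) q N"
    unfolding psi_def using nz by (simp add: poch_Suc mult_ac)
  have 4: "psi q t N (Suc i) * (1 - q ^ Suc i) 
     = poch q q N / (poch q q M * poch q q i) * (poch t q (Suc i) * poch (t * q) q M) / poch (t * q) q N"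
    unfolding psi_def using nz \<open>N - j = M\<close> j by (simp add: poch_Suc mult_ac)
  show ?thesis unfolding \<open>N + 1 - j = Suc M\<close> unfolding j 3 4 2 ..
qed

lemma psi_Suc_N:
  assumes "j \<le> N"
  shows "psi q t (Suc N) j * ((1 - q ^ (N + 1 - j)) * (1 - t * q ^ Suc N))
       = psi q t N j * ((1 - q ^ Suc N) * (1 - t * q ^ (N + 1 - j)))"
proof -
  obtain M where N: "N = j + M" using assms le_Suc_ex by blast
  have [simp]: "N - j = M" "Suc N - j = Suc M" "N + 1 - j = Suc M" using N by auto
  have nz: "poch q q N \<noteq> 0" "poch q q j \<noteq> 0" "poch q q M \<noteq> 0" "poch (t * q) q N \<noteq> 0"
    "1 - q * q ^ N \<noteq> 0" "1 - q * q ^ M \<noteq> 0" "1 - t * (q * q ^ N) \<noteq> 0"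
    using poch_q_nz poch_tq_nz qSuc tqSuc by auto
  show ?thesis unfolding psi_def
    by (simp add: poch_Suc) (use nz in \<open>simp add: field_simps\<close>)
qed

lemma szego_rec:
  assumes "0 < j" "j \<le> N"
  shows "psi q t (Suc N) j = psi q t N j + szego N * (psi q t N (N + 1 - j) * q ^ (N + 1 - j))"
proof -
  define m where "m = q ^ (N + 1 - j)"
  define u where "u = q ^ j"
  have um: "u * m = q * q ^ N" unfolding u_def m_def using assms
    by (simp flip: power_add power_Suc)
  have nz: "1 - m \<noteq> 0" "1 - t * (q * q ^ N) \<noteq> 0"
    using q_pow[of "N + 1 - j"] assms tqSuc[of N] by (auto simp: m_def)
  have 1: "psi q t (Suc N) j = psi q t N j * ((1 - q * q ^ N) * (1 - t * m)) / ((1 - m) * (1 - t * (q * q ^ N)))"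
    using psi_Suc_N[OF assms(2)] nz by (simp add: nonzero_eq_divide_eq m_def)
  have 2: "psi q t N (N + 1 - j) = psi q t N j * (1 - u) / (1 - m)"
    using psi_rev[OF assms] nz by (simp add: nonzero_eq_divide_eq m_def u_def)
  have gen: "P * (M * E + e * (v * m)) / (M * E) = P + e / E * (P * v / M * m)"
    if "M \<noteq> 0" "E \<noteq> 0" for P M E e v m :: 'k
    using that by (simp add: field_simps)
  have "(1 - q * q ^ N) * (1 - t * m) = (1 - m) * (1 - t * (q * q ^ N)) + (1 - t) * ((1 - u) * m)"
    by (simp add: algebra_simps flip: um)
  then have "psi q t (Suc N) j = psi q t N j + (1 - t) / (1 - t * (q * q ^ N)) * (psi q t N j * (1 - u) / (1 - m) * m)"
    unfolding 1 using gen[OF nz] by simp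
  then show ?thesis unfolding 2 szego_def m_def by simp
qed

lemma psi_top: "psi q t (Suc N) (Suc N) = szego N"
proof -
  have "poch t q (Suc N) = poch (t * q) q N * (1 - t)"
    using poch_tq[of N] by (simp add: poch_Suc)
  moreover have "poch (t * q) q (Suc N) = poch (t * q) q N * (1 - t * q ^ Suc N)"
    by (simp add: poch_Suc mult.assoc)
  ultimately show ?thesis
    using poch_q_nz[of "Suc N"] poch_tq_nz[of N] by (simp add: psi_def szego_def)
qed

definition Psi :: "nat \<Rightarrow> 'k \<Rightarrow> 'k" where "Psi N z = (\<Sum>j\<le>N. psi q t N j * z ^ j)"
text \<open>The reversed polynomial that accompanies \<open>Psi\<close> in the Szego recursion; up to powers of \<open>X\<close> the two are the polynomials \<open>e\<^sub>-\<^sub>N\<close> and \<open>e\<^sub>N\<^sub>+\<^sub>1\<close> in the variable \<open>z = X\<^sup>2\<close>.\<close>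

definition Phi :: "nat \<Rightarrow> 'k \<Rightarrow> 'k" where "Phi N z = (\<Sum>j\<le>N. psi q t N j * q ^ j * z ^ (N - j))"

text \<open>The recursion in summed form, for an arbitrary linear functional \<open>z\<^sup>j \<mapsto> x j\<close>; it is used for evaluation at a point and for the scalar squares.\<close>

lemma szego_sum:
  "(\<Sum>j\<le>Suc N. psi q t (Suc N) j * x j) = (\<Sum>j\<le>N. psi q t N j * x j) 
     + szego N * (\<Sum>i\<le>N. psi q t N i * q ^ i * x (Suc N - i))"
proof -
  have "(\<Sum>j\<le>Suc N. psi q t (Suc N) j * x j) 
      = x 0 + (\<Sum>j\<in>{1..N}. psi q t (Suc N) j * x j) + szego N * x (Suc N)"
    by (simp add: psi_top atMost_atLeast0 sum.atLeast_Suc_atMost)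
  also have "(\<Sum>j\<in>{1..N}. psi q t (Suc N) j * x j) 
    = (\<Sum>j\<in>{1..N}. psi q t N j * x j) + szego N * (\<Sum>j\<in>{1..N}. psi q t N (N + 1 - j) * q ^ (N + 1 - j) * x j)"
    unfolding sum_distrib_left sum.distrib[symmetric]
    by (intro sum.cong refl) (auto simp: szego_rec algebra_simps)
  also have "(\<Sum>j\<in>{1..N}. psi q t N (N + 1 - j) * q ^ (N + 1 - j) * x j) 
      = (\<Sum>i\<in>{1..N}. psi q t N i * q ^ i * x (Suc N - i))"
    by (rule sum.reindex_bij_witness[of _ "\<lambda>i. N + 1 - i" "\<lambda>i. N + 1 - i"]) auto
  finally show ?thesis
    by (simp add: atMost_atLeast0 sum.atLeast_Suc_atMost algebra_simps)
qed

lemma Phi_rev: "z \<noteq> 0 \<Longrightarrow> Phi N z = z ^ N * Psi N (q / z)"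
  unfolding Phi_def Psi_def sum_distrib_left
  by (intro sum.cong refl) (simp add: power_divide power_diff field_simps)

lemma Psi_Suc: "Psi (Suc N) z = Psi N z + szego N * z * Phi N z"
  unfolding Psi_def szego_sum Phi_def sum_distrib_left
  by (intro arg_cong2[where f = "(+)"] sum.cong refl) (auto simp: Suc_diff_le mult_ac)

lemma Phi_Suc:
  assumes "z \<noteq> 0" shows "Phi (Suc N) z = z * Phi N z + szego N * q ^ Suc N * Psi N z"
proof -
  have "Phi N (q / z) = (q / z) ^ N * Psi N z"
    using Phi_rev[of "q / z" N] assms q_nz by simp
  then show ?thesis using assms 
    by (simp add: Phi_rev Psi_Suc power_divide field_simps)
qed

definition evalue :: "nat \<Rightarrow> 'k" where
  "evalue N = (\<Prod>j\<in>{1..N}. (1 - t\<^sup>2 * q ^ j) / (t * (1 - t * q ^ j)))"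

text \<open>At \<open>z = 1/t\<close> the two polynomials agree, so the two-term recursion collapses to a product.\<close>

lemma Psi_Phi_evalue:
  assumes "t \<noteq> 0" shows "Psi N (1 / t) = evalue N \<and> Phi N (1 / t) = evalue N"
proof (induction N)
  case 0
  then show ?case by (simp add: Psi_def Phi_def evalue_def)
next
  case (Suc N)
  have nz: "1 - t * (q * q ^ N) \<noteq> 0" using tqSuc by auto
  have ev: "evalue (Suc N) = evalue N * ((1 - t\<^sup>2 * q ^ Suc N) / (t * (1 - t * q ^ Suc N)))"
    by (simp add: evalue_def)
  have "1 + szego N / t = (1 - t\<^sup>2 * q ^ Suc N) / (t * (1 - t * q ^ Suc N))"
    unfolding szego_def using nz assms by (simp add: field_simps power2_eq_square)
  moreover have "1 / t + szego N * q ^ Suc N = (1 - t\<^sup>2 * q ^ Suc N) / (t * (1 - t * q ^ Suc N))"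
    unfolding szego_def using nz assms by (simp add: field_simps power2_eq_square)
  moreover have "Psi (Suc N) (1 / t) = evalue N * (1 + szego N / t)"
    using Suc by (simp add: Psi_Suc algebra_simps)
  moreover have "Phi (Suc N) (1 / t) = evalue N * (1 / t + szego N * q ^ Suc N)"
    using Suc assms by (simp add: Phi_Suc algebra_simps)
  ultimately show ?case unfolding ev by metis
qed

definition enorm :: "nat \<Rightarrow> 'k" where
  "enorm N = (\<Prod>j\<in>{1..N}. (1 - q ^ j) * (1 - t\<^sup>2 * q ^ j) / (1 - t * q ^ j)\<^sup>2)"

lemma cc_minus': "cc q t (- int j) = q ^ j * cc q t (int j)"
  using cc_minus[of "int j"] by simp

text \<open>The recursion multiplies the scalar square by one minus \<open>q\<^sup>N\<^sup>+\<^sup>1\<close> times the square of the reflection coefficient, and this factors.\<close>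

lemma psum_norm: "psum N 0 = enorm N"
proof (induction N)
  case 0
  then show ?case by (simp add: psum_def enorm_def)
next
  case (Suc N)
  define kap where "kap = psum N (Suc N)"
  have p0: "psum M 0 = (\<Sum>i\<le>M. psi q t M i * (q ^ i * cc q t (int i)))" for M
    unfolding psum_def by (simp add: cc_minus')
  have "0 = psum (Suc N) (Suc N)" by (simp add: psum_0)
  also have "\<dots> = kap + szego N * (\<Sum>i\<le>N. psi q t N i * q ^ i * cc q t (int (Suc N) - int (Suc N - i)))"
    unfolding psum_def szego_sum[of N "\<lambda>j. cc q t (int (Suc N) - int j)"] kap_def ..
  also have "(\<Sum>i\<le>N. psi q t N i * q ^ i * cc q t (int (Suc N) - int (Suc N - i))) = psum N 0"
    unfolding p0 by (intro sum.cong refl) (auto simp: of_nat_diff mult.assoc)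
  finally have kap: "kap = - szego N * psum N 0" by (simp add: eq_neg_iff_add_eq_0)
  have "psum (Suc N) 0 = psum N 0 + szego N * (\<Sum>i\<le>N. psi q t N i * q ^ i * (q ^ (Suc N - i) * cc q t (int (Suc N - i))))"
    unfolding p0 by (rule szego_sum)
  also have "(\<Sum>i\<le>N. psi q t N i * q ^ i * (q ^ (Suc N - i) * cc q t (int (Suc N - i)))) = q ^ Suc N * kap"
    unfolding kap_def psum_def sum_distrib_left
  proof (intro sum.cong refl)
    fix i assume i: "i \<in> {..N}"
    have e: "q ^ i * q ^ (Suc N - i) = q ^ Suc N" using i by (subst power_add[symmetric]) simp
    have d: "int (Suc N - i) = int (Suc N) - int i" using i by auto
    have "psi q t N i * q ^ i * (q ^ (Suc N - i) * cc q t (int (Suc N - i)))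
       = (q ^ i * q ^ (Suc N - i)) * (psi q t N i * cc q t (int (Suc N - i)))"
      by (simp only: mult_ac)
    then show "psi q t N i * q ^ i * (q ^ (Suc N - i) * cc q t (int (Suc N - i)))
       = q ^ Suc N * (psi q t N i * cc q t (int (Suc N) - int i))"
      by (simp only: e d)
  qed
  finally have "psum (Suc N) 0 = psum N 0 * (1 - q ^ Suc N * (szego N)\<^sup>2)"
    unfolding kap by (simp add: algebra_simps power2_eq_square)
  moreover have "1 - q ^ Suc N * (szego N)\<^sup>2 = (1 - q ^ Suc N) * (1 - t\<^sup>2 * q ^ Suc N) / (1 - t * q ^ Suc N)\<^sup>2"
  proof -
    define Q where "Q = q ^ Suc N"
    have E: "1 - t * Q \<noteq> 0" using tqSuc[of N] by (simp add: Q_def)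
    have "(1 - t * Q)\<^sup>2 - Q * (1 - t)\<^sup>2 = (1 - Q) * (1 - t\<^sup>2 * Q)"
      by (simp add: power2_eq_square algebra_simps)
    then have "1 - Q * ((1 - t)\<^sup>2 / (1 - t * Q)\<^sup>2) = (1 - Q) * (1 - t\<^sup>2 * Q) / (1 - t * Q)\<^sup>2"
      using E by (simp add: eq_divide_eq left_diff_distrib)
    then show ?thesis by (simp only: szego_def power_divide Q_def)
  qed
  ultimately show ?case by (simp add: Suc enorm_def)
qed

lemma lcoeff_e_neg: "lcoeff (e_neg q t N) m = (\<Sum>j\<le>N. if 2 * int j - int N = m then psi q t N j else 0)"
  unfolding e_neg_def lookup_sum by (intro sum.cong refl) (auto simp: lookup_single)

lemma lcoeff_e_pos: "lcoeff (e_pos q t N) m = (\<Sum>j\<le>N. if int N + 1 - 2 * int j = m then psi q t N j * q ^ j else 0)"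
  unfolding e_pos_def lookup_sum by (intro sum.cong refl) (auto simp: lookup_single)

lemma e_neg_support: "lcoeff (e_neg q t N) k \<noteq> 0 \<Longrightarrow> \<exists>j\<le>N. 2 * int j - int N = k"
  unfolding lcoeff_e_neg by (rule ccontr) (auto elim!: notE intro!: sum.neutral)

lemma e_pos_support: "lcoeff (e_pos q t N) k \<noteq> 0 \<Longrightarrow> \<exists>j\<le>N. int N + 1 - 2 * int j = k"
  unfolding lcoeff_e_pos by (rule ccontr) (auto elim!: notE intro!: sum.neutral)

lemma e_neg_top: "lcoeff (e_neg q t N) (- int N) = 1"
proof -
  have "lcoeff (e_neg q t N) (- int N) = (\<Sum>j\<le>N. if j = 0 then psi q t N j else 0)"
    unfolding lcoeff_e_neg by (intro sum.cong refl) auto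
  then show ?thesis by simp
qed

lemma e_pos_top: "lcoeff (e_pos q t N) (int N + 1) = 1"
proof -
  have "lcoeff (e_pos q t N) (int N + 1) = (\<Sum>j\<le>N. if j = 0 then psi q t N j else 0)"
    unfolding lcoeff_e_pos by (intro sum.cong refl) auto
  then show ?thesis by simp
qed

lemma e_explicit_top: "lcoeff (e_explicit q t m) m = 1"
  using e_neg_top[of "nat (- m)"] e_pos_top[of "nat (m - 1)"] by (auto simp: e_explicit_def)

lemma e_explicit_support:
  assumes "lcoeff (e_explicit q t m) k \<noteq> 0" shows "k = m \<or> prec k m"
proof (cases "m \<le> 0")
  case True
  then obtain j where "j \<le> nat (- m)" "2 * int j - int (nat (- m)) = k"
    using assms e_neg_support[of "nat (- m)" k] by (auto simp: e_explicit_def)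
  then show ?thesis using True by (auto simp: prec_def)
next
  case False
  then obtain j where "j \<le> nat (m - 1)" "int (nat (m - 1)) + 1 - 2 * int j = k"
    using assms e_pos_support[of "nat (m - 1)" k] by (auto simp: e_explicit_def)
  then show ?thesis using False by (auto simp: prec_def)
qed

lemma ct_e_neg:
  "const_term (mu_weight q t) (e_neg q t N * lmonom 1 (int N - 2 * int l)) = psum N l"
proof -
  have "const_term (mu_weight q t) (e_neg q t N * lmonom 1 (int N - 2 * int l))
    = (\<Sum>j\<le>N. psi q t N j * mu_weight q t (2 * (int l - int j)))"
    unfolding e_neg_def sum_distrib_right const_term_sum
    by (intro sum.cong refl) (simp add: mult_single algebra_simps)
  then show ?thesis by (simp add: psum_def mu_weight_def)
qed

lemma ct_e_pos:
  "const_term (mu_weight q t) (e_pos q t N * lmonom 1 (2 * int l - int N - 1)) = q ^ l * psum N l"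
proof -
  have "const_term (mu_weight q t) (e_pos q t N * lmonom 1 (2 * int l - int N - 1))
    = (\<Sum>j\<le>N. psi q t N j * q ^ j * mu_weight q t (2 * (- (int l - int j))))"
    unfolding e_pos_def sum_distrib_right const_term_sum
    by (intro sum.cong refl) (simp add: mult_single algebra_simps)
  also have "\<dots> = (\<Sum>j\<le>N. q ^ l * (psi q t N j * cc q t (int l - int j)))"
  proof (intro sum.cong refl)
    fix j
    have "q ^ j * q powi (int l - int j) = q ^ l" using q_nz by (simp add: power_int_diff)
    moreover have "mu_weight q t (2 * (- (int l - int j))) = q powi (int l - int j) * cc q t (int l - int j)"
      unfolding mu_weight_def using cc_minus[of "int l - int j"] by simp
    ultimately show "psi q t N j * q ^ j * mu_weight q t (2 * (- (int l - int j)))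
       = q ^ l * (psi q t N j * cc q t (int l - int j))" by (simp add: mult_ac) 
  qed
  finally show ?thesis by (simp add: psum_def sum_distrib_left)
qed

lemma ct_parity:
  assumes "\<And>k. lcoeff f k \<noteq> 0 \<Longrightarrow> odd (k - m)"
  shows "const_term (mu_weight q t) (f * lmonom 1 (- m)) = 0"
proof -
  have "const_term (mu_weight q t) (f * lmonom 1 (- m)) = 
     (\<Sum>k\<in>Poly_Mapping.keys f. lcoeff f k * mu_weight q t (m - k))"
    by (subst (1) laurent_expand[of f]) (simp add: sum_distrib_right mult_single const_term_sum)
  also have "\<dots> = 0" using assms by (intro sum.neutral) (auto simp: mu_weight_def in_keys_iff)
  finally show ?thesis .
qed

lemma e_explicit_parity: "lcoeff (e_explicit q t m) k \<noteq> 0 \<Longrightarrow> even (k - m)"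
proof (cases "m \<le> 0")
  case True
  assume "lcoeff (e_explicit q t m) k \<noteq> 0"
  then obtain j where "j \<le> nat (- m)" "2 * int j - int (nat (- m)) = k"
    using True e_neg_support[of "nat (- m)" k] by (auto simp: e_explicit_def)
  then have "k - m = 2 * int j" using True by simp
  then show ?thesis by simp
next
  case False
  assume "lcoeff (e_explicit q t m) k \<noteq> 0"
  then obtain j where "j \<le> nat (m - 1)" "int (nat (m - 1)) + 1 - 2 * int j = k"
    using False e_pos_support[of "nat (m - 1)" k] by (auto simp: e_explicit_def)
  then have "k - m = - 2 * int j" using False by simp
  then show ?thesis by simp
qed

lemma e_explicit_orth:
  assumes "prec k m"
  shows "const_term (mu_weight q t) (e_explicit q t m * lmonom 1 (- k)) = 0"
proof (cases "even (k - m)")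
  case False
  show ?thesis
  proof (rule ct_parity)
    fix i assume "lcoeff (e_explicit q t m) i \<noteq> 0"
    then have "even (i - m)" by (rule e_explicit_parity)
    then show "odd (i - k)" using False by presburger
  qed
next
  case True
  show ?thesis
  proof (cases "m \<le> 0")
    case m: True
    have "even (k + m)" "0 < k - m" "k - m \<le> - 2 * m" using True assms m by (auto simp: prec_def)
    then obtain l where l: "k - m = 2 * int l" 
      using True by (metis evenE nonneg_int_cases zero_le_mult_iff less_imp_le zero_less_numeral not_less)
    have "0 < l" "l \<le> nat (- m)" using l \<open>0 < k - m\<close> \<open>k - m \<le> - 2 * m\<close> by auto
    moreover have "- k = int (nat (- m)) - 2 * int l" using l m by simp
    ultimately show ?thesis using ct_e_neg[of "nat (- m)" l] psum_0[of l "nat (- m)"] m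
      by (simp add: e_explicit_def)
  next
    case m: False
    have "even (k + m)" "0 < m - k" "m - k < 2 * m" using True assms m by (auto simp: prec_def)
    moreover have "even (m - k)" using True by simp
    ultimately obtain l where l: "m - k = 2 * int l" 
      by (metis evenE nonneg_int_cases zero_le_mult_iff less_imp_le zero_less_numeral not_less)
    have "0 < l" "l \<le> nat (m - 1)" using l \<open>0 < m - k\<close> \<open>m - k < 2 * m\<close> by auto
    moreover have "- k = 2 * int l - int (nat (m - 1)) - 1" using l m by simp
    ultimately show ?thesis using ct_e_pos[of "nat (m - 1)" l] psum_0[of l "nat (m - 1)"] m
      by (simp add: e_explicit_def)
  qed
qed

definition e_level :: "int \<Rightarrow> nat" where
  "e_level m = (if m \<le> 0 then nat (- m) else nat (m - 1))"

lemma e_explicit_norm: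
  "const_term (mu_weight q t) (e_explicit q t m * lmonom 1 (- m)) = enorm (e_level m)"
  using ct_e_neg[of "nat (- m)" 0] ct_e_pos[of "nat (m - 1)" 0]
  by (auto simp: e_explicit_def psum_norm e_level_def)

lemma leval_e_explicit:
  assumes "x \<noteq> 0" "x\<^sup>2 = 1 / t"
  shows "leval (e_explicit q t m) x \<noteq> 0 \<longleftrightarrow> evalue (e_level m) \<noteq> 0"
proof -
  have t: "t \<noteq> 0" using assms by auto
  have n: "leval (e_neg q t N) x = x powi (- int N) * Psi N (1 / t)" for N
    unfolding e_neg_def leval_sum Psi_def sum_distrib_left assms(2)[symmetric]
    using assms(1) by (intro sum.cong refl) (simp add: power_int_diff power_int_minus power_int_mult divide_inverse)
  have p: "leval (e_pos q t N) x = x powi (1 - int N) * Phi N (1 / t)" for N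
    unfolding e_pos_def leval_sum Phi_def sum_distrib_left assms(2)[symmetric]
  proof (intro sum.cong refl)
    fix i assume i: "i \<in> {..N}"
    have "int N + 1 - 2 * int i = (1 - int N) + int (2 * (N - i))" using i by auto
    then have "x powi (int N + 1 - 2 * int i) = x powi (1 - int N) * x powi (int (2 * (N - i)))"
      using assms(1) by (metis power_int_add)
    then have "x powi (int N + 1 - 2 * int i) = x powi (1 - int N) * (x\<^sup>2) ^ (N - i)"
      by (simp only: power_int_of_nat power_mult)
    then show "leval (lmonom (psi q t N i * q ^ i) (int N + 1 - 2 * int i)) x
         = x powi (1 - int N) * (psi q t N i * q ^ i * (x\<^sup>2) ^ (N - i))"
      by simp
  qed
  show ?thesis using assms(1) Psi_Phi_evalue[OF t]
    by (simp add: e_explicit_def n p e_level_def)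
qed

definition position :: "int \<Rightarrow> nat" where
  "position m = (if m > 0 then nat (2 * m - 1) else nat (- 2 * m))"

lemma prec_iff_position: "prec k m \<longleftrightarrow> position k < position m"
  by (auto simp: prec_def position_def)

lemma inj_position: "position k = position m \<Longrightarrow> k = m"
  by (auto simp: position_def eq_nat_nat_iff split: if_splits) presburger+

lemma orth_lower_imp_zero:
  assumes enorm: "\<And>N. enorm N \<noteq> 0"
  assumes "\<And>k. lcoeff f k \<noteq> 0 \<Longrightarrow> position k < r"
    and "\<And>k. position k < r \<Longrightarrow> const_term (mu_weight q t) (f * lmonom 1 (- k)) = 0"
  shows "f = 0"
  using assms(2,3)
proof (induction r arbitrary: f)
  case 0
  then show ?case by (intro poly_mapping_eqI) auto
next
  case (Suc r)
  obtain m where m: "position m = r"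
  proof (cases "even r")
    case True
    then have "position (- (int r div 2)) = r" by (auto simp: position_def)
    then show thesis by (rule that)
  next
    case False
    then have "position ((int r + 1) div 2) = r" by (auto simp: position_def elim!: oddE)
    then show thesis by (rule that)
  qed
  define g where "g = f - cst (lcoeff f m) * e_explicit q t m"
  have lg: "lcoeff (cst a * h) k = a * lcoeff h k" for a h k
    by (induction h rule: laurent_induct) (auto simp: lookup_add algebra_simps mult_single lookup_single when_def)
  have "g = 0"
  proof (rule Suc.IH)
    fix k assume k: "lcoeff g k \<noteq> 0"
    have "k \<noteq> m" using k by (auto simp: g_def lookup_minus lg e_explicit_top)
    moreover have "position k < Suc r"
    proof -
      have "lcoeff f k \<noteq> 0 \<or> lcoeff (e_explicit q t m) k \<noteq> 0"
        using k by (auto simp: g_def lookup_minus lg)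
      then show ?thesis
        using Suc.prems(1)[of k] e_explicit_support[of m k] m by (auto simp: prec_iff_position)
    qed
    ultimately show "position k < r" using inj_position[of k m] m by linarith
  next
    fix k assume k: "position k < r"
    have "g * lmonom 1 (- k) = f * lmonom 1 (- k) - cst (lcoeff f m) * (e_explicit q t m * lmonom 1 (- k))"
      by (simp add: g_def algebra_simps)
    then show "const_term (mu_weight q t) (g * lmonom 1 (- k)) = 0"
      using Suc.prems(2)[of k] k e_explicit_orth[of k m] m
      by (simp add: const_term_diff const_term_cst_mult prec_iff_position)
  qed
  then have f: "f = cst (lcoeff f m) * e_explicit q t m" by (simp add: g_def)
  have "0 = const_term (mu_weight q t) (f * lmonom 1 (- m))" using Suc.prems(2)[of m] m by simp
  also have "\<dots> = lcoeff f m * enorm (e_level m)"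
    by (subst f) (simp add: mult.assoc const_term_cst_mult e_explicit_norm)
  finally have "lcoeff f m = 0" using enorm by simp
  then show ?case by (subst f) simp
qed

text \<open>The monomials are totally ordered by \<open>prec\<close>. Since all scalar squares are nonzero, a polynomial that has only lower terms and is orthogonal to all lower monomials is zero, by induction along this order; so leading term and orthogonality determine \<open>e\<^sub>n\<close>.\<close>

lemma e_explicit_unique:
  assumes enorm: "\<And>N. enorm N \<noteq> 0"
  shows "(THE e. lcoeff e n = 1 \<and> (\<forall>m. lcoeff e m \<noteq> 0 \<longrightarrow> m = n \<or> prec m n) \<and>
     (\<forall>m. prec m n \<longrightarrow> const_term (mu_weight q t) (e * lmonom 1 (- m)) = 0)) = e_explicit q t n"
proof (rule the_equality)
  show "lcoeff (e_explicit q t n) n = 1 \<and> (\<forall>m. lcoeff (e_explicit q t n) m \<noteq> 0 \<longrightarrow> m = n \<or> prec m n) \<and>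
     (\<forall>m. prec m n \<longrightarrow> const_term (mu_weight q t) (e_explicit q t n * lmonom 1 (- m)) = 0)"
    using e_explicit_top e_explicit_support e_explicit_orth by blast
next
  fix e assume e: "lcoeff e n = 1 \<and> (\<forall>m. lcoeff e m \<noteq> 0 \<longrightarrow> m = n \<or> prec m n) \<and>
     (\<forall>m. prec m n \<longrightarrow> const_term (mu_weight q t) (e * lmonom 1 (- m)) = 0)"
  have "e - e_explicit q t n = 0"
  proof (rule orth_lower_imp_zero[OF enorm, where r = "position n"])
    fix k assume k: "lcoeff (e - e_explicit q t n) k \<noteq> 0"
    then have "k \<noteq> n" using e e_explicit_top[of n] by (auto simp: lookup_minus)
    moreover have "k = n \<or> prec k n"
    proof -
      have "lcoeff e k \<noteq> 0 \<or> lcoeff (e_explicit q t n) k \<noteq> 0" using k by (auto simp: lookup_minus)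
      then show ?thesis using e e_explicit_support[of n k] by blast
    qed
    ultimately show "position k < position n" by (simp add: prec_iff_position)
  next
    fix k assume k: "position k < position n"
    then show "const_term (mu_weight q t) ((e - e_explicit q t n) * lmonom 1 (- k)) = 0"
      using e e_explicit_orth[of k n] by (simp add: left_diff_distrib const_term_diff prec_iff_position)
  qed
  then show "e = e_explicit q t n" by simp
qed

end

section \<open>Specialization of rational functions\<close>

lemma poly_of_int_hom: "comm_ring_hom (\<lambda>c. poly (map_poly of_int c) (t::'k::field))"
  by unfold_locales (auto simp: of_int_poly_hom.hom_add of_int_poly_hom.hom_mult)

lemma poly_qt_hom: "comm_ring_hom (poly_qt q t)"
proof -
  interpret h: comm_ring_hom "\<lambda>c. poly (map_poly of_int c) t" by (rule poly_of_int_hom)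
  interpret m: map_poly_comm_ring_hom "\<lambda>c. poly (map_poly of_int c) t" ..
  show ?thesis
    by unfold_locales (auto simp: poly_qt_def m.hom_add m.hom_mult)
qed

interpretation poly_qt: comm_ring_hom "poly_qt q t" for q t by (rule poly_qt_hom)

text \<open>The relational form of regularity and specialization together: it can be proved by following the construction of a rational function, whereas \<open>specialize\<close> itself is a description operator.\<close>

definition spec_at :: "'k::field \<Rightarrow> 'k \<Rightarrow> ratfun \<Rightarrow> 'k \<Rightarrow> bool" where
  "spec_at q t r y \<longleftrightarrow> (\<exists>a b. r = Fraction_Field.Fract a b \<and> poly_qt q t b \<noteq> 0 \<and>
                         y = poly_qt q t a / poly_qt q t b)"

text \<open>Independence of the chosen fraction: cross-multiply and apply the homomorphism \<open>poly_qt q t\<close>.\<close>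

lemma spec_at_unique:
  assumes "spec_at q t r y" "spec_at q t r y'" shows "y = y'"
proof -
  obtain a b where 1: "r = Fraction_Field.Fract a b" "poly_qt q t b \<noteq> 0" "y = poly_qt q t a / poly_qt q t b"
    using assms(1) by (auto simp: spec_at_def)
  obtain c d where 2: "r = Fraction_Field.Fract c d" "poly_qt q t d \<noteq> 0" "y' = poly_qt q t c / poly_qt q t d"
    using assms(2) by (auto simp: spec_at_def)
  have "b \<noteq> 0" "d \<noteq> 0" using 1 2 by auto
  then have "a * d = c * b" using 1(1) 2(1) by (simp add: eq_fract)
  then have "poly_qt q t a * poly_qt q t d = poly_qt q t c * poly_qt q t b"
    by (metis poly_qt.hom_mult)
  then show ?thesis using 1 2 by (simp add: frac_eq_eq)
qed

lemma spec_at_specialize: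
  assumes "spec_at q t r y" shows "specialize q t r = y"
proof -
  have "specialize q t r = (THE y. spec_at q t r y)"
    unfolding specialize_def spec_at_def ..
  also have "\<dots> = y"
    using assms by (rule the_equality) (rule spec_at_unique[OF _ assms])
  finally show ?thesis .
qed

lemma spec_at_regular: "spec_at q t r y \<Longrightarrow> regular_at q t r"
  by (auto simp: spec_at_def regular_at_def)

lemma spec_at_poly: "spec_at q t (Fraction_Field.Fract a 1) (poly_qt q t a)"
  unfolding spec_at_def by (intro exI[of _ a] exI[of _ 1]) auto

lemma spec_at_0 [simp]: "spec_at q t 0 0" and spec_at_1 [simp]: "spec_at q t 1 1"
  using spec_at_poly[of q t 0] spec_at_poly[of q t 1]
  by (auto simp: Zero_fract_def One_fract_def)

lemma spec_at_mult:
  assumes "spec_at q t r y" "spec_at q t s z" shows "spec_at q t (r * s) (y * z)"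
proof -
  obtain a b where 1: "r = Fraction_Field.Fract a b" "poly_qt q t b \<noteq> 0" "y = poly_qt q t a / poly_qt q t b"
    using assms(1) by (auto simp: spec_at_def)
  obtain c d where 2: "s = Fraction_Field.Fract c d" "poly_qt q t d \<noteq> 0" "z = poly_qt q t c / poly_qt q t d"
    using assms(2) by (auto simp: spec_at_def)
  show ?thesis unfolding spec_at_def
    by (intro exI[of _ "a * c"] exI[of _ "b * d"]) (use 1 2 in \<open>auto simp: poly_qt.hom_mult\<close>)
qed

lemma spec_at_diff:
  assumes "spec_at q t r y" "spec_at q t s z" shows "spec_at q t (r - s) (y - z)"
proof -
  obtain a b where 1: "r = Fraction_Field.Fract a b" "poly_qt q t b \<noteq> 0" "y = poly_qt q t a / poly_qt q t b"
    using assms(1) by (auto simp: spec_at_def)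
  obtain c d where 2: "s = Fraction_Field.Fract c d" "poly_qt q t d \<noteq> 0" "z = poly_qt q t c / poly_qt q t d"
    using assms(2) by (auto simp: spec_at_def)
  have "b \<noteq> 0" "d \<noteq> 0" using 1 2 by auto
  then show ?thesis unfolding spec_at_def using 1 2
    by (intro exI[of _ "a * d - c * b"] exI[of _ "b * d"])
      (auto simp: poly_qt.hom_mult poly_qt.hom_minus diff_frac_eq)
qed

lemma spec_at_divide:
  assumes "spec_at q t r y" "spec_at q t s z" "z \<noteq> 0" shows "spec_at q t (r / s) (y / z)"
proof -
  obtain a b where 1: "r = Fraction_Field.Fract a b" "poly_qt q t b \<noteq> 0" "y = poly_qt q t a / poly_qt q t b"
    using assms(1) by (auto simp: spec_at_def)
  obtain c d where 2: "s = Fraction_Field.Fract c d" "poly_qt q t d \<noteq> 0" "z = poly_qt q t c / poly_qt q t d"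
    using assms(2) by (auto simp: spec_at_def)
  have "poly_qt q t c \<noteq> 0" using 2 assms(3) by auto
  then show ?thesis unfolding spec_at_def
    by (intro exI[of _ "a * d"] exI[of _ "b * c"]) (use 1 2 in \<open>auto simp: poly_qt.hom_mult\<close>)
qed

lemma spec_at_power: "spec_at q t r y \<Longrightarrow> spec_at q t (r ^ n) (y ^ n)"
  by (induction n) (auto intro: spec_at_mult)

lemma spec_at_prod:
  "(\<And>i. i \<in> A \<Longrightarrow> spec_at q t (f i) (g i)) \<Longrightarrow> spec_at q t (prod f A) (prod g A)"
  by (induction A rule: infinite_finite_induct) (auto intro: spec_at_mult)

definition rQ :: ratfun where "rQ = Fraction_Field.Fract [:0, 1:] 1"
definition rT :: ratfun where "rT = Fraction_Field.Fract [:[:0, 1:]:] 1"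

lemma spec_at_rQ: "spec_at q t rQ q"
  using spec_at_poly[of q t "[:0, 1:]"] by (simp add: rQ_def poly_qt_def map_poly_pCons)

lemma spec_at_rT: "spec_at q t rT t"
  using spec_at_poly[of q t "[:[:0, 1:]:]"] by (simp add: rT_def poly_qt_def map_poly_pCons)

lemmas spec_intros = spec_at_mult spec_at_diff spec_at_divide spec_at_power spec_at_prod
  spec_at_0 spec_at_1 spec_at_rQ spec_at_rT

text \<open>A monomial in independent variables is not constant; this gives every non-vanishing condition for the generic parameters.\<close>

lemma rT_rQ_ne_1: "a > 0 \<or> b > 0 \<Longrightarrow> rT ^ a * rQ ^ b \<noteq> 1"
proof
  assume ab: "a > 0 \<or> b > 0" and eq: "rT ^ a * rQ ^ b = 1"
  have "spec_at (2::real) 3 (rT ^ a * rQ ^ b) (3 ^ a * 2 ^ b)"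
    by (intro spec_intros)
  then have eq: "(3::real) ^ a * 2 ^ b = 1" unfolding eq by (rule spec_at_unique) (rule spec_at_1)
  have less: "1 < x * y" if "1 \<le> x" "1 \<le> y" "1 < x \<or> 1 < y" for x y :: real
  proof -
    have "x * 1 \<le> x * y" using that by (intro mult_left_mono) auto
    moreover have "1 * y \<le> x * y" using that by (intro mult_right_mono) auto
    ultimately show ?thesis using that by linarith
  qed
  have "(1::real) < 3 ^ a * 2 ^ b"
  proof (rule less)
    show "(1::real) \<le> 3 ^ a" "(1::real) \<le> 2 ^ b" by (auto intro: one_le_power)
    show "(1::real) < 3 ^ a \<or> (1::real) < 2 ^ b"
      using ab one_less_power[of "3::real" a] one_less_power[of "2::real" b] by auto
  qed
  then show False unfolding eq by simp
qed

lemma qt_params_generic: "qt_params rQ rT"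
proof
  show "rQ \<noteq> 0"
  proof
    assume "rQ = 0"
    then have "spec_at (2::real) 3 0 2" using spec_at_rQ[of 2 3] by simp
    then show False using spec_at_unique[OF _ spec_at_0] by fastforce
  qed
  show "rQ ^ i \<noteq> 1" if "i > 0" for i using rT_rQ_ne_1[of 0 i] that by simp
  show "rT * rQ ^ i \<noteq> 1" for i using rT_rQ_ne_1[of 1 i] by simp
qed

lemma enorm_generic: "qt_params.enorm rQ rT N \<noteq> 0"
proof -
  have "1 - rQ ^ j \<noteq> 0" "1 - rT\<^sup>2 * rQ ^ j \<noteq> 0" "1 - rT * rQ ^ j \<noteq> 0" if "j > 0" for j
    using rT_rQ_ne_1[of 0 j] rT_rQ_ne_1[of 2 j] rT_rQ_ne_1[of 1 j] that by auto
  then show ?thesis unfolding qt_params.enorm_def[OF qt_params_generic]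
    by (subst prod_zero_iff) auto
qed

context qt_params
begin

lemma spec_poch: "spec_at q t a b \<Longrightarrow> spec_at q t (poch a rQ m) (poch b q m)"
  unfolding poch_def by (intro spec_intros)

lemma spec_psi: "spec_at q t (psi rQ rT N j) (psi q t N j)"
  unfolding psi_def
  by (intro spec_intros spec_poch) (use poch_q_nz poch_tq_nz in auto)

lemma spec_cpos: "spec_at q t (cpos rQ rT n) (cpos q t n)"
  unfolding cpos_def
  by (intro spec_intros) (use tqSuc in auto)

lemma spec_mu_weight: "spec_at q t (mu_weight rQ rT k) (mu_weight q t k)"
proof -
  have "spec_at q t (cc rQ rT k) (cc q t k)" for k
  proof (cases "k \<ge> 0")
    case False
    define n where "n = nat (- k)"
    have "cc x y k = x ^ n * cpos x y n" for x y :: "'z::field"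
      using False by (simp add: cc_def n_def power_int_def)
    then show ?thesis
      using spec_at_mult[OF spec_at_power[OF spec_at_rQ] spec_cpos] by metis
  qed (auto simp: cc_def spec_cpos)
  then show ?thesis by (simp add: mu_weight_def)
qed

lemma spec_sum: "finite A \<Longrightarrow> (\<And>i. i \<in> A \<Longrightarrow> spec_at q t (f i) (g i)) \<Longrightarrow> spec_at q t (sum f A) (sum g A)"
proof (induction A rule: finite_induct)
  case (insert x A)
  have "spec_at q t (f x - (0 - sum f A)) (g x - (0 - sum g A))"
    using insert by (intro spec_intros) auto
  then show ?case using insert.hyps by simp
qed simp

lemma spec_e: "spec_at q t (lcoeff (e_explicit rQ rT m) k) (lcoeff (e_explicit q t m) k)"
proof -
  have if_spec: "spec_at q t (if P then x else 0) (if P then y else 0)" if "spec_at q t x y" for P x y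
    using that by simp
  have neg: "spec_at q t (lcoeff (e_neg rQ rT N) k) (lcoeff (e_neg q t N) k)" for N
    unfolding lcoeff_e_neg qt_params.lcoeff_e_neg[OF qt_params_generic]
    by (rule spec_sum[OF finite_atMost]) (rule if_spec[OF spec_psi])
  have pos: "spec_at q t (lcoeff (e_pos rQ rT N) k) (lcoeff (e_pos q t N) k)" for N
    unfolding lcoeff_e_pos qt_params.lcoeff_e_pos[OF qt_params_generic]
    by (rule spec_sum[OF finite_atMost])
      (rule if_spec[OF spec_at_mult[OF spec_psi spec_at_power[OF spec_at_rQ]]])
  show ?thesis unfolding e_explicit_def using neg pos by simp
qed

end

section \<open>The series \<open>\<mu>\<close>\<close>

abbreviation tau :: "int poly fract" where "tau \<equiv> to_fract [:0, 1:]"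

text \<open>The numbers \<open>a\<^sub>n = (t\<inverse>)\<^sub>n t\<^sup>n / (q)\<^sub>n\<close> of the \<open>q\<close>-binomial theorem: \<open>\<Prod>\<^sub>j (1 - q\<^sup>j z) / (1 - t q\<^sup>j z) = \<Sum>\<^sub>n a\<^sub>n z\<^sup>n\<close>.\<close>

definition acoef :: "nat \<Rightarrow> int poly fract fps" where
  "acoef n = (\<Prod>j<n. (fps_const tau - fps_X ^ j) * inverse (1 - fps_X ^ Suc j))"

lemma acoef_0 [simp]: "acoef 0 = 1" by (simp add: acoef_def)

lemma acoef_Suc: "acoef (Suc n) * (1 - fps_X ^ Suc n) = (fps_const tau - fps_X ^ n) * acoef n"
proof -
  have "inverse (1 - fps_X ^ Suc n) * (1 - fps_X ^ Suc n) = (1 :: int poly fract fps)"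
    by (rule inverse_mult_eq_1) simp
  then have "(A * (B * inverse (1 - fps_X ^ Suc n))) * (1 - fps_X ^ Suc n) = B * A"
    for A B :: "int poly fract fps"
    by (metis mult.assoc mult.commute mult_1)
  then show ?thesis unfolding acoef_def prod.lessThan_Suc .
qed

text \<open>The series \<open>\<Sum>\<^sub>n s\<^sub>n X\<^sup>2\<^sup>n\<close>, rearranged by powers of \<open>q\<close>.\<close>

definition up :: "(nat \<Rightarrow> 'a::field fps) \<Rightarrow> 'a fls fps" where
  "up s = Abs_fps (\<lambda>i. fps_to_fls (Abs_fps (\<lambda>k. if even k then fps_nth (s (k div 2)) i else 0)))"

text \<open>The series \<open>\<Sum>\<^sub>n s\<^sub>n X\<^sup>-\<^sup>2\<^sup>n\<close>. The sum at \<open>q\<^sup>i\<close> stops at \<open>n = i\<close>, which is correct when \<open>s\<^sub>n\<close> is divisible by \<open>q\<^sup>n\<close>; this is what makes the coefficients Laurent series.\<close>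

definition down :: "(nat \<Rightarrow> 'a::field fps) \<Rightarrow> 'a fls fps" where
  "down s = Abs_fps (\<lambda>i. \<Sum>n\<le>i. fls_const (fps_nth (s n) i) * fls_X_inv ^ (2 * n))"

lemma up_nth: "fls_nth (fps_nth (up s) i) k = (if k \<ge> 0 \<and> even k then fps_nth (s (nat k div 2)) i else 0)"
  by (auto simp: up_def even_nat_iff)

lemma const_X_inv_nth: "fls_nth (fls_const (c::'a::field) * fls_X_inv ^ n) k = (if k = - int n then c else 0)"
proof -
  have "fls_X_inv ^ n = fls_X_inv ^ n * (1 :: 'a fls)" by simp
  also have "\<dots> = fls_shift (int n) 1" by (rule fls_X_inv_power_times_conv_shift)
  finally show ?thesis by (simp only: fls_mult_const_nth) auto
qed

lemma down_nth:
  assumes "\<And>n i. i < n \<Longrightarrow> fps_nth (s n) i = 0"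
  shows "fls_nth (fps_nth (down s) i) (- int (2 * n)) = fps_nth (s n) i"
proof -
  have "fls_nth (fps_nth (down s) i) (- int (2 * n)) = (\<Sum>n'\<le>i. if - int (2 * n) = - int (2 * n') then fps_nth (s n') i else 0)"
    unfolding down_def by (simp only: fps_nth_Abs_fps fls_nth_sum const_X_inv_nth)
  also have "\<dots> = (\<Sum>n'\<le>i. if n' = n then fps_nth (s n) i else 0)"
    by (intro sum.cong) auto
  also have "\<dots> = fps_nth (s n) i" using assms[of i n] by auto
  finally show ?thesis .
qed

lemma down_nth_0:
  assumes "\<not> (k \<le> 0 \<and> even k)" shows "fls_nth (fps_nth (down s) i) k = 0"
proof -
  have "fls_nth (fps_nth (down s) i) k = (\<Sum>n'\<le>i. if k = - int (2 * n') then fps_nth (s n') i else 0)"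
    unfolding down_def by (simp only: fps_nth_Abs_fps fls_nth_sum const_X_inv_nth)
  also have "\<dots> = 0" using assms by (intro sum.neutral) auto
  finally show ?thesis .
qed

lemma up_nth': "fls_nth (fps_nth (up s) i) (int (2 * n)) = fps_nth (s n) i"
  by (simp add: up_nth nat_mult_distrib)

lemma up_nth_0: "\<not> (k \<ge> 0 \<and> even k) \<Longrightarrow> fls_nth (fps_nth (up s) i) k = 0"
  by (auto simp: up_nth)

lemma mult_X_power_nth: 
  "fps_nth (fps_const a * fps_X ^ N * fps_const b * f) i = (if i < N then 0 else a * b * fps_nth f (i - N))"
  for f :: "'a::comm_ring_1 fps"
proof -
  have "fps_const a * fps_X ^ N * fps_const b * f = fps_const (a * b) * (fps_X ^ N * f)"
    by (simp add: mult_ac flip: fps_const_mult)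
  then show ?thesis by (simp add: fps_X_power_mult_nth)
qed

lemma fls_X2_nth: "fls_nth (fls_const c * fls_X\<^sup>2 * g) k = c * fls_nth g (k - 2)"
  for g :: "'a::field fls"
proof -
  have "fls_X\<^sup>2 * g = fls_shift (- int 2) g" by (rule fls_X_power_times_conv_shift)
  then show ?thesis unfolding mult.assoc[of "fls_const c"] by simp
qed

lemma fls_X_inv2_nth: "fls_nth (fls_const c * (inverse fls_X)\<^sup>2 * g) k = c * fls_nth g (k + 2)"
  for g :: "'a::field fls"
proof -
  have "(inverse fls_X)\<^sup>2 * g = fls_shift (int 2) g"
    unfolding fls_inverse_X by (rule fls_X_inv_power_times_conv_shift)
  then show ?thesis unfolding mult.assoc[of "fls_const c"] by simp
qed

lemma up_factor:
  "(1 - fps_const (fls_const c) * fps_X ^ N * fps_const (fls_X ^ 2)) * up s 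
   = up (\<lambda>n. s n - (if n = 0 then 0 else fps_const c * (fps_X ^ N * s (n - 1))))" (is "_ = up ?s'")
proof (intro fps_ext fls_eqI)
  fix i k
  have "fls_nth (fps_nth ((1 - fps_const (fls_const c) * fps_X ^ N * fps_const (fls_X ^ 2)) * up s) i) k
    = fls_nth (fps_nth (up s) i) k - (if i < N then 0 else c * fls_nth (fps_nth (up s) (i - N)) (k - 2))"
    unfolding left_diff_distrib fps_sub_nth mult_X_power_nth mult_1_left fls_minus_nth
    by (cases "i < N") (simp_all only: fls_X2_nth if_True if_False fls_zero_nth)
  also have "\<dots> = fls_nth (fps_nth (up ?s') i) k"
  proof (cases "k \<ge> 0 \<and> even k")
    case True
    define n where "n = nat (k div 2)"
    have k: "k = int (2 * n)" using True by (simp add: n_def pos_imp_zdiv_nonneg_iff)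
    show ?thesis
    proof (cases n)
      case 0
      have "fls_nth (fps_nth (up s) (i - N)) (k - 2) = 0" using k 0 by (intro up_nth_0) auto
      then show ?thesis using 0 unfolding k up_nth' by simp
    next
      case (Suc m)
      have k2: "k - 2 = int (2 * m)" using k Suc by simp
      show ?thesis unfolding k2 unfolding k up_nth' using Suc
        by (simp add: fps_X_power_mult_nth)
    qed
  next
    case False
    then have "\<not> (k - 2 \<ge> 0 \<and> even (k - 2))" by auto
    then show ?thesis using False by (simp add: up_nth_0)
  qed
  finally show "fls_nth (fps_nth ((1 - fps_const (fls_const c) * fps_X ^ N * fps_const (fls_X ^ 2)) * up s) i) k
    = fls_nth (fps_nth (up ?s') i) k" .
qed

lemma down_factor:
  assumes s: "\<And>n i. i < n \<Longrightarrow> fps_nth (s n) i = 0" and N: "N > 0"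
  shows "(1 - fps_const (fls_const c) * fps_X ^ N * fps_const (inverse fls_X ^ 2)) * down s 
   = down (\<lambda>n. s n - (if n = 0 then 0 else fps_const c * (fps_X ^ N * s (n - 1))))" (is "_ = down ?s'")
proof (intro fps_ext fls_eqI)
  fix i k
  have s': "fps_nth (?s' n) i = 0" if "i < n" for n i 
    using that s[of i n] s[of "i - N" "n - 1"] N by (auto simp: fps_X_power_mult_nth)
  have "fls_nth (fps_nth ((1 - fps_const (fls_const c) * fps_X ^ N * fps_const (inverse fls_X ^ 2)) * down s) i) k
    = fls_nth (fps_nth (down s) i) k - (if i < N then 0 else c * fls_nth (fps_nth (down s) (i - N)) (k + 2))"
    unfolding left_diff_distrib fps_sub_nth mult_X_power_nth mult_1_left fls_minus_nth
    by (cases "i < N") (simp_all only: fls_X_inv2_nth if_True if_False fls_zero_nth)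
  also have "\<dots> = fls_nth (fps_nth (down ?s') i) k"
  proof (cases "k \<le> 0 \<and> even k")
    case True
    define n where "n = nat ((- k) div 2)"
    have k: "k = - int (2 * n)" using True by (simp add: n_def pos_imp_zdiv_nonneg_iff)
    show ?thesis
    proof (cases n)
      case 0
      have "fls_nth (fps_nth (down s) (i - N)) (k + 2) = 0" using k 0 by (intro down_nth_0) auto
      moreover have "fls_nth (fps_nth (down ?s') i) k = fps_nth (?s' 0) i"
        unfolding k 0 by (rule down_nth[OF s'])
      moreover have "fls_nth (fps_nth (down s) i) k = fps_nth (s 0) i"
        unfolding k 0 by (rule down_nth[OF s])
      ultimately show ?thesis by simp
    next
      case (Suc m)
      have k2: "k + 2 = - int (2 * m)" using k Suc by simp
      have "fls_nth (fps_nth (down ?s') i) k = fps_nth (?s' n) i"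
        unfolding k by (rule down_nth[OF s'])
      moreover have "fls_nth (fps_nth (down s) i) k = fps_nth (s n) i"
        unfolding k by (rule down_nth[OF s])
      moreover have "fls_nth (fps_nth (down s) (i - N)) (k + 2) = fps_nth (s m) (i - N)"
        unfolding k2 by (rule down_nth[OF s])
      ultimately show ?thesis by (simp add: Suc fps_X_power_mult_nth)
    qed
  next
    case False
    then have "\<not> (k + 2 \<le> 0 \<and> even (k + 2))" by auto
    then show ?thesis using False by (simp add: down_nth_0)
  qed
  finally show "fls_nth (fps_nth ((1 - fps_const (fls_const c) * fps_X ^ N * fps_const (inverse fls_X ^ 2)) * down s) i) k
    = fls_nth (fps_nth (down ?s') i) k" .
qed

text \<open>The tail \<open>\<Prod>\<^sub>j\<^sub>\<ge>\<^sub>N\<close> of the factors of \<open>\<mu>\<close> that involve \<open>X\<^sup>2\<close>; \<open>Bser\<close> is the tail of those that involve \<open>X\<^sup>-\<^sup>2\<close>.\<close>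

definition Aser :: "nat \<Rightarrow> int poly fract fls fps" where "Aser N = up (\<lambda>n. fps_X ^ (N * n) * acoef n)"
definition Bser :: "nat \<Rightarrow> int poly fract fls fps" where "Bser N = down (\<lambda>n. fps_X ^ (Suc N * n) * acoef n)"

lemma acoef_shift:
  "fps_X ^ (Suc N * Suc m) * acoef (Suc m) - fps_const 1 * (fps_X ^ N * (fps_X ^ (Suc N * m) * acoef m))
   = fps_X ^ (N * Suc m) * acoef (Suc m) - fps_const tau * (fps_X ^ N * (fps_X ^ (N * m) * acoef m))"
proof -
  define P :: "int poly fract fps" where "P = fps_X ^ (N * Suc m)"
  have e1: "fps_X ^ (Suc N * Suc m) = P * fps_X ^ Suc m"
    unfolding P_def power_add[symmetric] by (rule arg_cong[of _ _ "\<lambda>k. fps_X ^ k"]) simp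
  have e2: "fps_X ^ N * fps_X ^ (Suc N * m) = P * fps_X ^ m"
    unfolding P_def power_add[symmetric] by (rule arg_cong[of _ _ "\<lambda>k. fps_X ^ k"]) simp
  have e3: "fps_X ^ N * fps_X ^ (N * m) = P"
    unfolding P_def power_add[symmetric] by (rule arg_cong[of _ _ "\<lambda>k. fps_X ^ k"]) simp
  have "a' * (1 - x') = (c - x) * a \<Longrightarrow> P * x' * a' - 1 * (P * x * a) = P * a' - c * (P * a)"
    for a a' x x' c :: "int poly fract fps"
  proof -
    assume "a' * (1 - x') = (c - x) * a"
    then have "P * (a' * (1 - x')) = P * ((c - x) * a)" by simp
    then show ?thesis by (simp add: algebra_simps)
  qed
  from this[OF acoef_Suc] show ?thesis
    unfolding mult.assoc[symmetric, of "fps_X ^ N"] e1 e2 e3 fps_const_1_eq_1 P_def .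
qed

lemma acoef_shift':
  "fps_X ^ (Suc N * n) * acoef n - (if n = 0 then 0 else fps_const 1 * (fps_X ^ N * (fps_X ^ (Suc N * (n - 1)) * acoef (n - 1))))
    = fps_X ^ (N * n) * acoef n - (if n = 0 then 0 else fps_const tau * (fps_X ^ N * (fps_X ^ (N * (n - 1)) * acoef (n - 1))))"
proof (cases n)
  case (Suc m)
  show ?thesis using acoef_shift[of N m] unfolding Suc by (simp only: nat.distinct if_False diff_Suc_1)
qed simp

lemma Aser_factor:
  "(1 - fps_const (fls_const 1) * fps_X ^ N * fps_const (fls_X ^ 2)) * Aser (Suc N)
   = (1 - fps_const (fls_const tau) * fps_X ^ N * fps_const (fls_X ^ 2)) * Aser N"
  unfolding Aser_def up_factor
  by (rule arg_cong[of _ _ up], rule ext, rule acoef_shift')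

lemma Bser_small:
  assumes "i < n" shows "fps_nth (fps_X ^ (Suc N * n) * acoef n) i = 0"
proof -
  have "i < Suc N * n" using assms by (simp add: trans_less_add1)
  then show ?thesis by (simp only: fps_X_power_mult_nth if_True)
qed

lemma Bser_factor:
  "(1 - fps_const (fls_const 1) * fps_X ^ Suc N * fps_const (inverse fls_X ^ 2)) * Bser (Suc N)
   = (1 - fps_const (fls_const tau) * fps_X ^ Suc N * fps_const (inverse fls_X ^ 2)) * Bser N"
proof -
  have b: "(1 - fps_const (fls_const c) * fps_X ^ Suc N * fps_const (inverse fls_X ^ 2)) * Bser M
    = down (\<lambda>n. fps_X ^ (Suc M * n) * acoef n - (if n = 0 then 0 else fps_const c * (fps_X ^ Suc N * (fps_X ^ (Suc M * (n - 1)) * acoef (n - 1)))))" for c M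
    unfolding Bser_def by (rule down_factor) (simp_all only: Bser_small zero_less_Suc)
  show ?thesis unfolding b
    by (rule arg_cong[of _ _ down], rule ext, rule acoef_shift')
qed

text \<open>The coefficient of \<open>X\<^sup>2\<^sup>k\<close> in \<open>\<mu>\<close> is \<open>\<Sum>\<^sub>n q\<^sup>n a\<^sub>n a\<^sub>n\<^sub>+\<^sub>k\<close>. Its first order recursion telescopes; the partial sums leave a remainder of high order in \<open>q\<close>.\<close>

lemma acoef_cc_telescope:
  "(1 - fps_const tau * fps_X ^ Suc k) * (\<Sum>n\<le>L. fps_X ^ n * acoef n * acoef (n + Suc k))
   - (fps_const tau - fps_X ^ k) * (\<Sum>n\<le>L. fps_X ^ n * acoef n * acoef (n + k))
   = - (fps_X ^ Suc (L + k) * acoef (Suc L) * acoef (Suc L + k) * (1 - fps_X ^ Suc L))"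
proof (induction L)
  case 0
  have a: "acoef (Suc k) * (1 - fps_X ^ Suc k) = (fps_const tau - fps_X ^ k) * acoef k"
    "acoef (Suc 0) * (1 - fps_X) = (fps_const tau - 1) * acoef 0"
    using acoef_Suc[of k] acoef_Suc[of 0] by simp_all
  have "(1 - c * (q * y)) * d - (c - y) * b = - (q * y * a * d * (1 - q))"
    if "d * (1 - q * y) = (c - y) * b" "a * (1 - q) = (c - 1)" for a b c d q y :: "int poly fract fps"
  proof -
    have "- (q * y * a * d * (1 - q)) = - (q * y * d * (c - 1))" using that(2) by (simp add: mult_ac)
    then show ?thesis using that(1) by (simp add: algebra_simps)
  qed
  from this[of "acoef (Suc k)" fps_X "fps_X ^ k" "fps_const tau" "acoef k" "acoef (Suc 0)"] a
  show ?case by simp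
next
  case (Suc L)
  define x :: "int poly fract fps" where "x = fps_X ^ Suc L"
  define y :: "int poly fract fps" where "y = fps_X ^ k"
  define q :: "int poly fract fps" where "q = fps_X"
  define c where "c = fps_const tau"
  define a b d e where "a = acoef (Suc L)" and "b = acoef (Suc L + k)" and "d = acoef (Suc L + Suc k)"
    and "e = acoef (Suc (Suc L))"
  have 1: "e * (1 - q * x) = (c - x) * a" 
    unfolding e_def q_def x_def c_def a_def using acoef_Suc[of "Suc L"] by simp
  have 2: "d * (1 - q * (x * y)) = (c - x * y) * b"
    unfolding d_def q_def x_def y_def c_def b_def using acoef_Suc[of "Suc L + k"]
    by (simp add: power_add mult_ac)
  have "- (y * x * a * b * (1 - x)) + ((1 - c * (q * y)) * (x * a * d) - (c - y) * (x * a * b)) = - (q * x * y * e * d * (1 - q * x))"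
  proof -
    have "- (q * x * y * e * d * (1 - q * x)) = - (q * x * y * d * (e * (1 - q * x)))" by (simp only: mult_ac)
    also have "\<dots> = - (q * x * y * d * ((c - x) * a))" unfolding 1 ..
    finally have l: "- (q * x * y * e * d * (1 - q * x)) = - (q * x * y * d * ((c - x) * a))" .
    have "x * a * (d * (1 - q * (x * y)) - (c - x * y) * b) = 0" unfolding 2 by simp
    then show ?thesis unfolding l by (simp add: algebra_simps)
  qed
  moreover have "fps_X ^ Suc (L + k) = y * x" "fps_X ^ Suc k = q * y" "fps_X ^ Suc (Suc L + k) = q * x * y"
      "fps_X ^ Suc (Suc L) = q * x" "fps_X ^ Suc L = x" "fps_X ^ k = y"
    by (simp_all add: x_def y_def q_def power_add mult_ac)
  moreover have "acoef (Suc (Suc L) + k) = d" "acoef (Suc L + Suc k) = d" by (simp_all add: d_def)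
  ultimately show ?case using Suc
    unfolding sum.atMost_Suc a_def[symmetric] b_def[symmetric] e_def[symmetric] c_def[symmetric]
    by (simp only:) (simp only: distrib_left add_diff_add)
qed

text \<open>Extended by zero to negative indices, so that one formula covers all powers of \<open>X\<close>.\<close>

definition acoefi :: "int \<Rightarrow> int poly fract fps" where
  "acoefi k = (if k \<ge> 0 then acoef (nat k) else 0)"

lemma mu_term:
  fixes j :: nat
  defines "f \<equiv> (\<lambda>j. ((1 - fps_X ^ j * fps_const (fls_X ^ 2)) * (1 - fps_X ^ (j + 1) * fps_const (inverse fls_X ^ 2))) /
      ((1 - fps_const (fls_const tau) * fps_X ^ j * fps_const (fls_X ^ 2)) *
       (1 - fps_const (fls_const tau) * fps_X ^ (j + 1) * fps_const (inverse fls_X ^ 2))))"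
  shows "f j * (Aser (Suc j) * Bser (Suc j)) = Aser j * Bser j"
proof -
  define D1 where "D1 = 1 - fps_const (fls_const tau) * fps_X ^ j * fps_const (fls_X ^ 2)"
  define D2 where "D2 = 1 - fps_const (fls_const tau) * fps_X ^ Suc j * fps_const (inverse fls_X ^ 2)"
  define N1 where "N1 = 1 - fps_X ^ j * fps_const (fls_X ^ 2 :: int poly fract fls)"
  define N2 where "N2 = 1 - fps_X ^ Suc j * fps_const (inverse fls_X ^ 2 :: int poly fract fls)"
  have A: "N1 * Aser (Suc j) = D1 * Aser j" using Aser_factor[of j] by (simp add: N1_def D1_def)
  have B: "N2 * Bser (Suc j) = D2 * Bser j" using Bser_factor[of j] by (simp add: N2_def D2_def)
  have 1: "fps_nth D1 0 \<noteq> 0"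
  proof (cases j)
    case 0
    have "fls_nth (fps_nth D1 0) 0 = 1" by (simp add: D1_def 0 fls_X2_nth[where g = 1, simplified])
    then show ?thesis by auto
  next
    case (Suc i)
    then show ?thesis by (simp add: D1_def mult.assoc)
  qed
  have 2: "fps_nth D2 0 \<noteq> 0" by (simp add: D2_def)
  have nz: "fps_nth (D1 * D2) 0 \<noteq> 0" using 1 2 by simp
  have "f j = N1 * N2 * inverse (D1 * D2)"
    unfolding f_def N1_def N2_def D1_def D2_def Suc_eq_plus1[symmetric]
    using nz unfolding D1_def D2_def Suc_eq_plus1[symmetric] by (subst fps_divide_unit) simp_all
  then have "f j * (Aser (Suc j) * Bser (Suc j)) = inverse (D1 * D2) * ((N1 * Aser (Suc j)) * (N2 * Bser (Suc j)))"
    by (simp only: mult_ac)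
  also have "\<dots> = (inverse (D1 * D2) * (D1 * D2)) * (Aser j * Bser j)"
    unfolding A B by (simp only: mult_ac)
  also have "inverse (D1 * D2) * (D1 * D2) = 1" using nz by (rule inverse_mult_eq_1)
  finally show ?thesis by simp
qed

lemma Aser_cut: "i < N \<Longrightarrow> fps_nth (Aser N) i = (if i = 0 then 1 else 0)"
proof (rule fls_eqI)
  fix k assume i: "i < N"
  show "fls_nth (fps_nth (Aser N) i) k = fls_nth (if i = 0 then 1 else 0) k"
  proof (cases "k \<ge> 0 \<and> even k")
    case True
    define n where "n = nat (k div 2)"
    have k: "k = int (2 * n)" using True by (simp add: n_def pos_imp_zdiv_nonneg_iff)
    have "n > 0 \<Longrightarrow> i < N * n" using i by (metis less_le_trans mult.commute n_less_n_mult_m nat_mult_le_cancel1 le_eq_less_or_eq mult_le_mono2 One_nat_def Suc_leI mult.right_neutral)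
    then show ?thesis unfolding Aser_def k up_nth'
      by (cases "n = 0") (auto simp: fps_X_power_mult_nth)
  next
    case False
    then show ?thesis by (auto simp: Aser_def up_nth_0)
  qed
qed

lemma Bser_cut: "i < N \<Longrightarrow> fps_nth (Bser N) i = (if i = 0 then 1 else 0)"
proof (rule fls_eqI)
  fix k assume i: "i < N"
  show "fls_nth (fps_nth (Bser N) i) k = fls_nth (if i = 0 then 1 else 0) k"
  proof (cases "k \<le> 0 \<and> even k")
    case True
    define n where "n = nat ((- k) div 2)"
    have k: "k = - int (2 * n)" using True by (simp add: n_def pos_imp_zdiv_nonneg_iff)
    have "fls_nth (fps_nth (Bser N) i) k = fps_nth (fps_X ^ (Suc N * n) * acoef n) i"
      unfolding Bser_def k by (rule down_nth) (rule Bser_small)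
    moreover have "n > 0 \<Longrightarrow> i < Suc N * n" using i by (cases n) auto
    ultimately show ?thesis
      by (cases "n = 0") (auto simp: fps_X_power_mult_nth k simp del: mult_Suc)
  next
    case False
    then show ?thesis by (auto simp: Bser_def down_nth_0)
  qed
qed

text \<open>The product of the first \<open>N\<close> factors times the two tails is independent of \<open>N\<close> by the functional equations, and the tails tend to \<open>1\<close> in the \<open>q\<close>-adic sense.\<close>

lemma mu_series_eq: "mu_series = Aser 0 * Bser 0"
proof -
  define f where "f = (\<lambda>j. ((1 - fps_X ^ j * fps_const (fls_X ^ 2)) * (1 - fps_X ^ (j + 1) * fps_const (inverse fls_X ^ 2))) /
      ((1 - fps_const (fls_const tau) * fps_X ^ j * fps_const (fls_X ^ 2)) *
       (1 - fps_const (fls_const tau) * fps_X ^ (j + 1) * fps_const (inverse fls_X ^ 2))))"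
  have part: "(\<Prod>j<N. f j) * (Aser N * Bser N) = Aser 0 * Bser 0" for N
  proof (induction N)
    case (Suc N)
    have "(\<Prod>j<Suc N. f j) * (Aser (Suc N) * Bser (Suc N)) = (\<Prod>j<N. f j) * (f N * (Aser (Suc N) * Bser (Suc N)))"
      by (simp add: mult.assoc)
    also have "f N * (Aser (Suc N) * Bser (Suc N)) = Aser N * Bser N"
      unfolding f_def by (rule mu_term)
    finally show ?case using Suc by simp
  qed simp
  have C: "fps_nth (Aser N * Bser N) i = (if i = 0 then 1 else 0)" if "i < N" for i N
  proof -
    have "fps_nth (Aser N * Bser N) i = (\<Sum>l=0..i. (if l = 0 then 1 else 0) * (if i - l = 0 then 1 else 0))"
      unfolding fps_mult_nth using that by (intro sum.cong refl) (simp_all only: Aser_cut Bser_cut atLeastAtMost_iff, auto simp: Aser_cut Bser_cut)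
    also have "\<dots> = (\<Sum>l=0..i. if l = 0 then (if i = 0 then 1 else 0) else 0)"
      by (intro sum.cong) auto
    also have "\<dots> = (if i = 0 then 1 else 0)" by simp
    finally show ?thesis .
  qed
  have stab: "fps_nth (\<Prod>j<N. f j) i = fps_nth (Aser 0 * Bser 0) i" if "i < N" for i N
  proof -
    have "fps_nth (Aser 0 * Bser 0) i = fps_nth ((\<Prod>j<N. f j) * (Aser N * Bser N)) i"
      by (simp only: part)
    also have "\<dots> = (\<Sum>l=0..i. fps_nth (\<Prod>j<N. f j) l * (if i - l = 0 then 1 else 0))"
      unfolding fps_mult_nth[of "\<Prod>j<N. f j"] using that
      by (intro sum.cong refl arg_cong2[where f = "(*)"] C) auto
    also have "\<dots> = (\<Sum>l=0..i. if l = i then fps_nth (\<Prod>j<N. f j) i else 0)"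
      by (intro sum.cong) auto
    finally show ?thesis by simp
  qed
  have nz: "Aser 0 * Bser 0 \<noteq> 0"
  proof -
    have "Aser 0 \<noteq> 0"
    proof
      assume "Aser 0 = 0"
      then have "fls_nth (fps_nth (Aser 0) 0) (int (2 * 0)) = 0" by simp
      then show False unfolding Aser_def up_nth' by simp
    qed
    moreover have "Bser 0 \<noteq> 0"
    proof
      assume "Bser 0 = 0"
      then have "fls_nth (fps_nth (Bser 0) 0) (- int (2 * 0)) = 0" by simp
      moreover have "fls_nth (fps_nth (Bser 0) 0) (- int (2 * 0)) = fps_nth (fps_X ^ (Suc 0 * 0) * acoef 0) 0"
        unfolding Bser_def by (rule down_nth) (rule Bser_small)
      ultimately show False by simp
    qed
    ultimately show ?thesis by simp
  qed
  have "(\<lambda>n. \<Prod>i\<le>n. f i) \<longlonglongrightarrow> Aser 0 * Bser 0"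
  proof (rule tendsto_fpsI)
    fix i
    show "\<forall>\<^sub>F n in sequentially. fps_nth (\<Prod>i\<le>n. f i) i = fps_nth (Aser 0 * Bser 0) i"
      using eventually_ge_at_top[of i]
    proof eventually_elim
      case (elim n)
      then show ?case using stab[of i "Suc n"] by (simp only: lessThan_Suc_atMost)
    qed
  qed
  then have "f has_prod (Aser 0 * Bser 0)"
    using nz by (simp add: has_prod_def raw_has_prod_def)
  then have "prodinf f = Aser 0 * Bser 0" by (rule has_prod_unique[symmetric])
  then show ?thesis unfolding mu_series_def Let_def f_def .
qed

text \<open>Modulo \<open>q\<^sup>i\<^sup>+\<^sup>1\<close> only the terms with \<open>n \<le> i\<close> contribute, so the infinite sum may be cut anywhere beyond \<open>i\<close>.\<close>

lemma mu_coeff_nth: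
  assumes "i \<le> L"
  shows "fps_nth (mu_coeff (2 * k)) i = fps_nth (\<Sum>n\<le>L. fps_X ^ n * acoef n * acoefi (int n + k)) i"
proof -
  have A: "fls_nth (fps_nth (Aser 0) l) (2 * m) = fps_nth (acoefi m) l" for l m
  proof (cases "m \<ge> 0")
    case True
    then have "2 * m = int (2 * nat m)" by simp
    then show ?thesis unfolding Aser_def using True by (simp only: up_nth') (simp add: acoefi_def)
  next
    case False
    then show ?thesis unfolding Aser_def by (subst up_nth_0) (auto simp: acoefi_def)
  qed
  have B: "fps_nth (Bser 0) i' = (\<Sum>n\<le>L. fls_const (fps_nth (fps_X ^ n * acoef n) i') * fls_X_inv ^ (2 * n))"
    if "i' \<le> i" for i'
  proof -
    have "fps_nth (Bser 0) i' = (\<Sum>n\<le>i'. fls_const (fps_nth (fps_X ^ n * acoef n) i') * fls_X_inv ^ (2 * n))"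
      by (simp add: Bser_def down_def)
    also have "\<dots> = (\<Sum>n\<le>L. fls_const (fps_nth (fps_X ^ n * acoef n) i') * fls_X_inv ^ (2 * n))"
      using that assms by (intro sum.mono_neutral_left) (auto simp: fps_X_power_mult_nth)
    finally show ?thesis .
  qed
  have sh: "fls_nth (f * (fls_const c * fls_X_inv ^ (2 * n))) (2 * k) = fls_nth f (2 * (int n + k)) * c"
    for f :: "int poly fract fls" and c n
  proof -
    have "f * (fls_const c * fls_X_inv ^ (2 * n)) = fls_const c * (fls_X_inv ^ (2 * n) * f)"
      by (simp only: mult_ac)
    also have "fls_X_inv ^ (2 * n) * f = fls_shift (int (2 * n)) f"
      by (rule fls_X_inv_power_times_conv_shift)
    finally have e: "f * (fls_const c * fls_X_inv ^ (2 * n)) = fls_const c * fls_shift (int (2 * n)) f" .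
    show ?thesis unfolding e by (simp add: algebra_simps)
  qed
  have "fps_nth (mu_coeff (2 * k)) i = fls_nth (\<Sum>l=0..i. fps_nth (Aser 0) l * fps_nth (Bser 0) (i - l)) (2 * k)"
    by (simp add: mu_coeff_def mu_series_eq fps_mult_nth)
  also have "\<dots> = (\<Sum>l=0..i. \<Sum>n\<le>L. fps_nth (acoefi (int n + k)) l * fps_nth (fps_X ^ n * acoef n) (i - l))"
    unfolding fls_nth_sum
    by (intro sum.cong refl) (simp only: B diff_le_self sum_distrib_left fls_nth_sum sh A)
  also have "\<dots> = (\<Sum>n\<le>L. \<Sum>l=0..i. fps_nth (acoefi (int n + k)) l * fps_nth (fps_X ^ n * acoef n) (i - l))"
    by (rule sum.swap)
  also have "\<dots> = fps_nth (\<Sum>n\<le>L. fps_X ^ n * acoef n * acoefi (int n + k)) i"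
    unfolding fps_sum_nth
    by (intro sum.cong refl, subst mult.commute[of _ "acoefi _"]) (simp only: fps_mult_nth)
  finally show ?thesis .
qed

lemma mu_coeff_odd: "odd k \<Longrightarrow> mu_coeff k = 0"
proof (rule fps_ext)
  fix i assume k: "odd k"
  have up: "fls_nth (fps_nth (Aser 0) l) m = 0" if "odd m" for l m
    unfolding Aser_def by (rule up_nth_0) (use that in simp)
  have sh: "fls_nth (f * (fls_const c * fls_X_inv ^ (2 * n))) k = fls_nth f (k + int (2 * n)) * c"
    for f :: "int poly fract fls" and c n
  proof -
    have "f * (fls_const c * fls_X_inv ^ (2 * n)) = fls_const c * (fls_X_inv ^ (2 * n) * f)"
      by (simp only: mult_ac)
    also have "fls_X_inv ^ (2 * n) * f = fls_shift (int (2 * n)) f"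
      by (rule fls_X_inv_power_times_conv_shift)
    finally have e: "f * (fls_const c * fls_X_inv ^ (2 * n)) = fls_const c * fls_shift (int (2 * n)) f" .
    show ?thesis unfolding e by simp
  qed
  have B: "fps_nth (Bser 0) i' = (\<Sum>n\<le>i'. fls_const (fps_nth (fps_X ^ n * acoef n) i') * fls_X_inv ^ (2 * n))" for i'
    by (simp add: Bser_def down_def)
  have "fps_nth (mu_coeff k) i = fls_nth (\<Sum>l=0..i. fps_nth (Aser 0) l * fps_nth (Bser 0) (i - l)) k"
    by (simp add: mu_coeff_def mu_series_eq fps_mult_nth)
  also have "\<dots> = 0" unfolding fls_nth_sum B sum_distrib_left sh
    using k by (intro sum.neutral ballI) (simp add: up)
  finally show "fps_nth (mu_coeff k) i = fps_nth 0 i" by simp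
qed

lemma fps_mult_nth_cong:
  "(\<And>l. l \<le> i \<Longrightarrow> fps_nth f l = fps_nth g l) \<Longrightarrow> fps_nth (h * f) i = fps_nth (h * g) i"
  for h :: "'a::comm_ring_1 fps"
  unfolding fps_mult_nth by (intro sum.cong) auto

lemma mu_coeff_pos_rec:
  "(1 - fps_const tau * fps_X ^ Suc k) * mu_coeff (2 * int (Suc k)) = (fps_const tau - fps_X ^ k) * mu_coeff (2 * int k)"
proof (rule fps_ext)
  fix i
  define C where "C k = (\<Sum>n\<le>i. fps_X ^ n * acoef n * acoef (n + k))" for k
  have C: "fps_nth (mu_coeff (2 * int k)) l = fps_nth (C k) l" if "l \<le> i" for k l
  proof -
    have "acoefi (int n + int k) = acoef (n + k)" for n by (simp add: acoefi_def nat_add_distrib)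
    then show ?thesis using mu_coeff_nth[OF that, of "int k"] by (simp add: C_def)
  qed
  have "fps_nth ((1 - fps_const tau * fps_X ^ Suc k) * C (Suc k) - (fps_const tau - fps_X ^ k) * C k) i 
      = fps_nth (- (fps_X ^ Suc (i + k) * acoef (Suc i) * acoef (Suc i + k) * (1 - fps_X ^ Suc i))) i"
    unfolding C_def by (simp only: acoef_cc_telescope)
  also have "\<dots> = 0" by (simp only: mult.assoc fps_neg_nth fps_X_power_mult_nth) simp
  finally have "fps_nth ((1 - fps_const tau * fps_X ^ Suc k) * C (Suc k)) i = fps_nth ((fps_const tau - fps_X ^ k) * C k) i"
    by (simp only: fps_sub_nth right_minus_eq)
  then show "fps_nth ((1 - fps_const tau * fps_X ^ Suc k) * mu_coeff (2 * int (Suc k))) i 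
      = fps_nth ((fps_const tau - fps_X ^ k) * mu_coeff (2 * int k)) i"
    using fps_mult_nth_cong[OF C[of _ "Suc k"], of i "1 - fps_const tau * fps_X ^ Suc k"]
      fps_mult_nth_cong[OF C[of _ k], of i "fps_const tau - fps_X ^ k"] by (simp only:)
qed

lemma mu_coeff_neg: "mu_coeff (2 * (- int k)) = fps_X ^ k * mu_coeff (2 * int k)"
proof (rule fps_ext)
  fix i
  have "fps_nth (mu_coeff (2 * (- int k))) i = fps_nth (\<Sum>n\<le>i + k. fps_X ^ n * acoef n * acoefi (int n - int k)) i"
    using mu_coeff_nth[of i "i + k" "- int k"] by simp
  also have "(\<Sum>n\<le>i + k. fps_X ^ n * acoef n * acoefi (int n - int k)) = (\<Sum>n\<in>{k..i + k}. fps_X ^ n * acoef n * acoef (n - k))"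
    by (intro sum.mono_neutral_cong_right) (auto simp: acoefi_def nat_diff_distrib)
  also have "\<dots> = (\<Sum>m\<le>i. fps_X ^ (m + k) * acoef (m + k) * acoef m)"
    by (rule sum.reindex_bij_witness[of _ "\<lambda>m. m + k" "\<lambda>n. n - k"]) auto
  also have "\<dots> = fps_X ^ k * (\<Sum>m\<le>i. fps_X ^ m * acoef m * acoef (m + k))"
    unfolding sum_distrib_left by (intro sum.cong refl) (simp add: power_add mult_ac)
  also have "fps_nth \<dots> i = fps_nth (fps_X ^ k * mu_coeff (2 * int k)) i"
  proof (rule fps_mult_nth_cong)
    fix l assume "l \<le> i"
    have "acoefi (int n + int k) = acoef (n + k)" for n by (simp add: acoefi_def nat_add_distrib)
    then show "fps_nth (\<Sum>m\<le>i. fps_X ^ m * acoef m * acoef (m + k)) l = fps_nth (mu_coeff (2 * int k)) l"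
      using mu_coeff_nth[OF \<open>l \<le> i\<close>, of "int k"] by simp
  qed
  finally show "fps_nth (mu_coeff (2 * (- int k))) i = fps_nth (fps_X ^ k * mu_coeff (2 * int k)) i" .
qed

text \<open>Its value at \<open>q = 0\<close> is \<open>1\<close>.\<close>

lemma mu_coeff_0_nz: "mu_coeff 0 \<noteq> 0"
proof
  assume "mu_coeff 0 = 0"
  then have "fps_nth (mu_coeff (2 * 0)) 0 = 0" by simp
  moreover have "fps_nth (mu_coeff (2 * 0)) 0 = 1"
    by (subst mu_coeff_nth[of 0 0]) (auto simp: acoefi_def)
  ultimately show False by simp
qed

text \<open>The expansion of a polynomial in \<open>q\<close> and \<open>t\<close> as a power series in \<open>q\<close>.\<close>

definition qexp :: "int poly poly \<Rightarrow> int poly fract fps" where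
  "qexp a = fps_of_poly (map_poly to_fract a)"

lemma qexp_hom: "comm_ring_hom qexp"
proof -
  interpret h: comm_ring_hom "to_fract :: int poly \<Rightarrow> int poly fract"
    by unfold_locales auto
  interpret m: map_poly_comm_ring_hom "to_fract :: int poly \<Rightarrow> int poly fract" ..
  show ?thesis
    by unfold_locales (auto simp: qexp_def m.hom_add m.hom_mult fps_of_poly_add fps_of_poly_mult)
qed

interpretation qexp: comm_ring_hom qexp by (rule qexp_hom)

lemma qexp_eq_0_iff: "qexp a = 0 \<longleftrightarrow> a = 0"
  by (auto simp: qexp_def map_poly_eq_0_iff)

definition mu_ratio :: "int \<Rightarrow> ratfun \<Rightarrow> bool" where
  "mu_ratio k r \<longleftrightarrow> (\<exists>a b. b \<noteq> 0 \<and> r = Fraction_Field.Fract a b \<and> qexp b * mu_coeff k = qexp a * mu_coeff 0)"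

lemma mu_ratio_unique:
  assumes "mu_ratio k r" "mu_ratio k r'" shows "r = r'"
proof -
  obtain a b where 1: "b \<noteq> 0" "r = Fraction_Field.Fract a b" "qexp b * mu_coeff k = qexp a * mu_coeff 0"
    using assms(1) by (auto simp: mu_ratio_def)
  obtain c d where 2: "d \<noteq> 0" "r' = Fraction_Field.Fract c d" "qexp d * mu_coeff k = qexp c * mu_coeff 0"
    using assms(2) by (auto simp: mu_ratio_def)
  have "qexp d * (qexp b * mu_coeff k) = qexp b * (qexp d * mu_coeff k)" by (simp only: mult_ac)
  then have "(qexp d * qexp a - qexp b * qexp c) * mu_coeff 0 = 0" unfolding 1 2 by (simp add: algebra_simps)
  then have "qexp (d * a - b * c) = 0" using mu_coeff_0_nz by (simp add: qexp.hom_mult qexp.hom_minus)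
  then have "d * a = b * c" by (simp only: qexp_eq_0_iff right_minus_eq)
  then show ?thesis using 1 2 by (simp add: eq_fract mult.commute)
qed

lemma mu_ratio_mult:
  assumes "mu_ratio k r" "b \<noteq> 0" "qexp b * mu_coeff k' = qexp a * mu_coeff k"
  shows "mu_ratio k' (r * Fraction_Field.Fract a b)"
proof -
  obtain c d where 1: "d \<noteq> 0" "r = Fraction_Field.Fract c d" "qexp d * mu_coeff k = qexp c * mu_coeff 0"
    using assms(1) by (auto simp: mu_ratio_def)
  have "qexp (d * b) * mu_coeff k' = qexp d * (qexp b * mu_coeff k')" by (simp add: qexp.hom_mult mult_ac)
  also have "\<dots> = qexp a * (qexp d * mu_coeff k)" unfolding assms(3) by (simp only: mult_ac)
  also have "\<dots> = qexp (c * a) * mu_coeff 0" unfolding 1(3) by (simp add: qexp.hom_mult mult_ac)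
  finally show ?thesis unfolding mu_ratio_def using 1(1,2) assms(2)
    by (intro exI[of _ "c * a"] exI[of _ "d * b"]) auto
qed

lemma qexp_q: "qexp [:0, 1:] = fps_X" and qexp_t: "qexp [:[:0, 1:]:] = fps_const tau"
  by (simp_all add: qexp_def map_poly_pCons fps_of_poly_pCons)

lemma rQ_power: "rQ ^ n = Fraction_Field.Fract ([:0, 1:] ^ n) 1"
  by (induction n) (auto simp: rQ_def One_fract_def)

text \<open>The power series ratios satisfy the recursion of \<open>cc\<close>, whose coefficients are polynomials in \<open>q\<close> and \<open>t\<close>; so the rational functions demanded by \<open>mu0\<close> exist, and they are unique because \<open>mu_coeff 0\<close> is nonzero.\<close>

lemma mu0_eq: "mu0 k = mu_weight rQ rT k"
proof -
  define Q :: "int poly poly" where "Q = [:0, 1:]"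
  define U :: "int poly poly" where "U = [:[:0, 1:]:]"
  have Q: "qexp (Q ^ n) = fps_X ^ n" for n by (simp only: Q_def qexp.hom_power qexp_q)
  have U: "qexp U = fps_const tau" by (simp only: U_def qexp_t)
  have r0: "mu_ratio 0 1" unfolding mu_ratio_def by (intro exI[of _ 1]) (auto simp: One_fract_def)
  have step: "(rT - rQ ^ n) / (1 - rT * rQ ^ Suc n) = Fraction_Field.Fract (U - Q ^ n) (1 - U * Q ^ Suc n)"
    and nz: "1 - U * Q ^ Suc n \<noteq> 0" for n
  proof -
    have "rT * rQ ^ Suc n = Fraction_Field.Fract (U * Q ^ Suc n) 1"
      unfolding rQ_power by (simp add: rT_def U_def Q_def)
    moreover from this have "Fraction_Field.Fract (U * Q ^ Suc n) 1 \<noteq> Fraction_Field.Fract 1 1"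
      using qt_params.t_pow[OF qt_params_generic, of "Suc n"] by (simp add: One_fract_def)
    ultimately show "1 - U * Q ^ Suc n \<noteq> 0"
      and "(rT - rQ ^ n) / (1 - rT * rQ ^ Suc n) = Fraction_Field.Fract (U - Q ^ n) (1 - U * Q ^ Suc n)"
      unfolding rQ_power by (auto simp: rT_def U_def Q_def One_fract_def)
  qed
  have pos: "mu_ratio (2 * int n) (cpos rQ rT n)" for n
  proof (induction n)
    case 0
    then show ?case using r0 by (simp add: cpos_def)
  next
    case (Suc n)
    have "qexp (1 - U * Q ^ Suc n) * mu_coeff (2 * int (Suc n)) = qexp (U - Q ^ n) * mu_coeff (2 * int n)"
      unfolding qexp.hom_minus qexp.hom_mult Q U qexp.hom_one by (rule mu_coeff_pos_rec)
    from mu_ratio_mult[OF Suc nz this] show ?case unfolding cpos_def prod.lessThan_Suc step .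
  qed
  have neg: "mu_ratio (2 * (- int n)) (rQ ^ n * cpos rQ rT n)" for n
  proof -
    have "qexp 1 * mu_coeff (2 * (- int n)) = qexp (Q ^ n) * mu_coeff (2 * int n)"
      by (simp only: Q mu_coeff_neg qexp.hom_one mult_1)
    from mu_ratio_mult[OF pos _ this] show ?thesis by (simp add: rQ_power Q_def mult.commute)
  qed
  have "mu_ratio k (mu_weight rQ rT k)"
  proof (cases "even k")
    case True
    then obtain m where m: "k = 2 * m" by (auto elim: evenE)
    show ?thesis
    proof (cases "m \<ge> 0")
      case True
      then show ?thesis using pos[of "nat m"] by (simp add: m mu_weight_def cc_def)
    next
      case False
      then show ?thesis using neg[of "nat (- m)"] by (simp add: m mu_weight_def cc_def power_int_def)
    qed
  next
    case False
    then have "mu_coeff k = 0" by (rule mu_coeff_odd)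
    then show ?thesis unfolding mu_ratio_def using False
      by (intro exI[of _ 0] exI[of _ 1]) (auto simp: mu_weight_def Zero_fract_def)
  qed
  then show ?thesis unfolding mu0_def mu_ratio_def[symmetric] qexp_def[symmetric]
    by (intro the_equality) (auto intro: mu_ratio_unique)
qed

lemma e_generic_eq: "e_generic n = e_explicit rQ rT n"
  unfolding e_generic_def mu0_eq[abs_def]
  using qt_params.e_explicit_unique[OF qt_params_generic enorm_generic, of n] by simp

context qt_params
begin

lemma mu0_regular: "regular_at q t (mu0 k)"
  unfolding mu0_eq by (rule spec_at_regular[OF spec_mu_weight])

lemma specialize_mu0: "specialize q t (mu0 k) = mu_weight q t k"
  unfolding mu0_eq by (rule spec_at_specialize[OF spec_mu_weight])

lemma e_regular: "e_regular q t m"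
  unfolding e_regular_def e_generic_eq by (auto intro: spec_at_regular[OF spec_e])

lemma e_poly_eq: "e_poly q t m = e_explicit q t m"
proof (rule poly_mapping_eqI)
  fix k
  have 0: "specialize q t 0 = 0" by (rule spec_at_specialize[OF spec_at_0])
  have "lcoeff (e_poly q t m) k = specialize q t (lcoeff (e_generic m) k)"
    unfolding e_poly_def by (simp add: Poly_Mapping.map.rep_eq when_def 0)
  then show "lcoeff (e_poly q t m) k = lcoeff (e_explicit q t m) k"
    unfolding e_generic_eq by (simp add: spec_at_specialize[OF spec_e])
qed

end

section \<open>The case \<open>t = - q\<^sup>-\<^sup>n\<^sup>/\<^sup>2\<close>\<close>

context qt_params
begin

text \<open>The coefficient of \<open>x\<^sup>j\<close> in \<open>\<Prod>\<^sub>i\<^sub><\<^sub>N (1 + q\<^sup>i x)\<close>.\<close>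

definition gauss :: "nat \<Rightarrow> nat \<Rightarrow> 'k" where
  "gauss N j = poch q q N / (poch q q j * poch q q (N - j)) * q ^ (j choose 2)"

lemma gauss_0 [simp]: "gauss N 0 = 1" and gauss_nz: "gauss N j \<noteq> 0"
  using poch_q_nz q_nz by (simp_all add: gauss_def binomial_eq_0)

lemma choose_2_Suc: "Suc j choose 2 = (j choose 2) + j"
  by (simp add: numeral_2_eq_2)

lemma gauss_Suc_ratio:
  assumes "j < N" shows "gauss N (Suc j) * (1 - q ^ Suc j) = gauss N j * ((1 - q ^ (N - j)) * q ^ j)"
proof -
  obtain M where N: "N = j + Suc M" using assms less_imp_Suc_add by auto
  have s: "N - j = Suc M" "N - Suc j = M" using N by auto
  have nz: "poch q q j \<noteq> 0" "poch q q M \<noteq> 0" "1 - q * q ^ j \<noteq> 0" "1 - q * q ^ M \<noteq> 0"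
    using poch_q_nz qSuc by auto
  have "P / (pj * A * pM) * (c * u) * A = P / (pj * (pM * B)) * c * (B * u)"
    if "A \<noteq> 0" "B \<noteq> 0" for P pj pM A B c u :: 'k
    using that by (simp add: field_simps)
  from this[OF nz(3,4)] show ?thesis unfolding gauss_def s poch_Suc choose_2_Suc power_add power_Suc .
qed

lemma gauss_pascal:
  assumes "j < N" shows "gauss (Suc N) (Suc j) = gauss N (Suc j) + q ^ N * gauss N j"
proof -
  obtain M where N: "N = j + Suc M" using assms less_imp_Suc_add by auto
  have s: "N - j = Suc M" "N - Suc j = M" "Suc N - Suc j = Suc M" using N by auto
  have nz: "poch q q j \<noteq> 0" "poch q q M \<noteq> 0" "1 - q * q ^ j \<noteq> 0" "1 - q * q ^ M \<noteq> 0"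
    using poch_q_nz qSuc by auto
  have qN: "q ^ N = q * q ^ M * q ^ j" by (simp add: N power_add)
  have gen: "P * (B + m * A) / (pj * A * (pM * B)) * (c * u) = P / (pj * A * pM) * (c * u) + m * u * (P / (pj * (pM * B)) * c)"
    if "pj \<noteq> 0" "pM \<noteq> 0" "A \<noteq> 0" "B \<noteq> 0" for P pj pM A B c u m :: 'k
    using that by (simp add: field_simps)
  have e: "1 - q * q ^ N = (1 - q * q ^ M) + q * q ^ M * (1 - q * q ^ j)"
    unfolding qN by (simp add: algebra_simps)
  show ?thesis
    using gen[OF nz, where P = "poch q q N" and c = "q ^ (j choose 2)" and u = "q ^ j" and m = "q * q ^ M"]
    unfolding e[symmetric] qN[symmetric] gauss_def s poch_Suc choose_2_Suc power_add power_Suc .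
qed

lemma gauss_top: "gauss (Suc N) (Suc N) = q ^ N * gauss N N"
  using poch_q_nz[of N] poch_q_nz[of "Suc N"] unfolding gauss_def choose_2_Suc power_add by simp

text \<open>Stated for a ring homomorphism \<open>\<phi>\<close> into a commutative ring, since it is applied to scalars and to Laurent polynomials.\<close>

lemma q_binomial:
  fixes \<phi> :: "'k \<Rightarrow> 'a::comm_ring_1"
  assumes add: "\<And>a b. \<phi> (a + b) = \<phi> a + \<phi> b" and mult: "\<And>a b. \<phi> (a * b) = \<phi> a * \<phi> b"
    and one: "\<phi> 1 = 1"
  shows "(\<Prod>i<N. 1 + \<phi> (q ^ i) * u) = (\<Sum>j\<le>N. \<phi> (gauss N j) * u ^ j)"
proof (induction N)
  case 0
  then show ?case by (simp add: one)
next
  case (Suc N)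
  have "(\<Sum>j\<le>Suc N. \<phi> (gauss (Suc N) j) * u ^ j)
     = 1 + (\<Sum>j\<le>N. \<phi> (gauss (Suc N) (Suc j)) * u ^ Suc j)"
    by (subst sum.atMost_Suc_shift) (simp add: one)
  also have "(\<Sum>j\<le>N. \<phi> (gauss (Suc N) (Suc j)) * u ^ Suc j)
     = (\<Sum>j<N. \<phi> (gauss N (Suc j)) * u ^ Suc j + \<phi> (q ^ N) * u * (\<phi> (gauss N j) * u ^ j)) 
        + \<phi> (q ^ N) * u * (\<phi> (gauss N N) * u ^ N)"
    unfolding lessThan_Suc_atMost[symmetric] sum.lessThan_Suc gauss_top mult
    by (intro arg_cong2[where f = "(+)"] sum.cong refl)
      (simp_all add: gauss_pascal add mult algebra_simps)
  also have "\<dots> = (\<Sum>j<N. \<phi> (gauss N (Suc j)) * u ^ Suc j) + \<phi> (q ^ N) * u * (\<Sum>j\<le>N. \<phi> (gauss N j) * u ^ j)"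
    unfolding lessThan_Suc_atMost[symmetric] sum.lessThan_Suc
    by (simp add: sum.distrib sum_distrib_left distrib_left)
  also have "(\<Sum>j<N. \<phi> (gauss N (Suc j)) * u ^ Suc j) = (\<Sum>j\<le>N. \<phi> (gauss N j) * u ^ j) - 1"
    unfolding lessThan_Suc_atMost[symmetric] by (subst sum.lessThan_Suc_shift) (simp add: one)
  finally have "(\<Sum>j\<le>Suc N. \<phi> (gauss (Suc N) j) * u ^ j) 
      = (\<Sum>j\<le>N. \<phi> (gauss N j) * u ^ j) * (1 + \<phi> (q ^ N) * u)"
    by (simp add: algebra_simps)
  then show ?case using Suc by simp
qed

end

text \<open>The case \<open>t = - q\<^sup>-\<^sup>n\<^sup>/\<^sup>2\<close> over an arbitrary field: it serves the complex numbers and the field of the formal parameter alike.\<close>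

locale root_params =
  fixes h th :: "'k::field" and n :: nat
  assumes h_nz: "h \<noteq> 0" and h_pow: "\<And>k. k > 0 \<Longrightarrow> (h\<^sup>2) ^ k \<noteq> 1"
    and n_pos: "n > 0" and th2: "th\<^sup>2 = - inverse (h ^ n)" and not_char_2: "(1::'k) \<noteq> - 1"
begin

abbreviation "q \<equiv> h\<^sup>2"
abbreviation "t \<equiv> th\<^sup>2"
abbreviation "S \<equiv> disc_set h th n"

lemma th_nz: "th \<noteq> 0" using th2 h_nz by auto

lemma h_powi_eq_1: "h powi k = 1 \<longleftrightarrow> k = 0"
proof
  assume *: "h powi k = 1"
  have "(h\<^sup>2) ^ m = (h ^ m)\<^sup>2" for m by (simp only: power_mult[symmetric] mult.commute)
  moreover have "h ^ nat \<bar>k\<bar> = 1"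
    using * by (cases "k \<ge> 0") (auto simp: power_int_def power_inverse)
  ultimately have "(h\<^sup>2) ^ nat \<bar>k\<bar> = 1" by simp
  then show "k = 0" using h_pow[of "nat \<bar>k\<bar>"] by auto
qed simp

lemma t_powi: "t = - (h powi (- int n))" using th2 by (simp add: power_int_minus)

lemma t_h_ne_1: "t * h powi k \<noteq> 1"
proof
  assume *: "t * h powi k = 1"
  have e: "t * h powi k = - (h powi (k - int n))"
    unfolding t_powi using h_nz by (simp add: power_int_diff power_int_minus divide_inverse)
  then have "(h powi (k - int n)) * (h powi (k - int n)) = 1" using * by (metis minus_mult_minus mult_1)
  then have "h powi ((k - int n) + (k - int n)) = 1" using h_nz by (subst power_int_add) auto
  then have "k = int n" unfolding h_powi_eq_1 by simp
  then show False using e * not_char_2 by simp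
qed

lemma t_ne: "t * q ^ i \<noteq> 1" 
  using t_h_ne_1[of "int (2 * i)"] by (simp only: power_int_of_nat power_mult not_False_eq_True)

sublocale qt: qt_params q t
proof
  show "q \<noteq> 0" using h_nz by simp
  show "q ^ i \<noteq> 1" if "i > 0" for i using that by (rule h_pow)
  show "t * q ^ i \<noteq> 1" for i by (rule t_ne)
qed

lemma t2: "t\<^sup>2 * q ^ j = h powi (2 * int j - 2 * int n)"
proof -
  have "x\<^sup>2 = p * p" if "x = - p" for x p :: 'k using that by (simp add: power2_eq_square)
  note 1 = this[OF t_powi]
  have 2: "q ^ j = h powi (int (2 * j))" by (simp only: power_int_of_nat power_mult)
  have "t\<^sup>2 * q ^ j = h powi ((- int n + - int n) + int (2 * j))"
    unfolding 1 2 using h_nz by (metis power_int_add)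
  then show ?thesis by (simp add: algebra_simps)
qed

text \<open>The only factor \<open>1 - t\<^sup>2 q\<^sup>j\<close> that vanishes; all the degeneration at this value of \<open>t\<close> comes from it.\<close>

lemma t2_eq_1: "t\<^sup>2 * q ^ j = 1 \<longleftrightarrow> j = n"
  unfolding t2 h_powi_eq_1 by auto

lemma evalue_nz: "qt.evalue N \<noteq> 0 \<longleftrightarrow> N < n"
proof -
  have "qt.evalue N \<noteq> 0 \<longleftrightarrow> (\<forall>j\<in>{1..N}. t\<^sup>2 * q ^ j \<noteq> 1)"
    unfolding qt.evalue_def using t_ne th_nz by (subst prod_zero_iff) auto
  also have "\<dots> \<longleftrightarrow> N < n" unfolding t2_eq_1 using n_pos by auto
  finally show ?thesis .
qed

lemma enorm_nz: "qt.enorm N \<noteq> 0 \<longleftrightarrow> N < n"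
proof -
  have "qt.enorm N \<noteq> 0 \<longleftrightarrow> (\<forall>j\<in>{1..N}. t\<^sup>2 * q ^ j \<noteq> 1)"
    unfolding qt.enorm_def using t_ne qt.q_pow by (subst prod_zero_iff) auto
  also have "\<dots> \<longleftrightarrow> N < n" unfolding t2_eq_1 using n_pos by auto
  finally show ?thesis .
qed

lemma e_level_less: "qt.e_level m < n \<longleftrightarrow> m \<in> {- int n + 1..int n}"
  using n_pos by (auto simp: qt.e_level_def)

lemma e_poly_value: "leval (e_poly q t m) (inverse th) \<noteq> 0 \<longleftrightarrow> m \<in> {- int n + 1..int n}"
  unfolding qt.e_poly_eq e_level_less[symmetric] evalue_nz[symmetric]
proof (rule qt.leval_e_explicit)
  show "inverse th \<noteq> 0" using th_nz by simp
  show "(inverse th)\<^sup>2 = 1 / t" by (simp add: divide_inverse power_inverse)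
qed

subsection \<open>The set of values of \<open>X\<close>\<close>

text \<open>The points \<open>t\<^sup>-\<^sup>1\<^sup>/\<^sup>2\<close> and \<open>t\<^sup>1\<^sup>/\<^sup>2 q\<^sup>n\<^sup>/\<^sup>2\<close> are opposite, which makes \<open>S\<close> symmetric under \<open>x \<mapsto> - x\<close>.\<close>

lemma inv_th: "inverse th = - (th * h ^ n)"
proof -
  have "th * (th * h ^ n) = - 1" using th2 h_nz by (simp add: power2_eq_square mult.assoc[symmetric])
  then have "th * (- (th * h ^ n)) = 1" by simp
  then show ?thesis by (rule inverse_unique)
qed

lemma disc_set_eq: "S = (\<lambda>j. th * h ^ j) ` {1..n} \<union> (\<lambda>j. - (th * h ^ j)) ` {1..n}"
proof -
  have 1: "inverse th * h powi (- int j) = - (th * h ^ (n - j))" if "j < n" for j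
    unfolding inv_th using that h_nz by (simp add: power_int_minus power_diff divide_inverse)
  have "{inverse th * h powi (- int j) | j. j < n} = (\<lambda>j. - (th * h ^ j)) ` {1..n}"
  proof (intro equalityI subsetI)
    fix x assume "x \<in> {inverse th * h powi (- int j) | j. j < n}"
    then obtain j where j: "j < n" "x = - (th * h ^ (n - j))" using 1 by auto
    then have "n - j \<in> {1..n}" by auto
    then show "x \<in> (\<lambda>j. - (th * h ^ j)) ` {1..n}" unfolding j(2) by (rule imageI)
  next
    fix x assume "x \<in> (\<lambda>j. - (th * h ^ j)) ` {1..n}"
    then obtain j where j: "j \<in> {1..n}" "x = - (th * h ^ j)" by auto
    then have "n - j < n" "n - (n - j) = j" by auto
    then have "x = inverse th * h powi (- int (n - j))" using 1[of "n - j"] j by simp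
    then show "x \<in> {inverse th * h powi (- int j) | j. j < n}" using \<open>n - j < n\<close> by blast
  qed
  then show ?thesis unfolding disc_set_def by (auto simp: image_iff)
qed

lemma S_I: "j \<in> {1..n} \<Longrightarrow> th * h ^ j \<in> S" "j \<in> {1..n} \<Longrightarrow> - (th * h ^ j) \<in> S"
  unfolding disc_set_eq by auto

lemma S_cases:
  assumes "x \<in> S" obtains j s where "j \<in> {1..n}" "s = 1 \<or> s = - 1" "x = s * (th * h ^ j)"
proof -
  consider j where "j \<in> {1..n}" "x = th * h ^ j" | j where "j \<in> {1..n}" "x = - (th * h ^ j)"
    using assms unfolding disc_set_eq by blast
  then show thesis
  proof cases
    case (1 j)
    then show thesis using that[of j 1] by simp
  next
    case (2 j)
    then show thesis using that[of j "- 1"] by simp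
  qed
qed

lemma S_I': "j \<in> {1..n} \<Longrightarrow> s = 1 \<or> s = - 1 \<Longrightarrow> s * (th * h ^ j) \<in> S"
  using S_I by auto

lemma finite_S: "finite S" unfolding disc_set_eq by auto
lemma zero_S: "0 \<notin> S" unfolding disc_set_eq using th_nz h_nz by auto
lemma S_nz: "x \<in> S \<Longrightarrow> x \<noteq> 0" using zero_S by auto

lemma inv_th_in_S: "inverse th \<in> S" "- inverse th \<in> S"
  using S_I[of n] n_pos by (auto simp: inv_th)

lemma S_square: "x \<in> S \<Longrightarrow> \<exists>j\<in>{1..n}. x\<^sup>2 = t * q ^ j"
proof (elim S_cases)
  fix j s assume *: "j \<in> {1..n}" "s = 1 \<or> s = - 1" "x = s * (th * h ^ j)"
  have "x\<^sup>2 = t * q ^ j"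
    using *(2,3) by (auto simp: power_mult_distrib power_mult[symmetric] mult.commute)
  then show ?thesis using *(1) by blast
qed

lemma S_square_ne: assumes "x \<in> S" shows "x\<^sup>2 \<noteq> 1" "x\<^sup>2 \<noteq> t"
proof -
  obtain j where j: "j \<in> {1..n}" "x\<^sup>2 = t * q ^ j" using S_square assms by blast
  show "x\<^sup>2 \<noteq> 1" using j t_ne by auto
  show "x\<^sup>2 \<noteq> t" using j qt.q_pow[of j] th_nz by auto
qed

lemma S_pi: assumes "x \<in> S" shows "h / x \<in> S"
  using assms
proof (cases rule: S_cases)
  case (1 j s)
  have s: "inverse s = s" using 1 by auto
  have "h / x = s * (inverse th * (h * inverse (h ^ j)))" unfolding 1
    using s by (simp add: divide_inverse mult_ac)
  also have "\<dots> = - s * (th * h ^ (n + 1 - j))" unfolding inv_th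
    using 1 h_nz by (simp add: power_diff divide_inverse mult_ac)
  finally have e: "h / x = - s * (th * h ^ (n + 1 - j))" .
  show ?thesis unfolding e by (rule S_I') (use 1 in auto)
qed

text \<open>Inversion preserves \<open>S\<close> except at the two end points \<open>x\<^sup>2 = t\<inverse>\<close>.\<close>

lemma S_inv: assumes "x \<in> S" "x\<^sup>2 \<noteq> inverse t" shows "inverse x \<in> S"
  using assms(1)
proof (cases rule: S_cases)
  case (1 j s)
  have s: "inverse s = s" using 1 by auto
  have "j \<noteq> n"
  proof
    assume j: "j = n"
    have "x\<^sup>2 = (th * h ^ n)\<^sup>2" using 1 j by (auto simp: power_mult_distrib)
    also have "\<dots> = (inverse th)\<^sup>2" unfolding inv_th by simp
    finally show False using assms(2) by (simp add: power_inverse)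
  qed
  have "inverse x = s * (inverse th * (inverse (h ^ j)))" unfolding 1
    using s by (simp add: mult_ac)
  also have "\<dots> = - s * (th * h ^ (n - j))" unfolding inv_th
    using 1 h_nz by (simp add: power_diff divide_inverse mult_ac)
  finally have e: "inverse x = - s * (th * h ^ (n - j))" .
  show ?thesis unfolding e by (rule S_I') (use 1 \<open>j \<noteq> n\<close> in auto)
qed

lemma not_inv_S: assumes "x\<^sup>2 = inverse t" shows "inverse x \<notin> S"
proof
  assume "inverse x \<in> S"
  moreover have "(inverse x)\<^sup>2 = t" using assms by (simp add: power_inverse)
  ultimately show False using S_square_ne by auto
qed

subsection \<open>The ideal of \<open>e\<^sub>-\<^sub>n\<close>\<close>

lemma disjoint_images: "(\<lambda>j. th * h ^ j) ` {1..n} \<inter> (\<lambda>j. - (th * h ^ j)) ` {1..n} = {}"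
proof (rule ccontr)
  assume "\<not> ?thesis"
  then obtain i j where ij: "th * h ^ i = - (th * h ^ j)" by auto
  then have "th * (h ^ i + h ^ j) = 0" by (simp add: distrib_left)
  then have "h ^ i = - (h ^ j)" using th_nz by (simp add: eq_neg_iff_add_eq_0)
  then have m1: "h powi (int i - int j) = - 1" using h_nz by (simp add: power_int_diff)
  have "h powi ((int i - int j) + (int i - int j)) = h powi (int i - int j) * h powi (int i - int j)"
    by (rule power_int_add) (simp add: h_nz)
  then have "h powi ((int i - int j) + (int i - int j)) = 1" unfolding m1 by simp
  then have "int i - int j = 0" unfolding h_powi_eq_1 by simp
  then show False using m1 not_char_2 by simp
qed

lemma inj_th: "inj_on (\<lambda>j. th * h ^ j) {1..n}" "inj_on (\<lambda>j. - (th * h ^ j)) {1..n}"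
proof -
  have "i = j" if "h ^ i = h ^ j" for i j
  proof -
    have "h powi (int i - int j) = 1" using h_nz that by (simp add: power_int_diff)
    then show ?thesis by (simp add: h_powi_eq_1)
  qed
  then show "inj_on (\<lambda>j. th * h ^ j) {1..n}" "inj_on (\<lambda>j. - (th * h ^ j)) {1..n}"
    using th_nz by (auto intro!: inj_onI)
qed

lemma prod_S: "(\<Prod>x\<in>S. f x) = (\<Prod>j\<in>{1..n}. f (th * h ^ j) * f (- (th * h ^ j)))"
  for f :: "'k \<Rightarrow> 'a::comm_monoid_mult"
  unfolding disc_set_eq
  by (subst prod.union_disjoint[OF _ _ disjoint_images])
    (simp_all only: prod.reindex[OF inj_th(1)] prod.reindex[OF inj_th(2)] prod.distrib o_def
      finite_imageI finite_atLeastAtMost)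

lemma sum_S: "(\<Sum>x\<in>S. f x) = (\<Sum>j\<in>{1..n}. f (th * h ^ j) + f (- (th * h ^ j)))"
  for f :: "'k \<Rightarrow> 'a::comm_monoid_add"
  unfolding disc_set_eq
  by (subst sum.union_disjoint[OF _ _ disjoint_images])
    (simp_all only: sum.reindex[OF inj_th(1)] sum.reindex[OF inj_th(2)] sum.distrib o_def
      finite_imageI finite_atLeastAtMost)

lemma card_S: "card S = 2 * n"
  unfolding disc_set_eq
  by (subst card_Un_disjoint[OF _ _ disjoint_images])
    (simp_all only: card_image[OF inj_th(1)] card_image[OF inj_th(2)] finite_imageI finite_atLeastAtMost, simp)

lemma vpoly_S: "vpoly S = (\<Prod>j\<in>{1..n}. lmonom 1 2 - cst (t * q ^ j))"
  unfolding vpoly_def prod_S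
proof (intro prod.cong refl)
  fix j
  have sq: "(XX - cst a) * (XX - cst (- a)) = lmonom 1 2 - cst (a\<^sup>2)" for a :: 'k
    by (simp add: single_uminus algebra_simps mult_single power2_eq_square)
  have "(th * h ^ j)\<^sup>2 = t * q ^ j" by (simp add: power_mult_distrib power_mult[symmetric] mult.commute)
  then show "(XX - cst (th * h ^ j)) * (XX - cst (- (th * h ^ j))) = lmonom 1 2 - cst (t * q ^ j)"
    unfolding sq by (simp only:)
qed

text \<open>At this \<open>t\<close> the shifted factorials of \<open>psi\<close> cancel against each other, and a pure \<open>q\<close>-binomial coefficient remains.\<close>

lemma psi_special: "j \<le> n \<Longrightarrow> psi q t n j = qt.gauss n j * inverse (h ^ n) ^ j"
proof (induction j)
  case 0
  then show ?case by simp
next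
  case (Suc j)
  define c where "c = inverse (h ^ n)"
  have f: "1 - t * q ^ j = q ^ j * c * (1 - t * q ^ (n - j))"
  proof -
    have "q ^ j * c * (t * q ^ (n - j)) = - (c * c) * (q ^ j * q ^ (n - j))" by (simp add: th2 c_def)
    also have "q ^ j * q ^ (n - j) = h ^ n * h ^ n" using Suc.prems
      by (simp flip: power_add power_mult add: mult_2)
    also have "- (c * c) * (h ^ n * h ^ n) = - 1" using h_nz by (simp add: c_def field_simps)
    finally show ?thesis by (simp add: th2 c_def algebra_simps)
  qed
  have nz: "1 - t * q ^ (n - j) \<noteq> 0" "1 - q ^ Suc j \<noteq> 0" using t_ne qt.qSuc by auto
  have "psi q t n (Suc j) * ((1 - q ^ Suc j) * (1 - t * q ^ (n - j)))
     = qt.gauss n j * c ^ j * ((1 - q ^ (n - j)) * (1 - t * q ^ j))"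
    using qt.psi_Suc[of j n] Suc by (simp add: c_def)
  also have "\<dots> = (qt.gauss n j * ((1 - q ^ (n - j)) * q ^ j)) * c ^ Suc j * (1 - t * q ^ (n - j))"
    unfolding f by (simp add: mult_ac)
  also have "qt.gauss n j * ((1 - q ^ (n - j)) * q ^ j) = qt.gauss n (Suc j) * (1 - q ^ Suc j)"
    using qt.gauss_Suc_ratio[of j n] Suc.prems by simp
  finally have "psi q t n (Suc j) * ((1 - q ^ Suc j) * (1 - t * q ^ (n - j))) 
      = qt.gauss n (Suc j) * c ^ Suc j * ((1 - q ^ Suc j) * (1 - t * q ^ (n - j)))"
    by (simp only: mult_ac)
  then show ?case using nz unfolding c_def by (metis mult_right_cancel mult_eq_0_iff)
qed

text \<open>By the \<open>q\<close>-binomial theorem \<open>e\<^sub>-\<^sub>n\<close> is \<open>X\<^sup>-\<^sup>n\<close> times a product over \<open>j\<close> of factors with roots \<open>X\<^sup>2 = t q\<^sup>j\<close>.\<close>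

lemma e_neg_vpoly: "\<exists>c. c \<noteq> 0 \<and> e_poly q t (- int n) = lmonom c (- int n) * vpoly S"
proof -
  define b where "b = inverse (h ^ n)"
  have "e_poly q t (- int n) = e_neg q t n" by (simp add: qt.e_poly_eq e_explicit_def)
  also have "\<dots> = (\<Sum>j\<le>n. lmonom 1 (- int n) * (cst (qt.gauss n j) * lmonom b 2 ^ j))"
    unfolding e_neg_def
    by (intro sum.cong refl) (simp add: psi_special b_def mult_single single_power algebra_simps)
  also have "\<dots> = lmonom 1 (- int n) * (\<Prod>i<n. 1 + cst (q ^ i) * lmonom b 2)"
    by (subst qt.q_binomial) (auto simp: single_add mult_single sum_distrib_left)
  also have "(\<Prod>i<n. 1 + cst (q ^ i) * lmonom b 2) = (\<Prod>i<n. cst (q ^ i * b) * (lmonom 1 2 - cst (t * q ^ (n - i))))"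
  proof (intro prod.cong refl)
    fix i assume i: "i \<in> {..<n}"
    have "q ^ i * b * (t * q ^ (n - i)) = - (b * b) * (q ^ i * q ^ (n - i))" by (simp add: th2 b_def)
    also have "q ^ i * q ^ (n - i) = h ^ n * h ^ n" using i
      by (simp flip: power_add power_mult add: mult_2)
    also have "- (b * b) * (h ^ n * h ^ n) = - 1" using h_nz by (simp add: b_def field_simps)
    finally show "1 + cst (q ^ i) * lmonom b 2 = cst (q ^ i * b) * (lmonom 1 2 - cst (t * q ^ (n - i)))"
      by (simp add: right_diff_distrib mult_single single_uminus)
  qed
  also have "\<dots> = (\<Prod>i<n. cst (q ^ i * b)) * (\<Prod>i<n. lmonom 1 2 - cst (t * q ^ (n - i)))"
    by (rule prod.distrib)
  also have "(\<Prod>i<n. lmonom 1 2 - cst (t * q ^ (n - i))) = vpoly S"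
    unfolding vpoly_S by (rule prod.reindex_bij_witness[of _ "\<lambda>j. n - j" "\<lambda>i. n - i"]) auto
  also have "(\<Prod>i<n. cst (q ^ i * b)) = cst (\<Prod>i<n. q ^ i * b)"
  proof -
    have "(\<Prod>i\<in>A. cst (f i)) = cst (\<Prod>i\<in>A. f i)" for A :: "nat set" and f :: "nat \<Rightarrow> 'k"
      by (induction A rule: infinite_finite_induct) (auto simp: mult_single)
    then show ?thesis .
  qed
  finally have "e_poly q t (- int n) = lmonom (\<Prod>i<n. q ^ i * b) (- int n) * vpoly S"
    by (simp add: mult.assoc[symmetric] mult_single)
  moreover have "(\<Prod>i<n. q ^ i * b) \<noteq> 0" using h_nz by (simp add: b_def)
  ultimately show ?thesis by blast
qed

definition Ideal :: "'k laurent set" where "Ideal = {f. \<forall>x\<in>S. leval f x = 0}"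

lemma principal_ideal_e: "principal_ideal (e_poly q t (- int n)) = Ideal"
proof -
  obtain c where c: "c \<noteq> 0" "e_poly q t (- int n) = lmonom c (- int n) * vpoly S"
    using e_neg_vpoly by blast
  have u: "lmonom c (- int n) dvd (1 :: 'k laurent)"
    by (rule dvdI[of _ _ "lmonom (inverse c) (int n)"]) (simp add: mult_single c)
  have "e_poly q t (- int n) dvd f \<longleftrightarrow> vpoly S dvd f" for f
    unfolding c using u by (simp add: mult.commute[of "lmonom c _"] is_unit_mult_iff mult_unit_dvd_iff)
  then show ?thesis unfolding principal_ideal_def Ideal_def
    using vpoly_dvd_iff[OF finite_S zero_S] by auto
qed

subsection \<open>The constant term as a sum over \<open>S\<close>\<close>

lemma tq_prod_nz: "(\<Prod>i<m. 1 - t * q ^ Suc i) \<noteq> 0"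
proof -
  have "1 - t * q ^ Suc i \<noteq> 0" for i using t_ne[of "Suc i"] by (metis eq_iff_diff_eq_0)
  then show ?thesis by (subst prod_zero_iff) (auto simp del: power_Suc)
qed

text \<open>As \<open>t\<inverse> = t q\<^sup>n\<close>, almost all factors of \<open>c\<^sub>k\<close> cancel, and what remains is \<open>t\<^sup>k\<close> times a polynomial of degree \<open>n - 1\<close> in \<open>q\<^sup>k\<close>.\<close>

lemma cc_special:
  "cc q t k = t powi k * ((\<Prod>i<n - 1. 1 - t * q ^ Suc i * q powi k) / (\<Prod>i<n - 1. 1 - t * q ^ Suc i))"
proof -
  define D where "D = (\<Prod>i<n - 1. 1 - t * q ^ Suc i)"
  define g where "g k = t powi k * ((\<Prod>i<n - 1. 1 - t * q ^ Suc i * q powi k) / D)" for k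
  have D: "D \<noteq> 0" unfolding D_def by (rule tq_prod_nz)
  have tn: "inverse t = t * q ^ n"
  proof (rule inverse_unique)
    show "t * (t * q ^ n) = 1" using t2_eq_1[of n] by (simp add: power2_eq_square mult.assoc)
  qed
  have q0: "q \<noteq> 0" using h_nz by simp
  have rec: "g (k + 1) * (1 - t * q powi (k + 1)) = (t - q powi k) * g k" for k
  proof -
    have t1: "t powi (k + 1) = t * t powi k" using th_nz by (simp add: power_int_add)
    have q1: "q powi (k + 1) = q * q powi k" using q0 by (simp add: power_int_add)
    define F where "F i = 1 - t * q ^ Suc i * q powi k" for i
    have F: "1 - t * q ^ Suc i * q powi (k + 1) = F (Suc i)" for i
      unfolding F_def q1 by (simp add: mult_ac)
    have F0: "1 - t * q powi (k + 1) = F 0" by (simp add: F_def q1 mult_ac)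
    have Fn: "t - q powi k = t * F (n - 1)"
    proof -
      have "t * (t * q ^ n) = 1" using tn th_nz by (metis right_inverse power_not_zero)
      then have "t * (t * q ^ Suc (n - 1) * q powi k) = q powi k"
        using n_pos by (simp add: mult.assoc[symmetric])
      then show ?thesis unfolding F_def by (simp add: right_diff_distrib)
    qed
    have pe: "(\<Prod>i<n - 1. F (Suc i)) * F 0 = (\<Prod>i<n - 1. F i) * F (n - 1)"
      by (metis prod.lessThan_Suc prod.lessThan_Suc_shift mult.commute)
    have g1: "g (k + 1) = t * t powi k * ((\<Prod>i<n - 1. F (Suc i)) / D)"
      unfolding g_def F t1 ..
    have g2: "g k = t powi k * ((\<Prod>i<n - 1. F i) / D)" unfolding g_def F_def ..
    have "g (k + 1) * F 0 = t * t powi k * (((\<Prod>i<n - 1. F (Suc i)) * F 0) / D)"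
      unfolding g1 by simp
    also have "\<dots> = t * F (n - 1) * g k" unfolding pe g2 by simp
    finally show ?thesis unfolding F0 Fn .
  qed
  have g0: "g 0 = 1" using D by (simp add: g_def D_def)
  have pos: "cc q t (int k) = g (int k)" for k
  proof (induction k)
    case 0
    then show ?case by (simp add: g0)
  next
    case (Suc k)
    have "q powi (int k + 1) = q ^ Suc k" using q0 by (simp add: power_int_add)
    then have "1 - t * q powi (int k + 1) \<noteq> 0" using t_ne[of "Suc k"] by (metis eq_iff_diff_eq_0)
    moreover have "cc q t (int k + 1) * (1 - t * q powi (int k + 1)) = g (int k + 1) * (1 - t * q powi (int k + 1))"
      unfolding qt.cc_rec rec Suc ..
    ultimately have "cc q t (int k + 1) = g (int k + 1)" by simp
    then show ?case by (simp add: add.commute)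
  qed
  have neg: "cc q t (- int k) = g (- int k)" for k
  proof (induction k)
    case 0
    then show ?case by (simp add: g0)
  next
    case (Suc k)
    have s: "- int (Suc k) + 1 = - int k" by simp
    have "t - q powi (- int (Suc k)) \<noteq> 0"
    proof
      assume "t - q powi (- int (Suc k)) = 0"
      then have "t = inverse (q ^ Suc k)" by (simp only: power_int_minus power_int_of_nat right_minus_eq)
      then have "t * q ^ Suc k = 1" using q0 by (metis left_inverse power_not_zero)
      then show False using t_ne[of "Suc k"] by simp
    qed
    moreover have "(t - q powi (- int (Suc k))) * cc q t (- int (Suc k)) = (t - q powi (- int (Suc k))) * g (- int (Suc k))"
      using qt.cc_rec[of "- int (Suc k)"] rec[of "- int (Suc k)"] Suc by (simp only: s)
    ultimately show ?case by simp
  qed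
  have "cc q t k = g k" using pos[of "nat k"] neg[of "nat (- k)"] by (cases "k \<ge> 0") auto
  then show ?thesis by (simp add: g_def D_def)
qed

definition cc_coeff :: "nat \<Rightarrow> 'k" where
  "cc_coeff i = qt.gauss (n - 1) i * (- (t * q)) ^ i / (\<Prod>i<n - 1. 1 - t * q ^ Suc i)"

lemma cc_coeff_nz: "cc_coeff i \<noteq> 0"
proof -
  have "- (t * q) \<noteq> 0" using th_nz h_nz by simp
  then have "(- (t * q)) ^ i \<noteq> 0" by (rule power_not_zero)
  then show ?thesis unfolding cc_coeff_def divide_eq_0_iff mult_eq_0_iff
    using qt.gauss_nz tq_prod_nz by blast
qed

text \<open>Expanding this polynomial in powers of \<open>q\<^sup>k\<close> writes the moments \<open>c\<^sub>k\<close> as those of a measure supported at the points \<open>t q\<^sup>i\<close>.\<close>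

lemma cc_sum: "cc q t k = (\<Sum>i<n. cc_coeff i * (t * q ^ i) powi k)"
proof -
  have q0: "q \<noteq> 0" using h_nz by simp
  have "(\<Prod>i<n - 1. 1 - t * q ^ Suc i * q powi k) = (\<Prod>i<n - 1. 1 + (\<lambda>a. a) (q ^ i) * (- (t * q) * q powi k))"
    by (intro prod.cong refl) (simp add: mult_ac)
  also have "\<dots> = (\<Sum>i\<le>n - 1. qt.gauss (n - 1) i * (- (t * q) * q powi k) ^ i)"
    by (rule qt.q_binomial) auto
  also have "{..n - 1} = {..<n}" using n_pos by auto
  finally have e: "(\<Prod>i<n - 1. 1 - t * q ^ Suc i * q powi k) = (\<Sum>i<n. qt.gauss (n - 1) i * (- (t * q) * q powi k) ^ i)" .
  have p: "(t * q ^ i) powi k = t powi k * (q powi k) ^ i" for i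
    by (simp only: power_int_mult_distrib power_int_power power_int_power' mult_ac)
  show ?thesis unfolding cc_special e p cc_coeff_def sum_divide_distrib sum_distrib_left power_mult_distrib
    by (intro sum.cong refl) (simp only: times_divide_eq_right times_divide_eq_left mult_ac)
qed

text \<open>The mass at \<open>X\<^sup>2 = t q\<^sup>j\<close>, halved between the two square roots. The index \<open>j\<close> runs over \<open>1..n\<close>, and \<open>t q\<^sup>j\<close> is the inverse of \<open>t q\<^sup>n\<^sup>-\<^sup>j\<close>, hence the index \<open>n - j\<close>: the functional pairs with \<open>\<mu>\<^sup>0\<close> at the opposite power.\<close>

definition mass :: "'k \<Rightarrow> 'k" where
  "mass x = cc_coeff (n - (THE j. j \<in> {1..n} \<and> (x = th * h ^ j \<or> x = - (th * h ^ j)))) / 2"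

lemma two_nz: "(2::'k) \<noteq> 0"
  using not_char_2 by (metis add_eq_0_iff one_add_one)

lemma mass_eq: assumes "j \<in> {1..n}" shows "mass (th * h ^ j) = cc_coeff (n - j) / 2" "mass (- (th * h ^ j)) = cc_coeff (n - j) / 2"
proof -
  have 1: "(THE i. i \<in> {1..n} \<and> (x = th * h ^ i \<or> x = - (th * h ^ i))) = j"
    if "x = th * h ^ j \<or> x = - (th * h ^ j)" for x
  proof (rule the_equality)
    show "j \<in> {1..n} \<and> (x = th * h ^ j \<or> x = - (th * h ^ j))" using assms that by simp
    fix i assume i: "i \<in> {1..n} \<and> (x = th * h ^ i \<or> x = - (th * h ^ i))"
    have ne: "th * h ^ a \<noteq> - (th * h ^ b)" if "a \<in> {1..n}" "b \<in> {1..n}" for a b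
      using disjoint_images that by blast
    have "th * h ^ i = th * h ^ j"
      using that i ne[of i j] ne[of j i] assms by (metis neg_equal_iff_equal)
    then show "i = j" using inj_th(1) i assms by (auto dest: inj_onD)
  qed
  show "mass (th * h ^ j) = cc_coeff (n - j) / 2" "mass (- (th * h ^ j)) = cc_coeff (n - j) / 2"
    unfolding mass_def 1[OF disjI1[OF refl]] 1[OF disjI2[OF refl]] by (rule refl)+
qed

lemma mass_nz: "mass x \<noteq> 0" using cc_coeff_nz two_nz by (simp add: mass_def)

lemma const_term_S: "const_term (mu_weight q t) f = (\<Sum>x\<in>S. mass x * leval f x)"
proof (induction f rule: laurent_induct)
  case (add f g)
  then show ?case by (simp add: const_term_add leval_add sum.distrib distrib_left)
next
  case (monom c m)
  have q0: "q \<noteq> 0" using h_nz by simp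
  have "(\<Sum>x\<in>S. mass x * leval (lmonom c m) x) = (\<Sum>j\<in>{1..n}. c * (cc_coeff (n - j) / 2 * ((th * h ^ j) powi m + (- (th * h ^ j)) powi m)))"
    unfolding sum_S by (intro sum.cong refl) (simp add: mass_eq algebra_simps)
  also have "\<dots> = c * mu_weight q t (- m)"
  proof (cases "even m")
    case False
    then have "(- x) powi m = - (x powi m)" for x :: 'k by (simp add: power_int_minus_left)
    then show ?thesis using False by (simp add: mu_weight_def)
  next
    case True
    then obtain k where k: "m = 2 * k" by (auto elim: evenE)
    have *: "cc_coeff (n - j) / 2 * ((th * h ^ j) powi m + (- (th * h ^ j)) powi m) = cc_coeff (n - j) * (t * q ^ (n - j)) powi (- k)"
      if "j \<in> {1..n}" for j
    proof -
      have "(t * q ^ (n - j)) * (t * q ^ j) = t\<^sup>2 * q ^ n" using that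
        by (simp add: power2_eq_square mult_ac flip: power_add)
      also have "\<dots> = 1" by (rule iffD2[OF t2_eq_1 refl])
      finally have inv: "inverse (t * q ^ (n - j)) = t * q ^ j" by (rule inverse_unique)
      have "(th * h ^ j) powi m = ((th * h ^ j) powi 2) powi k" unfolding k by (rule power_int_mult)
      also have "(th * h ^ j) powi 2 = t * q ^ j"
        by (simp add: power_mult_distrib flip: power_mult) (simp add: mult.commute)
      also have "(t * q ^ j) powi k = (t * q ^ (n - j)) powi (- k)"
        unfolding inv[symmetric] by (simp only: power_int_inverse power_int_minus)
      finally have "(th * h ^ j) powi m = (t * q ^ (n - j)) powi (- k)" .
      moreover have "(- (th * h ^ j)) powi m = (th * h ^ j) powi m" using True by (simp add: power_int_minus_left)
      ultimately show ?thesis using two_nz by simp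
    qed
    have "(\<Sum>j\<in>{1..n}. c * (cc_coeff (n - j) / 2 * ((th * h ^ j) powi m + (- (th * h ^ j)) powi m)))
      = (\<Sum>j\<in>{1..n}. c * (cc_coeff (n - j) * (t * q ^ (n - j)) powi (- k)))"
      using * by (intro sum.cong refl) simp
    also have "\<dots> = (\<Sum>i<n. c * (cc_coeff i * (t * q ^ i) powi (- k)))"
      by (rule sum.reindex_bij_witness[of _ "\<lambda>i. n - i" "\<lambda>j. n - j"]) auto
    also have "\<dots> = c * cc q t (- k)" unfolding cc_sum sum_distrib_left ..
    also have "cc q t (- k) = mu_weight q t (- m)"
    proof -
      have "- m div 2 = - k" unfolding k by presburger
      then show ?thesis using True by (simp add: mu_weight_def)
    qed
    finally show ?thesis .
  qed
  finally show ?case by simp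
qed

text \<open>A discrete measure without zero masses is nondegenerate on functions on its support.\<close>

lemma const_term_radical: "(\<forall>g. const_term (mu_weight q t) (f * g) = 0) \<longleftrightarrow> f \<in> Ideal"
proof
  assume *: "\<forall>g. const_term (mu_weight q t) (f * g) = 0"
  show "f \<in> Ideal" unfolding Ideal_def
  proof (intro CollectI ballI)
    fix x assume x: "x \<in> S"
    have "0 = const_term (mu_weight q t) (f * delta S x)" using * by simp
    also have "\<dots> = (\<Sum>y\<in>S. if x = y then mass x * leval f x else 0)"
      unfolding const_term_S using finite_S zero_S x S_nz
      by (intro sum.cong refl) (auto simp: leval_mult leval_delta)
    also have "\<dots> = mass x * leval f x" using finite_S x by simp
    finally show "leval f x = 0" using mass_nz by simp
  qed
next
  assume "f \<in> Ideal"
  then show "\<forall>g. const_term (mu_weight q t) (f * g) = 0"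
    using S_nz by (auto simp: Ideal_def const_term_S leval_mult intro!: sum.neutral)
qed

end

section \<open>The operators on Laurent polynomials\<close>

lemma subst_inv_divdiff: "subst_inv 1 (divdiff f) = lmonom 1 2 * divdiff f"
proof -
  have "subst_inv 1 ((lmonom 1 2 - 1) * divdiff f) = f - subst_inv 1 f"
    unfolding divdiff_eq by (simp add: subst_inv_diff)
  then have "(lmonom 1 (- 2) - 1) * subst_inv 1 (divdiff f) = f - subst_inv 1 f"
    by (simp add: subst_inv_mult subst_inv_diff)
  moreover have "lmonom 1 2 * (lmonom 1 (- 2) - 1) = (1 - lmonom 1 2 :: 'a laurent)"
    by (simp add: right_diff_distrib mult_single)
  ultimately have "(1 - lmonom 1 2) * subst_inv 1 (divdiff f) = lmonom 1 2 * (f - subst_inv 1 f)"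
    by (metis mult.assoc)
  then have "(lmonom 1 2 - 1) * subst_inv 1 (divdiff f) = lmonom 1 2 * (subst_inv 1 f - f)"
    by (simp add: algebra_simps)
  also have "subst_inv 1 f - f = (lmonom 1 2 - 1) * divdiff f" by (rule divdiff_eq[symmetric])
  also have "lmonom 1 2 * ((lmonom 1 2 - 1) * divdiff f) = (lmonom 1 2 - 1) * (lmonom 1 2 * divdiff f)"
    by (simp only: mult.left_commute)
  finally show ?thesis using XX2_ne by (metis mult_left_cancel)
qed

text \<open>The divided difference of \<open>f\<close> is \<open>s\<close>-invariant up to the factor \<open>X\<^sup>2\<close>.\<close>

lemma divdiff_divdiff: "divdiff (divdiff f) = divdiff f"
  by (rule divdiff_unique) (simp add: subst_inv_divdiff algebra_simps)

lemma opT_add: "opT_poly th (f + g) = opT_poly th f + opT_poly th g"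
  by (simp add: opT_poly_eq subst_inv_add divdiff_add algebra_simps)

lemma opT_cst_mult: "opT_poly th (cst a * f) = cst a * opT_poly th f"
  unfolding opT_poly_eq divdiff_cst_mult subst_inv_mult[OF one_neq_zero] subst_inv_single
  by (simp add: algebra_simps)

lemma opT_mult:
  "opT_poly th (f * g) = subst_inv 1 f * opT_poly th g + cst (th - inverse th) * divdiff f * g"
  by (simp add: opT_poly_eq subst_inv_mult divdiff_mult algebra_simps)

lemma opT_1 [simp]: "opT_poly th 1 = cst th" by (simp add: opT_poly_eq)

lemma opT_opT:
  assumes "th \<noteq> 0"
  shows "opT_poly th (opT_poly th f) = cst (th - inverse th) * opT_poly th f + f"
proof -
  define c where "c = th - inverse th"
  define d where "d = divdiff f"
  define s where "s = subst_inv 1 f"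
  have ds: "lmonom 1 2 * d = d + s - f" using divdiff_eq[of f] by (simp add: d_def s_def algebra_simps)
  have s1: "subst_inv 1 (cst a * g) = cst a * subst_inv 1 g" for a and g :: "'a laurent"
    by (simp add: subst_inv_mult[OF one_neq_zero])
  have A: "subst_inv 1 (opT_poly th f) = cst th * f + cst c * (lmonom 1 2 * d)"
    unfolding opT_poly_eq subst_inv_add s1 subst_inv_divdiff by (simp add: c_def d_def)
  have B: "divdiff (opT_poly th f) = cst c * d - cst th * d"
    unfolding opT_poly_eq divdiff_add divdiff_cst_mult divdiff_subst_inv divdiff_divdiff
    by (simp add: c_def d_def)
  have "opT_poly th (opT_poly th f) = cst th * (cst th * f + cst c * (lmonom 1 2 * d)) + cst c * (cst c * d - cst th * d)"
    unfolding opT_poly_eq[of th "opT_poly th f"] A B c_def ..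
  also have "\<dots> = cst c * (cst th * s + cst c * d) + (cst th * cst th - cst th * cst c) * f"
    unfolding ds by (simp add: algebra_simps)
  also have "cst th * cst th - cst th * cst c = (1 :: 'a laurent)"
    using assms by (simp add: mult_single c_def algebra_simps flip: single_diff)
  finally show ?thesis by (simp add: opT_poly_eq c_def d_def s_def)
qed

lemma opT_XX_opT:
  assumes "th \<noteq> 0"
  shows "opT_poly th (XX * opT_poly th f) = lmonom 1 (- 1) * f"
  unfolding opT_mult[of th XX] opT_opT[OF assms] divdiff_XX by (simp add: algebra_simps)

lemma leval_opT:
  assumes "x \<noteq> 0"
  shows "(x\<^sup>2 - 1) * leval (opT_poly th f) x 
    = (th * x\<^sup>2 - inverse th) * leval f (inverse x) - (th - inverse th) * leval f x"
proof -
  have "(x\<^sup>2 - 1) * leval (opT_poly th f) x = th * (x\<^sup>2 - 1) * leval f (inverse x) + (th - inverse th) * ((x\<^sup>2 - 1) * leval (divdiff f) x)"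
    using assms by (simp add: opT_poly_eq leval_hom leval_subst_inv algebra_simps divide_inverse)
  also have "\<dots> = (th * x\<^sup>2 - inverse th) * leval f (inverse x) - (th - inverse th) * leval f x"
    unfolding leval_divdiff[OF assms] by (simp add: algebra_simps)
  finally show ?thesis .
qed

section \<open>Chains of weights\<close>

text \<open>If \<open>1/x\<close> lies in \<open>Z\<close>, then so does \<open>h / (1/x) = x h\<close>. Repeating this one runs along \<open>x, x h, x h\<^sup>2, \<dots>\<close>; as \<open>Z\<close> is finite and \<open>h\<close> is not a root of unity, some inverse must be missing, and there \<open>K\<close> holds.\<close>

lemma weight_chain:
  fixes h :: "'k::field"
  assumes fin: "finite Z" and Z0: "0 \<notin> Z" and h: "h \<noteq> 0" "\<And>k. k > 0 \<Longrightarrow> h ^ k \<noteq> 1"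
    and pi: "\<And>x. x \<in> Z \<Longrightarrow> h / x \<in> Z" and s: "\<And>x. x \<in> Z \<Longrightarrow> inverse x \<in> Z \<or> K x"
    and x: "x \<in> Z"
  shows "\<exists>k. (\<forall>i\<le>k. x * h ^ i \<in> Z) \<and> K (x * h ^ k) \<and> inverse (x * h ^ k) \<notin> Z"
proof -
  have x0: "x \<noteq> 0" using x Z0 by auto
  have step: "x * h ^ Suc i \<in> Z" if "inverse (x * h ^ i) \<in> Z" for i
    using pi[OF that] by (simp add: divide_inverse mult_ac)
  have "\<exists>i. inverse (x * h ^ i) \<notin> Z"
  proof (rule ccontr)
    assume "\<not> ?thesis"
    then have all: "inverse (x * h ^ i) \<in> Z" for i by auto
    have "inj (\<lambda>i. inverse (x * h ^ i))"
    proof (rule linorder_injI)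
      fix i j :: nat assume "i < j"
      then obtain d where "j = i + Suc d" by (metis less_imp_Suc_add add_Suc_right)
      then show "inverse (x * h ^ i) \<noteq> inverse (x * h ^ j)"
        using x0 h(1) h(2)[of "Suc d"] by (simp only: inverse_eq_iff_eq) (simp add: power_add)
    qed
    then have "infinite (range (\<lambda>i. inverse (x * h ^ i)))" by (rule range_inj_infinite)
    moreover have "range (\<lambda>i. inverse (x * h ^ i)) \<subseteq> Z" using all by auto
    ultimately show False using fin finite_subset by blast
  qed
  define k where "k = (LEAST i. inverse (x * h ^ i) \<notin> Z)"
  have k: "inverse (x * h ^ k) \<notin> Z" unfolding k_def by (rule LeastI_ex) fact
  have below: "inverse (x * h ^ i) \<in> Z" if "i < k" for i
    using not_less_Least[of i "\<lambda>i. inverse (x * h ^ i) \<notin> Z"] that by (auto simp: k_def)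
  have "x * h ^ i \<in> Z" if "i \<le> k" for i
    using that
  proof (cases i)
    case (Suc j)
    then show ?thesis using step[of j] below[of j] that by simp
  qed (use x in simp)
  moreover from this[of k] have "K (x * h ^ k)" using s[of "x * h ^ k"] k by auto
  ultimately show ?thesis using k by blast
qed

context root_params
begin

lemma h_pow': "k > 0 \<Longrightarrow> h ^ k \<noteq> 1"
  using h_powi_eq_1[of "int k"] by simp

lemma inverse_t_sq: "inverse t * inverse t = h ^ (2 * n)"
proof -
  have "inverse t = - (h ^ n)" by (simp add: th2)
  then show ?thesis by (simp only: minus_mult_minus mult_2 power_add)
qed

lemma h_pow_inj: "h ^ i = h ^ j \<Longrightarrow> i = j"
proof -
  assume "h ^ i = h ^ j"
  then have "h powi (int i - int j) = 1" using h_nz by (simp add: power_int_diff)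
  then show "i = j" by (simp add: h_powi_eq_1)
qed

text \<open>From any point of \<open>C\<close> the chain reaches an end point \<open>y\<close> with \<open>y\<^sup>2 = t\<inverse>\<close>. The chain from \<open>h / y\<close> runs through the whole half of \<open>S\<close> that ends in \<open>- y\<close>, and repeating the argument from \<open>- y\<close> gives the other half.\<close>

lemma closed_weights:
  assumes C: "C \<subseteq> S" "C \<noteq> {}" and pi: "\<And>x. x \<in> C \<Longrightarrow> h / x \<in> C"
    and s: "\<And>x. x \<in> C \<Longrightarrow> inverse x \<in> C \<or> x\<^sup>2 = inverse t"
  shows "C = S"
proof
  show "C \<subseteq> S" by fact
  have fin: "finite C" "0 \<notin> C" using C finite_S zero_S finite_subset by auto
  have chain: "\<exists>k. (\<forall>i\<le>k. x * h ^ i \<in> C) \<and> (x * h ^ k)\<^sup>2 = inverse t \<and> inverse (x * h ^ k) \<notin> C"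
    if "x \<in> C" for x
    by (rule weight_chain[of C h "\<lambda>x. x\<^sup>2 = inverse t", OF fin h_nz])
      (use that pi s h_pow' in auto)
  have step: "(\<forall>j\<in>{1..n}. inverse y * h ^ j \<in> C) \<and> - y \<in> C" if y: "y \<in> C" "y\<^sup>2 = inverse t" for y
  proof -
    have y0: "y \<noteq> 0" using y fin by auto
    obtain k where k: "\<forall>i\<le>k. h / y * h ^ i \<in> C" "(h / y * h ^ k)\<^sup>2 = inverse t"
      using chain[OF pi[OF y(1)]] by blast
    have "h / y * h ^ k * y = h ^ Suc k" using y0 by simp
    then have "h ^ (2 * Suc k) = (h / y * h ^ k)\<^sup>2 * y\<^sup>2"
      unfolding power_even_eq power_mult_distrib[symmetric] by (rule arg_cong[OF sym])
    also have "\<dots> = h ^ (2 * n)" unfolding k(2) y(2) by (rule inverse_t_sq)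
    finally have "Suc k = n" using h_pow_inj by fastforce
    have all: "inverse y * h ^ j \<in> C" if j: "j \<in> {1..n}" for j
    proof -
      obtain i where i: "j = Suc i" using j by (cases j) auto
      have "h / y * h ^ i = inverse y * h ^ j" by (simp add: i divide_inverse)
      moreover have "i \<le> k" using i j \<open>Suc k = n\<close> by auto
      ultimately show ?thesis using k(1) by metis
    qed
    have "inverse y * h ^ n = - y"
    proof -
      have "inverse t = - (h ^ n)" by (simp add: th2)
      then have "y * y = - (h ^ n)" using y(2) unfolding power2_eq_square[of y] by simp
      then have "h ^ n = y * (- y)" by simp
      then show ?thesis using y0 by simp
    qed
    then have "- y \<in> C" using all[of n] n_pos by auto
    then show ?thesis using all by blast
  qed
  obtain x where "x \<in> C" using C by auto
  from chain[OF this] obtain y where y: "y \<in> C" "y\<^sup>2 = inverse t" by blast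
  have "- y \<in> C" "(- y)\<^sup>2 = inverse t" using step[OF y] y by auto
  note both = step[OF y] step[OF this]
  have "(y * th) * (y * th) = (y * y) * (th * th)" by (simp only: mult_ac)
  also have "\<dots> = inverse t * t" using y(2) by (simp only: power2_eq_square)
  also have "\<dots> = 1" using th_nz by simp
  finally have "y * th = 1 \<or> y * th = - 1" by (simp only: square_eq_1_iff)
  then have "y * th = 1 \<or> y * (- th) = 1" by auto
  then have "inverse y = th \<or> inverse y = - th" using inverse_unique by blast
  then show "S \<subseteq> C" unfolding disc_set_eq using both by auto
qed

lemma ideal_mult: "f \<in> Ideal \<Longrightarrow> g * f \<in> Ideal"
  using S_nz by (auto simp: Ideal_def leval_mult)

text \<open>Modulo the ideal, multiplication by \<open>f\<close> is diagonal in the basis of delta functions.\<close>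

lemma delta_reduce:
  assumes "x \<in> S" shows "f * delta S x - cst (leval f x) * delta S x \<in> Ideal"
  using assms S_nz by (auto simp: Ideal_def leval_hom leval_delta[OF finite_S zero_S])

lemma interpolate_reduce: "f - (\<Sum>x\<in>S. cst (leval f x) * delta S x) \<in> Ideal"
  using leval_interpolate[OF finite_S zero_S, of _ "leval f"] by (auto simp: Ideal_def leval_diff)

text \<open>A subspace stable under \<open>X\<close> is, modulo the ideal, spanned by delta functions. The operators \<open>\<pi>\<close> and \<open>T\<close> move its support along the chain (for \<open>T\<close> the coefficient of the reflected delta function vanishes only at the ends), so by \<open>closed_weights\<close> the support is empty or everything.\<close>

lemma poly_quotient_irreducible:
  assumes add: "\<And>f g. f \<in> N \<Longrightarrow> g \<in> N \<Longrightarrow> f + g \<in> N" and mult: "\<And>f g. f \<in> N \<Longrightarrow> g * f \<in> N"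
    and T: "\<And>f. f \<in> N \<Longrightarrow> opT_poly th f \<in> N" and pi: "\<And>f. f \<in> N \<Longrightarrow> subst_inv h f \<in> N"
    and I: "Ideal \<subseteq> N"
  shows "N = Ideal \<or> N = UNIV"
proof -
  define C where "C = {x \<in> S. \<exists>f\<in>N. leval f x \<noteq> 0}"
  have delta: "delta S x \<in> N" if x: "x \<in> C" for x
  proof -
    obtain f where f: "f \<in> N" "leval f x \<noteq> 0" and "x \<in> S" using x by (auto simp: C_def)
    have "f * delta S x - cst (leval f x) * delta S x \<in> N" using delta_reduce[OF \<open>x \<in> S\<close>] I by auto
    then have "delta S x * f + (- 1) * (f * delta S x - cst (leval f x) * delta S x) \<in> N"
      using f by (intro add mult)
    moreover have "delta S x * f + (- 1) * (f * delta S x - cst (leval f x) * delta S x) = cst (leval f x) * delta S x"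
      by (simp add: algebra_simps)
    ultimately have "cst (inverse (leval f x)) * (cst (leval f x) * delta S x) \<in> N"
      using mult by metis
    then show ?thesis unfolding mult.assoc[symmetric] mult_single using f(2) by simp
  qed
  show ?thesis
  proof (cases "C = {}")
    case True
    then have "N \<subseteq> Ideal" by (auto simp: C_def Ideal_def)
    then show ?thesis using I by auto
  next
    case False
    have "C = S"
    proof (rule closed_weights)
      show "C \<subseteq> S" "C \<noteq> {}" using False by (auto simp: C_def)
      fix x assume x: "x \<in> C"
      then have xS: "x \<in> S" by (auto simp: C_def)
      have x0: "x \<noteq> 0" using xS by (rule S_nz)
      have "leval (subst_inv h (delta S x)) (h / x) = 1"
        using x0 h_nz xS by (simp add: leval_subst_inv leval_delta[OF finite_S zero_S])
      then show "h / x \<in> C" using S_pi[OF xS] pi[OF delta[OF x]] by (force simp: C_def)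
      show "inverse x \<in> C \<or> x\<^sup>2 = inverse t"
      proof (cases "x\<^sup>2 = inverse t")
        case False
        have iS: "inverse x \<in> S" by (rule S_inv[OF xS False])
        have "inverse x \<noteq> x" using S_square_ne(1)[OF xS] x0 
          by (metis power2_eq_square right_inverse)
        then have "leval (delta S x) (inverse x) = 0"
          using iS xS by (simp add: leval_delta[OF finite_S zero_S])
        moreover have "leval (delta S x) x = 1" using xS by (simp add: leval_delta[OF finite_S zero_S])
        ultimately have e: "((inverse x)\<^sup>2 - 1) * leval (opT_poly th (delta S x)) (inverse x) = th * (inverse x)\<^sup>2 - inverse th"
          using leval_opT[of "inverse x" th "delta S x"] x0 by simp
        have "th * (inverse x)\<^sup>2 - inverse th \<noteq> 0"
        proof
          assume "th * (inverse x)\<^sup>2 - inverse th = 0"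
          then have "th * (th * (inverse x)\<^sup>2) = 1" using th_nz by simp
          then have "x\<^sup>2 = x\<^sup>2 * (th * (th * (inverse x)\<^sup>2))" by simp
          also have "\<dots> = (th * th) * (x * inverse x)\<^sup>2" by (simp only: power_mult_distrib mult_ac)
          also have "\<dots> = t" using x0 by (simp add: power2_eq_square)
          finally have "x\<^sup>2 = t" .
          then show False using S_square_ne(2)[OF xS] by simp
        qed
        then have "leval (opT_poly th (delta S x)) (inverse x) \<noteq> 0" using e by auto
        then show ?thesis using iS T[OF delta[OF x]] by (auto simp: C_def)
      qed simp
    qed
    have "f \<in> N" for f
    proof -
      have "(\<Sum>x\<in>A. cst (leval f x) * delta S x) \<in> N" if "finite A" "A \<subseteq> S" for A
        using that
      proof (induction A rule: finite_induct)
        case empty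
        have "0 \<in> Ideal" by (simp add: Ideal_def)
        then show ?case using I by auto
      next
        case (insert x A)
        then show ?case using delta[of x] \<open>C = S\<close> by (auto intro!: add mult)
      qed
      then have "(\<Sum>x\<in>S. cst (leval f x) * delta S x) \<in> N" using finite_S by blast
      moreover have "f - (\<Sum>x\<in>S. cst (leval f x) * delta S x) \<in> N" using interpolate_reduce I by auto
      ultimately show ?thesis using add by force
    qed
    then show ?thesis by auto
  qed
qed

lemma Ideal_pi: assumes "f \<in> Ideal" shows "subst_inv h f \<in> Ideal"
  using assms S_nz S_pi h_nz by (auto simp: Ideal_def leval_subst_inv)

text \<open>At a point \<open>x\<close> with \<open>1/x \<in> S\<close> this is clear. At an end point \<open>x\<^sup>2 = t\<inverse>\<close>, where \<open>1/x \<notin> S\<close>, the coefficient of \<open>f(1/x)\<close> in \<open>(T f)(x)\<close> vanishes.\<close>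

lemma Ideal_T: assumes f: "f \<in> Ideal" shows "opT_poly th f \<in> Ideal"
  unfolding Ideal_def
proof (intro CollectI ballI)
  fix x assume x: "x \<in> S"
  have x0: "x \<noteq> 0" using x by (rule S_nz)
  have fx: "leval f x = 0" using f x by (auto simp: Ideal_def)
  have "(th * x\<^sup>2 - inverse th) * leval f (inverse x) = 0"
  proof (cases "x\<^sup>2 = inverse t")
    case True
    have "th * inverse t = inverse th" using th_nz by (simp add: power2_eq_square)
    then show ?thesis unfolding True by simp
  next
    case False
    then show ?thesis using f S_inv[OF x] by (auto simp: Ideal_def)
  qed
  then have "(x\<^sup>2 - 1) * leval (opT_poly th f) x = 0" unfolding leval_opT[OF x0] fx by simp
  then show "leval (opT_poly th f) x = 0" using S_square_ne(1)[OF x] by auto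
qed

end

section \<open>Annihilator ideals\<close>

definition linear_prod :: "'k::field list \<Rightarrow> 'k laurent" where
  "linear_prod A = prod_list (map (\<lambda>a. XX - cst a) A)"

lemma cst_hom: "comm_ring_hom (cst :: 'k::field \<Rightarrow> 'k laurent)"
  by unfold_locales (auto simp: single_add mult_single)

text \<open>The fundamental theorem of algebra for Laurent polynomials: clear denominators by a monomial.\<close>

lemma laurent_factor:
  fixes f :: "complex laurent"
  assumes "f \<noteq> 0"
  obtains c m A where "c \<noteq> 0" "0 \<notin> set A" "f = lmonom c m * linear_prod A"
proof -
  interpret c: comm_ring_hom "cst :: complex \<Rightarrow> complex laurent" by (rule cst_hom)
  interpret mp: map_poly_comm_ring_hom "cst :: complex \<Rightarrow> complex laurent" ..
  define lp where "lp p = poly (map_poly cst p) (XX :: complex laurent)" for p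
  have lp_add: "lp (p + r) = lp p + lp r" and lp_mult: "lp (p * r) = lp p * lp r" for p r
    by (simp_all add: lp_def mp.hom_add mp.hom_mult)
  have lp_const: "lp [:a:] = cst a" for a by (cases "a = 0") (simp_all add: lp_def map_poly_pCons)
  have lp_lin: "lp [:- a, 1:] = XX - cst a" for a 
    by (simp add: lp_def single_uminus map_poly_pCons)
  have lp_monom: "lp (Polynomial.monom a k) = lmonom a (int k)" for a k
    by (simp add: lp_def c.map_poly_hom_monom poly_monom single_power mult_single)
  have lp_sum: "lp (sum g B) = (\<Sum>i\<in>B. lp (g i))" for g :: "int \<Rightarrow> complex poly" and B
  proof (induction B rule: infinite_finite_induct)
    case (insert x F)
    then show ?case by (simp add: lp_add)
  qed (simp_all add: lp_def)
  define N where "N = (\<Sum>m\<in>Poly_Mapping.keys f. \<bar>m\<bar>)"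
  have N: "0 \<le> m + N" if "m \<in> Poly_Mapping.keys f" for m
  proof -
    have "\<bar>m\<bar> \<le> N" unfolding N_def using that by (intro member_le_sum) auto
    then show ?thesis by linarith
  qed
  define p where "p = (\<Sum>m\<in>Poly_Mapping.keys f. Polynomial.monom (lcoeff f m) (nat (m + N)))"
  have "lp p = (\<Sum>m\<in>Poly_Mapping.keys f. lmonom 1 N * lmonom (lcoeff f m) m)"
    unfolding p_def lp_sum lp_monom using N by (intro sum.cong refl) (simp add: mult_single add.commute)
  also have "\<dots> = lmonom 1 N * f" unfolding sum_distrib_left[symmetric] laurent_expand[symmetric] ..
  finally have lpf: "lp p = lmonom 1 N * f" .
  have f: "f = lmonom 1 (- N) * lp p" unfolding lpf mult.assoc[symmetric] mult_single by simp
  have "p \<noteq> 0" using f assms by (auto simp: lp_def)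
  obtain as where as: "Polynomial.smult (coeff p (degree p)) (\<Prod>a\<leftarrow>as. [:- a, 1:]) = p"
    using fundamental_theorem_algebra_factorized[of p] by blast
  have lpl: "lp (\<Prod>a\<leftarrow>as. [:- a, 1:]) = linear_prod as" for as
  proof (induction as)
    case Nil
    show ?case using lp_const[of 1] by (simp add: linear_prod_def one_pCons)
  next
    case (Cons a as)
    have "lp (\<Prod>a\<leftarrow>a # as. [:- a, 1:]) = lp [:- a, 1:] * lp (\<Prod>a\<leftarrow>as. [:- a, 1:])"
      by (simp only: list.map prod_list.Cons lp_mult)
    then show ?case by (simp only: Cons lp_lin linear_prod_def list.map prod_list.Cons)
  qed
  have "p = [:coeff p (degree p):] * (\<Prod>a\<leftarrow>as. [:- a, 1:])" using as by simp
  then have lpp: "lp p = cst (coeff p (degree p)) * linear_prod as" 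
    using lp_mult lp_const lpl by metis
  have "\<exists>k. linear_prod as = lmonom 1 (int k) * linear_prod (filter (\<lambda>a. a \<noteq> 0) as)" for as :: "complex list"
  proof (induction as)
    case Nil
    show ?case by (intro exI[of _ 0]) simp
  next
    case (Cons a as)
    then obtain k where k: "linear_prod as = lmonom 1 (int k) * linear_prod (filter (\<lambda>a. a \<noteq> 0) as)" by blast
    show ?case
    proof (cases "a = 0")
      case True
      have "linear_prod (a # as) = lmonom 1 (int (Suc k)) * linear_prod (filter (\<lambda>a. a \<noteq> 0) (a # as))"
        using k True by (simp add: linear_prod_def mult_single flip: mult.assoc)
      then show ?thesis by blast
    next
      case False
      have "linear_prod (a # as) = lmonom 1 (int k) * linear_prod (filter (\<lambda>a. a \<noteq> 0) (a # as))"
        using k False by (simp add: linear_prod_def mult.left_commute)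
      then show ?thesis by blast
    qed
  qed
  then obtain k where k: "linear_prod as = lmonom 1 (int k) * linear_prod (filter (\<lambda>a. a \<noteq> 0) as)" by blast
  have "f = lmonom (coeff p (degree p)) (int k - N) * linear_prod (filter (\<lambda>a. a \<noteq> 0) as)"
    unfolding f lpp k mult.assoc[symmetric] mult_single by (simp add: algebra_simps)
  from that[OF _ _ this] show thesis using \<open>p \<noteq> 0\<close> by simp
qed

lemma linear_prod_remove: "a \<in> set A \<Longrightarrow> linear_prod A = (XX - cst a) * linear_prod (remove1 a A)"
  unfolding linear_prod_def by (rule prod_list_map_remove1)

lemma leval_linear_prod: "x \<noteq> 0 \<Longrightarrow> leval (linear_prod A) x = 0 \<longleftrightarrow> x \<in> set A"
  by (induction A) (auto simp: linear_prod_def leval_mult leval_diff)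

lemma linear_prod_distinct: "distinct A \<Longrightarrow> linear_prod A = vpoly (set A)"
  by (simp add: linear_prod_def vpoly_def prod.distinct_set_conv_list)

lemma XX_cst_nz: "XX - cst a \<noteq> (0 :: 'k::field laurent)"
proof
  assume "XX - cst a = 0"
  then have "lcoeff (XX - cst a) 1 = 0" by simp
  then show False by (simp add: lookup_minus lookup_single)
qed

text \<open>Double zeros are handled by divisibility, avoiding derivatives.\<close>

lemma square_dvd_iff:
  assumes "x \<noteq> (0::'k::field)"
  shows "(XX - cst x)\<^sup>2 dvd f \<longleftrightarrow> (\<exists>g. f = (XX - cst x) * g \<and> leval g x = 0)"
proof
  assume "(XX - cst x)\<^sup>2 dvd f"
  then obtain g where "f = (XX - cst x)\<^sup>2 * g" by (auto elim: dvdE)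
  then have "f = (XX - cst x) * ((XX - cst x) * g)" by (simp add: power2_eq_square mult.assoc)
  then show "\<exists>g. f = (XX - cst x) * g \<and> leval g x = 0"
    using assms by (intro exI[of _ "(XX - cst x) * g"]) (auto simp: leval_mult leval_diff)
next
  assume "\<exists>g. f = (XX - cst x) * g \<and> leval g x = 0"
  then obtain g where g: "f = (XX - cst x) * g" "leval g x = 0" by blast
  then obtain g' where "g = (XX - cst x) * g'" using root_iff_dvd[OF assms] by (auto elim: dvdE)
  then show "(XX - cst x)\<^sup>2 dvd f" using g by (simp add: power2_eq_square mult.assoc[symmetric])
qed

lemma square_dvd_cancel:
  assumes x: "x \<noteq> (0::'k::field)" and d: "(XX - cst x)\<^sup>2 dvd k * f" and k: "leval k x \<noteq> 0"
  shows "(XX - cst x)\<^sup>2 dvd f"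
proof -
  obtain g where g: "k * f = (XX - cst x) * g" "leval g x = 0" using d square_dvd_iff[OF x] by blast
  have "leval k x * leval f x = 0" using arg_cong[OF g(1), of "\<lambda>u. leval u x"] x 
    by (simp add: leval_mult leval_diff)
  then have "leval f x = 0" using k by simp
  then obtain f' where f': "f = (XX - cst x) * f'" using root_iff_dvd[OF x] by (auto elim: dvdE)
  have "(XX - cst x) * (k * f') = (XX - cst x) * g" using g(1) f' by (simp add: mult.left_commute)
  then have "k * f' = g" using XX_cst_nz by (metis mult_left_cancel)
  then have "leval k x * leval f' x = 0" using g(2) leval_mult[OF x] by metis
  then show ?thesis using k f' square_dvd_iff[OF x] by auto
qed

lemma subst_inv_linear:
  assumes "x \<noteq> 0" "c \<noteq> 0"
  shows "subst_inv c (XX - cst x) = lmonom (- x) (- 1) * (XX - cst (c / x))"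
  using assms by (simp add: subst_inv_diff right_diff_distrib mult_single single_uminus)

lemma square_dvd_subst_inv:
  assumes x: "x \<noteq> 0" "c \<noteq> 0" and d: "(XX - cst x)\<^sup>2 dvd subst_inv c f"
  shows "(XX - cst (c / x))\<^sup>2 dvd f"
proof -
  obtain g where "subst_inv c f = (XX - cst x)\<^sup>2 * g" using d by (auto elim: dvdE)
  then have "subst_inv c (subst_inv c f) = subst_inv c ((XX - cst x)\<^sup>2 * g)" by simp
  then have "f = (subst_inv c (XX - cst x))\<^sup>2 * subst_inv c g"
    using x by (simp add: subst_inv_mult power2_eq_square)
  then have "f = (XX - cst (c / x))\<^sup>2 * ((lmonom (- x) (- 1))\<^sup>2 * subst_inv c g)"
    unfolding subst_inv_linear[OF x] by (simp only: power_mult_distrib mult_ac)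
  then show ?thesis by (metis dvd_triv_left)
qed

text \<open>The square of the intertwiner \<open>(X\<^sup>2 - 1) T + (t\<^sup>1\<^sup>/\<^sup>2 - t\<^sup>-\<^sup>1\<^sup>/\<^sup>2)\<close>, a symmetric Laurent polynomial that vanishes exactly for \<open>X\<^sup>2 = t\<^sup>\<plusminus>\<^sup>1\<close>.\<close>

definition kappa_sq :: "'k::field \<Rightarrow> 'k laurent" where
  "kappa_sq th = cst (th\<^sup>2 + inverse (th\<^sup>2)) - lmonom 1 2 - lmonom 1 (- 2)"

lemma subst_inv_kappa_sq: "subst_inv 1 (kappa_sq th) = kappa_sq th"
  by (simp add: kappa_sq_def subst_inv_diff)

lemma leval_kappa_sq:
  assumes "x \<noteq> 0" "th \<noteq> 0"
  shows "leval (kappa_sq th) x = - inverse (x\<^sup>2) * ((x\<^sup>2 - th\<^sup>2) * (x\<^sup>2 - inverse (th\<^sup>2)))"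
proof -
  have "leval (kappa_sq th) x = th\<^sup>2 + inverse (th\<^sup>2) - x\<^sup>2 - inverse (x\<^sup>2)"
    by (simp add: kappa_sq_def leval_diff power_int_minus)
  also have "\<dots> = - inverse (x\<^sup>2) * ((x\<^sup>2 - th\<^sup>2) * (x\<^sup>2 - inverse (th\<^sup>2)))"
  proof -
    have "a + inverse a - b - inverse b = - inverse b * ((b - a) * (b - inverse a))"
      if "a \<noteq> 0" "b \<noteq> 0" for a b :: 'a
      using that by (simp add: field_simps)
    then show ?thesis using assms by simp
  qed
  finally show ?thesis .
qed

lemma kappa_sq_root:
  assumes "x \<noteq> 0" "th \<noteq> 0"
  shows "leval (kappa_sq th) x = 0 \<longleftrightarrow> x\<^sup>2 = th\<^sup>2 \<or> x\<^sup>2 = inverse (th\<^sup>2)"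
  using assms by (simp add: leval_kappa_sq)

text \<open>For \<open>t\<^sup>2 \<noteq> 1\<close> the four zeros \<open>X\<^sup>2 = t\<^sup>\<plusminus>\<^sup>1\<close> are distinct, hence simple.\<close>

lemma kappa_sq_simple:
  assumes x: "x \<noteq> 0" "th \<noteq> 0" and root: "x\<^sup>2 = th\<^sup>2 \<or> x\<^sup>2 = inverse (th\<^sup>2)" and tt: "(th\<^sup>2)\<^sup>2 \<noteq> 1"
    and two: "(2::'k::field) \<noteq> 0"
  obtains k where "kappa_sq th = (XX - cst (x::'k)) * k" "leval k x \<noteq> 0"
proof -
  define a where "a = x\<^sup>2"
  have a0: "a \<noteq> 0" using x by (simp add: a_def)
  have aa: "a + inverse a = th\<^sup>2 + inverse (th\<^sup>2)" using root x by (auto simp: a_def)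
  have a1: "a - inverse a \<noteq> 0"
  proof
    assume "a - inverse a = 0"
    then have "a * a = 1" using a0 by (metis eq_iff_diff_eq_0 right_inverse)
    moreover have "a = th\<^sup>2 \<or> a = inverse (th\<^sup>2)" using root by (simp add: a_def)
    ultimately have "th\<^sup>2 * th\<^sup>2 = 1"
      by (metis inverse_mult_distrib inverse_1 inverse_inverse_eq)
    then show False using tt by (metis power2_eq_square)
  qed
  define k where "k = - lmonom 1 (- 2) * ((XX + cst x) * (lmonom 1 2 - cst (inverse a)))"
  have sq: "(XX - cst x) * (XX + cst x) = lmonom 1 2 - cst a"
    by (simp add: algebra_simps mult_single a_def power2_eq_square)
  have "(XX - cst x) * k = - lmonom 1 (- 2) * (((XX - cst x) * (XX + cst x)) * (lmonom 1 2 - cst (inverse a)))"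
    unfolding k_def by (simp only: mult_ac)
  also have "\<dots> = cst (a + inverse a) - lmonom 1 2 - lmonom 1 (- 2)"
    unfolding sq using a0 by (simp add: algebra_simps mult_single single_add)
  finally have "kappa_sq th = (XX - cst x) * k" unfolding kappa_sq_def aa ..
  moreover have "leval k x = - inverse a * (2 * x * (a - inverse a))"
    using x by (simp add: k_def leval_hom a_def power_int_minus)
  then have "leval k x \<noteq> 0" using a0 a1 x two by simp
  ultimately show thesis by (rule that)
qed

text \<open>The properties of the annihilator of a finite dimensional representation in \<open>\<complex>[X\<^sup>\<plusminus>\<^sup>1]\<close> on which the classification of parameters rests. The divided difference is available only when \<open>T\<close> genuinely mixes \<open>f(X)\<close> and \<open>f(X\<inverse>)\<close>.\<close>

locale annihilator =
  fixes h th :: complex and J :: "complex laurent set"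
  assumes h_nz: "h \<noteq> 0" and th_nz: "th \<noteq> 0" and h_pow: "\<And>k. k > 0 \<Longrightarrow> (h\<^sup>2) ^ k \<noteq> 1"
    and J_add: "\<And>f g. f \<in> J \<Longrightarrow> g \<in> J \<Longrightarrow> f + g \<in> J"
    and J_mult: "\<And>f g. f \<in> J \<Longrightarrow> g * f \<in> J"
    and J_nonzero: "\<exists>f\<in>J. f \<noteq> 0" and J_proper: "1 \<notin> J"
    and J_pi: "\<And>f. f \<in> J \<Longrightarrow> subst_inv h f \<in> J"
    and J_kappa: "\<And>f. f \<in> J \<Longrightarrow> kappa_sq th * subst_inv 1 f \<in> J"
    and J_divdiff: "\<And>f. th - inverse th \<noteq> 0 \<Longrightarrow> f \<in> J \<Longrightarrow> subst_inv 1 f \<in> J \<Longrightarrow> divdiff f \<in> J"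
begin

definition Z where "Z = {x. x \<noteq> 0 \<and> (\<forall>f\<in>J. leval f x = 0)}"
text \<open>The common zeros of multiplicity at least two; they decide between the half-integral and the integral case.\<close>

definition Z2 where "Z2 = {x. x \<noteq> 0 \<and> (\<forall>f\<in>J. (XX - cst x)\<^sup>2 dvd f)}"

lemma Z2_subset: "Z2 \<subseteq> Z"
  by (force simp: Z2_def Z_def square_dvd_iff leval_mult leval_diff)

text \<open>Choose an element \<open>linear_prod A\<close> of \<open>J\<close> with as few factors as possible. Its roots are the common zeros, and they are distinct unless there is a common double zero.\<close>

lemma Z_structure: "finite Z \<and> Z \<noteq> {} \<and> (Z2 = {} \<longrightarrow> vpoly Z \<in> J)"
proof -
  let ?P = "\<lambda>A. 0 \<notin> set A \<and> linear_prod A \<in> J"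
  obtain f where f: "f \<in> J" "f \<noteq> 0" using J_nonzero by blast
  obtain c m A where A: "c \<noteq> 0" "0 \<notin> set A" "f = lmonom c m * linear_prod A" using laurent_factor[OF f(2)] .
  have "linear_prod A = lmonom (inverse c) (- m) * f"
    unfolding A(3) mult.assoc[symmetric] mult_single using A(1) by simp
  then have "?P A" using A(2) J_mult[OF f(1)] by simp
  then obtain A where A: "?P A" and min: "\<And>B. ?P B \<Longrightarrow> length A \<le> length B"
    using ex_has_least_nat[of ?P A length] by blast
  have strip: False if a: "a \<in> set A" "linear_prod (remove1 a A) \<in> J" for a
  proof -
    have "?P (remove1 a A)" using A a by (auto dest: notin_set_remove1)
    note le = min[OF this]
    moreover have "length (remove1 a A) = length A - 1" using a by (simp add: length_remove1)
    moreover have "0 < length A" using a(1) by (rule length_pos_if_in_set)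
    ultimately show False by arith
  qed
  have AZ: "a \<in> Z" if a: "a \<in> set A" for a
  proof (rule ccontr)
    have a0: "a \<noteq> 0" using A a by auto
    assume "a \<notin> Z"
    then obtain f where f: "f \<in> J" "leval f a \<noteq> 0" using a0 by (auto simp: Z_def)
    obtain f' where f': "f - cst (leval f a) = (XX - cst a) * f'" using root_imp_dvd[OF a0, of f] by (auto elim: dvdE)
    define g where "g = linear_prod (remove1 a A)"
    have lp: "linear_prod A = (XX - cst a) * g" unfolding g_def by (rule linear_prod_remove[OF a])
    have e: "cst (leval f a) = f - (XX - cst a) * f'" using f' by (simp add: algebra_simps)
    have "cst (leval f a) * g = g * f + (- f') * linear_prod A"
      unfolding lp e by (simp add: algebra_simps)
    then have "cst (leval f a) * g \<in> J" using A f by (auto intro: J_add J_mult simp del: mult_minus_left)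
    then have "cst (inverse (leval f a)) * (cst (leval f a) * g) \<in> J" by (rule J_mult)
    then have "g \<in> J" unfolding mult.assoc[symmetric] mult_single using f(2) by simp
    then show False using strip[OF a] by (simp add: g_def)
  qed
  have ZA: "Z \<subseteq> set A" using A leval_linear_prod by (auto simp: Z_def)
  then have Z: "Z = set A" using AZ by auto
  have "A \<noteq> []" using A J_proper by (auto simp: linear_prod_def)
  moreover have "distinct A" if Z2: "Z2 = {}"
  proof (rule ccontr)
    assume "\<not> distinct A"
    then obtain xs a ys zs where "A = xs @ [a] @ ys @ [a] @ zs" using not_distinct_decomp by blast
    then have a: "a \<in> set A" "a \<in> set (remove1 a A)" by (auto simp: remove1_append)
    have a0: "a \<noteq> 0" using A a by auto
    obtain f where f: "f \<in> J" "\<not> (XX - cst a)\<^sup>2 dvd f" using Z2 a0 by (auto simp: Z2_def)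
    have "leval f a = 0" using AZ[OF a(1)] f by (auto simp: Z_def)
    then obtain f1 where f1: "f = (XX - cst a) * f1" using root_iff_dvd[OF a0] by (auto elim: dvdE)
    have v: "leval f1 a \<noteq> 0" using f(2) f1 square_dvd_iff[OF a0] by blast
    obtain f2 where f2: "f1 - cst (leval f1 a) = (XX - cst a) * f2" using root_imp_dvd[OF a0, of f1] by (auto elim: dvdE)
    define g where "g = linear_prod (remove1 a (remove1 a A))"
    have l1: "linear_prod (remove1 a A) = (XX - cst a) * g" unfolding g_def by (rule linear_prod_remove[OF a(2)])
    have l2: "linear_prod A = (XX - cst a) * ((XX - cst a) * g)" using linear_prod_remove[OF a(1)] l1 by simp
    have e: "cst (leval f1 a) = f1 - (XX - cst a) * f2" using f2 by (simp add: algebra_simps)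
    have "cst (leval f1 a) * ((XX - cst a) * g) = g * f + (- f2) * linear_prod A"
      unfolding l2 f1 e by (simp add: algebra_simps)
    then have "cst (leval f1 a) * ((XX - cst a) * g) \<in> J" using A f by (auto intro: J_add J_mult simp del: mult_minus_left)
    then have "cst (inverse (leval f1 a)) * (cst (leval f1 a) * ((XX - cst a) * g)) \<in> J" by (rule J_mult)
    then have "(XX - cst a) * g \<in> J" unfolding mult.assoc[symmetric] mult_single using v by simp
    then show False using strip[OF a(1)] l1 by simp
  qed
  ultimately show ?thesis unfolding Z using A linear_prod_distinct[of A] by auto
qed

lemma Z_pi: assumes "x \<in> Z" shows "h / x \<in> Z"
  unfolding Z_def
proof (intro CollectI conjI ballI)
  show "h / x \<noteq> 0" using assms h_nz by (auto simp: Z_def)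
  fix f assume "f \<in> J"
  then have "leval (subst_inv h f) x = 0" using J_pi assms by (auto simp: Z_def)
  then show "leval f (h / x) = 0" using assms h_nz by (auto simp: Z_def leval_subst_inv)
qed

lemma Z_s: assumes "x \<in> Z" shows "inverse x \<in> Z \<or> (x\<^sup>2 = th\<^sup>2 \<or> x\<^sup>2 = inverse (th\<^sup>2))"
proof (rule disjCI)
  have x: "x \<noteq> 0" using assms by (auto simp: Z_def)
  assume "\<not> (x\<^sup>2 = th\<^sup>2 \<or> x\<^sup>2 = inverse (th\<^sup>2))"
  then have k: "leval (kappa_sq th) x \<noteq> 0" using kappa_sq_root[OF x th_nz] by blast
  show "inverse x \<in> Z" unfolding Z_def
  proof (intro CollectI conjI ballI)
    show "inverse x \<noteq> 0" using x by simp
    fix f assume "f \<in> J"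
    then have "leval (kappa_sq th * subst_inv 1 f) x = 0" using J_kappa assms by (auto simp: Z_def)
    then show "leval f (inverse x) = 0" using x k by (simp add: leval_mult leval_subst_inv divide_inverse)
  qed
qed

lemma Z2_pi: assumes "x \<in> Z2" shows "h / x \<in> Z2"
  using assms h_nz J_pi by (auto simp: Z2_def intro!: square_dvd_subst_inv)

lemma Z2_s: assumes "x \<in> Z2" shows "inverse x \<in> Z2 \<or> (x\<^sup>2 = th\<^sup>2 \<or> x\<^sup>2 = inverse (th\<^sup>2))"
proof (rule disjCI)
  have x: "x \<noteq> 0" using assms by (auto simp: Z2_def)
  assume "\<not> (x\<^sup>2 = th\<^sup>2 \<or> x\<^sup>2 = inverse (th\<^sup>2))"
  then have k: "leval (kappa_sq th) x \<noteq> 0" using kappa_sq_root[OF x th_nz] by blast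
  show "inverse x \<in> Z2" unfolding Z2_def
  proof (intro CollectI conjI ballI)
    show "inverse x \<noteq> 0" using x by simp
    fix f assume "f \<in> J"
    then have "(XX - cst x)\<^sup>2 dvd kappa_sq th * subst_inv 1 f" using J_kappa assms by (auto simp: Z2_def)
    then have "(XX - cst x)\<^sup>2 dvd subst_inv 1 f" using square_dvd_cancel[OF x _ k] by blast
    then show "(XX - cst (inverse x))\<^sup>2 dvd f" using square_dvd_subst_inv[of x 1 f] x by (simp add: divide_inverse)
  qed
qed

text \<open>At a zero of \<open>kappa_sq\<close>, which is simple, a double zero loses one order when it is carried to the inverse point; so at least a simple zero remains there.\<close>

lemma Z2_simple:
  assumes "x \<in> Z2" "x\<^sup>2 = th\<^sup>2 \<or> x\<^sup>2 = inverse (th\<^sup>2)" "(th\<^sup>2)\<^sup>2 \<noteq> 1"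
  shows "inverse x \<in> Z"
proof -
  have x: "x \<noteq> 0" using assms by (auto simp: Z2_def)
  obtain k where k: "kappa_sq th = (XX - cst x) * k" "leval k x \<noteq> 0"
    using kappa_sq_simple[OF x th_nz assms(2,3)] by auto
  show ?thesis unfolding Z_def
  proof (intro CollectI conjI ballI)
    show "inverse x \<noteq> 0" using x by simp
    fix f assume "f \<in> J"
    then have "(XX - cst x)\<^sup>2 dvd kappa_sq th * subst_inv 1 f" using J_kappa assms by (auto simp: Z2_def)
    then obtain g where "kappa_sq th * subst_inv 1 f = (XX - cst x) * g" "leval g x = 0"
      using square_dvd_iff[OF x] by blast
    then have "(XX - cst x) * (k * subst_inv 1 f) = (XX - cst x) * g" by (simp add: k mult.assoc)
    then have "k * subst_inv 1 f = g" using XX_cst_nz by (metis mult_left_cancel)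
    then have "leval k x * leval f (inverse x) = 0"
      using \<open>leval g x = 0\<close> x leval_mult[OF x, of k "subst_inv 1 f"] by (simp add: leval_subst_inv divide_inverse)
    then show "leval f (inverse x) = 0" using k(2) by simp
  qed
qed

text \<open>At \<open>u\<^sup>2 = 1\<close> the divided difference of \<open>f\<close> is a derivative of \<open>f\<close> up to a nonzero factor; applied to \<open>kappa_sq th * f\<close>, which lies in the ideal together with its image under \<open>X \<mapsto> X\<inverse>\<close>, this shows that \<open>u\<close> is a double zero.\<close>

lemma fixed_point_double:
  assumes u: "u \<in> Z" "u * u = 1" and t1: "th - inverse th \<noteq> 0"
  shows "u \<in> Z2"
  unfolding Z2_def
proof (intro CollectI conjI ballI)
  show u0: "u \<noteq> 0" using u by auto
  fix f assume f: "f \<in> J"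
  have iu: "inverse u = u" using u by (metis inverse_unique)
  have "leval f u = 0" using u f by (auto simp: Z_def)
  then obtain f1 where f1: "f = (XX - cst u) * f1" using root_iff_dvd[OF u0] by (auto elim: dvdE)
  define K where "K = kappa_sq th"
  have K: "leval K u \<noteq> 0"
  proof -
    have "th\<^sup>2 \<noteq> 1" using t1 th_nz by (auto simp: power2_eq_1_iff)
    moreover have "inverse (th\<^sup>2) \<noteq> 1" using \<open>th\<^sup>2 \<noteq> 1\<close> by (metis inverse_inverse_eq inverse_1)
    ultimately show ?thesis using kappa_sq_root[OF u0 th_nz] u by (auto simp: K_def power2_eq_square)
  qed
  define g where "g = K * f"
  have gJ: "g \<in> J" unfolding g_def by (rule J_mult[OF f])
  have sg: "subst_inv 1 g = K * subst_inv 1 f" by (simp add: g_def subst_inv_mult subst_inv_kappa_sq K_def)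
  have "subst_inv 1 g \<in> J" unfolding sg K_def by (rule J_kappa[OF f])
  then have dJ: "divdiff g \<in> J" by (rule J_divdiff[OF t1 gJ])
  have lin: "subst_inv 1 (XX - cst u) = lmonom (- u) (- 1) * (XX - cst u)"
    using subst_inv_linear[OF u0, of 1] iu by (simp add: divide_inverse)
  have sf: "subst_inv 1 f = lmonom (- u) (- 1) * (XX - cst u) * subst_inv 1 f1"
    unfolding f1 by (simp add: subst_inv_mult lin)
  have "lmonom 1 2 - 1 = (XX - cst u) * (XX + cst u)"
    using u by (simp add: algebra_simps mult_single)
  then have "(XX - cst u) * ((XX + cst u) * divdiff g) = subst_inv 1 g - g"
    using divdiff_eq[of g] by (simp only: mult.assoc)
  also have "\<dots> = (XX - cst u) * (K * (lmonom (- u) (- 1) * subst_inv 1 f1)) - (XX - cst u) * (K * f1)"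
  proof (rule arg_cong2[where f = "(-)"])
    show "subst_inv 1 g = (XX - cst u) * (K * (lmonom (- u) (- 1) * subst_inv 1 f1))"
      unfolding sg sf by (simp only: mult_ac)
    show "g = (XX - cst u) * (K * f1)" unfolding g_def f1 by (simp only: mult_ac)
  qed
  also have "\<dots> = (XX - cst u) * (K * (lmonom (- u) (- 1) * subst_inv 1 f1 - f1))"
    by (simp only: right_diff_distrib)
  finally have "(XX + cst u) * divdiff g = K * (lmonom (- u) (- 1) * subst_inv 1 f1 - f1)"
    using XX_cst_nz by (metis mult_left_cancel)
  from arg_cong[OF this, of "\<lambda>f. leval f u"]
  have "(u + u) * leval (divdiff g) u = leval K u * (- u * inverse u * leval f1 u - leval f1 u)"
    using u0 iu by (simp add: leval_hom leval_subst_inv divide_inverse power_int_minus)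
  moreover have "leval (divdiff g) u = 0" using dJ u by (auto simp: Z_def)
  ultimately have "leval f1 u = 0" using K u0 by simp
  then show "(XX - cst u)\<^sup>2 dvd f" using f1 square_dvd_iff[OF u0] by blast
qed

lemma h_pow': "k > 0 \<Longrightarrow> h ^ k \<noteq> 1"
  using h_pow[of k] by (metis power_mult mult.commute power_one)

lemma h_pow_inj: "h ^ i = h ^ j \<Longrightarrow> i = j"
proof (induction i j rule: linorder_wlog)
  case (le a b)
  then have "h ^ b = h ^ a * h ^ (b - a)" by (metis le_add_diff_inverse power_add)
  then have "h ^ (b - a) = 1" using h_nz le by simp
  then show ?case using h_pow'[of "b - a"] le by (cases "b - a = 0") auto
qed simp

abbreviation "K x \<equiv> x\<^sup>2 = th\<^sup>2 \<or> x\<^sup>2 = inverse (th\<^sup>2)"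

lemma Z_chain:
  assumes "x \<in> Z" shows "\<exists>k. (\<forall>i\<le>k. x * h ^ i \<in> Z) \<and> K (x * h ^ k) \<and> inverse (x * h ^ k) \<notin> Z"
  by (rule weight_chain) (use Z_structure Z_pi Z_s h_nz h_pow' assms in \<open>auto simp: Z_def\<close>)

lemma Z2_chain:
  assumes "x \<in> Z2" shows "\<exists>k. (\<forall>i\<le>k. x * h ^ i \<in> Z2) \<and> K (x * h ^ k) \<and> inverse (x * h ^ k) \<notin> Z2"
proof (rule weight_chain)
  show "finite Z2" using Z_structure Z2_subset finite_subset by blast
qed (use Z2_pi Z2_s h_nz h_pow' assms in \<open>auto simp: Z2_def\<close>)

text \<open>The chain through \<open>x\<close> has two ends, found by running from \<open>x\<close> and from \<open>h / x\<close>. At both ends \<open>x\<^sup>2 = t\<^sup>\<plusminus>\<^sup>1\<close>; comparing them expresses the square of an end as a power of \<open>h\<close> up to sign, and hence \<open>t\<close> as well.\<close>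

lemma Z_two_ended:
  assumes x: "x \<in> Z"
  shows "\<exists>k k' y. y = x * h ^ k \<and> inverse y \<notin> Z \<and> K y \<and> (\<forall>i\<le>k. x * h ^ i \<in> Z) \<and> (\<forall>i\<le>k'. x / h ^ i \<in> Z) \<and>
     (y\<^sup>2 = h ^ Suc (k + k') \<or> y\<^sup>2 = - (h ^ Suc (k + k')))"
proof -
  have x0: "x \<noteq> 0" using x by (auto simp: Z_def)
  obtain k where k: "\<forall>i\<le>k. x * h ^ i \<in> Z" "K (x * h ^ k)" "inverse (x * h ^ k) \<notin> Z" using Z_chain[OF x] by blast
  obtain k' where k': "\<forall>i\<le>k'. h / x * h ^ i \<in> Z" "K (h / x * h ^ k')" using Z_chain[OF Z_pi[OF x]] by blast
  define y where "y = x * h ^ k"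
  define y' where "y' = h / x * h ^ k'"
  have yy: "y * y' = h ^ Suc (k + k')" using x0 by (simp add: y_def y'_def power_add)
  have low: "x / h ^ i \<in> Z" if "i \<le> k'" for i
  proof -
    have "h / (h / x * h ^ i) \<in> Z" using k'(1) that Z_pi by blast
    moreover have "h / (h / x * h ^ i) = x / h ^ i" using h_nz x0 by (simp add: field_simps)
    ultimately show ?thesis by simp
  qed
  have "y\<^sup>2 = y'\<^sup>2"
  proof (rule ccontr)
    assume "y\<^sup>2 \<noteq> y'\<^sup>2"
    moreover have "K y" "K y'" unfolding y_def y'_def by (rule k(2), rule k'(2))
    ultimately have "y\<^sup>2 * y'\<^sup>2 = 1" using th_nz by auto
    then have "(y * y')\<^sup>2 = 1" by (simp add: power_mult_distrib)
    then have "(h\<^sup>2) ^ Suc (k + k') = 1" unfolding yy by (metis power_mult mult.commute)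
    then show False using h_pow by blast
  qed
  then have "y' = y \<or> y' = - y" by (auto simp: power2_eq_iff)
  then have "y\<^sup>2 = h ^ Suc (k + k') \<or> y\<^sup>2 = - (h ^ Suc (k + k'))"
    using yy by (auto simp: power2_eq_square) (metis minus_minus mult_minus_right)+
  then show ?thesis using k low y_def by blast
qed

text \<open>The length of a chain determines \<open>t\<^sup>\<plusminus>\<^sup>1\<close> up to sign as a power of \<open>q\<^sup>1\<^sup>/\<^sup>2\<close>. An even power with the positive sign has to be excluded: then the middle of the chain is \<open>\<plusminus>1\<close>, where the zero is double, and double zeros spread along the chain to its end. There \<open>Z2_simple\<close> contradicts that the inverse of the end is not a zero.\<close>

theorem parameter_cases:
  "(\<exists>m::nat. th\<^sup>2 = h ^ (2 * m + 1) \<or> th\<^sup>2 = inverse (h ^ (2 * m + 1))) \<or>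
   (\<exists>n::nat. n > 0 \<and> (th\<^sup>2 = - (h ^ n) \<or> th\<^sup>2 = - inverse (h ^ n)))"
proof -
  obtain x where x: "x \<in> Z" using Z_structure by auto
  obtain k k' y where y: "y = x * h ^ k" "inverse y \<notin> Z" "K y" "\<forall>i\<le>k. x * h ^ i \<in> Z" "\<forall>i\<le>k'. x / h ^ i \<in> Z"
    "y\<^sup>2 = h ^ Suc (k + k') \<or> y\<^sup>2 = - (h ^ Suc (k + k'))" using Z_two_ended[OF x] by blast
  define N where "N = Suc (k + k')"
  have th: "th\<^sup>2 = y\<^sup>2 \<or> th\<^sup>2 = inverse (y\<^sup>2)" using y(3) by auto
  have y6: "y\<^sup>2 = h ^ N \<or> y\<^sup>2 = - (h ^ N)" using y(6) by (simp only: N_def)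
  show ?thesis
  proof (cases "y\<^sup>2 = - (h ^ N)")
    case True
    then have "th\<^sup>2 = - (h ^ N) \<or> th\<^sup>2 = - inverse (h ^ N)" using th by auto
    moreover have "N > 0" by (simp add: N_def)
    ultimately show ?thesis by blast
  next
    case False
    then have yN: "y\<^sup>2 = h ^ N" using y6 by blast
    show ?thesis
    proof (cases "even N")
      case False
      then obtain m where "N = 2 * m + 1" by (auto elim: oddE)
      then show ?thesis using th yN by auto
    next
      case True
      then obtain m where m: "N = 2 * m" by (auto elim: evenE)
      have m0: "m > 0" using m by (auto simp: N_def)
      have t1: "th\<^sup>2 \<noteq> 1"
      proof
        assume "th\<^sup>2 = 1"
        then have "h ^ N = 1" using th yN by (metis inverse_1 inverse_inverse_eq)
        then show False using h_pow'[of N] by (simp add: N_def)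
      qed
      have t2: "(th\<^sup>2)\<^sup>2 \<noteq> 1"
      proof
        assume "(th\<^sup>2)\<^sup>2 = 1"
        then have "(h ^ N)\<^sup>2 = 1" using th yN by (metis power_inverse inverse_1 inverse_inverse_eq)
        then have "h ^ (N * 2) = 1" by (simp only: power_mult)
        then show False using h_pow'[of "N * 2"] by (simp add: N_def)
      qed
      define u where "u = y / h ^ m"
      have uZ: "u \<in> Z"
      proof (cases "m \<le> k")
        case True
        then have "u = x * h ^ (k - m)" using h_nz by (simp add: u_def y(1) power_diff)
        then show ?thesis using y(4) by simp
      next
        case False
        then have "u = x / h ^ (m - k)" using h_nz by (simp add: u_def y(1) power_diff)
        moreover have "m - k \<le> k'" using m m0 False by (simp add: N_def)
        ultimately show ?thesis using y(5) by simp
      qed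
      have uu: "u * u = 1"
      proof -
        have "y * y = h ^ m * h ^ m" using yN unfolding m by (simp only: power2_eq_square mult_2 power_add)
        then show ?thesis using h_nz by (simp add: u_def)
      qed
      have "th - inverse th \<noteq> 0"
        using t1 th_nz by (metis eq_iff_diff_eq_0 power2_eq_square right_inverse)
      then have "u \<in> Z2" by (rule fixed_point_double[OF uZ uu])
      then obtain l where l: "u * h ^ l \<in> Z2" "K (u * h ^ l)" using Z2_chain by blast
      have "(u * h ^ l)\<^sup>2 = h ^ (l * 2)" using uu by (simp add: power_mult_distrib power2_eq_square power_mult)
      then have "h ^ (l * 2) = h ^ N \<or> h ^ (l * 2) = inverse (h ^ N)" using l(2) th yN by auto
      then have "l = m"
      proof
        assume "h ^ (l * 2) = h ^ N"
        then have "l * 2 = N" by (rule h_pow_inj)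
        then show ?thesis using m by simp
      next
        assume "h ^ (l * 2) = inverse (h ^ N)"
        then have "h ^ (l * 2) * h ^ N = 1" using h_nz by simp
        then have "h ^ (l * 2 + N) = 1" by (simp only: power_add)
        then show ?thesis using h_pow'[of "l * 2 + N"] by (simp add: N_def)
      qed
      then have "u * h ^ l = y" using h_nz by (simp add: u_def)
      then have "inverse y \<in> Z" using Z2_simple[OF l(1) l(2) t2] by simp
      then show ?thesis using y(2) by simp
    qed
  qed
qed

text \<open>The ends of the chains are now located at \<open>x\<^sup>2 = t\<inverse>\<close>, so that the common zeros form a closed subset of \<open>S\<close>, hence all of \<open>S\<close>, and there are no double zeros.\<close>

theorem annihilator_eq:
  assumes n: "n > 0" "th\<^sup>2 = - inverse (h ^ n)"
  shows "J = root_params.Ideal h th n"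
proof -
  interpret r: root_params h th n using h_nz h_pow n by unfold_locales auto
  have ti: "inverse (th\<^sup>2) = - (h ^ n)" by (simp add: n)
  have t2: "(th\<^sup>2)\<^sup>2 \<noteq> 1"
  proof
    assume "(th\<^sup>2)\<^sup>2 = 1"
    then have "inverse (th\<^sup>2) * inverse (th\<^sup>2) = 1" by (metis power2_eq_square inverse_mult_distrib inverse_1)
    then show False using r.inverse_t_sq h_pow'[of "2 * n"] n by simp
  qed
  have ZS: "Z \<subseteq> r.S"
  proof
    fix x assume x: "x \<in> Z"
    obtain k k' y where y: "y = x * h ^ k" "K y" 
      "y\<^sup>2 = h ^ Suc (k + k') \<or> y\<^sup>2 = - (h ^ Suc (k + k'))" using Z_two_ended[OF x] by blast
    define N where "N = Suc (k + k')"
    have "(y\<^sup>2)\<^sup>2 = h ^ (2 * N)"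
      using y(3) unfolding N_def[symmetric] power_even_eq by (elim disjE) (simp_all only: power2_minus)
    have "y\<^sup>2 = inverse (th\<^sup>2) \<and> N = n"
    proof (cases "y\<^sup>2 = inverse (th\<^sup>2)")
      case True
      then have "h ^ (2 * N) = h ^ (2 * n)"
        using \<open>(y\<^sup>2)\<^sup>2 = h ^ (2 * N)\<close> r.inverse_t_sq by (metis power2_eq_square)
      then show ?thesis using True h_pow_inj by fastforce
    next
      case False
      then have "y\<^sup>2 = th\<^sup>2" using y(2) by blast
      then have "h ^ (2 * N) * h ^ (2 * n) = (th\<^sup>2 * th\<^sup>2) * (inverse (th\<^sup>2) * inverse (th\<^sup>2))"
        using \<open>(y\<^sup>2)\<^sup>2 = h ^ (2 * N)\<close> r.inverse_t_sq by (metis power2_eq_square)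
      also have "\<dots> = (th\<^sup>2 * inverse (th\<^sup>2)) * (th\<^sup>2 * inverse (th\<^sup>2))" by (simp only: mult_ac)
      also have "\<dots> = 1" using th_nz by simp
      finally have "h ^ (2 * N + 2 * n) = 1" by (simp only: power_add)
      then show ?thesis using h_pow'[of "2 * N + 2 * n"] n by simp
    qed
    then have yt: "y\<^sup>2 = (inverse th)\<^sup>2" and N: "N = n" by (auto simp: power_inverse)
    have "y = inverse th \<or> y = - inverse th" using yt by (simp add: power2_eq_iff)
    then obtain s where s: "s = 1 \<or> s = - 1" "y = s * inverse th" by (metis mult_1 mult_minus1)
    have "x * h ^ k = - s * (th * h ^ n)" using s(2) y(1) r.inv_th by simp
    also have "h ^ n = h ^ (n - k) * h ^ k" using N by (simp add: N_def flip: power_add)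
    finally have "x * h ^ k = (- s * (th * h ^ (n - k))) * h ^ k" by (simp add: mult.assoc)
    then have "x = - s * (th * h ^ (n - k))" using h_nz by (metis mult_right_cancel power_not_zero)
    moreover have "n - k \<in> {1..n}" using N by (auto simp: N_def)
    ultimately show "x \<in> r.S" using r.S_I'[of "n - k" "- s"] s(1) by auto
  qed
  have Z: "Z = r.S"
  proof (rule r.closed_weights[OF ZS])
    show "Z \<noteq> {}" using Z_structure by blast
    fix x assume x: "x \<in> Z"
    show "h / x \<in> Z" by (rule Z_pi[OF x])
    show "inverse x \<in> Z \<or> x\<^sup>2 = inverse (th\<^sup>2)" using Z_s[OF x] r.S_square_ne(2)[of x] ZS x by blast
  qed
  have "Z2 = {}"
  proof (rule ccontr)
    assume "Z2 \<noteq> {}"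
    then obtain x where "x \<in> Z2" by blast
    then obtain k where k: "x * h ^ k \<in> Z2" "K (x * h ^ k)" using Z2_chain by blast
    then have "inverse (x * h ^ k) \<in> r.S" using Z2_simple[OF k t2] Z by simp
    moreover have "(x * h ^ k)\<^sup>2 = inverse (th\<^sup>2)"
      using k r.S_square_ne(2)[of "x * h ^ k"] Z2_subset Z by blast
    ultimately show False using r.not_inv_S by blast
  qed
  then have v: "vpoly r.S \<in> J" using Z_structure Z by simp
  show ?thesis
  proof
    show "J \<subseteq> r.Ideal" using Z by (auto simp: r.Ideal_def Z_def)
    show "r.Ideal \<subseteq> J"
    proof
      fix f assume "f \<in> r.Ideal"
      then have "vpoly r.S dvd f" using vpoly_dvd_iff[OF r.finite_S r.zero_S] by (auto simp: r.Ideal_def)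
      then obtain g where "f = g * vpoly r.S" by (metis dvdE mult.commute)
      then show "f \<in> J" using J_mult[OF v] by simp
    qed
  qed
qed

end

section \<open>Laurent polynomials acting on representations\<close>

locale cmodule = module "class_ring :: complex ring" M for M (structure)
begin

lemma smc [simp]: "v \<in> carrier M \<Longrightarrow> c \<odot> v \<in> carrier M" using smult_closed by simp
lemma sm_l: "v \<in> carrier M \<Longrightarrow> (c + d) \<odot> v = c \<odot> v \<oplus> d \<odot> v" using smult_l_distr[of c d v] by simp
lemma sm_r: "v \<in> carrier M \<Longrightarrow> w \<in> carrier M \<Longrightarrow> c \<odot> (v \<oplus> w) = c \<odot> v \<oplus> c \<odot> w" using smult_r_distr[of c v w] by simp
lemma sm_m: "v \<in> carrier M \<Longrightarrow> c \<odot> (d \<odot> v) = (c * d) \<odot> v" using smult_assoc1[of c d v] by simp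
lemma sm_1 [simp]: "v \<in> carrier M \<Longrightarrow> 1 \<odot> v = v" using smult_one[of v] by simp
lemma sm_0 [simp]: "v \<in> carrier M \<Longrightarrow> 0 \<odot> v = \<zero>" using smult_l_null[of v] by simp
lemma sm_z [simp]: "c \<odot> \<zero> = \<zero>" using smult_r_null[of c] by simp

lemma sm_neg: assumes "v \<in> carrier M" shows "\<ominus> v = (- 1) \<odot> v"
proof -
  have "(- 1) \<odot> v \<oplus> v = ((- 1) + 1) \<odot> v" using assms by (simp only: sm_l sm_1)
  also have "\<dots> = \<zero>" using assms by simp
  finally show ?thesis using assms by (intro minus_equality) auto
qed

lemma sm_cancel: "v \<in> carrier M \<Longrightarrow> c \<noteq> 0 \<Longrightarrow> c \<odot> v = \<zero> \<Longrightarrow> v = \<zero>"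
  by (metis sm_m sm_1 sm_z left_inverse)

end

text \<open>Stated as a predicate on the operator, so that closure and linearity become conditional rewrite rules.\<close>

definition linear_op :: "(complex, 'v, 'm) module_scheme \<Rightarrow> ('v \<Rightarrow> 'v) \<Rightarrow> bool" where
  "linear_op M F \<longleftrightarrow> F \<in> module_hom class_ring M M"

lemma linear_opI:
  assumes "\<And>v. v \<in> carrier M \<Longrightarrow> F v \<in> carrier M"
    and "\<And>v w. v \<in> carrier M \<Longrightarrow> w \<in> carrier M \<Longrightarrow> F (v \<oplus>\<^bsub>M\<^esub> w) = F v \<oplus>\<^bsub>M\<^esub> F w"
    and "\<And>c v. v \<in> carrier M \<Longrightarrow> F (c \<odot>\<^bsub>M\<^esub> v) = c \<odot>\<^bsub>M\<^esub> F v"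
  shows "linear_op M F"
  unfolding linear_op_def module_hom_def using assms by blast

lemma linear_op_closed [simp]: "linear_op M F \<Longrightarrow> v \<in> carrier M \<Longrightarrow> F v \<in> carrier M"
  unfolding linear_op_def using module_hom_closed by blast

lemma linear_op_add:
  "linear_op M F \<Longrightarrow> v \<in> carrier M \<Longrightarrow> w \<in> carrier M \<Longrightarrow> F (v \<oplus>\<^bsub>M\<^esub> w) = F v \<oplus>\<^bsub>M\<^esub> F w"
  unfolding linear_op_def by (rule module_hom_add)

lemma linear_op_smult:
  assumes "linear_op M F" "v \<in> carrier M" shows "F (c \<odot>\<^bsub>M\<^esub> v) = c \<odot>\<^bsub>M\<^esub> F v"
proof (rule module_hom_smult[of F class_ring M M])
  show "c \<in> carrier class_ring" by simp
qed (use assms in \<open>simp_all only: linear_op_def\<close>)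

lemma linear_op_funpow: "linear_op M F \<Longrightarrow> linear_op M (F ^^ k)"
proof (induction k)
  case 0
  then show ?case by (auto intro: linear_opI)
next
  case (Suc k)
  then have k: "linear_op M (F ^^ k)" by simp
  show ?case
  proof (rule linear_opI)
    fix v assume v: "v \<in> carrier M"
    show "(F ^^ Suc k) v \<in> carrier M" using Suc.prems k v by simp
    show "(F ^^ Suc k) (c \<odot>\<^bsub>M\<^esub> v) = c \<odot>\<^bsub>M\<^esub> (F ^^ Suc k) v" for c
      using Suc.prems k v by (simp add: linear_op_smult[OF k] linear_op_smult[OF Suc.prems])
    fix w assume w: "w \<in> carrier M"
    show "(F ^^ Suc k) (v \<oplus>\<^bsub>M\<^esub> w) = (F ^^ Suc k) v \<oplus>\<^bsub>M\<^esub> (F ^^ Suc k) w"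
      using Suc.prems k v w by (simp add: linear_op_add[OF k] linear_op_add[OF Suc.prems])
  qed
qed

lemma (in cmodule) linear_op_zero [simp]: "linear_op M F \<Longrightarrow> F \<zero> = \<zero>"
proof -
  assume F: "linear_op M F"
  have c: "F \<zero> \<in> carrier M" using F by simp
  have "F (0 \<odot> \<zero>) = 0 \<odot> F \<zero>" using F by (rule linear_op_smult) simp
  then show "F \<zero> = \<zero>" unfolding sm_z sm_0[OF c] .
qed

text \<open>The inverse of \<open>X\<close> is carried along as a second operator, which avoids reasoning about inverse functions and makes the dual action of \<open>Y\<inverse>\<close> an instance.\<close>

locale laurent_action = cmodule M for M (structure) +
  fixes X Xi :: "'a \<Rightarrow> 'a"
  assumes X_lin: "linear_op M X" and Xi_lin: "linear_op M Xi"
    and X_Xi: "v \<in> carrier M \<Longrightarrow> X (Xi v) = v" and Xi_X: "v \<in> carrier M \<Longrightarrow> Xi (X v) = v"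
begin

definition Xpow :: "int \<Rightarrow> 'a \<Rightarrow> 'a" where
  "Xpow m = (if m \<ge> 0 then X ^^ nat m else Xi ^^ nat (- m))"

text \<open>The operator \<open>f(X)\<close>.\<close>

definition act :: "complex laurent \<Rightarrow> 'a \<Rightarrow> 'a" where
  "act f v = (\<Oplus>m\<in>Poly_Mapping.keys f. lcoeff f m \<odot> Xpow m v)"

lemma Xpow_lin: "linear_op M (Xpow m)"
  unfolding Xpow_def using linear_op_funpow X_lin Xi_lin by auto

lemma Xpow_0 [simp]: "Xpow 0 v = v" by (simp add: Xpow_def)

lemma Xpow_Suc: assumes v: "v \<in> carrier M" shows "Xpow (m + 1) v = X (Xpow m v)"
proof (cases "m \<ge> 0")
  case True
  then have "nat (m + 1) = Suc (nat m)" by simp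
  then show ?thesis using True by (simp add: Xpow_def)
next
  case False
  then have "nat (- m) = Suc (nat (- (m + 1)))" by simp
  then have e: "Xpow m v = Xi (Xpow (m + 1) v)" using False by (auto simp: Xpow_def)
  show ?thesis unfolding e by (rule X_Xi[symmetric]) (simp add: Xpow_lin v)
qed

lemma Xpow_pred: assumes v: "v \<in> carrier M" shows "Xpow (m - 1) v = Xi (Xpow m v)"
  using Xpow_Suc[OF v, of "m - 1"] Xi_X[of "Xpow (m - 1) v"] v by (simp add: Xpow_lin)

lemma Xpow_add: assumes v: "v \<in> carrier M" shows "Xpow (m + k) v = Xpow m (Xpow k v)"
proof (induction m rule: int_induct[where k = 0])
  case (step1 i)
  have "Xpow (i + 1 + k) v = X (Xpow (i + k) v)" using Xpow_Suc[OF v, of "i + k"] by (simp add: algebra_simps)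
  then show ?case using step1 Xpow_Suc[of "Xpow k v" i] v by (simp add: Xpow_lin)
next
  case (step2 i)
  have "Xpow (i - 1 + k) v = Xi (Xpow (i + k) v)" using Xpow_pred[OF v, of "i + k"] by (simp add: algebra_simps)
  then show ?case using step2 Xpow_pred[of "Xpow k v" i] v by (simp add: Xpow_lin)
qed simp

lemma act_superset:
  assumes "finite A" "Poly_Mapping.keys f \<subseteq> A" "v \<in> carrier M"
  shows "act f v = (\<Oplus>m\<in>A. lcoeff f m \<odot> Xpow m v)"
  unfolding act_def
  by (rule add.finprod_mono_neutral_cong_left) (use assms in \<open>auto simp: Xpow_lin in_keys_iff\<close>)

lemma act_closed [simp]: "v \<in> carrier M \<Longrightarrow> act f v \<in> carrier M"
  unfolding act_def by (rule finsum_closed) (auto simp: Xpow_lin)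

lemma act_add: assumes v: "v \<in> carrier M" shows "act (f + g) v = act f v \<oplus> act g v"
proof -
  let ?A = "Poly_Mapping.keys f \<union> Poly_Mapping.keys g"
  have "act (f + g) v = (\<Oplus>m\<in>?A. lcoeff (f + g) m \<odot> Xpow m v)"
    by (rule act_superset) (use v Poly_Mapping.keys_add[of f g] in auto)
  also have "\<dots> = (\<Oplus>m\<in>?A. lcoeff f m \<odot> Xpow m v \<oplus> lcoeff g m \<odot> Xpow m v)"
    by (rule finsum_cong') (use v in \<open>auto simp: lookup_add sm_l Xpow_lin\<close>)
  also have "\<dots> = (\<Oplus>m\<in>?A. lcoeff f m \<odot> Xpow m v) \<oplus> (\<Oplus>m\<in>?A. lcoeff g m \<odot> Xpow m v)"
    by (rule finsum_addf) (use v in \<open>auto simp: Xpow_lin\<close>)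
  also have "(\<Oplus>m\<in>?A. lcoeff f m \<odot> Xpow m v) = act f v" by (rule act_superset[symmetric]) (use v in auto)
  also have "(\<Oplus>m\<in>?A. lcoeff g m \<odot> Xpow m v) = act g v" by (rule act_superset[symmetric]) (use v in auto)
  finally show ?thesis .
qed

lemma act_single: assumes v: "v \<in> carrier M" shows "act (lmonom c m) v = c \<odot> Xpow m v"
proof -
  have "act (lmonom c m) v = (\<Oplus>k\<in>{m}. lcoeff (lmonom c m) k \<odot> Xpow k v)"
    by (rule act_superset) (use v in auto)
  also have "\<dots> = c \<odot> Xpow m v" using v by (simp add: Xpow_lin)
  finally show ?thesis .
qed

lemma act_0 [simp]: "v \<in> carrier M \<Longrightarrow> act 0 v = \<zero>" by (simp add: act_def)
lemma act_cst: "v \<in> carrier M \<Longrightarrow> act (cst c) v = c \<odot> v" by (simp add: act_single)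
lemma act_1 [simp]: "v \<in> carrier M \<Longrightarrow> act 1 v = v" using act_cst[of v 1] by simp

lemma Xpow_1: "Xpow 1 v = X v" "Xpow (- 1) v = Xi v" by (simp_all add: Xpow_def)

lemma act_XX: "v \<in> carrier M \<Longrightarrow> act XX v = X v"
  and act_Xinv: "v \<in> carrier M \<Longrightarrow> act (lmonom 1 (- 1)) v = Xi v"
  using X_lin Xi_lin by (simp_all add: act_single Xpow_1)

lemma act_lin: "linear_op M (act f)"
proof (rule linear_opI)
  fix v w assume v: "v \<in> carrier M" "w \<in> carrier M"
  show "act f (v \<oplus> w) = act f v \<oplus> act f w"
  proof (induction f rule: laurent_induct)
    case (add f g)
    then show ?case using v by (simp add: act_add a_ac)
  next
    case (monom c m)
    then show ?case using v by (simp add: act_single Xpow_lin linear_op_add sm_r)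
  qed
next
  fix c v assume v: "v \<in> carrier M"
  show "act f (c \<odot> v) = c \<odot> act f v"
  proof (induction f rule: laurent_induct)
    case (add f g)
    then show ?case using v by (simp add: act_add sm_r)
  next
    case (monom d m)
    then show ?case using v by (simp add: act_single Xpow_lin linear_op_smult sm_m mult.commute)
  qed
qed simp

lemma act_mult: assumes v: "v \<in> carrier M" shows "act (f * g) v = act f (act g v)"
proof (induction f rule: laurent_induct)
  case (add f f')
  then show ?case using v by (simp add: distrib_right act_add)
next
  case (monom c m)
  show ?case
  proof (induction g rule: laurent_induct)
    case (add g g')
    then show ?case using v by (simp add: distrib_left act_add act_lin linear_op_add)
  next
    case (monom d k)
    then show ?case using v 
      by (simp add: mult_single act_single act_lin Xpow_lin Xpow_add linear_op_smult sm_m mult.commute[of c d])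
  qed
qed

lemma act_cst_mult: "v \<in> carrier M \<Longrightarrow> act (cst c * f) v = c \<odot> act f v"
  by (simp add: act_mult act_cst)

lemma act_uminus: "v \<in> carrier M \<Longrightarrow> act (- f) v = (- 1) \<odot> act f v"
  using act_cst_mult[of v "- 1" f] by (simp add: single_uminus)

lemma act_diff: "v \<in> carrier M \<Longrightarrow> act (f - g) v = act f v \<oplus> (- 1) \<odot> act g v"
  using act_add[of v f "- g"] by (simp add: act_uminus)

end

text \<open>Multiplicative statements need only be checked on constants and on \<open>X\<^sup>\<plusminus>\<^sup>1\<close>.\<close>

lemma laurent_mult_induct [case_names cst X Xinv add mult]:
  fixes f :: "'k::comm_ring_1 laurent"
  assumes c: "\<And>c. P (cst c)" and X: "P XX" "P (lmonom 1 (- 1))"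
    and add: "\<And>f g. P f \<Longrightarrow> P g \<Longrightarrow> P (f + g)" and mult: "\<And>f g. P f \<Longrightarrow> P g \<Longrightarrow> P (f * g)"
  shows "P f"
proof (induction f rule: laurent_induct)
  case (monom c m)
  have "P (lmonom 1 m)"
  proof (induction m rule: int_induct[where k = 0])
    case base
    then show ?case using c[of 1] .
  next
    case (step1 i)
    have "lmonom 1 (i + 1) = lmonom 1 i * (XX :: 'k laurent)" by (simp add: mult_single)
    then show ?case using mult[OF step1(2) X(1)] by simp
  next
    case (step2 i)
    have "lmonom 1 (i - 1) = lmonom 1 i * (lmonom 1 (- 1) :: 'k laurent)" by (simp add: mult_single)
    then show ?case using mult[OF step2(2) X(2)] by simp
  qed
  from mult[OF c[of c] this] show ?case by (simp add: mult_single)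
qed (rule add)

section \<open>Representations as triples of operators\<close>

text \<open>The generator \<open>Y\<close> is replaced by \<open>P = Y T\<inverse>\<close>. In these terms the relations are quadratic or braid-like, they contain \<open>t\<^sup>1\<^sup>/\<^sup>2\<close> only through \<open>t\<^sup>1\<^sup>/\<^sup>2 - t\<^sup>-\<^sup>1\<^sup>/\<^sup>2\<close>, and the duality between \<open>X\<close> and \<open>Y\<inverse>\<close> becomes visible.\<close>

locale hecke_triple = laurent_action M X Xi for M (structure) and X Xi +
  fixes T P :: "'a \<Rightarrow> 'a" and h th :: complex
  assumes h_nz: "h \<noteq> 0" and th_nz: "th \<noteq> 0"
    and T_lin: "linear_op M T" and P_lin: "linear_op M P"
    and TT: "v \<in> carrier M \<Longrightarrow> T (T v) = (th - inverse th) \<odot> T v \<oplus> v"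
    and TXT: "v \<in> carrier M \<Longrightarrow> T (X (T v)) = Xi v"
    and PP: "v \<in> carrier M \<Longrightarrow> P (P v) = v"
    and PXP: "v \<in> carrier M \<Longrightarrow> P (X (P v)) = h \<odot> Xi v"
begin

abbreviation "gam \<equiv> th - inverse th"

lemmas lin = X_lin Xi_lin T_lin P_lin act_lin

definition Ti where "Ti v = T v \<oplus> (- gam) \<odot> v"

lemma Ti_lin: "linear_op M Ti"
proof (rule linear_opI)
  fix v w assume v: "v \<in> carrier M" "w \<in> carrier M"
  then have c: "T v \<in> carrier M" "T w \<in> carrier M" using lin by auto
  show "Ti (v \<oplus> w) = Ti v \<oplus> Ti w"
    unfolding Ti_def linear_op_add[OF T_lin v] sm_r[OF v] using v c by (simp add: a_ac)
next
  fix v assume v: "v \<in> carrier M"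
  then have c: "T v \<in> carrier M" using lin by auto
  then show "Ti v \<in> carrier M" using v by (simp add: Ti_def)
  show "Ti (c \<odot> v) = c \<odot> Ti v" for c
    unfolding Ti_def using v c by (simp add: linear_op_smult[OF T_lin v] sm_r sm_m mult.commute)
qed

lemma cancel_c: "v \<in> carrier M \<Longrightarrow> w \<in> carrier M \<Longrightarrow> (c \<odot> v \<oplus> w) \<oplus> (- c) \<odot> v = w"
proof -
  assume v: "v \<in> carrier M" "w \<in> carrier M"
  have "(c \<odot> v \<oplus> w) \<oplus> (- c) \<odot> v = (c + (- c)) \<odot> v \<oplus> w" using v unfolding sm_l[OF v(1)] by (simp add: a_ac)
  then show ?thesis using v by simp
qed

lemma T_Ti: assumes v: "v \<in> carrier M" shows "T (Ti v) = v"
proof -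
  have "T (Ti v) = (gam \<odot> T v \<oplus> v) \<oplus> (- gam) \<odot> T v"
    using v unfolding Ti_def by (simp add: linear_op_add[OF T_lin] linear_op_smult[OF T_lin] TT lin)
  then show ?thesis using v by (simp only: cancel_c linear_op_closed[OF T_lin])
qed

lemma Ti_T: assumes v: "v \<in> carrier M" shows "Ti (T v) = v"
  using v unfolding Ti_def by (simp only: TT cancel_c linear_op_closed[OF T_lin])

text \<open>The commutation rule of Bernstein and Lusztig, extended from \<open>X\<^sup>\<plusminus>\<^sup>1\<close> to all Laurent polynomials by the twisted Leibniz rule.\<close>

lemma T_act:
  "v \<in> carrier M \<Longrightarrow> T (act f v) = act (subst_inv 1 f) (T v) \<oplus> gam \<odot> act (divdiff f) v"
proof (induction f arbitrary: v rule: laurent_mult_induct)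
  case (cst c)
  then show ?case by (simp add: act_cst linear_op_smult[OF T_lin] lin)
next
  case X
  have Tv: "T v \<in> carrier M" "Ti v \<in> carrier M" using X lin Ti_lin by auto
  have "T (X v) = T (X (T (Ti v)))" using X by (simp add: T_Ti)
  also have "\<dots> = Xi (Ti v)" using X Tv by (simp add: TXT)
  also have "\<dots> = Xi (T v) \<oplus> (- gam) \<odot> Xi v"
    using X Tv unfolding Ti_def by (simp add: linear_op_add[OF Xi_lin] linear_op_smult[OF Xi_lin])
  finally have "T (X v) = Xi (T v) \<oplus> (- gam) \<odot> Xi v" .
  then show ?case using X Tv by (simp add: act_XX divdiff_XX act_uminus act_Xinv sm_m lin)
next
  case Xinv
  define w where "w = Xi v"
  have w: "w \<in> carrier M" "Xi w \<in> carrier M" "T v \<in> carrier M" "T w \<in> carrier M" "Ti w \<in> carrier M"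
    using Xinv lin Ti_lin by (auto simp: w_def)
  have vX: "v = X w" using Xinv by (simp add: w_def X_Xi)
  have "T v = T (X (T (Ti w)))" using w by (simp add: T_Ti vX)
  also have "\<dots> = Xi (Ti w)" using w by (simp add: TXT)
  finally have "X (T v) = Ti w" using w by (simp add: X_Xi)
  then have "T w = X (T v) \<oplus> gam \<odot> w"
  proof -
    assume e: "X (T v) = Ti w"
    have "(gam + (- gam)) \<odot> w = \<zero>" using w by simp
    then have "gam \<odot> w \<oplus> (- gam) \<odot> w = \<zero>" using w by (simp only: sm_l)
    then show ?thesis unfolding e Ti_def using w by (simp add: a_assoc) (simp add: a_comm)
  qed
  moreover have "divdiff (lmonom 1 (- 1)) = (lmonom 1 (- 1) :: complex laurent)"
    by (rule divdiff_unique) (simp add: algebra_simps mult_single)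
  ultimately show ?case using Xinv w by (simp add: act_Xinv act_XX w_def)
next
  case (add f g)
  have Tv: "T v \<in> carrier M" using add lin by auto
  show ?case using add Tv
    by (simp add: act_add subst_inv_add divdiff_add linear_op_add[OF T_lin] sm_r a_ac)
next
  case (mult f g)
  have c: "T v \<in> carrier M" using mult lin by auto
  have "T (act (f * g) v) = act (subst_inv 1 f) (T (act g v)) \<oplus> gam \<odot> act (divdiff f) (act g v)"
    using mult by (simp add: act_mult)
  also have "act (subst_inv 1 f) (T (act g v)) = act (subst_inv 1 f) (act (subst_inv 1 g) (T v)) \<oplus> gam \<odot> act (subst_inv 1 f) (act (divdiff g) v)"
    using mult c by (simp add: linear_op_add[OF act_lin] linear_op_smult[OF act_lin])
  finally show ?case using mult(3) c
    by (simp add: divdiff_mult subst_inv_mult act_mult act_add sm_r a_ac)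
qed

lemma P_act: "v \<in> carrier M \<Longrightarrow> P (act f v) = act (subst_inv h f) (P v)"
proof (induction f arbitrary: v rule: laurent_mult_induct)
  case (cst c)
  then show ?case by (simp add: act_cst linear_op_smult[OF P_lin] lin)
next
  case X
  have "P (X v) = P (X (P (P v)))" using X by (simp add: PP)
  also have "\<dots> = h \<odot> Xi (P v)" using X by (simp add: PXP lin)
  finally show ?case using X by (simp add: act_XX act_single Xpow_1 lin)
next
  case Xinv
  have Pv: "P v \<in> carrier M" using Xinv lin by auto
  have "P (Xi v) = inverse h \<odot> P (h \<odot> Xi v)"
    using Xinv h_nz by (simp add: linear_op_smult[OF P_lin] sm_m lin)
  also have "h \<odot> Xi v = P (X (P v))" using Xinv by (simp add: PXP)
  also have "P (P (X (P v))) = X (P v)" using Pv by (simp add: PP lin)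
  finally show ?case using Xinv Pv by (simp add: act_Xinv act_single Xpow_1 power_int_minus lin)
next
  case (add f g)
  then show ?case by (simp add: act_add subst_inv_add linear_op_add[OF P_lin] lin)
next
  case (mult f g)
  then show ?case by (simp add: act_mult subst_inv_mult[OF h_nz] lin)
qed

lemma act_T:
  assumes v: "v \<in> carrier M"
  shows "act f (T v) = T (act (subst_inv 1 f) v) \<oplus> gam \<odot> act (divdiff f) v"
proof -
  have Tv: "T v \<in> carrier M" using v lin by auto
  have "T (act (subst_inv 1 f) v) = act f (T v) \<oplus> (- gam) \<odot> act (divdiff f) v"
    using T_act[OF v, of "subst_inv 1 f"] v by (simp add: divdiff_subst_inv act_uminus sm_m)
  then have "T (act (subst_inv 1 f) v) \<oplus> gam \<odot> act (divdiff f) v 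
     = act f (T v) \<oplus> ((- gam) \<odot> act (divdiff f) v \<oplus> gam \<odot> act (divdiff f) v)"
    using v Tv by (simp add: a_assoc)
  also have "(- gam) \<odot> act (divdiff f) v \<oplus> gam \<odot> act (divdiff f) v = \<zero>"
    using v sm_l[of "act (divdiff f) v" "- gam" gam] by simp
  finally show ?thesis using Tv by simp
qed

text \<open>The intertwiner that exchanges \<open>X\<close> and \<open>X\<inverse>\<close>.\<close>

definition kappa where "kappa v = act (lmonom 1 2 - 1) (T v) \<oplus> gam \<odot> v"

lemma kappa_closed [simp]: "v \<in> carrier M \<Longrightarrow> kappa v \<in> carrier M"
  by (simp add: kappa_def lin)

text \<open>Move \<open>T\<close> to the right by \<open>T_act\<close>. The terms that contain \<open>T\<close> cancel, and only a Laurent polynomial in \<open>X\<close> is left.\<close>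

lemma kappa_kappa:
  assumes v: "v \<in> carrier M" shows "kappa (kappa v) = act (kappa_sq th) v"
proof -
  define D :: "complex laurent" where "D = lmonom 1 2 - 1"
  define D' :: "complex laurent" where "D' = lmonom 1 (- 2) - 1"
  have Tv: "T v \<in> carrier M" "T (T v) \<in> carrier M" using v lin by auto
  have sD: "subst_inv 1 D = D'" by (simp add: D_def D'_def subst_inv_diff)
  have dD: "divdiff D = - (1 + lmonom 1 (- 2))"
    by (rule divdiff_unique) (simp add: D_def subst_inv_diff algebra_simps mult_single)
  have "T (act D (T v)) = act D' (gam \<odot> T v \<oplus> v) \<oplus> gam \<odot> act (- (1 + lmonom 1 (- 2))) (T v)"
    using T_act[OF Tv(1), of D] v by (simp add: sD dD TT)
  also have "act D' (gam \<odot> T v \<oplus> v) = act (cst gam * D') (T v) \<oplus> act D' v"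
    using v Tv by (simp add: linear_op_add[OF act_lin] linear_op_smult[OF act_lin] act_cst_mult)
  also have "gam \<odot> act (- (1 + lmonom 1 (- 2))) (T v) = act (cst gam * (- (1 + lmonom 1 (- 2)))) (T v)"
    using Tv by (simp only: act_cst_mult)
  finally have "T (act D (T v)) = act (cst gam * D' + cst gam * (- (1 + lmonom 1 (- 2)))) (T v) \<oplus> act D' v"
    using v Tv by (simp add: act_add[OF Tv(1)] a_ac)
  also have "cst gam * D' + cst gam * (- (1 + lmonom 1 (- 2))) = cst (- (2 * gam))"
  proof -
    have "cst gam * D' + cst gam * (- (1 + lmonom 1 (- 2))) = cst gam * (D' - (1 + lmonom 1 (- 2)))"
      by (simp add: algebra_simps)
    also have "D' - (1 + lmonom 1 (- 2)) = cst (- 2)" by (simp add: D'_def single_uminus)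
    also have "cst gam * cst (- 2) = cst (- (2 * gam))" unfolding mult_single by (simp add: algebra_simps)
    finally show ?thesis .
  qed
  finally have 1: "T (act D (T v)) = act (cst (- (2 * gam))) (T v) \<oplus> act D' v" .
  have "T (kappa v) = T (act D (T v)) \<oplus> act (cst gam) (T v)"
    unfolding kappa_def D_def[symmetric] using v Tv
    by (simp add: linear_op_add[OF T_lin] linear_op_smult[OF T_lin] act_cst)
  also have "\<dots> = act (cst (- (2 * gam)) + cst gam) (T v) \<oplus> act D' v"
    unfolding 1 using v Tv by (simp add: act_add[OF Tv(1)] a_ac)
  also have "cst (- (2 * gam)) + cst gam = cst (- gam)" by (simp flip: single_add)
  finally have 2: "T (kappa v) = act (cst (- gam)) (T v) \<oplus> act D' v" .
  have "kappa (kappa v) = act D (T (kappa v)) \<oplus> gam \<odot> kappa v"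
    by (simp only: kappa_def D_def)
  also have "act D (T (kappa v)) = act (D * cst (- gam)) (T v) \<oplus> act (D * D') v"
    unfolding 2 using v Tv by (simp add: linear_op_add[OF act_lin] act_mult)
  also have "gam \<odot> kappa v = act (cst gam * D) (T v) \<oplus> act (cst (gam * gam)) v"
    unfolding kappa_def D_def[symmetric] using v Tv by (simp add: sm_r act_cst_mult act_cst sm_m)
  finally have "kappa (kappa v) = act (D * cst (- gam) + cst gam * D) (T v) \<oplus> act (D * D' + cst (gam * gam)) v"
    using v Tv by (simp add: act_add[OF Tv(1)] act_add[OF v] a_ac)
  also have "D * cst (- gam) + cst gam * D = 0" 
    unfolding mult.commute[of "cst gam" D] distrib_left[symmetric] single_add[symmetric] by simp
  also have "D * D' + cst (gam * gam) = kappa_sq th"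
  proof -
    have "gam * gam = th\<^sup>2 + inverse (th\<^sup>2) - 2"
      using th_nz by (simp add: power2_eq_square algebra_simps)
    then have "cst (gam * gam) = cst (th\<^sup>2 + inverse (th\<^sup>2)) - cst 2" by (simp only: single_diff)
    then show ?thesis by (simp add: D_def D'_def kappa_sq_def algebra_simps mult_single)
  qed
  finally show ?thesis using v Tv by simp
qed

definition ann :: "complex laurent set" where "ann = {f. \<forall>v\<in>carrier M. act f v = \<zero>}"

lemma annI: "(\<And>v. v \<in> carrier M \<Longrightarrow> act f v = \<zero>) \<Longrightarrow> f \<in> ann" by (simp add: ann_def)
lemma annD: "f \<in> ann \<Longrightarrow> v \<in> carrier M \<Longrightarrow> act f v = \<zero>" by (simp add: ann_def)

text \<open>If \<open>f(X) = 0\<close>, then \<open>f(X\<inverse>)\<close> vanishes on the image of the intertwiner, hence its product with \<open>kappa_sq\<close> vanishes everywhere.\<close>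

lemma annihilator_ann:
  assumes h: "\<And>k. k > 0 \<Longrightarrow> (h\<^sup>2) ^ k \<noteq> 1" and nz: "\<exists>f\<in>ann. f \<noteq> 0" and M: "carrier M \<noteq> {\<zero>}"
  shows "annihilator h th ann"
proof
  show "h \<noteq> 0" "th \<noteq> 0" by (fact h_nz th_nz)+
  show "(h\<^sup>2) ^ k \<noteq> 1" if "k > 0" for k using h that .
  show "\<exists>f\<in>ann. f \<noteq> 0" by fact
  show "f + g \<in> ann" if "f \<in> ann" "g \<in> ann" for f g
    using that by (intro annI) (simp add: act_add annD)
  show "g * f \<in> ann" if "f \<in> ann" for f g
    using that by (intro annI) (simp add: act_mult annD lin)
  show "1 \<notin> ann"
  proof
    assume "1 \<in> ann"
    then have "v = \<zero>" if "v \<in> carrier M" for v using annD[of 1 v] that by simp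
    then show False using M by auto
  qed
  show "subst_inv h f \<in> ann" if f: "f \<in> ann" for f
  proof (rule annI)
    fix v assume v: "v \<in> carrier M"
    have "act (subst_inv h f) v = act (subst_inv h f) (P (P v))" using v by (simp add: PP)
    also have "\<dots> = P (act f (P v))" using v by (simp add: P_act lin)
    also have "\<dots> = \<zero>" using f v by (simp add: annD lin)
    finally show "act (subst_inv h f) v = \<zero>" .
  qed
  have key: "act (subst_inv 1 f) (T v) \<oplus> gam \<odot> act (divdiff f) v = \<zero>" if "f \<in> ann" "v \<in> carrier M" for f v
    using T_act[of v f] that by (simp add: annD lin)
  show "kappa_sq th * subst_inv 1 f \<in> ann" if f: "f \<in> ann" for f
  proof -
    have sk: "act (subst_inv 1 f) (kappa v) = \<zero>" if v: "v \<in> carrier M" for v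
    proof -
      have Tv: "T v \<in> carrier M" using v lin by auto
      have "act (lmonom 1 2 - 1) (act (subst_inv 1 f) (T v) \<oplus> gam \<odot> act (divdiff f) v) = \<zero>"
        using key[OF f v] by (simp add: lin)
      then have "act ((lmonom 1 2 - 1) * subst_inv 1 f) (T v) \<oplus> gam \<odot> act ((lmonom 1 2 - 1) * divdiff f) v = \<zero>"
        using v Tv by (simp add: linear_op_add[OF act_lin] linear_op_smult[OF act_lin] act_mult)
      moreover have "act ((lmonom 1 2 - 1) * divdiff f) v = act (subst_inv 1 f) v"
        unfolding divdiff_eq using v f by (simp add: act_diff annD)
      moreover have "act ((lmonom 1 2 - 1) * subst_inv 1 f) (T v) = act (subst_inv 1 f) (act (lmonom 1 2 - 1) (T v))"
        using Tv by (subst mult.commute) (simp only: act_mult)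
      ultimately show ?thesis unfolding kappa_def
        using v Tv by (simp add: linear_op_add[OF act_lin] linear_op_smult[OF act_lin])
    qed
    show ?thesis
    proof (rule annI)
      fix v assume v: "v \<in> carrier M"
      have "act (kappa_sq th * subst_inv 1 f) v = act (subst_inv 1 f) (act (kappa_sq th) v)"
        using v by (subst mult.commute) (rule act_mult)
      also have "\<dots> = \<zero>" using sk[of "kappa v"] v by (simp add: kappa_kappa)
      finally show "act (kappa_sq th * subst_inv 1 f) v = \<zero>" .
    qed
  qed
  show "divdiff f \<in> ann" if f: "gam \<noteq> 0" "f \<in> ann" "subst_inv 1 f \<in> ann" for f
  proof (rule annI)
    fix v assume v: "v \<in> carrier M"
    have "gam \<odot> act (divdiff f) v = \<zero>" using key[OF f(2) v] annD[OF f(3), of "T v"] v by (simp add: lin)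
    then show "act (divdiff f) v = \<zero>" using f(1) v by (intro sm_cancel[of "act (divdiff f) v" gam]) auto
  qed
qed

definition Y where "Y v = P (T v)"
definition Yi where "Yi v = Ti (P v)"

lemma X_P_X: assumes v: "v \<in> carrier M" shows "X (P (X v)) = h \<odot> P v"
proof -
  have "P (X (P (P v))) = h \<odot> Xi (P v)" using v by (simp add: PXP lin)
  then have "P (X v) = h \<odot> Xi (P v)" using v by (simp add: PP)
  then show ?thesis using v by (simp add: linear_op_smult[OF X_lin] X_Xi lin)
qed

text \<open>The duality of the double affine Hecke algebra: \<open>X \<mapsto> Y\<inverse>\<close>, \<open>T \<mapsto> T\<close>. The new involution \<open>X T\<close> arises from \<open>T X T = X\<inverse>\<close>.\<close>

lemma dual: "hecke_triple M Yi Y T (\<lambda>v. X (T v)) h th"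
proof
  show "linear_op M Yi" unfolding Yi_def
    by (rule linear_opI) (auto simp: lin Ti_lin linear_op_add[OF P_lin] linear_op_smult[OF P_lin]
        linear_op_add[OF Ti_lin] linear_op_smult[OF Ti_lin])
  show "linear_op M Y" unfolding Y_def
    by (rule linear_opI) (auto simp: lin linear_op_add[OF P_lin] linear_op_smult[OF P_lin]
        linear_op_add[OF T_lin] linear_op_smult[OF T_lin])
  show "linear_op M (\<lambda>v. X (T v))"
    by (rule linear_opI) (auto simp: lin linear_op_add[OF X_lin] linear_op_smult[OF X_lin]
        linear_op_add[OF T_lin] linear_op_smult[OF T_lin])
  fix v assume v: "v \<in> carrier M"
  show "Yi (Y v) = v" "Y (Yi v) = v" using v by (simp_all add: Yi_def Y_def PP T_Ti Ti_T lin Ti_lin)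
  show "T (T v) = (th - inverse th) \<odot> T v \<oplus> v" by (rule TT[OF v])
  show "T (Yi (T v)) = Y v" using v by (simp add: Yi_def Y_def T_Ti lin)
  show "X (T (X (T v))) = v" using v by (simp add: TXT X_Xi)
  show "X (T (Yi (X (T v)))) = h \<odot> Y v" using v by (simp add: Yi_def Y_def T_Ti X_P_X lin)
qed (fact h_nz th_nz T_lin)+

text \<open>Modelled on evaluation at \<open>t\<^sup>-\<^sup>1\<^sup>/\<^sup>2\<close>, which has these properties for the dual of the polynomial representation.\<close>

definition invariant_functional :: "('a \<Rightarrow> complex) \<Rightarrow> bool" where
  "invariant_functional G \<longleftrightarrow> (\<forall>v\<in>carrier M. \<forall>w\<in>carrier M. G (v \<oplus> w) = G v + G w) \<and>
     (\<forall>c. \<forall>v\<in>carrier M. G (c \<odot> v) = c * G v) \<and> (\<forall>v\<in>carrier M. G (T v) = th * G v) \<and> (\<forall>v\<in>carrier M. G (P v) = G v)"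

definition functional_radical :: "('a \<Rightarrow> complex) \<Rightarrow> 'a set" where
  "functional_radical G = {v \<in> carrier M. \<forall>f. G (act f v) = 0}"

text \<open>A functional with \<open>G T = t\<^sup>1\<^sup>/\<^sup>2 G\<close> and \<open>G P = G\<close> can absorb every \<open>T\<close> and \<open>P\<close> that has been moved to the left past \<open>f(X)\<close>; so its radical for \<open>X\<close> is a subrepresentation.\<close>

lemma functional_radical_closed:
  assumes G: "invariant_functional G" and v: "v \<in> functional_radical G"
  shows "act f v \<in> functional_radical G" "T v \<in> functional_radical G" "P v \<in> functional_radical G"
proof -
  have vc: "v \<in> carrier M" and v0: "\<And>f. G (act f v) = 0" using v by (auto simp: functional_radical_def)
  show "act f v \<in> functional_radical G"
    using vc v0 by (auto simp: functional_radical_def simp flip: act_mult)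
  have "G (act f (T v)) = 0" for f
  proof -
    have "G (act f (T v)) = th * G (act (subst_inv 1 f) v) + gam * G (act (divdiff f) v)"
      unfolding act_T[OF vc] using G vc by (auto simp: invariant_functional_def lin)
    then show ?thesis using v0 by simp
  qed
  then show "T v \<in> functional_radical G" using vc by (simp add: functional_radical_def lin)
  have "G (act f (P v)) = 0" for f
  proof -
    have "act f (P v) = P (act (subst_inv h f) v)" using vc h_nz by (simp add: P_act)
    then show ?thesis using G vc v0 by (auto simp: invariant_functional_def)
  qed
  then show "P v \<in> functional_radical G" using vc by (simp add: functional_radical_def lin)
qed

end

section \<open>Finite dimensional representations\<close>

context laurent_action
begin

lemma act_sum: "finite I \<Longrightarrow> v \<in> carrier M \<Longrightarrow> act (\<Sum>i\<in>I. F i) v = (\<Oplus>i\<in>I. act (F i) v)"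
proof (induction I rule: finite_induct)
  case (insert i I)
  then show ?case by (simp add: act_add)
qed simp

text \<open>The vectors \<open>X\<^sup>i a\<close> for \<open>i \<le> dim M\<close> are linearly dependent or repeat.\<close>

lemma vector_annihilator:
  assumes vs: "vectorspace (class_ring :: complex ring) M" and fd: "vectorspace.fin_dim (class_ring :: complex ring) M"
    and a: "a \<in> carrier M"
  shows "\<exists>f. f \<noteq> 0 \<and> act f a = \<zero>"
proof -
  interpret V: vectorspace "class_ring :: complex ring" M by (rule vs)
  define F where "F i = Xpow (int i) a" for i :: nat
  have F: "F i \<in> carrier M" for i using a by (simp add: F_def Xpow_lin)
  have act_F: "act (lmonom c (int i)) a = c \<odot> F i" for c i using a by (simp add: act_single F_def)
  show ?thesis
  proof (cases "inj_on F {..V.dim}")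
    case False
    then obtain i j where ij: "i \<noteq> j" "F i = F j" by (auto simp: inj_on_def)
    have "act (lmonom 1 (int i) - lmonom 1 (int j)) a = (1 + (- 1)) \<odot> F i"
      using a F by (simp only: act_diff act_F sm_l ij(2) sm_1)
    moreover have "lmonom 1 (int i) - lmonom 1 (int j) \<noteq> (0 :: complex laurent)"
    proof
      assume "lmonom 1 (int i) - lmonom 1 (int j) = (0 :: complex laurent)"
      then have "lcoeff (lmonom 1 (int i) - lmonom 1 (int j)) (int i) = (0::complex)" by simp
      then show False using ij by (simp add: lookup_minus lookup_single)
    qed
    ultimately show ?thesis using F by (intro exI[of _ "lmonom 1 (int i) - lmonom 1 (int j)"]) simp
  next
    case inj: True
    have "lin_dep (F ` {..V.dim})"
    proof (rule ccontr)
      assume "lin_indpt (F ` {..V.dim})"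
      then have "card (F ` {..V.dim}) \<le> V.dim" using V.li_le_dim(2)[OF fd] F by blast
      then show False using inj by (simp add: card_image)
    qed
    then obtain A c v where A: "finite A" "A \<subseteq> F ` {..V.dim}" "lincomb c A = \<zero>" "v \<in> A" "c v \<noteq> 0"
      unfolding lin_dep_def by auto
    define I where "I = {i \<in> {..V.dim}. F i \<in> A}"
    have I: "finite I" "F ` I = A" "inj_on F I"
      using A(2) inj by (auto simp: I_def inj_on_def)
    define f where "f = (\<Sum>i\<in>I. lmonom (c (F i)) (int i))"
    have "act f a = (\<Oplus>i\<in>I. c (F i) \<odot> F i)"
      unfolding f_def using I a by (simp add: act_sum act_F)
    also have "\<dots> = (\<Oplus>u\<in>F ` I. c u \<odot> u)"
      by (rule add.finprod_reindex[symmetric]) (use F I in auto)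
    also have "\<dots> = \<zero>" using A(3) by (simp add: lincomb_def I)
    finally have "act f a = \<zero>" .
    moreover obtain i where i: "i \<in> I" "F i = v" using A(4) I(2) by auto
    have "lcoeff f (int i) = c v"
      unfolding f_def using I i by (simp add: lookup_sum lookup_single when_def)
    then have "f \<noteq> 0" using A(5) by auto
    ultimately show ?thesis by blast
  qed
qed

lemma kernel_submodule: "submodule (class_ring :: complex ring) {v \<in> carrier M. act f v = \<zero>} M"
  by (unfold_locales)
    (auto simp: linear_op_add[OF act_lin] linear_op_smult[OF act_lin] linear_op_zero[OF act_lin])

text \<open>Multiply the annihilators of finitely many generators; the kernel of the product is a subspace.\<close>

lemma common_annihilator:
  assumes vs: "vectorspace (class_ring :: complex ring) M" and fd: "vectorspace.fin_dim (class_ring :: complex ring) M"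
  shows "\<exists>f. f \<noteq> 0 \<and> (\<forall>v\<in>carrier M. act f v = \<zero>)"
proof -
  interpret V: vectorspace "class_ring :: complex ring" M by (rule vs)
  obtain A where A: "finite A" "A \<subseteq> carrier M" "span A = carrier M" using fd unfolding V.fin_dim_def by auto
  have "\<exists>f. f \<noteq> 0 \<and> (\<forall>v\<in>A. act f v = \<zero>)" using A(1,2)
  proof (induction A rule: finite_induct)
    case empty
    then show ?case by (intro exI[of _ 1]) auto
  next
    case (insert a A)
    then obtain f where f: "f \<noteq> 0" "\<forall>v\<in>A. act f v = \<zero>" by auto
    obtain g where g: "g \<noteq> 0" "act g a = \<zero>" using vector_annihilator[OF vs fd, of a] insert by auto
    have "act (f * g) v = \<zero>" if "v \<in> insert a A" for v
    proof (cases "v = a")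
      case True
      then show ?thesis using g insert by (simp add: act_mult act_lin)
    next
      case False
      then have v: "v \<in> A" "v \<in> carrier M" using that insert by auto
      have "act (f * g) v = act g (act f v)" unfolding mult.commute[of f g] using v by (simp add: act_mult)
      then show ?thesis using f v by (simp add: act_lin)
    qed
    then show ?case using f g by (intro exI[of _ "f * g"]) auto
  qed
  then obtain f where f: "f \<noteq> 0" "\<forall>v\<in>A. act f v = \<zero>" by blast
  have "span A \<subseteq> {v \<in> carrier M. act f v = \<zero>}"
    by (rule span_is_subset) (use A f in \<open>auto intro: kernel_submodule\<close>)
  then show ?thesis using f A by auto
qed

end

text \<open>A coordinate function with respect to a basis, rescaled.\<close>

lemma linear_functional_exists:
  fixes M :: "(complex, 'v, 'm) module_scheme" (structure)
  assumes vs: "vectorspace class_ring M" and fd: "vectorspace.fin_dim class_ring M"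
    and w: "w \<in> carrier M" "w \<noteq> \<zero>"
  shows "\<exists>g. (\<forall>v\<in>carrier M. \<forall>u\<in>carrier M. g (v \<oplus> u) = g v + g u) \<and>
             (\<forall>c. \<forall>v\<in>carrier M. g (c \<odot> v) = c * g v) \<and> g w = (1::complex)"
proof -
  interpret V: vectorspace "class_ring :: complex ring" M by (rule vs)
  obtain B where B: "finite B" "V.basis B" using V.finite_basis_exists[OF fd] by blast
  have BM: "B \<subseteq> carrier M" using B by (auto simp: V.basis_def)
  have ex1: "\<exists>!a. a \<in> B \<rightarrow>\<^sub>E UNIV \<and> V.lincomb a B = v" if "v \<in> carrier M" for v
    using V.basis_criterion[OF B(1) BM] B(2) that by simp
  define co where "co v = (THE a. a \<in> B \<rightarrow>\<^sub>E UNIV \<and> V.lincomb a B = v)" for v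
  have co: "co v \<in> B \<rightarrow>\<^sub>E UNIV" "V.lincomb (co v) B = v" if "v \<in> carrier M" for v
    using theI'[OF ex1[OF that]] by (auto simp: co_def)
  have lr: "V.lincomb (restrict a B) B = V.lincomb a B" for a
    unfolding V.lincomb_def by (rule V.finsum_cong') (use BM in auto)
  have co_eq: "co v b = a b" if "v \<in> carrier M" "V.lincomb a B = v" "b \<in> B" for v a b
  proof -
    have "restrict a B \<in> B \<rightarrow>\<^sub>E UNIV \<and> V.lincomb (restrict a B) B = v" using that lr by auto
    then have "co v = restrict a B" unfolding co_def using ex1[OF that(1)] by (intro the1_equality) auto
    then show ?thesis using that by simp
  qed
  have "\<exists>b\<in>B. co w b \<noteq> 0"
  proof (rule ccontr)
    assume "\<not> ?thesis"
    then have "V.lincomb (co w) B = (\<Oplus>b\<in>B. \<zero>)"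
      unfolding V.lincomb_def using BM V.lmult_0 by (intro V.finsum_cong') auto
    then show False using co(2)[OF w(1)] w(2) by simp
  qed
  then obtain b where b: "b \<in> B" "co w b \<noteq> 0" by blast
  define g where "g v = co v b / co w b" for v
  have "co (v \<oplus> u) b = co v b + co u b" if v: "v \<in> carrier M" "u \<in> carrier M" for v u
    by (rule co_eq[of _ "\<lambda>x. co v x + co u x"])
      (use V.lincomb_sum[OF B(1) BM, of "co v" "co u"] co v b in \<open>auto\<close>)
  moreover have "co (c \<odot> v) b = c * co v b" if v: "v \<in> carrier M" for c v
    by (rule co_eq[of _ "\<lambda>x. c * co v x"])
      (use V.lincomb_smult[OF BM, of "co v" c] co v b in \<open>auto\<close>)
  ultimately show ?thesis using b by (intro exI[of _ g]) (auto simp: g_def add_divide_distrib)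
qed

section \<open>Spherical vectors and the splitting\<close>

context root_params
begin

text \<open>The spectral projection at \<open>t\<^sup>-\<^sup>1\<^sup>/\<^sup>2\<close>. It also vanishes at \<open>\<plusminus>t\<^sup>1\<^sup>/\<^sup>2\<close>, which lie outside \<open>S\<close>: these are the inverses of the end points, so that \<open>proj(X\<inverse>)\<close> vanishes on \<open>S\<close> and \<open>proj\<close> commutes with \<open>T\<close>.\<close>

definition proj where "proj = delta (S \<union> {th, - th}) (inverse th)"

lemma th_notin_S: "th \<notin> S" "- th \<notin> S"
  using S_square_ne(2)[of th] S_square_ne(2)[of "- th"] by auto

lemma leval_proj:
  assumes "x \<in> S \<union> {th, - th}" shows "leval proj x = (if x = inverse th then 1 else 0)"
  unfolding proj_def using assms leval_delta[of "S \<union> {th, - th}" "inverse th" x] finite_S zero_S th_nz inv_th_in_S by auto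

lemma proj_reduce: "f * proj - cst (leval f (inverse th)) * proj \<in> Ideal"
  using S_nz by (auto simp: Ideal_def leval_hom leval_proj)

lemma leval_proj_inverse: assumes x: "x \<in> S" shows "leval proj (inverse x) = 0"
proof -
  have ne: "inverse x \<noteq> inverse th" using x th_notin_S by auto
  show ?thesis
  proof (cases "x\<^sup>2 = inverse t")
    case True
    then have "(x - inverse th) * (x + inverse th) = 0" by (simp add: algebra_simps power2_eq_square)
    then have "x = inverse th \<or> x = - inverse th" by (auto simp: eq_neg_iff_add_eq_0)
    then have "inverse x = th \<or> inverse x = - th" by auto
    then have "inverse x \<in> S \<union> {th, - th}" by auto
    then show ?thesis using ne by (simp add: leval_proj)
  next
    case False
    then show ?thesis using S_inv[OF x] ne by (simp add: leval_proj)
  qed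
qed

lemma subst_inv_proj: "subst_inv 1 proj \<in> Ideal"
  using S_nz leval_proj_inverse by (auto simp: Ideal_def leval_subst_inv divide_inverse)

text \<open>The constant \<open>t\<^sup>1\<^sup>/\<^sup>2\<close> is the value of \<open>- (t\<^sup>1\<^sup>/\<^sup>2 - t\<^sup>-\<^sup>1\<^sup>/\<^sup>2) / (x\<^sup>2 - 1)\<close> at \<open>x = t\<^sup>-\<^sup>1\<^sup>/\<^sup>2\<close>; it becomes the eigenvalue of \<open>T\<close>.\<close>

lemma divdiff_proj: "cst (th - inverse th) * divdiff proj - cst th * proj \<in> Ideal"
  unfolding Ideal_def
proof (intro CollectI ballI)
  fix x assume x: "x \<in> S"
  have x0: "x \<noteq> 0" "x\<^sup>2 - 1 \<noteq> 0" using S_nz S_square_ne x by auto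
  have e: "(x\<^sup>2 - 1) * leval (divdiff proj) x = - leval proj x"
    using leval_divdiff[OF x0(1), of proj] leval_proj_inverse[OF x] by simp
  show "leval (cst (th - inverse th) * divdiff proj - cst th * proj) x = 0"
  proof (cases "x = inverse th")
    case True
    have p: "leval proj x = 1" using x True by (simp add: leval_proj)
    have "(x\<^sup>2 - 1) * ((th - inverse th) * leval (divdiff proj) x - th) =
        (th - inverse th) * ((x\<^sup>2 - 1) * leval (divdiff proj) x) - (x\<^sup>2 - 1) * th"
      by (simp add: algebra_simps)
    also have "\<dots> = 0" unfolding e p using th_nz unfolding True by (simp add: algebra_simps power2_eq_square)
    finally show ?thesis using x0 p by (simp add: leval_hom)
  next
    case False
    have p: "leval proj x = 0" using x False by (simp add: leval_proj)
    then have "leval (divdiff proj) x = 0" using e x0 by simp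
    then show ?thesis using x0 p by (simp add: leval_hom)
  qed
qed

end

locale fd_triple = hecke_triple M X Xi T P h th + r: root_params h th n
  for M (structure) and X Xi T P h th n +
  assumes vs: "vectorspace (class_ring :: complex ring) M" and fd: "vectorspace.fin_dim (class_ring :: complex ring) M"
    and nontrivial: "carrier M \<noteq> {\<zero>}"
begin

lemma ann_eq: "ann = r.Ideal"
proof -
  interpret A: annihilator h th ann
    by (rule annihilator_ann) (use r.h_pow nontrivial common_annihilator[OF vs fd] in \<open>auto simp: ann_def\<close>)
  show ?thesis by (rule A.annihilator_eq[OF r.n_pos r.th2])
qed

lemma act_Ideal: "f \<in> r.Ideal \<Longrightarrow> v \<in> carrier M \<Longrightarrow> act f v = \<zero>"
  using ann_eq annD by blast

lemma act_cong_Ideal: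
  assumes "f - g \<in> r.Ideal" "v \<in> carrier M" shows "act f v = act g v"
proof -
  have "act f v = act (f - g) v \<oplus> act g v" using assms(2) by (simp flip: act_add)
  then show ?thesis using act_Ideal[OF assms] assms(2) by simp
qed

text \<open>The dual triple satisfies the same hypotheses, so every statement about \<open>X\<close> holds for \<open>Y\<inverse>\<close>.\<close>

lemma dual_fd: "fd_triple M Yi Y T (\<lambda>v. X (T v)) h th n"
  by (intro fd_triple.intro dual r.root_params_axioms fd_triple_axioms.intro vs fd nontrivial)

lemma proj_act: "v \<in> carrier M \<Longrightarrow> act f (act r.proj v) = leval f (inverse th) \<odot> act r.proj v"
  using act_cong_Ideal[OF r.proj_reduce[of f]] by (simp add: act_mult act_cst)

lemma act_proj: "v \<in> carrier M \<Longrightarrow> act r.proj (act f v) = leval f (inverse th) \<odot> act r.proj v"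
  using proj_act[of v f] by (simp flip: act_mult add: mult.commute)

lemma gam_divdiff_proj: "v \<in> carrier M \<Longrightarrow> gam \<odot> act (divdiff r.proj) v = th \<odot> act r.proj v"
  using act_cong_Ideal[OF r.divdiff_proj] by (simp add: act_mult act_cst)

lemma T_proj: "v \<in> carrier M \<Longrightarrow> T (act r.proj v) = th \<odot> act r.proj v"
  by (simp add: T_act act_Ideal[OF r.subst_inv_proj] gam_divdiff_proj lin)

lemma proj_T: "v \<in> carrier M \<Longrightarrow> act r.proj (T v) = th \<odot> act r.proj v"
  by (simp add: act_T act_Ideal[OF r.subst_inv_proj] gam_divdiff_proj lin)

lemma proj_nonzero: "\<exists>v\<in>carrier M. act r.proj v \<noteq> \<zero>"
proof (rule ccontr)
  assume "\<not> ?thesis"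
  then have "r.proj \<in> r.Ideal" unfolding ann_eq[symmetric] ann_def by auto
  then show False using r.inv_th_in_S(1) r.leval_proj[of "inverse th"] by (auto simp: r.Ideal_def)
qed

text \<open>Both the vector and the functional come from the spectral projection of \<open>Y\<inverse>\<close> at \<open>t\<^sup>-\<^sup>1\<^sup>/\<^sup>2\<close>. On its image \<open>T\<close> and \<open>Y\<close> both act by \<open>t\<^sup>1\<^sup>/\<^sup>2\<close>, hence \<open>P\<close> acts by \<open>1\<close>; and since it commutes with \<open>T\<close> and \<open>Y\<close>, composing it with any functional gives an invariant one.\<close>

lemma spherical_vector:
  "\<exists>w G. w \<in> carrier M \<and> T w = th \<odot> w \<and> P w = w \<and> invariant_functional G \<and> G w = 1"
proof -
  interpret D: fd_triple M Yi Y T "\<lambda>v. X (T v)" h th n by (rule dual_fd)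
  let ?p = "D.act r.proj"
  obtain v0 where v0: "v0 \<in> carrier M" "?p v0 \<noteq> \<zero>" using D.proj_nonzero by blast
  define w where "w = ?p v0"
  have w: "w \<in> carrier M" "w \<noteq> \<zero>" using v0 by (auto simp: w_def)
  have Tw: "T w = th \<odot> w" unfolding w_def by (rule D.T_proj[OF v0(1)])
  have Yw: "Y w = th \<odot> w"
    using D.proj_act[OF v0(1), of "lmonom 1 (- 1)"] w by (simp add: D.act_Xinv w_def power_int_minus)
  have "th \<odot> P w = th \<odot> w" using Yw w by (simp add: Y_def Tw linear_op_smult[OF P_lin])
  then have "inverse th \<odot> (th \<odot> P w) = inverse th \<odot> (th \<odot> w)" by simp
  then have Pw: "P w = w" using w th_nz by (simp add: sm_m lin)
  obtain g where g: "\<And>v u. v \<in> carrier M \<Longrightarrow> u \<in> carrier M \<Longrightarrow> g (v \<oplus> u) = g v + g u"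
    "\<And>c v. v \<in> carrier M \<Longrightarrow> g (c \<odot> v) = c * g v" "g w = (1::complex)"
    using linear_functional_exists[OF vs fd w] by blast
  define G where "G v = g (?p v)" for v
  have pY: "?p (Y v) = th \<odot> ?p v" if "v \<in> carrier M" for v
    using D.act_proj[OF that, of "lmonom 1 (- 1)"] that by (simp add: D.act_Xinv power_int_minus)
  \<comment> \<open>\<open>P = Y T\<inverse>\<close>, and \<open>t\<^sup>1\<^sup>/\<^sup>2 (t\<^sup>1\<^sup>/\<^sup>2 - gam) = 1\<close>\<close>
  have pP: "?p (P v) = ?p v" if v: "v \<in> carrier M" for v
  proof -
    have Tv: "T v \<in> carrier M" "P v \<in> carrier M" "Ti v \<in> carrier M" using v lin Ti_lin by auto
    have "?p (P v) = ?p (Y (Ti v))" using v by (simp add: Y_def T_Ti)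
    also have "\<dots> = th \<odot> ?p (Ti v)" using Tv by (simp add: pY)
    also have "?p (Ti v) = th \<odot> ?p v \<oplus> (- gam) \<odot> ?p v"
      unfolding Ti_def using v Tv by (simp add: linear_op_add[OF D.act_lin] linear_op_smult[OF D.act_lin] D.proj_T)
    also have "\<dots> = (th - gam) \<odot> ?p v" using v sm_l[of "?p v" th "- gam"] by simp
    finally show ?thesis using v th_nz by (simp add: sm_m)
  qed
  have "invariant_functional G" unfolding invariant_functional_def G_def
    by (auto simp: linear_op_add[OF D.act_lin] linear_op_smult[OF D.act_lin] g D.proj_T pP)
  moreover have "?p w = w"
    using D.proj_act[OF v0(1), of r.proj] v0(1) by (simp add: w_def r.leval_proj r.inv_th_in_S)
  then have "G w = 1" by (simp add: G_def g)
  ultimately show ?thesis using w(1) Tw Pw by blast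
qed

text \<open>This and \<open>cyclic_P\<close> say that \<open>f \<mapsto> f(X) w\<close> intertwines the polynomial representation with \<open>M\<close>.\<close>

lemma cyclic_T:
  assumes w: "w \<in> carrier M" "T w = th \<odot> w"
  shows "T (act f w) = act (opT_poly th f) w"
  using w by (simp add: T_act opT_poly_eq act_add act_cst_mult linear_op_smult[OF act_lin])

lemma cyclic_P: "w \<in> carrier M \<Longrightarrow> P w = w \<Longrightarrow> P (act f w) = act (subst_inv h f) w"
  by (simp add: P_act)

text \<open>The form \<open>(f, g) \<mapsto> G(f(X) g(X) w)\<close> on \<open>\<P>\<close> has a stable proper radical containing the ideal of \<open>S\<close>; by irreducibility it equals that ideal, so the delta functions form an orthogonal basis without isotropic vectors. The complement of the submodule generated by \<open>w\<close> is then the radical of \<open>G\<close>, and projection to it is given by orthogonal expansion.\<close>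

theorem cyclic_splitting:
  obtains w N where "w \<in> carrier M" "T w = th \<odot> w" "P w = w" "\<And>f. act f w = \<zero> \<longleftrightarrow> f \<in> r.Ideal"
    and "N \<subseteq> carrier M" "\<zero> \<in> N" "\<And>u v. u \<in> N \<Longrightarrow> v \<in> N \<Longrightarrow> u \<oplus> v \<in> N"
      "\<And>u f. u \<in> N \<Longrightarrow> act f u \<in> N" "\<And>u. u \<in> N \<Longrightarrow> T u \<in> N" "\<And>u. u \<in> N \<Longrightarrow> P u \<in> N"
    and "\<And>f. act f w \<in> N \<Longrightarrow> act f w = \<zero>"
    and "\<And>v. v \<in> carrier M \<Longrightarrow> \<exists>f. \<exists>u\<in>N. v = act f w \<oplus> u"
proof -
  obtain w G where w: "w \<in> carrier M" "T w = th \<odot> w" "P w = w" and G: "invariant_functional G" "G w = 1"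
    using spherical_vector by blast
  have Gadd: "G (v \<oplus> u) = G v + G u" if "v \<in> carrier M" "u \<in> carrier M" for v u
    using G that by (auto simp: invariant_functional_def)
  have Gsm: "G (c \<odot> v) = c * G v" if "v \<in> carrier M" for c v
    using G that by (auto simp: invariant_functional_def)
  have G0: "G \<zero> = 0" using Gsm[of \<zero> 0] by simp
  let ?N = "functional_radical G"
  have Nc: "?N \<subseteq> carrier M" by (auto simp: functional_radical_def)
  have Nadd: "u \<oplus> v \<in> ?N" if "u \<in> ?N" "v \<in> ?N" for u v
    using that by (auto simp: functional_radical_def linear_op_add[OF act_lin] Gadd)
  define R where "R = {f. act f w \<in> ?N}"
  have "R = r.Ideal \<or> R = UNIV"
  proof (rule r.poly_quotient_irreducible)
    show "f + g \<in> R" if "f \<in> R" "g \<in> R" for f g using that w Nadd by (auto simp: R_def act_add)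
    show "g * f \<in> R" if "f \<in> R" for f g
      using that w functional_radical_closed(1)[OF G(1)] by (auto simp: R_def act_mult)
    show "opT_poly th f \<in> R" if "f \<in> R" for f
      using that functional_radical_closed(2)[OF G(1)] unfolding R_def mem_Collect_eq cyclic_T[OF w(1,2), symmetric] by blast
    show "subst_inv h f \<in> R" if "f \<in> R" for f
      using that functional_radical_closed(3)[OF G(1)] unfolding R_def mem_Collect_eq cyclic_P[OF w(1,3), symmetric] by blast
    show "r.Ideal \<subseteq> R" using w by (auto simp: R_def functional_radical_def act_Ideal linear_op_zero[OF act_lin] G0)
  qed
  moreover have "1 \<notin> R"
  proof
    assume "1 \<in> R"
    then have "act 1 w \<in> ?N" by (simp only: R_def mem_Collect_eq)
    then have "G (act 1 (act 1 w)) = 0" unfolding functional_radical_def by blast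
    then show False using w G by simp
  qed
  ultimately have R: "R = r.Ideal" by auto
  have zero_N: "\<zero> \<in> ?N" by (auto simp: functional_radical_def linear_op_zero[OF act_lin] G0)
  have Gact: "G (act g v) = (\<Sum>x\<in>r.S. leval g x * G (act (delta r.S x) v))" if v: "v \<in> carrier M" for g v
  proof -
    have "G (act (\<Sum>x\<in>A. cst (leval g x) * delta r.S x) v) = (\<Sum>x\<in>A. leval g x * G (act (delta r.S x) v))" if "finite A" for A
      using that by (induction A rule: finite_induct) (simp_all add: G0 v act_add Gadd act_cst_mult Gsm)
    then show ?thesis using act_cong_Ideal[OF r.interpolate_reduce[of g] v] r.finite_S by simp
  qed
  have ld: "leval (delta r.S x) y = (if x = y then 1 else 0)" if "x \<in> r.S" "y \<in> r.S" for x y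
    using leval_delta[OF r.finite_S r.zero_S] that by auto
  have wx: "G (act (delta r.S x) w) \<noteq> 0" if x: "x \<in> r.S" for x
  proof
    assume z: "G (act (delta r.S x) w) = 0"
    have "G (act g (act (delta r.S x) w)) = 0" for g
    proof -
      have "G (act g (act (delta r.S x) w)) = G (act (g * delta r.S x) w)" using w by (simp add: act_mult)
      also have "act (g * delta r.S x) w = act (cst (leval g x) * delta r.S x) w"
        by (rule act_cong_Ideal[OF r.delta_reduce[OF x] w(1)])
      finally show ?thesis using w z by (simp add: act_cst_mult Gsm)
    qed
    then have "delta r.S x \<in> R" using w by (simp add: R_def functional_radical_def)
    then show False using R x ld[OF x x] by (auto simp: r.Ideal_def)
  qed
  have split: "\<exists>f. \<exists>u\<in>?N. v = act f w \<oplus> u" if v: "v \<in> carrier M" for v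
  proof -
    \<comment> \<open>the orthogonal expansion of \<open>v\<close> along the vectors \<open>\<delta>\<^sub>x(X) w\<close>\<close>
    define f where "f = (\<Sum>x\<in>r.S. cst (G (act (delta r.S x) v) / G (act (delta r.S x) w)) * delta r.S x)"
    have fx: "leval f x = G (act (delta r.S x) v) / G (act (delta r.S x) w)" if "x \<in> r.S" for x
      unfolding f_def using leval_interpolate[OF r.finite_S r.zero_S that] by simp
    let ?u = "v \<oplus> (- 1) \<odot> act f w"
    have "G (act g ?u) = 0" for g
    proof -
      have "G (act g ?u) = G (act g v) + (- 1) * G (act g (act f w))"
        using v w by (simp add: linear_op_add[OF act_lin] linear_op_smult[OF act_lin] Gadd Gsm)
      also have "act g (act f w) = act (g * f) w" using w by (simp add: act_mult)
      also have "G (act (g * f) w) = (\<Sum>x\<in>r.S. leval g x * G (act (delta r.S x) v))"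
        unfolding Gact[OF w(1), of "g * f"] by (rule sum.cong) (use fx wx r.S_nz in \<open>auto simp: leval_mult\<close>)
      also have "\<dots> = G (act g v)" by (rule Gact[OF v, symmetric])
      finally show ?thesis by simp
    qed
    then have "?u \<in> ?N" using v w by (simp add: functional_radical_def)
    moreover have "v = act f w \<oplus> ?u"
    proof -
      have "act f w \<oplus> ?u = v \<oplus> (act f w \<oplus> (- 1) \<odot> act f w)" using v w by (simp add: a_ac)
      also have "act f w \<oplus> (- 1) \<odot> act f w = (1 + (- 1)) \<odot> act f w" using w by (simp only: sm_l sm_1 act_closed)
      finally show ?thesis using v w by simp
    qed
    ultimately show ?thesis by blast
  qed
  have RN: "f \<in> r.Ideal" if "act f w \<in> ?N" for f using that unfolding R[symmetric] R_def by simp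
  show thesis
  proof (rule that[of w ?N])
    show "act f w = \<zero> \<longleftrightarrow> f \<in> r.Ideal" for f
      using RN[of f] zero_N act_Ideal[OF _ w(1), of f] by auto
    show "act f w = \<zero>" if "act f w \<in> ?N" for f by (rule act_Ideal[OF RN[OF that] w(1)])
  qed (fact w Nc zero_N Nadd split | rule functional_radical_closed[OF G(1)], assumption)+
qed

end

section \<open>Representations and triples\<close>

context cmodule
begin

lemma move_term:
  assumes "a \<in> carrier M" "b \<in> carrier M" "u \<in> carrier M" "a \<oplus> c \<odot> u = b" shows "a = b \<oplus> (- c) \<odot> u"
proof -
  have "b \<oplus> (- c) \<odot> u = a \<oplus> (c \<odot> u \<oplus> (- c) \<odot> u)" using assms(1-3) unfolding assms(4)[symmetric] by (simp add: a_assoc)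
  also have "c \<odot> u \<oplus> (- c) \<odot> u = (c + (- c)) \<odot> u" using assms by (simp only: sm_l)
  finally show ?thesis using assms by simp
qed

lemma minus_zero_iff: assumes c: "a \<in> carrier M" "b \<in> carrier M" shows "a \<ominus> b = \<zero> \<longleftrightarrow> a = b"
proof -
  have e: "a \<ominus> b = a \<oplus> (- 1) \<odot> b" using c by (simp add: a_minus_def sm_neg)
  have "(1 + (- 1)) \<odot> b = b \<oplus> (- 1) \<odot> b" using c by (simp only: sm_l sm_1)
  then show ?thesis unfolding e using move_term[of a \<zero> b "- 1"] c by auto
qed

lemma linear_op_scale: assumes F: "linear_op M F" shows "linear_op M (\<lambda>v. c \<odot> F v)"
proof (rule linear_opI)
  fix v w assume v: "v \<in> carrier M" "w \<in> carrier M"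
  then have c: "F v \<in> carrier M" "F w \<in> carrier M" using F by auto
  show "c \<odot> F (v \<oplus> w) = c \<odot> F v \<oplus> c \<odot> F w" using c by (simp add: linear_op_add[OF F v] sm_r)
next
  fix v assume v: "v \<in> carrier M"
  then show "c \<odot> F v \<in> carrier M" using F by simp
  show "c \<odot> F (d \<odot> v) = d \<odot> (c \<odot> F v)" for d
    using v F by (simp add: linear_op_smult[OF F v] sm_m mult.commute)
qed

lemma linear_op_inv_into:
  assumes F: "linear_op M F" and b: "bij_betw F (carrier M) (carrier M)"
  shows "linear_op M (inv_into (carrier M) F)"
proof -
  let ?G = "inv_into (carrier M) F"
  have G: "?G v \<in> carrier M" "F (?G v) = v" if "v \<in> carrier M" for v
    using that bij_betw_imp_surj_on[OF b] by (simp_all add: inv_into_into f_inv_into_f)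
  have eq: "?G v = u" if "u \<in> carrier M" "F u = v" for u v
    using that bij_betw_imp_inj_on[OF b] by auto
  show ?thesis
  proof (rule linear_opI)
    fix v w assume v: "v \<in> carrier M" "w \<in> carrier M"
    then have c: "?G v \<in> carrier M" "?G w \<in> carrier M" using G by auto
    show "?G (v \<oplus> w) = ?G v \<oplus> ?G w" by (rule eq) (use v c in \<open>simp_all add: G linear_op_add[OF F c]\<close>)
  next
    fix v assume v: "v \<in> carrier M"
    then have c: "?G v \<in> carrier M" using G by auto
    show "?G v \<in> carrier M" by fact
    show "?G (d \<odot> v) = d \<odot> ?G v" for d by (rule eq) (use v c in \<open>simp_all add: G linear_op_smult[OF F c]\<close>)
  qed
qed

end

text \<open>The operator \<open>Y T\<inverse>\<close>, with \<open>T\<inverse>\<close> eliminated by the quadratic relation.\<close>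

definition rep_P :: "complex \<Rightarrow> 'v hh_module \<Rightarrow> 'v \<Rightarrow> 'v" where
  "rep_P th M v = opY M (opT M v \<oplus>\<^bsub>M\<^esub> (- (th - inverse th)) \<odot>\<^bsub>M\<^esub> v)"

text \<open>That \<open>P\<close> is an involution is \<open>T Y\<inverse> T = Y\<close>, since then \<open>Y T\<inverse> = T Y\<inverse>\<close>. The relation between \<open>P\<close> and \<open>X\<close> is the remaining one, rewritten as \<open>X Y = q\<^sup>1\<^sup>/\<^sup>2 Y X T\<^sup>2\<close>.\<close>

lemma hh_rep_triple:
  fixes M :: "'v hh_module" (structure)
  assumes rep: "hh_rep h th M" and h: "h \<noteq> 0" and th: "th \<noteq> 0"
  shows "hecke_triple M (opX M) (opXinv M) (opT M) (rep_P th M) h th"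
    and "v \<in> carrier M \<Longrightarrow> rep_P th M (opT M v) = opY M v"
    and "v \<in> carrier M \<Longrightarrow> opYinv M v = opT M (rep_P th M v) \<oplus> (- (th - inverse th)) \<odot> rep_P th M v"
proof -
  have vs: "vectorspace (class_ring :: complex ring) M" using rep by (simp add: hh_rep_def)
  interpret cmodule M using vs by (intro cmodule.intro) (simp add: vectorspace_def)
  interpret R: hh_rep h th M by (rule rep)
  let ?g = "th - inverse th"
  define Ti where "Ti v = opT M v \<oplus> (- ?g) \<odot> v" for v
  have P_def: "rep_P th M v = opY M (Ti v)" for v by (simp add: rep_P_def Ti_def)
  have X: "linear_op M (opX M)" and Y: "linear_op M (opY M)" and T: "linear_op M (opT M)"
    using R.opX_hom R.opY_hom R.opT_hom by (simp_all add: linear_op_def)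
  have Xi: "linear_op M (opXinv M)" unfolding opXinv_def by (rule linear_op_inv_into[OF X R.opX_bij])
  have Yi: "linear_op M (opYinv M)" unfolding opYinv_def by (rule linear_op_inv_into[OF Y R.opY_bij])
  have XXi: "opX M (opXinv M v) = v" "opXinv M (opX M v) = v" if "v \<in> carrier M" for v
    using that R.opX_bij unfolding opXinv_def by (simp_all add: bij_betw_inv_into_left bij_betw_inv_into_right)
  have YYi: "opY M (opYinv M v) = v" "opYinv M (opY M v) = v" if "v \<in> carrier M" for v
    using that R.opY_bij unfolding opYinv_def by (simp_all add: bij_betw_inv_into_left bij_betw_inv_into_right)
  have TT: "opT M (opT M v) = ?g \<odot> opT M v \<oplus> v" if v: "v \<in> carrier M" for v
  proof -
    let ?w = "opT M v \<oplus> inverse th \<odot> v"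
    have c: "opT M v \<in> carrier M" "opT M (opT M v) \<in> carrier M" using v T by auto
    have "opT M ?w \<ominus> th \<odot> ?w = \<zero>" using R.T_quadratic[OF v] by (simp add: Let_def)
    then have "opT M ?w = th \<odot> ?w" using v c T by (subst (asm) minus_zero_iff) auto
    then have "opT M (opT M v) \<oplus> inverse th \<odot> opT M v = th \<odot> opT M v \<oplus> v"
      using v c th by (simp add: linear_op_add[OF T] linear_op_smult[OF T] sm_r sm_m)
    then have "opT M (opT M v) = (th \<odot> opT M v \<oplus> v) \<oplus> (- inverse th) \<odot> opT M v"
      using v c by (intro move_term) auto
    also have "\<dots> = (th \<odot> opT M v \<oplus> (- inverse th) \<odot> opT M v) \<oplus> v" using v c by (simp add: a_ac)
    also have "\<dots> = ?g \<odot> opT M v \<oplus> v" using c sm_l[of "opT M v" th "- inverse th"] by simp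
    finally show ?thesis .
  qed
  have Tic: "Ti v \<in> carrier M" if "v \<in> carrier M" for v using that T by (simp add: Ti_def)
  have TiT: "Ti (opT M v) = v" if v: "v \<in> carrier M" for v
  proof -
    have "v = opT M (opT M v) \<oplus> (- ?g) \<odot> opT M v"
      by (rule move_term) (use v T TT in \<open>auto simp: a_comm\<close>)
    then show ?thesis by (simp add: Ti_def)
  qed
  have Ti_lin: "linear_op M Ti"
  proof (rule linear_opI)
    fix v w assume v: "v \<in> carrier M" "w \<in> carrier M"
    then have c: "opT M v \<in> carrier M" "opT M w \<in> carrier M" using T by auto
    show "Ti (v \<oplus> w) = Ti v \<oplus> Ti w"
      unfolding Ti_def linear_op_add[OF T v] sm_r[OF v] using v c by (simp add: a_ac)
  next
    fix v assume v: "v \<in> carrier M"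
    then have c: "opT M v \<in> carrier M" using T by auto
    then show "Ti v \<in> carrier M" using v by (simp add: Ti_def)
    show "Ti (c \<odot> v) = c \<odot> Ti v" for c
      unfolding Ti_def using v c by (simp add: linear_op_smult[OF T v] sm_r sm_m mult.commute)
  qed
  have TTi: "opT M (Ti v) = v" if v: "v \<in> carrier M" for v
  proof -
    have "opT M (Ti v) = Ti (opT M v)"
      using v T by (simp add: Ti_def linear_op_add[OF T] linear_op_smult[OF T])
    then show ?thesis using v by (simp add: TiT)
  qed
  have P_lin: "linear_op M (rep_P th M)"
    by (rule linear_opI) (auto simp: P_def Y Ti_lin linear_op_add[OF Ti_lin] linear_op_smult[OF Ti_lin]
        linear_op_add[OF Y] linear_op_smult[OF Y])
  have TYi: "opT M (opYinv M v) = rep_P th M v" if v: "v \<in> carrier M" for v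
    using R.TYT[OF Tic[OF v]] v by (simp add: P_def TTi)
  have PP: "rep_P th M (rep_P th M v) = v" if v: "v \<in> carrier M" for v
    unfolding TYi[OF v, symmetric] using v Yi by (simp add: P_def TiT YYi)
  have XY: "opX M (opY M u) = h \<odot> opY M (opX M (opT M (opT M u)))" if u: "u \<in> carrier M" for u
  proof -
    let ?z = "opY M (opX M (opT M (opT M (h \<odot> u))))"
    have z: "?z \<in> carrier M" using u X Y T by simp
    have "opX M (opY M u) = opX M (opY M (opYinv M (opXinv M ?z)))" using R.YXYX[OF u] by simp
    also have "\<dots> = ?z" using z Xi by (simp add: YYi XXi)
    also have "\<dots> = h \<odot> opY M (opX M (opT M (opT M u)))"
      using u X Y T by (simp add: linear_op_smult[OF T] linear_op_smult[OF X] linear_op_smult[OF Y])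
    finally show ?thesis .
  qed
  show "hecke_triple M (opX M) (opXinv M) (opT M) (rep_P th M) h th"
  proof
    fix v assume v: "v \<in> carrier M"
    show "opT M (opX M (opT M v)) = opXinv M v" by (rule R.TXT[OF v])
    have "opX M (rep_P th M v) = h \<odot> opY M (opX M (opT M v))"
      unfolding P_def using XY[OF Tic[OF v]] v by (simp add: TTi)
    also have "opX M (opT M v) = Ti (opXinv M v)"
      using R.TXT[OF v] TiT[of "opX M (opT M v)"] v X T by simp
    finally have "opX M (rep_P th M v) = h \<odot> rep_P th M (opXinv M v)" by (simp add: P_def)
    then show "rep_P th M (opX M (rep_P th M v)) = h \<odot> opXinv M v"
      using v Xi P_lin by (simp add: linear_op_smult[OF P_lin] PP)
  qed (use h th X Xi T P_lin XXi TT PP in auto)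
  show "rep_P th M (opT M v) = opY M v" if "v \<in> carrier M" using that by (simp add: P_def TiT)
  show "opYinv M v = opT M (rep_P th M v) \<oplus> (- ?g) \<odot> rep_P th M v" if v: "v \<in> carrier M"
    unfolding Ti_def[symmetric] TYi[OF v, symmetric] using v Yi by (simp add: TiT)
qed

lemma triple_hh_rep:
  fixes M :: "'v hh_module" (structure)
  assumes vs: "vectorspace (class_ring :: complex ring) M" and tr: "hecke_triple M (opX M) Xi (opT M) P h th"
    and Y: "\<And>v. v \<in> carrier M \<Longrightarrow> opY M v = P (opT M v)"
  shows "hh_rep h th M" and "v \<in> carrier M \<Longrightarrow> opXinv M v = Xi v"
    and "v \<in> carrier M \<Longrightarrow> opYinv M v = hecke_triple.Yi M (opT M) P th v"
proof -
  interpret H: hecke_triple M "opX M" Xi "opT M" P h th by (rule tr)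
  interpret D: hecke_triple M H.Yi H.Y "opT M" "\<lambda>v. opX M (opT M v)" h th by (rule H.dual)
  have Y': "opY M v = H.Y v" if "v \<in> carrier M" for v using Y[OF that] by (simp add: H.Y_def)
  have Ylin: "linear_op M (opY M)"
    by (rule linear_opI) (auto simp: Y' D.lin linear_op_add[OF D.Xi_lin] linear_op_smult[OF D.Xi_lin])
  have Xb: "bij_betw (opX M) (carrier M) (carrier M)"
    by (rule bij_betw_byWitness[where f' = Xi]) (auto simp: H.X_Xi H.Xi_X H.lin)
  have Yb: "bij_betw (opY M) (carrier M) (carrier M)"
    by (rule bij_betw_byWitness[where f' = H.Yi]) (auto simp: Y' D.X_Xi D.Xi_X D.lin)
  have Xinv: "opXinv M v = Xi v" if v: "v \<in> carrier M" for v
    unfolding opXinv_def by (rule inv_into_f_eq[OF bij_betw_imp_inj_on[OF Xb]]) (use v in \<open>auto simp: H.lin H.X_Xi\<close>)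
  have Yinv: "opYinv M v = H.Yi v" if v: "v \<in> carrier M" for v
    unfolding opYinv_def by (rule inv_into_f_eq[OF bij_betw_imp_inj_on[OF Yb]]) (use v in \<open>auto simp: D.lin D.X_Xi D.Xi_X Y'\<close>)
  have PXi: "P (Xi v) = inverse h \<odot> opX M (P v)" if v: "v \<in> carrier M" for v
    using H.P_act[OF v, of "lmonom 1 (- 1)"] v by (simp add: H.act_Xinv H.act_single H.Xpow_1 H.lin power_int_minus)
  show "hh_rep h th M"
  proof (intro hh_rep.intro hh_rep_axioms.intro vs Xb Yb)
    show "opX M \<in> module_hom class_ring M M" "opY M \<in> module_hom class_ring M M" "opT M \<in> module_hom class_ring M M"
      using H.X_lin Ylin H.T_lin by (simp_all add: linear_op_def)
    fix v assume v: "v \<in> carrier M"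
    note c = H.lin Ylin D.lin
    show "opT M (opX M (opT M v)) = opXinv M v" using v by (simp add: H.TXT Xinv)
    show "opT M (opYinv M (opT M v)) = opY M v" using v by (simp add: D.TXT Yinv Y' c)
    show "opYinv M (opXinv M (opY M (opX M (opT M (opT M (h \<odot> v)))))) = v"
    proof -
      let ?T = "opT M v"
      have "opY M (opX M (opT M ?T)) = P (Xi ?T)" using v by (simp add: Y c H.TXT)
      then have "opXinv M (opY M (opX M (opT M ?T))) = Xi (inverse h \<odot> opX M (P ?T))" using v by (simp add: Xinv PXi c)
      also have "\<dots> = inverse h \<odot> P ?T" using v by (simp add: linear_op_smult[OF H.Xi_lin] H.Xi_X c)
      also have "P ?T = opY M v" using v by (simp add: Y)
      finally have e: "opXinv M (opY M (opX M (opT M ?T))) = inverse h \<odot> opY M v" .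
      have "opXinv M (opY M (opX M (opT M (opT M (h \<odot> v))))) = h \<odot> opXinv M (opY M (opX M (opT M ?T)))"
        using v by (simp add: linear_op_smult[OF H.T_lin] linear_op_smult[OF H.X_lin] linear_op_smult[OF Ylin] 
            linear_op_smult[OF H.Xi_lin] Xinv c)
      also have "\<dots> = opY M v" unfolding e using v H.h_nz by (simp add: H.sm_m c)
      finally show ?thesis using v by (simp add: Yinv Y' c D.X_Xi D.Xi_X)
    qed
    show "(let w = opT M v \<oplus> inverse th \<odot> v in opT M w \<ominus> th \<odot> w) = \<zero>"
    proof -
      have Tc: "opT M v \<in> carrier M" using v c by simp
      have "opT M (opT M v \<oplus> inverse th \<odot> v) = (H.gam \<odot> opT M v \<oplus> v) \<oplus> inverse th \<odot> opT M v"
        using v Tc by (simp add: linear_op_add[OF H.T_lin] linear_op_smult[OF H.T_lin] H.TT)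
      also have "\<dots> = (H.gam \<odot> opT M v \<oplus> inverse th \<odot> opT M v) \<oplus> v" using v Tc by (simp add: H.a_ac)
      also have "H.gam \<odot> opT M v \<oplus> inverse th \<odot> opT M v = th \<odot> opT M v"
        using Tc by (simp flip: H.sm_l)
      also have "th \<odot> opT M v \<oplus> v = th \<odot> (opT M v \<oplus> inverse th \<odot> v)"
        using v Tc H.th_nz by (simp add: H.sm_r H.sm_m)
      finally show ?thesis using v Tc by (simp add: Let_def H.minus_zero_iff)
    qed
  qed
  show "opXinv M v = Xi v" if "v \<in> carrier M" using that by (rule Xinv)
  show "opYinv M v = H.Yi v" if "v \<in> carrier M" using that by (rule Yinv)
qed

text \<open>All sign automorphisms at once: \<open>X \<mapsto> a X\<close>, \<open>T \<mapsto> c T\<close>, \<open>P \<mapsto> b P\<close>. The condition on \<open>th'\<close> keeps the quadratic relation; besides \<open>\<iota>\<close> it allows \<open>a = b = c = 1\<close> with \<open>th' = - inverse th\<close>, a change of parameter that leaves the representation alone.\<close>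

lemma (in hecke_triple) sign_twist:
  assumes a: "a * a = 1" and b: "b * b = 1" and c: "c * c = 1"
    and th': "th' \<noteq> 0" "th' - inverse th' = c * (th - inverse th)"
  shows "hecke_triple M (\<lambda>v. a \<odot> X v) (\<lambda>v. a \<odot> Xi v) (\<lambda>v. c \<odot> T v) (\<lambda>v. b \<odot> P v) h th'"
proof
  fix v assume v: "v \<in> carrier M"
  have cl: "X v \<in> carrier M" "Xi v \<in> carrier M" "T v \<in> carrier M" "P v \<in> carrier M" "T (T v) \<in> carrier M" "X (T v) \<in> carrier M"
     "T (X (T v)) \<in> carrier M" "X (P v) \<in> carrier M" "P (X (P v)) \<in> carrier M"
    using v lin by auto
  note sm = linear_op_smult[OF X_lin] linear_op_smult[OF Xi_lin] linear_op_smult[OF T_lin] linear_op_smult[OF P_lin]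
  have bb: "b * (b * x) = x" and cc: "c * (c * x) = x" for x
    using b c by (simp_all flip: mult.assoc)
  show "a \<odot> X (a \<odot> Xi v) = v" "a \<odot> Xi (a \<odot> X v) = v" using v cl a by (simp_all add: sm sm_m X_Xi Xi_X)
  show "c \<odot> T (c \<odot> T v) = (th' - inverse th') \<odot> (c \<odot> T v) \<oplus> v"
    using v cl c unfolding th' by (simp add: sm sm_m TT sm_r mult_ac cc)
  show "c \<odot> T (a \<odot> X (c \<odot> T v)) = a \<odot> Xi v"
    using v cl c by (simp add: sm sm_m TXT mult_ac cc)
  show "b \<odot> P (b \<odot> P v) = v" using v cl b by (simp add: sm sm_m PP)
  show "b \<odot> P (a \<odot> X (b \<odot> P v)) = h \<odot> (a \<odot> Xi v)"
    using v cl b by (simp add: sm sm_m PXP mult_ac bb)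
qed (auto simp: h_nz th'(1) intro: linear_op_scale lin)

lemma vectorspace_image:
  fixes M :: "(complex, 'v, 'm) module_scheme" and N :: "(complex, 'w, 'l) module_scheme"
  assumes vs: "vectorspace class_ring M" and surj: "\<phi> ` carrier M = carrier N"
    and add: "\<And>v w. v \<in> carrier M \<Longrightarrow> w \<in> carrier M \<Longrightarrow> \<phi> (v \<oplus>\<^bsub>M\<^esub> w) = \<phi> v \<oplus>\<^bsub>N\<^esub> \<phi> w"
    and sm: "\<And>c v. v \<in> carrier M \<Longrightarrow> \<phi> (c \<odot>\<^bsub>M\<^esub> v) = c \<odot>\<^bsub>N\<^esub> \<phi> v"
    and zero: "\<phi> \<zero>\<^bsub>M\<^esub> = \<zero>\<^bsub>N\<^esub>"
  shows "vectorspace class_ring N"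
proof -
  interpret V: cmodule M using vs by (intro cmodule.intro) (simp add: vectorspace_def)
  have cl: "\<phi> v \<in> carrier N" if "v \<in> carrier M" for v using surj that by auto
  have N: "\<exists>v\<in>carrier M. u = \<phi> v" if "u \<in> carrier N" for u using surj that by auto
  show ?thesis
  proof (rule vs_criteria)
    show "field (class_ring :: complex ring)" by (rule class_field)
    show "\<zero>\<^bsub>N\<^esub> \<in> carrier N" using cl[of "\<zero>\<^bsub>M\<^esub>"] zero by simp
    show "\<forall>v\<in>carrier N. \<exists>neg_v\<in>carrier N. v \<oplus>\<^bsub>N\<^esub> neg_v = \<zero>\<^bsub>N\<^esub>"
    proof
      fix u assume "u \<in> carrier N"
      then obtain v where v: "v \<in> carrier M" "u = \<phi> v" using N by blast
      then have "u \<oplus>\<^bsub>N\<^esub> \<phi> (\<ominus>\<^bsub>M\<^esub> v) = \<zero>\<^bsub>N\<^esub>" using add[of v "\<ominus>\<^bsub>M\<^esub> v"] zero by (simp add: V.r_neg)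
      then show "\<exists>neg_v\<in>carrier N. u \<oplus>\<^bsub>N\<^esub> neg_v = \<zero>\<^bsub>N\<^esub>" using v cl by blast
    qed
  qed (auto dest!: N simp: cl V.sm_l V.sm_r V.sm_m V.a_ac zero[symmetric] simp flip: add sm)
qed

text \<open>The transport of structure along a surjection, for quotients as well as for modules that share a carrier.\<close>

lemma hecke_triple_image:
  fixes M :: "(complex, 'v, 'm) module_scheme" and N :: "(complex, 'w, 'l) module_scheme"
  assumes tr: "hecke_triple M X Xi T P h th" and mN: "module (class_ring :: complex ring) N"
    and surj: "\<phi> ` carrier M = carrier N"
    and add: "\<And>v w. v \<in> carrier M \<Longrightarrow> w \<in> carrier M \<Longrightarrow> \<phi> (v \<oplus>\<^bsub>M\<^esub> w) = \<phi> v \<oplus>\<^bsub>N\<^esub> \<phi> w"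
    and sm: "\<And>c v. v \<in> carrier M \<Longrightarrow> \<phi> (c \<odot>\<^bsub>M\<^esub> v) = c \<odot>\<^bsub>N\<^esub> \<phi> v"
    and ops: "\<And>v. v \<in> carrier M \<Longrightarrow> X' (\<phi> v) = \<phi> (X v)" "\<And>v. v \<in> carrier M \<Longrightarrow> Xi' (\<phi> v) = \<phi> (Xi v)"
      "\<And>v. v \<in> carrier M \<Longrightarrow> T' (\<phi> v) = \<phi> (T v)" "\<And>v. v \<in> carrier M \<Longrightarrow> P' (\<phi> v) = \<phi> (P v)"
  shows "hecke_triple N X' Xi' T' P' h th"
    and "v \<in> carrier M \<Longrightarrow> laurent_action.act N X' Xi' f (\<phi> v) = \<phi> (laurent_action.act M X Xi f v)"
proof -
  interpret H: hecke_triple M X Xi T P h th by (rule tr)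
  have N: "\<exists>v\<in>carrier M. u = \<phi> v" if "u \<in> carrier N" for u using surj that by auto
  have cl: "\<phi> v \<in> carrier N" if "v \<in> carrier M" for v using surj that by auto
  have lin: "linear_op N F'" if F: "linear_op M F" and e: "\<And>v. v \<in> carrier M \<Longrightarrow> F' (\<phi> v) = \<phi> (F v)" for F F'
  proof (rule linear_opI)
    fix u assume "u \<in> carrier N"
    then obtain v where v: "v \<in> carrier M" "u = \<phi> v" using N by blast
    show "F' u \<in> carrier N" using v F e cl by simp
    show "F' (c \<odot>\<^bsub>N\<^esub> u) = c \<odot>\<^bsub>N\<^esub> F' u" for c
      using v F by (simp add: e sm[symmetric] linear_op_smult[OF F])
    fix u' assume "u' \<in> carrier N"
    then obtain v' where v': "v' \<in> carrier M" "u' = \<phi> v'" using N by blast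
    show "F' (u \<oplus>\<^bsub>N\<^esub> u') = F' u \<oplus>\<^bsub>N\<^esub> F' u'"
      using v v' F by (simp add: e add[symmetric] linear_op_add[OF F])
  qed
  show 1: "hecke_triple N X' Xi' T' P' h th"
  proof (intro hecke_triple.intro laurent_action.intro laurent_action_axioms.intro hecke_triple_axioms.intro cmodule.intro mN)
    show "linear_op N X'" "linear_op N Xi'" "linear_op N T'" "linear_op N P'"
      using lin[OF H.X_lin] lin[OF H.Xi_lin] lin[OF H.T_lin] lin[OF H.P_lin] ops by blast+
    fix u assume "u \<in> carrier N"
    then obtain v where v: "v \<in> carrier M" and u: "u = \<phi> v" using N by blast
    show "X' (Xi' u) = u" "Xi' (X' u) = u" "T' (X' (T' u)) = Xi' u" "P' (P' u) = u" 
      "T' (T' u) = (th - inverse th) \<odot>\<^bsub>N\<^esub> T' u \<oplus>\<^bsub>N\<^esub> u" "P' (X' (P' u)) = h \<odot>\<^bsub>N\<^esub> Xi' u"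
      unfolding u using v
      by (simp_all add: ops H.lin H.X_Xi H.Xi_X H.TXT H.PP H.TT H.PXP add sm)
  qed (rule H.h_nz H.th_nz)+
  interpret H': hecke_triple N X' Xi' T' P' h th by (rule 1)
  show "H'.act f (\<phi> v) = \<phi> (H.act f v)" if v: "v \<in> carrier M"
  proof -
    have "\<forall>v\<in>carrier M. H'.act f (\<phi> v) = \<phi> (H.act f v)"
    proof (induction f rule: laurent_mult_induct)
      case (cst c)
      then show ?case by (simp add: H.act_cst H'.act_cst cl sm)
    next
      case X
      then show ?case by (simp add: H.act_XX H'.act_XX cl ops)
    next
      case Xinv
      then show ?case by (simp add: H.act_Xinv H'.act_Xinv cl ops)
    next
      case (add f g)
      then show ?case by (simp add: H.act_add H'.act_add cl assms(4))
    next
      case (mult f g)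
      then show ?case by (simp add: H.act_mult H'.act_mult cl)
    qed
    then show ?thesis using v by blast
  qed
qed

section \<open>Spherical representations\<close>

lemma fin_dim_image:
  fixes M :: "(complex, 'v, 'm) module_scheme" and N :: "(complex, 'w, 'l) module_scheme"
  assumes vsM: "vectorspace class_ring M" and vsN: "vectorspace class_ring N" and surj: "\<phi> ` carrier M = carrier N"
    and add: "\<And>v w. v \<in> carrier M \<Longrightarrow> w \<in> carrier M \<Longrightarrow> \<phi> (v \<oplus>\<^bsub>M\<^esub> w) = \<phi> v \<oplus>\<^bsub>N\<^esub> \<phi> w"
    and sm: "\<And>c v. v \<in> carrier M \<Longrightarrow> \<phi> (c \<odot>\<^bsub>M\<^esub> v) = c \<odot>\<^bsub>N\<^esub> \<phi> v"
    and zero: "\<phi> \<zero>\<^bsub>M\<^esub> = \<zero>\<^bsub>N\<^esub>"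
    and fd: "vectorspace.fin_dim class_ring M"
  shows "vectorspace.fin_dim class_ring N"
proof -
  interpret M: vectorspace "class_ring :: complex ring" M by (rule vsM)
  interpret N: vectorspace "class_ring :: complex ring" N by (rule vsN)
  obtain A where A: "finite A" "A \<subseteq> carrier M" "M.span A = carrier M" using fd by (auto simp: M.fin_dim_def)
  have B: "\<phi> ` A \<subseteq> carrier N" using A surj by auto
  have sub: "submodule class_ring (N.span (\<phi> ` A)) N" by (rule N.span_is_submodule[OF B])
  interpret S: submodule "class_ring :: complex ring" "N.span (\<phi> ` A)" N by (rule sub)
  have "submodule class_ring {v \<in> carrier M. \<phi> v \<in> N.span (\<phi> ` A)} M"
    by (rule submodule.intro) (use S.m_closed S.zero_closed S.smult_closed zero in \<open>auto simp: add sm M.module_axioms\<close>)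
  moreover have "A \<subseteq> {v \<in> carrier M. \<phi> v \<in> N.span (\<phi> ` A)}" using A(2) N.in_own_span[OF B] by auto
  ultimately have "M.span A \<subseteq> {v \<in> carrier M. \<phi> v \<in> N.span (\<phi> ` A)}" by (intro M.span_is_subset)
  then have "\<phi> v \<in> N.span (\<phi> ` A)" if "v \<in> carrier M" for v using A(3) that by blast
  then have "carrier N \<subseteq> N.span (\<phi> ` A)" unfolding surj[symmetric] by blast
  then have "N.span (\<phi> ` A) = carrier N" using S.subset by auto
  then show ?thesis unfolding N.fin_dim_def using A(1) B by blast
qed

text \<open>Representations generated by a vector \<open>w\<close> as in \<open>cyclic_splitting\<close>. They are all isomorphic, since \<open>f(X) w\<close> determines \<open>f\<close> modulo the ideal of \<open>S\<close>.\<close>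

locale spherical_rep = hecke_triple M X Xi T P h th + r: root_params h th n
  for M (structure) and X Xi T P h th n +
  fixes w
  assumes vs: "vectorspace (class_ring :: complex ring) M"
    and w [simp]: "w \<in> carrier M" and Tw: "T w = th \<odot> w" and Pw: "P w = w"
    and act_w_0: "\<And>f. act f w = \<zero> \<longleftrightarrow> f \<in> r.Ideal"
    and generated: "\<And>v. v \<in> carrier M \<Longrightarrow> \<exists>f. v = act f w"
begin

lemma act_w_eq: "act f w = act g w \<longleftrightarrow> f - g \<in> r.Ideal"
  unfolding act_w_0[symmetric] act_diff[OF w] using minus_zero_iff[of "act f w" "act g w"]
  by (simp add: a_minus_def sm_neg)

lemma T_act_w: "T (act f w) = act (opT_poly th f) w"
  by (simp add: T_act Tw opT_poly_eq act_add act_cst_mult linear_op_smult[OF act_lin])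

lemma P_act_w: "P (act f w) = act (subst_inv h f) w"
  by (simp add: P_act Pw)

lemma w_nonzero: "w \<noteq> \<zero>"
  using act_w_0[of 1] r.inv_th_in_S(1) by (auto simp: r.Ideal_def)

lemma nontrivial: "carrier M \<noteq> {\<zero>}"
  using w w_nonzero by (metis singletonD)

text \<open>Pull a subrepresentation back along \<open>f \<mapsto> f(X) w\<close>.\<close>

lemma irreducible:
  assumes N: "N \<subseteq> carrier M" "\<zero> \<in> N" and add: "\<And>u v. u \<in> N \<Longrightarrow> v \<in> N \<Longrightarrow> u \<oplus> v \<in> N"
    and sm: "\<And>c v. v \<in> N \<Longrightarrow> c \<odot> v \<in> N"
    and ops: "\<And>v. v \<in> N \<Longrightarrow> X v \<in> N" "\<And>v. v \<in> N \<Longrightarrow> Xi v \<in> N" "\<And>v. v \<in> N \<Longrightarrow> T v \<in> N" "\<And>v. v \<in> N \<Longrightarrow> P v \<in> N"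
  shows "N = {\<zero>} \<or> N = carrier M"
proof -
  have NM: "u \<in> carrier M" if "u \<in> N" for u using that N(1) by (rule subsetD[rotated])
  have act: "act f u \<in> N" if "u \<in> N" for f u
    using that
  proof (induction f arbitrary: u rule: laurent_mult_induct)
    case (cst c)
    show ?case unfolding act_cst[OF NM[OF cst]] by (rule sm[OF cst])
  next
    case X
    show ?case unfolding act_XX[OF NM[OF X]] by (rule ops(1)[OF X])
  next
    case Xinv
    show ?case unfolding act_Xinv[OF NM[OF Xinv]] by (rule ops(2)[OF Xinv])
  next
    case (add f g)
    show ?case unfolding act_add[OF NM[OF add(3)]] by (rule assms(3)[OF add(1,2)[OF add(3)]])
  next
    case (mult f g)
    show ?case unfolding act_mult[OF NM[OF mult(3)]] by (rule mult(1)[OF mult(2)[OF mult(3)]])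
  qed
  define R where "R = {f. act f w \<in> N}"
  have R: "f \<in> R \<longleftrightarrow> act f w \<in> N" for f by (simp add: R_def)
  have "R = r.Ideal \<or> R = UNIV"
  proof (rule r.poly_quotient_irreducible)
    show "f + g \<in> R" if "f \<in> R" "g \<in> R" for f g using that unfolding R act_add[OF w] by (rule add)
    show "g * f \<in> R" if "f \<in> R" for f g using that unfolding R act_mult[OF w] by (rule act)
    show "opT_poly th f \<in> R" if "f \<in> R" for f using that unfolding R T_act_w[symmetric] by (rule ops(3))
    show "subst_inv h f \<in> R" if "f \<in> R" for f using that unfolding R P_act_w[symmetric] by (rule ops(4))
    show "r.Ideal \<subseteq> R"
    proof
      fix f assume "f \<in> r.Ideal"
      then have "act f w = \<zero>" by (rule act_w_0[THEN iffD2])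
      then show "f \<in> R" using N(2) by (simp only: R)
    qed
  qed
  then show ?thesis
  proof
    assume RI: "R = r.Ideal"
    have "u = \<zero>" if u: "u \<in> N" for u
    proof -
      obtain f where f: "u = act f w" using generated[OF NM[OF u]] by blast
      then have "f \<in> r.Ideal" using u by (simp only: R RI[symmetric])
      then show ?thesis using f act_w_0 by simp
    qed
    then show ?thesis using N(2) by blast
  next
    assume RU: "R = UNIV"
    have "v \<in> N" if v: "v \<in> carrier M" for v
    proof -
      obtain f where f: "v = act f w" using generated[OF v] by blast
      have "f \<in> R" by (simp only: RU UNIV_I)
      then show ?thesis by (simp only: R f)
    qed
    then show ?thesis using N(1) by blast
  qed
qed

text \<open>The vectors \<open>\<delta>\<^sub>x(X) w\<close>, for \<open>x \<in> S\<close>, form a basis.\<close>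

lemma act_delta_basis:
  "vectorspace.fin_dim (class_ring :: complex ring) M" "vectorspace.dim (class_ring :: complex ring) M = 2 * n"
proof -
  interpret V: vectorspace "class_ring :: complex ring" M by (rule vs)
  define b where "b x = act (delta r.S x) w" for x
  have ld: "leval (delta r.S x) y = (if x = y then 1 else 0)" if "x \<in> r.S" "y \<in> r.S" for x y
    using leval_delta[OF r.finite_S r.zero_S] that by auto
  have inj: "inj_on b r.S"
  proof (rule inj_onI)
    fix x y assume xy: "x \<in> r.S" "y \<in> r.S" "b x = b y"
    then have "delta r.S x - delta r.S y \<in> r.Ideal" by (simp add: b_def act_w_eq)
    then have "leval (delta r.S x) x - leval (delta r.S y) x = 0" using xy by (auto simp: r.Ideal_def leval_diff)
    then show "x = y" using xy ld by (auto split: if_splits)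
  qed
  let ?B = "b ` r.S"
  have B: "finite ?B" "?B \<subseteq> carrier M" using r.finite_S by (auto simp: b_def)
  have lin: "lincomb c ?B = act (\<Sum>x\<in>r.S. cst (c (b x)) * delta r.S x) w" for c
  proof -
    have "lincomb c ?B = (\<Oplus>x\<in>r.S. c (b x) \<odot> b x)"
      unfolding lincomb_def by (rule add.finprod_reindex) (use B inj in auto)
    also have "\<dots> = act (\<Sum>x\<in>r.S. cst (c (b x)) * delta r.S x) w"
      by (simp add: act_sum r.finite_S act_cst_mult b_def)
    finally show ?thesis .
  qed
  have "lin_indpt ?B"
  proof (rule finite_lin_indpt2[OF B])
    fix c assume "lincomb c ?B = \<zero>"
    then have I: "(\<Sum>x\<in>r.S. cst (c (b x)) * delta r.S x) \<in> r.Ideal" by (simp add: lin act_w_0)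
    have "c (b x) = 0" if x: "x \<in> r.S" for x
      using I x leval_interpolate[OF r.finite_S r.zero_S x, of "\<lambda>x. c (b x)"] by (auto simp: r.Ideal_def)
    then show "\<forall>v\<in>?B. c v = \<zero>\<^bsub>class_ring\<^esub>" by auto
  qed
  moreover have gen: "span ?B = carrier M"
  proof
    show "carrier M \<subseteq> span ?B"
    proof
      fix v assume "v \<in> carrier M"
      then obtain f where f: "v = act f w" using generated by blast
      define c where "c u = leval f (inv_into r.S b u)" for u
      have "lincomb c ?B = act (\<Sum>x\<in>r.S. cst (leval f x) * delta r.S x) w"
        unfolding lin using inj by (simp add: c_def cong: sum.cong)
      also have "\<dots> = v" unfolding f by (rule act_w_eq[THEN iffD2, symmetric]) (rule r.interpolate_reduce)
      finally show "v \<in> span ?B" unfolding finite_span[OF B] by auto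
    qed
    show "span ?B \<subseteq> carrier M" by (rule span_is_subset2[OF B(2)])
  qed
  ultimately have bas: "V.basis ?B" using B by (simp add: V.basis_def)
  show "V.fin_dim" unfolding V.fin_dim_def using B gen by blast
  show "V.dim = 2 * n" using V.dim_basis[OF B(1) bas] inj by (simp add: card_image r.card_S)
qed

end

lemma hh_submodule_closed:
  fixes M :: "'v hh_module" (structure)
  assumes rep: "hh_rep h th M" and N: "hh_submodule N M"
  shows "N \<subseteq> carrier M" "\<zero> \<in> N" "\<And>u v. u \<in> N \<Longrightarrow> v \<in> N \<Longrightarrow> u \<oplus> v \<in> N" "\<And>c v. v \<in> N \<Longrightarrow> c \<odot> v \<in> N"
    "\<And>v. v \<in> N \<Longrightarrow> opX M v \<in> N" "\<And>v. v \<in> N \<Longrightarrow> opXinv M v \<in> N" "\<And>v. v \<in> N \<Longrightarrow> opT M v \<in> N"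
    "\<And>v. v \<in> N \<Longrightarrow> opY M v \<in> N" "\<And>v. v \<in> N \<Longrightarrow> rep_P th M v \<in> N"
proof -
  interpret S: submodule "class_ring :: complex ring" N M using N by (simp add: hh_submodule_def VectorSpace.subspace_def)
  show "N \<subseteq> carrier M" "\<zero> \<in> N" by (rule S.subset S.zero_closed)+
  show add: "u \<oplus> v \<in> N" if "u \<in> N" "v \<in> N" for u v using that by (rule S.m_closed)
  show sm: "c \<odot> v \<in> N" if "v \<in> N" for c v using S.smult_closed[of c v] that by simp
  have ops: "F v \<in> N" if "F \<in> {opX M, opXinv M, opY M, opYinv M, opT M}" "v \<in> N" for F v
    using N that unfolding hh_submodule_def by blast
  then show X: "opX M v \<in> N" and "opXinv M v \<in> N" and T: "opT M v \<in> N" and Y: "opY M v \<in> N" if "v \<in> N" for v using that by auto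
  show "rep_P th M v \<in> N" if "v \<in> N" for v using that unfolding rep_P_def by (intro Y add T sm)
qed

lemma hh_submoduleI:
  fixes M :: "'v hh_module" (structure)
  assumes rep: "hh_rep h th M" "h \<noteq> 0" "th \<noteq> 0" and N: "N \<subseteq> carrier M" "\<zero> \<in> N"
    and add: "\<And>u v. u \<in> N \<Longrightarrow> v \<in> N \<Longrightarrow> u \<oplus> v \<in> N" and sm: "\<And>c v. v \<in> N \<Longrightarrow> c \<odot> v \<in> N"
    and ops: "\<And>v. v \<in> N \<Longrightarrow> opX M v \<in> N" "\<And>v. v \<in> N \<Longrightarrow> opXinv M v \<in> N" "\<And>v. v \<in> N \<Longrightarrow> opT M v \<in> N"
    and P: "\<And>v. v \<in> N \<Longrightarrow> rep_P th M v \<in> N"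
  shows "hh_submodule N M"
proof -
  have vs: "vectorspace (class_ring :: complex ring) M" using rep by (simp add: hh_rep_def)
  have m: "module (class_ring :: complex ring) M" using vs by (simp add: vectorspace_def)
  have "submodule (class_ring :: complex ring) N M" by (rule submodule.intro) (use m N add sm in auto)
  moreover have Y: "opY M v \<in> N" if v: "v \<in> N" for v
  proof -
    have vM: "v \<in> carrier M" using v N(1) by (rule subsetD[rotated])
    show ?thesis using P[OF ops(3)[OF v]] unfolding hh_rep_triple(2)[OF rep vM] .
  qed
  moreover have "opYinv M v \<in> N" if v: "v \<in> N" for v
  proof -
    have vM: "v \<in> carrier M" using v N(1) by (rule subsetD[rotated])
    show ?thesis unfolding hh_rep_triple(3)[OF rep vM] by (rule add[OF ops(3)[OF P[OF v]] sm[OF P[OF v]]])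
  qed
  ultimately show ?thesis
    unfolding hh_submodule_def VectorSpace.subspace_def using vs ops by (simp add: image_subset_iff)
qed

definition spherical :: "complex \<Rightarrow> complex \<Rightarrow> nat \<Rightarrow> 'v hh_module \<Rightarrow> 'v \<Rightarrow> bool" where
  "spherical h th n M w \<longleftrightarrow> hh_rep h th M \<and> spherical_rep M (opX M) (opXinv M) (opT M) (rep_P th M) h th n w"

lemma spherical_irreducible:
  assumes "spherical h th n M w" shows "hh_irreducible M"
proof -
  have rep: "hh_rep h th M" using assms by (simp add: spherical_def)
  interpret S: spherical_rep M "opX M" "opXinv M" "opT M" "rep_P th M" h th n w using assms by (simp add: spherical_def)
  have "N = {\<zero>\<^bsub>M\<^esub>} \<or> N = carrier M" if N: "hh_submodule N M" for N
    by (rule S.irreducible) (rule hh_submodule_closed[OF rep N]; assumption)+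
  then show ?thesis unfolding hh_irreducible_def using S.nontrivial by blast
qed

lemma irreducible_indecomposable: 
  assumes rep: "hh_rep h th M" and irr: "hh_irreducible M" shows "hh_indecomposable M"
  unfolding hh_indecomposable_def
proof (intro conjI allI impI)
  show "carrier M \<noteq> {\<zero>\<^bsub>M\<^esub>}" using irr by (simp add: hh_irreducible_def)
  fix A B assume AB: "hh_submodule A M \<and> hh_submodule B M \<and> A \<inter> B = {\<zero>\<^bsub>M\<^esub>} \<and> A <+>\<^bsub>M\<^esub> B = carrier M"
  then have A: "hh_submodule A M" and B: "hh_submodule B M" and int: "A \<inter> B = {\<zero>\<^bsub>M\<^esub>}" by blast+
  have "A = {\<zero>\<^bsub>M\<^esub>} \<or> A = carrier M" using irr A unfolding hh_irreducible_def by blast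
  moreover have "B = {\<zero>\<^bsub>M\<^esub>}" if "A = carrier M"
    using int hh_submodule_closed(1)[OF rep B] unfolding that by (simp only: Int_absorb1)
  ultimately show "A = {\<zero>\<^bsub>M\<^esub>} \<or> B = {\<zero>\<^bsub>M\<^esub>}" by blast
qed

lemma spherical_fd_indecomposable:
  assumes "spherical h th n M w"
  shows "fd_indecomposable_rep h th M" "hh_dim M = 2 * n"
proof -
  have rep: "hh_rep h th M" using assms by (simp add: spherical_def)
  interpret S: spherical_rep M "opX M" "opXinv M" "opT M" "rep_P th M" h th n w using assms by (simp add: spherical_def)
  show "hh_dim M = 2 * n" by (rule S.act_delta_basis)
  show "fd_indecomposable_rep h th M"
    unfolding fd_indecomposable_rep_def
    using rep S.act_delta_basis(1) irreducible_indecomposable[OF rep spherical_irreducible[OF assms]] by simp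
qed

text \<open>In \<open>cyclic_splitting\<close> the summand generated by the spherical vector is nonzero, so the other one must be zero.\<close>

theorem indecomposable_spherical:
  fixes M :: "'v hh_module" (structure)
  assumes rp: "root_params h th n" and M: "fd_indecomposable_rep h th M"
  shows "\<exists>w. spherical h th n M w"
proof -
  interpret r: root_params h th n by (rule rp)
  have rep: "hh_rep h th M" and fd: "hh_fin_dim M" and ind: "hh_indecomposable M"
    using M by (auto simp: fd_indecomposable_rep_def)
  have vs: "vectorspace (class_ring :: complex ring) M" using rep by (simp add: hh_rep_def)
  note tr = hh_rep_triple[OF rep r.h_nz r.th_nz]
  interpret F: fd_triple M "opX M" "opXinv M" "opT M" "rep_P th M" h th n
    by (intro fd_triple.intro tr(1) rp fd_triple_axioms.intro vs fd) (use ind in \<open>simp add: hh_indecomposable_def\<close>)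
  show ?thesis
  proof (rule F.cyclic_splitting)
  fix w N assume w: "w \<in> carrier M" "opT M w = th \<odot> w" "rep_P th M w = w" "\<And>f. F.act f w = \<zero> \<longleftrightarrow> f \<in> r.Ideal"
    and N: "N \<subseteq> carrier M" "\<zero> \<in> N" "\<And>u v. u \<in> N \<Longrightarrow> v \<in> N \<Longrightarrow> u \<oplus> v \<in> N"
      "\<And>u f. u \<in> N \<Longrightarrow> F.act f u \<in> N" "\<And>u. u \<in> N \<Longrightarrow> opT M u \<in> N" "\<And>u. u \<in> N \<Longrightarrow> rep_P th M u \<in> N"
    and disj: "\<And>f. F.act f w \<in> N \<Longrightarrow> F.act f w = \<zero>"
    and split: "\<And>v. v \<in> carrier M \<Longrightarrow> \<exists>f. \<exists>u\<in>N. v = F.act f w \<oplus> u"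
  let ?C = "range (\<lambda>f. F.act f w)"
  have NN: "hh_submodule N M"
  proof (rule hh_submoduleI[OF rep r.h_nz r.th_nz])
    have NM: "v \<in> carrier M" if "v \<in> N" for v using that N(1) by (rule subsetD[rotated])
    show "c \<odot> v \<in> N" if "v \<in> N" for c v using N(4)[OF that, of "cst c"] unfolding F.act_cst[OF NM[OF that]] .
    show "opX M v \<in> N" if "v \<in> N" for v using N(4)[OF that, of XX] unfolding F.act_XX[OF NM[OF that]] .
    show "opXinv M v \<in> N" if "v \<in> N" for v
      using N(4)[OF that, of "lmonom 1 (- 1)"] unfolding F.act_Xinv[OF NM[OF that]] .
  qed (rule N; assumption)+
  have actC: "F.act g (F.act f w) \<in> ?C" for f g using F.act_mult[OF w(1), of g f] by (metis rangeI)
  have CC: "hh_submodule ?C M"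
  proof (rule hh_submoduleI[OF rep r.h_nz r.th_nz])
    show "?C \<subseteq> carrier M" using w(1) by (simp add: image_subset_iff)
    show "\<zero> \<in> ?C" using F.act_0[OF w(1)] by (metis rangeI)
    show "u \<oplus> v \<in> ?C" if "u \<in> ?C" "v \<in> ?C" for u v
    proof -
      obtain f g where fg: "u = F.act f w" "v = F.act g w" using \<open>u \<in> ?C\<close> \<open>v \<in> ?C\<close> by blast
      show ?thesis unfolding fg F.act_add[OF w(1), symmetric] by (rule rangeI)
    qed
    fix v assume "v \<in> ?C"
    then obtain f where v: "v = F.act f w" by blast
    have c: "F.act f w \<in> carrier M" by (rule F.act_closed[OF w(1)])
    show "c \<odot> v \<in> ?C" for c using actC[of "cst c" f] unfolding v F.act_cst[OF c] .
    show "opX M v \<in> ?C" using actC[of XX f] unfolding v F.act_XX[OF c] .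
    show "opXinv M v \<in> ?C" using actC[of "lmonom 1 (- 1)" f] unfolding v F.act_Xinv[OF c] .
    show "opT M v \<in> ?C" unfolding v F.cyclic_T[OF w(1,2)] by (rule rangeI)
    show "rep_P th M v \<in> ?C" unfolding v F.cyclic_P[OF w(1,3)] by (rule rangeI)
  qed
  have "u = \<zero>" if u: "u \<in> ?C" "u \<in> N" for u
  proof -
    obtain f where f: "u = F.act f w" using u(1) by blast
    show ?thesis using u(2) unfolding f by (rule disj)
  qed
  then have "?C \<inter> N = {\<zero>}" using hh_submodule_closed(2)[OF rep CC] N(2) by blast
  moreover have "?C <+>\<^bsub>M\<^esub> N = carrier M"
  proof
    show "?C <+>\<^bsub>M\<^esub> N \<subseteq> carrier M" unfolding set_add_def' using w(1) N(1) by (auto simp: subset_iff)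
    show "carrier M \<subseteq> ?C <+>\<^bsub>M\<^esub> N"
    proof
      fix v assume "v \<in> carrier M"
      then obtain f u where "u \<in> N" "v = F.act f w \<oplus> u" using split by blast
      then show "v \<in> ?C <+>\<^bsub>M\<^esub> N" unfolding set_add_def' by blast
    qed
  qed
  ultimately have "?C = {\<zero>} \<or> N = {\<zero>}" using ind CC NN unfolding hh_indecomposable_def by blast
  moreover have "?C \<noteq> {\<zero>}"
  proof
    assume "?C = {\<zero>}"
    moreover have "F.act 1 w \<in> ?C" by (rule rangeI)
    ultimately have "F.act 1 w = \<zero>" by (simp only: singleton_iff)
    then have "1 \<in> r.Ideal" by (rule w(4)[THEN iffD1])
    then show False using r.inv_th_in_S(1) by (auto simp: r.Ideal_def)
  qed
  ultimately have N0: "N = {\<zero>}" by blast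
  have "spherical_rep M (opX M) (opXinv M) (opT M) (rep_P th M) h th n w"
  proof (intro spherical_rep.intro tr(1) rp spherical_rep_axioms.intro vs w)
    fix v assume "v \<in> carrier M"
    then show "\<exists>f. v = F.act f w" using split[of v] N0 w(1) by auto
  qed
  then show ?thesis using rep unfolding spherical_def by blast
  qed
qed

text \<open>The isomorphism sends \<open>f(X) w\<close> to \<open>f(X) w'\<close>.\<close>

theorem spherical_iso:
  fixes M :: "'v hh_module" and N :: "'w hh_module"
  assumes M: "spherical h th n M w" and N: "spherical h th n N w'"
  shows "hh_iso M N"
proof -
  interpret A: spherical_rep M "opX M" "opXinv M" "opT M" "rep_P th M" h th n w using M by (simp add: spherical_def)
  interpret B: spherical_rep N "opX N" "opXinv N" "opT N" "rep_P th N" h th n w' using N by (simp add: spherical_def)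
  have rM: "hh_rep h th M" and rN: "hh_rep h th N" using M N by (simp_all add: spherical_def)
  define \<phi> where "\<phi> v = B.act (SOME f. v = A.act f w) w'" for v
  have sym: "f - g \<in> A.r.Ideal \<Longrightarrow> g - f \<in> A.r.Ideal" for f g by (simp add: A.r.Ideal_def leval_diff)
  have \<phi>: "\<phi> (A.act f w) = B.act f w'" for f
  proof -
    have "A.act f w = A.act (SOME g. A.act f w = A.act g w) w" by (rule someI[of _ f]) simp
    then have "f - (SOME g. A.act f w = A.act g w) \<in> A.r.Ideal" by (rule A.act_w_eq[THEN iffD1])
    then show ?thesis unfolding \<phi>_def by (rule B.act_w_eq[THEN iffD2, OF sym])
  qed
  have cyc: "\<exists>f. v = A.act f w" if "v \<in> carrier M" for v using A.generated that .
  have hom: "\<phi> \<in> module_hom class_ring M N"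
    unfolding module_hom_def
    by (auto dest!: cyc simp: \<phi>) (auto simp: \<phi> simp flip: A.act_add B.act_add A.act_cst_mult B.act_cst_mult)
  moreover have "bij_betw \<phi> (carrier M) (carrier N)"
    unfolding bij_betw_def
  proof
    show "inj_on \<phi> (carrier M)"
      by (rule inj_onI) (auto dest!: cyc simp: \<phi> A.act_w_eq B.act_w_eq)
    show "\<phi> ` carrier M = carrier N"
    proof
      show "\<phi> ` carrier M \<subseteq> carrier N" by (auto dest!: cyc simp: \<phi>)
      show "carrier N \<subseteq> \<phi> ` carrier M"
      proof
        fix u assume "u \<in> carrier N"
        then obtain f where "u = B.act f w'" using B.generated by blast
        then have "u = \<phi> (A.act f w)" by (simp add: \<phi>)
        then show "u \<in> \<phi> ` carrier M" by auto
      qed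
    qed
  qed
  moreover have "\<phi> (opX M v) = opX N (\<phi> v) \<and> \<phi> (opY M v) = opY N (\<phi> v) \<and> \<phi> (opT M v) = opT N (\<phi> v)" if v: "v \<in> carrier M" for v
  proof -
    obtain f where f: "v = A.act f w" using cyc v by blast
    have YM: "opY M v = A.act (subst_inv h (opT_poly th f)) w"
      using hh_rep_triple(2)[OF rM A.h_nz A.th_nz v] by (simp add: f A.T_act_w A.P_act_w)
    have YN: "opY N (B.act f w') = B.act (subst_inv h (opT_poly th f)) w'"
      using hh_rep_triple(2)[OF rN A.h_nz A.th_nz, of "B.act f w'"] by (simp add: B.T_act_w B.P_act_w)
    have XM: "opX M v = A.act (XX * f) w" and XN: "opX N (B.act f w') = B.act (XX * f) w'"
      by (simp_all add: f A.act_mult B.act_mult A.act_XX B.act_XX)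
    show ?thesis unfolding YM XM unfolding f \<phi> YN XN A.T_act_w B.T_act_w by simp
  qed
  ultimately show ?thesis unfolding hh_iso_def by blast
qed

section \<open>Twisting by signs\<close>

lemma twist_rep:
  fixes M N :: "'v hh_module"
  assumes M: "hh_rep h th M" "h \<noteq> 0" "th \<noteq> 0"
    and rec: "carrier N = carrier M" "add N = add M" "smult N = smult M" "zero N = zero M"
    and ops: "\<And>v. v \<in> carrier M \<Longrightarrow> opX N v = a \<odot>\<^bsub>M\<^esub> opX M v" "\<And>v. v \<in> carrier M \<Longrightarrow> opT N v = c \<odot>\<^bsub>M\<^esub> opT M v"
      "\<And>v. v \<in> carrier M \<Longrightarrow> opY N v = (b * c) \<odot>\<^bsub>M\<^esub> opY M v"
    and abc: "a * a = 1" "b * b = 1" "c * c = 1" and th': "th' \<noteq> 0" "th' - inverse th' = c * (th - inverse th)"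
  shows "hh_rep h th' N" "v \<in> carrier M \<Longrightarrow> opXinv N v = a \<odot>\<^bsub>M\<^esub> opXinv M v"
    "hh_fin_dim M \<Longrightarrow> hh_fin_dim N"
proof -
  note tr = hh_rep_triple[OF M]
  interpret H: hecke_triple M "opX M" "opXinv M" "opT M" "rep_P th M" h th by (rule tr(1))
  have vs: "vectorspace (class_ring :: complex ring) M" using M by (simp add: hh_rep_def)
  have vsN: "vectorspace (class_ring :: complex ring) N"
    by (rule vectorspace_image[OF vs, of id]) (simp_all add: rec)
  have mN: "module (class_ring :: complex ring) N" using vsN by (simp add: vectorspace_def)
  have "hecke_triple N (opX N) (\<lambda>v. a \<odot>\<^bsub>M\<^esub> opXinv M v) (opT N) (\<lambda>v. b \<odot>\<^bsub>M\<^esub> rep_P th M v) h th'"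
    by (rule hecke_triple_image(1)[OF H.sign_twist[OF abc th'] mN, of id]) (simp_all add: rec ops)
  note rep = triple_hh_rep[OF vsN this]
  have Y: "opY N v = b \<odot>\<^bsub>M\<^esub> rep_P th M (opT N v)" if "v \<in> carrier N" for v
  proof -
    have v: "v \<in> carrier M" using that by (simp only: rec)
    then have c: "opT M v \<in> carrier M" by (rule linear_op_closed[OF H.T_lin])
    have "opY N v = (b * c) \<odot>\<^bsub>M\<^esub> rep_P th M (opT M v)" by (simp only: ops(3)[OF v] tr(2)[OF v])
    also have "\<dots> = b \<odot>\<^bsub>M\<^esub> (c \<odot>\<^bsub>M\<^esub> rep_P th M (opT M v))"
      by (rule H.sm_m[symmetric]) (rule linear_op_closed[OF H.P_lin c])
    also have "c \<odot>\<^bsub>M\<^esub> rep_P th M (opT M v) = rep_P th M (opT N v)"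
      by (simp only: ops(2)[OF v] linear_op_smult[OF H.P_lin c])
    finally show ?thesis .
  qed
  show "hh_rep h th' N" by (rule rep(1)) (rule Y)
  show "opXinv N v = a \<odot>\<^bsub>M\<^esub> opXinv M v" if "v \<in> carrier M" by (rule rep(2)) (use Y that rec in auto)
  show "hh_fin_dim N" if "hh_fin_dim M"
    by (rule fin_dim_image[OF vs vsN, of id]) (simp_all add: rec that)
qed

text \<open>The twisted representation has the same subrepresentations, because the generators change only by signs.\<close>

lemma twist_spherical:
  fixes M N :: "'v hh_module"
  assumes sp: "spherical h th n M w"
    and rec: "carrier N = carrier M" "add N = add M" "smult N = smult M" "zero N = zero M"
    and ops: "\<And>v. v \<in> carrier M \<Longrightarrow> opX N v = a \<odot>\<^bsub>M\<^esub> opX M v" "\<And>v. v \<in> carrier M \<Longrightarrow> opT N v = c \<odot>\<^bsub>M\<^esub> opT M v"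
      "\<And>v. v \<in> carrier M \<Longrightarrow> opY N v = (b * c) \<odot>\<^bsub>M\<^esub> opY M v"
    and abc: "a * a = 1" "b * b = 1" "c * c = 1" and th': "th' \<noteq> 0" "th' - inverse th' = c * (th - inverse th)"
  shows "fd_indecomposable_rep h th' N"
proof -
  interpret S: spherical_rep M "opX M" "opXinv M" "opT M" "rep_P th M" h th n w using sp by (simp add: spherical_def)
  have rM: "hh_rep h th M" using sp by (simp add: spherical_def)
  note tw = twist_rep[OF rM S.h_nz S.th_nz rec _ _ _ abc th']
  have N: "hh_rep h th' N" by (rule tw(1)) (erule ops)+
  have NXi: "opXinv N v = a \<odot>\<^bsub>M\<^esub> opXinv M v" if v: "v \<in> carrier M" for v
    by (rule tw(2)) (erule ops | rule v)+
  have Nfd: "hh_fin_dim N" by (rule tw(3)) (erule ops | rule S.act_delta_basis)+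
  have "A = {\<zero>\<^bsub>M\<^esub>} \<or> A = carrier M" if A: "hh_submodule A N" for A
  proof -
    note cl = hh_submodule_closed[OF N A, unfolded rec]
    have AM: "v \<in> carrier M" if "v \<in> A" for v using cl(1) that by auto
    have X: "opX M v \<in> A" if v: "v \<in> A" for v
      using cl(4)[OF cl(5)[OF v], of a] AM[OF v] abc by (simp add: ops S.sm_m S.lin)
    have Xi: "opXinv M v \<in> A" if v: "v \<in> A" for v
      using cl(4)[OF cl(6)[OF v], of a] AM[OF v] abc by (simp add: NXi S.sm_m S.lin)
    have T: "opT M v \<in> A" if v: "v \<in> A" for v
      using cl(4)[OF cl(7)[OF v], of c] AM[OF v] abc by (simp add: ops S.sm_m S.lin)
    have Y: "opY M v \<in> A" if v: "v \<in> A" for v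
    proof -
      have Yc: "opY M v \<in> carrier M" using hh_rep_triple(2)[OF rM S.h_nz S.th_nz AM[OF v]] AM[OF v] S.lin by (metis linear_op_closed)
      have "c * b * (b * c) = (b * b) * (c * c)" by (simp only: mult_ac)
      then have "c * b * (b * c) = 1" by (simp only: abc mult_1)
      then show ?thesis using cl(4)[OF cl(8)[OF v], of "c * b"] AM[OF v] Yc by (simp add: ops S.sm_m)
    qed
    show "A = {\<zero>\<^bsub>M\<^esub>} \<or> A = carrier M"
    proof (rule S.irreducible)
      show "rep_P th M v \<in> A" if "v \<in> A" for v
        unfolding rep_P_def by (rule Y[OF cl(3)[OF T[OF that] cl(4)[OF that]]])
    qed (rule cl(1-4) X Xi T; assumption)+
  qed
  then have "hh_irreducible N" unfolding hh_irreducible_def rec using S.nontrivial by blast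
  then show ?thesis unfolding fd_indecomposable_rep_def
    using N Nfd irreducible_indecomposable[OF N] by simp
qed

text \<open>The parameters \<open>t\<^sup>1\<^sup>/\<^sup>2\<close> and \<open>- t\<^sup>-\<^sup>1\<^sup>/\<^sup>2\<close> have the same representations. This reduces \<open>t = - q\<^sup>n\<^sup>/\<^sup>2\<close> to \<open>t = - q\<^sup>-\<^sup>n\<^sup>/\<^sup>2\<close>.\<close>

lemma change_sign_of_th:
  assumes M: "fd_indecomposable_rep h th M" and nz: "h \<noteq> 0" "th \<noteq> 0" shows "fd_indecomposable_rep h (- inverse th) M"
proof -
  have rep: "hh_rep h th M" using M by (simp add: fd_indecomposable_rep_def)
  interpret H: hecke_triple M "opX M" "opXinv M" "opT M" "rep_P th M" h th by (rule hh_rep_triple(1)[OF rep nz])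
  have Y: "opY M v \<in> carrier M" if "v \<in> carrier M" for v
    using hh_rep_triple(2)[OF rep nz that] that H.lin by (metis linear_op_closed)
  have "hh_rep h (- inverse th) M"
    by (rule twist_rep(1)[OF rep nz, where a = 1 and b = 1 and c = 1]) (use nz Y in \<open>auto simp: H.lin\<close>)
  then show ?thesis using M by (simp add: fd_indecomposable_rep_def)
qed

section \<open>The polynomial representation\<close>

lemma poly_rep_simps [simp]:
  "carrier (poly_rep h th) = UNIV" "\<zero>\<^bsub>poly_rep h th\<^esub> = 0" "f \<oplus>\<^bsub>poly_rep h th\<^esub> g = f + g"
  "c \<odot>\<^bsub>poly_rep h th\<^esub> f = cst c * f" "opX (poly_rep h th) f = XX * f" "opY (poly_rep h th) = opY_poly h th"
  "opT (poly_rep h th) = opT_poly th"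
  by (simp_all add: poly_rep_def)

lemma vectorspace_poly_rep: "vectorspace class_ring (poly_rep h th)"
proof (rule vs_criteria)
  show "field (class_ring :: complex ring)" by (rule class_field)
  show "\<forall>v\<in>carrier (poly_rep h th). \<exists>neg_v\<in>carrier (poly_rep h th). v \<oplus>\<^bsub>poly_rep h th\<^esub> neg_v = \<zero>\<^bsub>poly_rep h th\<^esub>"
    by (auto intro: exI[of _ "- v" for v])
qed (auto simp: algebra_simps mult_single single_add)

lemma linear_op_mult: "linear_op (poly_rep h th) ((*) k)"
proof (rule linear_opI)
  show "k * (f \<oplus>\<^bsub>poly_rep h th\<^esub> g) = k * f \<oplus>\<^bsub>poly_rep h th\<^esub> k * g" for f g
    by (simp only: poly_rep_simps distrib_left)
  show "k * (c \<odot>\<^bsub>poly_rep h th\<^esub> f) = c \<odot>\<^bsub>poly_rep h th\<^esub> (k * f)" for c f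
    unfolding poly_rep_simps by (rule mult.left_commute)
qed simp

text \<open>In the polynomial representation \<open>P\<close> is the operator \<open>\<pi>\<close>.\<close>

lemma poly_rep_triple:
  assumes "h \<noteq> 0" "th \<noteq> 0"
  shows "hecke_triple (poly_rep h th) ((*) XX) ((*) (lmonom 1 (- 1))) (opT_poly th) (subst_inv h) h th"
proof (intro hecke_triple.intro laurent_action.intro laurent_action_axioms.intro hecke_triple_axioms.intro cmodule.intro)
  show "module class_ring (poly_rep h th)" using vectorspace_poly_rep by (simp add: vectorspace_def)
  show "linear_op (poly_rep h th) (opT_poly th)" by (rule linear_opI) (simp_all add: opT_add opT_cst_mult)
  show "linear_op (poly_rep h th) (subst_inv h)" by (rule linear_opI) (simp_all add: subst_inv_add subst_inv_mult assms)
  show "linear_op (poly_rep h th) ((*) XX)" "linear_op (poly_rep h th) ((*) (lmonom 1 (- 1)))"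
    by (rule linear_op_mult)+
  fix f :: "complex laurent"
  have e: "XX * lmonom 1 (- 1) = (1 :: complex laurent)" "lmonom 1 (- 1) * XX = (1 :: complex laurent)"
    by (simp_all add: mult_single)
  show "XX * (lmonom 1 (- 1) * f) = f" "lmonom 1 (- 1) * (XX * f) = f"
    by (simp_all only: mult.assoc[symmetric] e mult_1)
  show "opT_poly th (opT_poly th f) = (th - inverse th) \<odot>\<^bsub>poly_rep h th\<^esub> opT_poly th f \<oplus>\<^bsub>poly_rep h th\<^esub> f"
    using assms by (simp add: opT_opT)
  show "opT_poly th (XX * opT_poly th f) = lmonom 1 (- 1) * f" using assms by (simp add: opT_XX_opT)
  show "subst_inv h (subst_inv h f) = f" using assms by simp
  show "subst_inv h (XX * subst_inv h f) = h \<odot>\<^bsub>poly_rep h th\<^esub> (lmonom 1 (- 1) * f)"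
    using assms by (simp add: subst_inv_mult mult_single flip: mult.assoc)
qed (fact assms)+

locale poly_triple =
  fixes h th :: complex
  assumes nz: "h \<noteq> 0" "th \<noteq> 0"
begin

abbreviation "PR \<equiv> poly_rep h th"

sublocale hecke_triple PR "(*) XX" "(*) (lmonom 1 (- 1))" "opT_poly th" "subst_inv h" h th
  by (rule poly_rep_triple[OF nz])

sublocale D: hecke_triple PR Yi Y "opT_poly th" "\<lambda>v. XX * opT_poly th v" h th
  by (rule dual)

lemma PR_triple': "hecke_triple PR (opX PR) ((*) (lmonom 1 (- 1))) (opT PR) (subst_inv h) h th"
proof -
  have "opX PR = (*) XX" by (simp add: fun_eq_iff)
  then show ?thesis using poly_rep_triple[OF nz] by simp
qed

lemma hh_rep_PR: "hh_rep h th PR"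
  and opXinv_PR: "opXinv PR f = lmonom 1 (- 1) * f"
  and opYinv_PR: "opYinv PR f = Yi f"
  using triple_hh_rep[OF vectorspace_poly_rep PR_triple'] by (simp_all add: opY_poly_def)

lemma opY_eq: "opY_poly h th = Y" by (simp add: Y_def opY_poly_def fun_eq_iff)

lemma rep_P_PR: "rep_P th PR f = subst_inv h f"
proof -
  have "rep_P th PR f = subst_inv h (opT_poly th (Ti f))" by (simp add: rep_P_def opY_poly_def Ti_def)
  also have "opT_poly th (Ti f) = f" by (rule T_Ti) simp
  finally show ?thesis .
qed

lemma finsum_PR: "finite A \<Longrightarrow> finsum PR F A = sum F A"
  by (induction A rule: finite_induct) simp_all

lemma act_PR: "act f g = f * g"
proof (induction f arbitrary: g rule: laurent_mult_induct)
  case (add f g)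
  then show ?case by (simp add: act_add distrib_right)
next
  case (mult f g)
  then show ?case by (simp add: act_mult mult.assoc)
qed (simp_all add: act_cst act_XX act_Xinv)

text \<open>Thus \<open>f(Y\<inverse>)\<close> is the action belonging to the dual triple.\<close>

lemma eval_Yinv_eq: "eval_Yinv h th f g = D.act f g"
proof -
  have inv: "inv_into UNIV Y = Yi"
    using opYinv_PR by (simp add: opYinv_def fun_eq_iff opY_eq)
  show ?thesis
    unfolding eval_Yinv_def D.act_def finsum_PR[OF finite_keys] D.Xpow_def opY_eq inv
    by (rule sum.cong) simp_all
qed

end

text \<open>An additive subgroup \<open>I\<close> suffices to compute with cosets; the parameters only fix the record in which the cosets are formed.\<close>

locale laurent_subgroup =
  fixes h th :: complex and I :: "complex laurent set"
  assumes I_0: "0 \<in> I" and I_diff: "\<And>f g. f \<in> I \<Longrightarrow> g \<in> I \<Longrightarrow> f - g \<in> I"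
begin

abbreviation "cs f \<equiv> I +>\<^bsub>poly_rep h th\<^esub> f"

lemma I_uminus: "f \<in> I \<Longrightarrow> - f \<in> I" using I_diff[OF I_0, of f] by simp
lemma I_add: "f \<in> I \<Longrightarrow> g \<in> I \<Longrightarrow> f + g \<in> I" using I_diff[OF _ I_uminus, of f g] by simp

lemma mem_cs: "g \<in> cs f \<longleftrightarrow> g - f \<in> I"
proof -
  have "g \<in> cs f \<longleftrightarrow> (\<exists>i\<in>I. g = i + f)" by (auto simp: a_r_coset_def')
  also have "\<dots> \<longleftrightarrow> g - f \<in> I" by (metis add_diff_cancel_right' diff_add_cancel)
  finally show ?thesis .
qed

lemma cs_eq: "cs f = cs g \<longleftrightarrow> f - g \<in> I"
proof
  assume "cs f = cs g"
  then show "f - g \<in> I" using mem_cs[of f f] mem_cs[of f g] I_0 by simp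
next
  assume fg: "f - g \<in> I"
  have "k - f \<in> I \<longleftrightarrow> k - g \<in> I" for k
    using I_add[OF _ fg, of "k - f"] I_diff[OF _ fg, of "k - g"] by auto
  then show "cs f = cs g" by (auto simp: mem_cs)
qed

lemma cs_0: "cs 0 = I" by (auto simp: mem_cs)

lemma cs_add: "cs f <+>\<^bsub>poly_rep h th\<^esub> cs g = cs (f + g)"
proof
  show "cs f <+>\<^bsub>poly_rep h th\<^esub> cs g \<subseteq> cs (f + g)"
  proof
    fix k assume "k \<in> cs f <+>\<^bsub>poly_rep h th\<^esub> cs g"
    then obtain a b where ab: "a - f \<in> I" "b - g \<in> I" "k = a + b" by (auto simp: set_add_def' mem_cs)
    have e: "k - (f + g) = (a - f) + (b - g)" by (simp add: ab(3))
    show "k \<in> cs (f + g)" using I_add[OF ab(1,2)] unfolding mem_cs e .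
  qed
  show "cs (f + g) \<subseteq> cs f <+>\<^bsub>poly_rep h th\<^esub> cs g"
  proof
    fix k assume "k \<in> cs (f + g)"
    then have "k - g \<in> cs f" by (simp add: mem_cs algebra_simps)
    moreover have "g \<in> cs g" by (simp add: mem_cs I_0)
    moreover have "k = (k - g) + g" by simp
    ultimately show "k \<in> cs f <+>\<^bsub>poly_rep h th\<^esub> cs g" unfolding set_add_def' poly_rep_simps by blast
  qed
qed

text \<open>Operators on the quotient are defined as unions over a coset; for additive operators that preserve \<open>I\<close> all members of the union agree.\<close>

lemma cs_op:
  assumes F: "\<And>f g. F (f - g) = F f - F g" and I: "\<And>f. f \<in> I \<Longrightarrow> F f \<in> I"
  shows "(\<Union>v\<in>cs f. cs (F v)) = cs (F f)"
proof -
  have c: "cs (F v) = cs (F f)" if "v \<in> cs f" for v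
  proof -
    have "F (v - f) \<in> I" using that unfolding mem_cs by (rule I)
    then show ?thesis unfolding cs_eq F .
  qed
  have "f \<in> cs f" by (simp add: mem_cs I_0)
  then have ne: "cs f \<noteq> {}" by blast
  have "(\<Union>v\<in>cs f. cs (F v)) = (\<Union>v\<in>cs f. cs (F f))" by (rule SUP_cong[OF refl c])
  also have "\<dots> = cs (F f)" by (rule SUP_const[OF ne])
  finally show ?thesis .
qed

abbreviation "QR \<equiv> hh_quot (poly_rep h th) I"

lemma QR_simps: "carrier QR = range cs" "\<zero>\<^bsub>QR\<^esub> = cs 0" "cs f \<oplus>\<^bsub>QR\<^esub> cs g = cs (f + g)"
proof -
  have "carrier QR = a_rcosets\<^bsub>poly_rep h th\<^esub> I" by (simp add: hh_quot_def)
  then show "carrier QR = range cs"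
    unfolding A_RCOSETS_def' poly_rep_simps by (simp only: UNION_singleton_eq_range)
  have "\<zero>\<^bsub>QR\<^esub> = I" by (simp add: hh_quot_def)
  then show "\<zero>\<^bsub>QR\<^esub> = cs 0" by (simp only: cs_0)
  have "cs f \<oplus>\<^bsub>QR\<^esub> cs g = cs f <+>\<^bsub>poly_rep h th\<^esub> cs g" by (simp add: hh_quot_def)
  then show "cs f \<oplus>\<^bsub>QR\<^esub> cs g = cs (f + g)" by (simp only: cs_add)
qed

end

locale laurent_submodule = poly_triple h th for h th + fixes I assumes sub: "hh_submodule I (poly_rep h th)"
begin

lemmas closed = hh_submodule_closed[OF hh_rep_PR sub, unfolded poly_rep_simps opXinv_PR rep_P_PR]

sublocale laurent_subgroup h th I
proof
  show "0 \<in> I" by (rule closed(2))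
  show "f - g \<in> I" if "f \<in> I" "g \<in> I" for f g
    using closed(3)[OF that(1) closed(4)[OF that(2), of "- 1"]] by (simp add: single_uminus)
qed

lemma T_diff: "opT_poly th (f - g) = opT_poly th f - opT_poly th g"
  using opT_add[of th "f - g" g] by simp

lemma Y_diff: "opY_poly h th (f - g) = opY_poly h th f - opY_poly h th g"
  by (simp add: opY_poly_def T_diff subst_inv_diff)

lemma QR_ops: "c \<odot>\<^bsub>QR\<^esub> cs f = cs (cst c * f)" "opX QR (cs f) = cs (XX * f)" "opT QR (cs f) = cs (opT_poly th f)"
    "opY QR (cs f) = cs (opY_poly h th f)"
proof -
  have "c \<odot>\<^bsub>QR\<^esub> cs f = (\<Union>v\<in>cs f. cs (cst c * v))" by (simp add: hh_quot_def)
  also have "\<dots> = cs (cst c * f)" by (rule cs_op[OF right_diff_distrib closed(4)])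
  finally show "c \<odot>\<^bsub>QR\<^esub> cs f = cs (cst c * f)" .
  have "opX QR (cs f) = (\<Union>v\<in>cs f. cs (XX * v))" by (simp add: hh_quot_def)
  also have "\<dots> = cs (XX * f)" by (rule cs_op[OF right_diff_distrib closed(5)])
  finally show "opX QR (cs f) = cs (XX * f)" .
  have "opT QR (cs f) = (\<Union>v\<in>cs f. cs (opT_poly th v))" by (simp add: hh_quot_def)
  also have "\<dots> = cs (opT_poly th f)" by (rule cs_op[OF T_diff closed(7)])
  finally show "opT QR (cs f) = cs (opT_poly th f)" .
  have "opY QR (cs f) = (\<Union>v\<in>cs f. cs (opY_poly h th v))" by (simp add: hh_quot_def)
  also have "\<dots> = cs (opY_poly h th f)" by (rule cs_op[OF Y_diff closed(8)])
  finally show "opY QR (cs f) = cs (opY_poly h th f)" .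
qed

lemma vectorspace_QR: "vectorspace class_ring QR"
  by (rule vectorspace_image[OF vectorspace_poly_rep[of h th], of cs]) (simp_all add: QR_simps QR_ops)

lemma QR_rep: "hh_rep h th QR" "opXinv QR (cs f) = cs (lmonom 1 (- 1) * f)" "rep_P th QR (cs f) = cs (subst_inv h f)"
proof -
  have m: "module (class_ring :: complex ring) QR" using vectorspace_QR by (simp add: vectorspace_def)
  define Xi' where "Xi' A = (\<Union>v\<in>A. cs (lmonom 1 (- 1) * v))" for A
  define P' where "P' A = (\<Union>v\<in>A. cs (subst_inv h v))" for A
  have Xi': "Xi' (cs f) = cs (lmonom 1 (- 1) * f)" for f
    unfolding Xi'_def by (rule cs_op[OF right_diff_distrib closed(6)])
  have pi: "subst_inv h f \<in> I" if "f \<in> I" for f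
    using hh_submodule_closed(9)[OF hh_rep_PR sub that] by (simp add: rep_P_PR)
  have P': "P' (cs f) = cs (subst_inv h f)" for f
    unfolding P'_def by (rule cs_op) (simp_all add: subst_inv_diff pi)
  have "hecke_triple QR (opX QR) Xi' (opT QR) P' h th"
    by (rule hecke_triple_image(1)[OF poly_rep_triple[OF nz] m, of cs]) (simp_all add: QR_simps QR_ops Xi' P')
  note rep = triple_hh_rep[OF vectorspace_QR this]
  have Y: "opY QR v = P' (opT QR v)" if "v \<in> carrier QR" for v
    using that by (auto simp: QR_simps QR_ops P' opY_poly_def)
  show "hh_rep h th QR" by (rule rep(1)) (rule Y)
  show "opXinv QR (cs f) = cs (lmonom 1 (- 1) * f)"
    unfolding Xi'[symmetric] by (rule rep(2)) (use Y in \<open>auto simp: QR_simps\<close>)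
  have "rep_P th QR (cs f) = cs (rep_P th PR f)" by (simp add: rep_P_def QR_simps QR_ops)
  then show "rep_P th QR (cs f) = cs (subst_inv h f)" by (simp add: rep_P_PR)
qed

lemma act_QR: "laurent_action.act QR (opX QR) (opXinv QR) f (cs g) = cs (f * g)"
proof -
  have m: "module (class_ring :: complex ring) QR" using vectorspace_QR by (simp add: vectorspace_def)
  have "laurent_action.act QR (opX QR) (opXinv QR) f (cs g) = cs (act f g)"
    by (rule hecke_triple_image(2)[OF poly_rep_triple[OF nz] m, where T' = "opT QR" and P' = "rep_P th QR"])
      (simp_all add: QR_simps QR_ops QR_rep)
  then show ?thesis by (simp only: act_PR)
qed

end

section \<open>The representation \<open>V\<^sub>2\<^sub>n\<close>\<close>

locale complex_root = root_params h th n for h th :: complex and n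
begin

sublocale poly_triple h th using h_nz th_nz by unfold_locales

lemma sub_Ideal: "hh_submodule Ideal (poly_rep h th)"
proof (rule hh_submoduleI[OF hh_rep_PR h_nz th_nz])
  show "f \<in> Ideal \<Longrightarrow> opT PR f \<in> Ideal" for f using Ideal_T by simp
  show "f \<in> Ideal \<Longrightarrow> rep_P th PR f \<in> Ideal" for f using Ideal_pi by (simp add: rep_P_PR)
qed (auto simp: ideal_mult opXinv_PR Ideal_def leval_hom S_nz)

sublocale V: laurent_submodule h th Ideal by unfold_locales (rule sub_Ideal)

lemma V2n_eq: "V2n h th n = hh_quot (poly_rep h th) Ideal"
  by (simp add: V2n_def principal_ideal_e)

lemma spherical_V2n: "spherical h th n (V2n h th n) (V.cs 1)"
  unfolding spherical_def V2n_eq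
proof (intro conjI spherical_rep.intro spherical_rep_axioms.intro V.QR_rep(1) V.vectorspace_QR root_params_axioms
    hh_rep_triple(1) h_nz th_nz)
  show "laurent_action.act V.QR (opX V.QR) (opXinv V.QR) f (V.cs 1) = \<zero>\<^bsub>V.QR\<^esub> \<longleftrightarrow> f \<in> Ideal" for f
    by (simp add: V.act_QR V.QR_simps V.cs_eq)
  show "\<exists>f. v = laurent_action.act V.QR (opX V.QR) (opXinv V.QR) f (V.cs 1)" if "v \<in> carrier V.QR" for v
    using that by (auto simp: V.act_QR V.QR_simps)
qed (simp_all add: V.QR_simps V.QR_ops V.QR_rep)

text \<open>The class of \<open>1\<close> in a quotient of \<open>\<P>\<close> for \<open>t\<^sup>-\<^sup>1\<^sup>/\<^sup>2\<close> would be an eigenvector of \<open>Y\<inverse>\<close> with eigenvalue \<open>t\<^sup>1\<^sup>/\<^sup>2\<close>. On \<open>V\<^sub>2\<^sub>n\<close> the eigenvalues of \<open>Y\<inverse>\<close> lie in \<open>S\<close>, which does not contain \<open>t\<^sup>1\<^sup>/\<^sup>2\<close>; so the image of \<open>1\<close> is zero, and with it the whole quotient.\<close>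

lemma V2n_iota_not_quotient:
  "\<not> (\<exists>N. hh_submodule N (poly_rep h (inverse th)) \<and>
      hh_iso (hh_quot (poly_rep h (inverse th)) N) (twist_iota (V2n h th n)))"
proof (intro notI, elim exE conjE)
  fix N assume N: "hh_submodule N (poly_rep h (inverse th))"
    and iso: "hh_iso (hh_quot (poly_rep h (inverse th)) N) (twist_iota (V2n h th n))"
  interpret N: laurent_submodule h "inverse th" N
    using h_nz th_nz N by unfold_locales auto
  let ?V = "V2n h th n"
  interpret W: spherical_rep ?V "opX ?V" "opXinv ?V" "opT ?V" "rep_P th ?V" h th n "V.cs 1"
    using spherical_V2n by (simp add: spherical_def)
  have repV: "hh_rep h th ?V" using spherical_V2n by (simp add: spherical_def)
  interpret F: fd_triple ?V "opX ?V" "opXinv ?V" "opT ?V" "rep_P th ?V" h th n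
    by unfold_locales (rule W.vs W.act_delta_basis W.nontrivial)+
  interpret FD: fd_triple ?V W.Yi W.Y "opT ?V" "\<lambda>v. opX ?V (opT ?V v)" h th n by (rule F.dual_fd)
  have tw: "carrier (twist_iota ?V) = carrier ?V" "\<zero>\<^bsub>twist_iota ?V\<^esub> = \<zero>\<^bsub>?V\<^esub>" "opY (twist_iota ?V) = opY ?V"
    "c \<odot>\<^bsub>twist_iota ?V\<^esub> v = c \<odot>\<^bsub>?V\<^esub> v" for c v
    by (simp_all add: twist_iota_def)
  obtain \<phi> where hom: "\<phi> \<in> module_hom class_ring N.QR (twist_iota ?V)"
    and \<phi>: "bij_betw \<phi> (carrier N.QR) (carrier (twist_iota ?V)) \<and> (\<forall>v\<in>carrier N.QR.
      \<phi> (opX N.QR v) = opX (twist_iota ?V) (\<phi> v) \<and> \<phi> (opY N.QR v) = opY (twist_iota ?V) (\<phi> v) \<and>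
      \<phi> (opT N.QR v) = opT (twist_iota ?V) (\<phi> v))"
    using iso unfolding hh_iso_def by (elim bexE)
  have bij: "bij_betw \<phi> (carrier N.QR) (carrier ?V)" using \<phi> by (simp only: tw)
  have \<phi>Y: "\<phi> (opY N.QR v) = opY ?V (\<phi> v)" if "v \<in> carrier N.QR" for v using \<phi> that by (simp only: tw)
  have csQ: "N.cs f \<in> carrier N.QR" for f unfolding N.QR_simps by (rule rangeI)
  have sm: "\<phi> (c \<odot>\<^bsub>N.QR\<^esub> N.cs f) = c \<odot>\<^bsub>?V\<^esub> \<phi> (N.cs f)" for c f
    using module_hom_smult[OF hom, of c "N.cs f"] csQ by (simp add: tw)
  define w where "w = \<phi> (N.cs 1)"
  have w: "w \<in> carrier ?V" unfolding w_def by (rule bij_betw_apply[OF bij csQ])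
  have "opY_poly h (inverse th) 1 = cst (inverse th)" by (simp add: opY_poly_def)
  then have "opY N.QR (N.cs 1) = inverse th \<odot>\<^bsub>N.QR\<^esub> N.cs 1" by (simp add: N.QR_ops)
  then have "opY ?V w = inverse th \<odot>\<^bsub>?V\<^esub> w" unfolding w_def by (simp only: sm \<phi>Y[OF csQ, symmetric])
  then have Yw: "W.Y w = inverse th \<odot>\<^bsub>?V\<^esub> w"
    using hh_rep_triple(2)[OF repV h_nz th_nz w] by (simp add: W.Y_def)
  have Yiw: "W.Yi w = th \<odot>\<^bsub>?V\<^esub> w"
  proof -
    have "w = W.Yi (W.Y w)" by (rule FD.X_Xi[OF w, symmetric])
    also have "\<dots> = inverse th \<odot>\<^bsub>?V\<^esub> W.Yi w" unfolding Yw by (rule linear_op_smult[OF FD.X_lin w])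
    finally have e: "w = inverse th \<odot>\<^bsub>?V\<^esub> W.Yi w" .
    have "th \<odot>\<^bsub>?V\<^esub> (inverse th \<odot>\<^bsub>?V\<^esub> W.Yi w) = W.Yi w" using w th_nz by (simp add: W.sm_m FD.lin)
    then show ?thesis unfolding e[symmetric] by (rule sym)
  qed
  have actw: "FD.act f w = leval f th \<odot>\<^bsub>?V\<^esub> w" for f
  proof (induction f rule: laurent_mult_induct)
    case (cst c)
    then show ?case using w by (simp add: FD.act_cst)
  next
    case X
    then show ?case using w by (simp add: FD.act_XX Yiw)
  next
    case Xinv
    then show ?case using w by (simp add: FD.act_Xinv Yw power_int_minus)
  next
    case (add f g)
    then show ?case using w by (simp add: FD.act_add leval_add W.sm_l)
  next
    case (mult f g)
    then show ?case using w th_nz by (simp add: FD.act_mult leval_mult linear_op_smult[OF FD.act_lin] W.sm_m mult.commute)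
  qed
  have "vpoly S \<in> Ideal" using S_nz finite_S by (auto simp: Ideal_def leval_vpoly)
  then have "FD.act (vpoly S) w = \<zero>\<^bsub>?V\<^esub>" by (rule FD.act_Ideal[OF _ w])
  then have "leval (vpoly S) th \<odot>\<^bsub>?V\<^esub> w = \<zero>\<^bsub>?V\<^esub>" unfolding actw .
  moreover have "leval (vpoly S) th \<noteq> 0" using th_notin_S finite_S th_nz by (auto simp: leval_vpoly)
  ultimately have w0: "w = \<zero>\<^bsub>?V\<^esub>" using W.sm_cancel[OF w] by blast
  have \<phi>0: "\<phi> (N.cs 0) = \<zero>\<^bsub>?V\<^esub>"
    using sm[of 0 1] w by (simp add: N.QR_ops w_def)
  have "N.cs 1 = N.cs 0"
    by (rule inj_onD[OF bij_betw_imp_inj_on[OF bij] _ csQ csQ]) (simp only: \<phi>0 w0 w_def[symmetric])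
  then have one: "1 \<in> N" by (simp add: N.cs_eq)
  have mult: "f * g \<in> N" if "g \<in> N" for f g
    using that
  proof (induction f arbitrary: g rule: laurent_mult_induct)
    case (cst c)
    then show ?case by (rule N.closed(4))
  next
    case X
    then show ?case by (rule N.closed(5))
  next
    case Xinv
    then show ?case by (rule N.closed(6))
  next
    case (add f k)
    show ?case unfolding distrib_right by (rule N.closed(3)[OF add(1,2)[OF add(3)]])
  next
    case (mult f k)
    show ?case unfolding mult.assoc by (rule mult(1)[OF mult(2)[OF mult(3)]])
  qed
  have "V.cs 1 \<in> \<phi> ` carrier N.QR" unfolding bij_betw_imp_surj_on[OF bij] by (rule W.w)
  then obtain y where y: "V.cs 1 = \<phi> y" "y \<in> carrier N.QR" by (rule imageE)
  from y(2) obtain f where f: "y = N.cs f" unfolding N.QR_simps by (rule rangeE)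
  have "N.cs f = N.cs 0" using mult[OF one, of f] by (simp add: N.cs_eq)
  then have "V.cs 1 = \<zero>\<^bsub>?V\<^esub>" by (simp only: y(1) f \<phi>0)
  then show False using W.w_nonzero by (rule notE[rotated])
qed

end

section \<open>Functions on the support and the evaluation pairing\<close>

context complex_root
begin

text \<open>Injectivity is the definition of the ideal, surjectivity is interpolation.\<close>

lemma V2n_functions:
  "\<exists>\<phi>. mod_hom class_ring (V2n h th n) (ring.func_space (class_ring :: complex ring) S) \<phi> \<and>
     bij_betw \<phi> (carrier (V2n h th n)) (carrier (ring.func_space (class_ring :: complex ring) S)) \<and>
     (\<forall>f. \<phi> (Ideal +>\<^bsub>poly_rep h th\<^esub> f) = discretize S f)"
proof -
  have cr: "cring (class_ring :: complex ring)"
    by (rule domain.axioms(1)[OF field.axioms(1)[OF class_field]])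
  let ?F = "ring.func_space (class_ring :: complex ring) S"
  have F: "carrier ?F = S \<rightarrow>\<^sub>E UNIV" "a \<oplus>\<^bsub>?F\<^esub> b = restrict (\<lambda>x. a x + b x) S" "c \<odot>\<^bsub>?F\<^esub> a = restrict (\<lambda>x. c * a x) S"
    for a b and c :: complex
    by (simp_all add: ring.func_space_def[OF cring.axioms(1)[OF cr]])
  have leval_eq: "leval f x = leval g x" if "f - g \<in> Ideal" "x \<in> S" for f g x
    using that unfolding Ideal_def by (simp add: leval_diff)
  define \<phi> where "\<phi> A = discretize S (SOME f. f \<in> A)" for A
  have \<phi>: "\<phi> (V.cs f) = discretize S f" for f
  proof -
    have "(SOME g. g \<in> V.cs f) \<in> V.cs f" by (rule someI[of _ f]) (simp add: V.mem_cs V.I_0)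
    then have "(SOME g. g \<in> V.cs f) - f \<in> Ideal" by (simp only: V.mem_cs)
    then show ?thesis unfolding \<phi>_def discretize_def by (intro restrict_ext leval_eq)
  qed
  have inj: "V.cs f = V.cs g" if e: "discretize S f = discretize S g" for f g
  proof -
    have "leval f x = leval g x" if x: "x \<in> S" for x
    proof -
      have "discretize S f x = discretize S g x" by (simp only: e)
      then show ?thesis using x by (simp add: discretize_def)
    qed
    then show ?thesis unfolding V.cs_eq unfolding Ideal_def by (simp add: leval_diff)
  qed
  have "mod_hom class_ring V.QR ?F \<phi>"
  proof (intro mod_hom.intro mod_hom_axioms.intro)
    show "module class_ring V.QR" using V.vectorspace_QR by (simp add: vectorspace_def)
    show "module class_ring ?F" by (rule cring.func_space_is_module[OF cr])
    show "\<phi> \<in> module_hom class_ring V.QR ?F"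
    proof -
      have add: "\<phi> (a \<oplus>\<^bsub>V.QR\<^esub> b) = \<phi> a \<oplus>\<^bsub>?F\<^esub> \<phi> b" if ab: "a \<in> carrier V.QR" "b \<in> carrier V.QR" for a b
      proof -
        obtain f g where fg: "a = V.cs f" "b = V.cs g" using ab unfolding V.QR_simps by blast
        show ?thesis unfolding fg V.QR_simps \<phi> F discretize_def by (rule restrict_ext) (simp add: leval_add)
      qed
      have sm: "\<phi> (c \<odot>\<^bsub>V.QR\<^esub> a) = c \<odot>\<^bsub>?F\<^esub> \<phi> a" if a: "a \<in> carrier V.QR" for a c
      proof -
        obtain f where f: "a = V.cs f" using a unfolding V.QR_simps by blast
        show ?thesis unfolding f V.QR_ops \<phi> F discretize_def by (rule restrict_ext) (simp add: leval_mult S_nz)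
      qed
      have cl: "\<phi> a \<in> carrier ?F" if a: "a \<in> carrier V.QR" for a
      proof -
        obtain f where f: "a = V.cs f" using a unfolding V.QR_simps by blast
        show ?thesis unfolding f \<phi> F discretize_def by simp
      qed
      show ?thesis unfolding module_hom_def using add sm cl by (simp add: Pi_iff)
    qed
  qed
  moreover have "bij_betw \<phi> (carrier V.QR) (carrier ?F)"
    unfolding bij_betw_def
  proof
    show "inj_on \<phi> (carrier V.QR)"
    proof (rule inj_onI)
      fix a b assume ab: "a \<in> carrier V.QR" "b \<in> carrier V.QR" and e: "\<phi> a = \<phi> b"
      obtain f g where fg: "a = V.cs f" "b = V.cs g" using ab unfolding V.QR_simps by blast
      show "a = b" using e unfolding fg \<phi> by (rule inj)
    qed
    show "\<phi> ` carrier V.QR = carrier ?F"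
    proof
      show "\<phi> ` carrier V.QR \<subseteq> carrier ?F" by (auto simp: V.QR_simps \<phi> F discretize_def)
      show "carrier ?F \<subseteq> \<phi> ` carrier V.QR"
      proof
        fix a assume a: "a \<in> carrier ?F"
        define f where "f = (\<Sum>x\<in>S. cst (a x) * delta S x)"
        have "discretize S f x = a x" for x
          using a leval_interpolate[OF finite_S zero_S, of x a] by (auto simp: F discretize_def f_def PiE_def extensional_def)
        then have "a = \<phi> (V.cs f)" unfolding \<phi> by auto
        then show "a \<in> \<phi> ` carrier V.QR" by (simp add: V.QR_simps)
      qed
    qed
  qed
  ultimately show ?thesis using \<phi> unfolding V2n_eq by blast
qed

abbreviation "E f \<equiv> leval f (inverse th)"

text \<open>In \<open>(T f)(t\<^sup>-\<^sup>1\<^sup>/\<^sup>2)\<close> the terms with \<open>f(t\<^sup>1\<^sup>/\<^sup>2)\<close> cancel.\<close>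

lemma E_invariant: "E (opT_poly th f) = th * E f" "E (XX * f) = inverse th * E f" "E (cst c * f) = c * E f" "E (f + g) = E f + E g"
proof -
  show "E (opT_poly th f) = th * E f"
  proof -
    have sq: "(inverse th)\<^sup>2 - 1 \<noteq> 0" using S_square_ne(1)[OF inv_th_in_S(1)] by simp
    have si: "leval (subst_inv 1 f) (inverse th) = leval f th"
      using th_nz by (simp add: leval_subst_inv divide_inverse)
    have d: "((inverse th)\<^sup>2 - 1) * E (divdiff f) = leval f th - E f"
      using leval_divdiff[of "inverse th" f] th_nz by simp
    have "((inverse th)\<^sup>2 - 1) * E (opT_poly th f) =
        ((inverse th)\<^sup>2 - 1) * (th * leval f th) + (th - inverse th) * (((inverse th)\<^sup>2 - 1) * E (divdiff f))"
      using th_nz by (simp add: opT_poly_eq leval_hom si algebra_simps)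
    also have "\<dots> = ((inverse th)\<^sup>2 - 1) * (th * E f)"
      unfolding d using th_nz by (simp add: field_simps power2_eq_square)
    finally show ?thesis using sq by simp
  qed
qed (use th_nz in \<open>simp_all add: leval_hom\<close>)

lemma D_invariant: "D.invariant_functional E"
  unfolding D.invariant_functional_def using th_nz by (simp add: E_invariant)

lemma Ideal_E: "f \<in> Ideal \<Longrightarrow> E f = 0"
  using inv_th_in_S(1) by (auto simp: Ideal_def)

lemma D_act_Ideal:
  assumes f: "f \<in> Ideal" shows "D.act g f \<in> Ideal"
proof -
  have Yi: "Yi k \<in> Ideal" if "k \<in> Ideal" for k
    using sub_Ideal that unfolding hh_submodule_def by (auto simp flip: opYinv_PR)
  show ?thesis using f
  proof (induction g arbitrary: f rule: laurent_mult_induct)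
    case (add g g')
    show ?case using V.I_add[OF add(1,2)[OF add(3)]] by (simp add: D.act_add)
  next
    case (mult g g')
    show ?case using mult(1)[OF mult(2)[OF mult(3)]] by (simp add: D.act_mult)
  next
    case Xinv
    have e: "D.act (lmonom 1 (- 1)) f = Y f" by (rule D.act_Xinv) simp
    show ?case unfolding e unfolding Y_def by (intro Ideal_pi Ideal_T Xinv)
  qed (auto simp: D.act_cst D.act_XX Yi ideal_mult)
qed

text \<open>On the finite dimensional quotient \<open>V\<^sub>2\<^sub>n\<close> the operator \<open>Y\<inverse>\<close> has the same annihilator as \<open>X\<close>.\<close>

lemma Ideal_D_act:
  assumes f: "f \<in> Ideal" shows "D.act f g \<in> Ideal"
proof -
  let ?V = "V.QR"
  interpret W: spherical_rep ?V "opX ?V" "opXinv ?V" "opT ?V" "rep_P th ?V" h th n "V.cs 1"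
    using spherical_V2n by (simp add: spherical_def V2n_eq)
  interpret F: fd_triple ?V "opX ?V" "opXinv ?V" "opT ?V" "rep_P th ?V" h th n
    by unfold_locales (rule W.vs W.act_delta_basis W.nontrivial)+
  interpret FD: fd_triple ?V W.Yi W.Y "opT ?V" "\<lambda>v. opX ?V (opT ?V v)" h th n by (rule F.dual_fd)
  have m: "module (class_ring :: complex ring) ?V" using V.vectorspace_QR by (simp add: vectorspace_def)
  have 1: "FD.act f (V.cs g) = V.cs (D.act f g)"
    by (rule hecke_triple_image(2)[OF dual m, where T' = "opT ?V" and P' = "\<lambda>v. opX ?V (opT ?V v)"])
      (simp_all add: V.QR_simps V.QR_ops V.QR_rep W.Yi_def W.Ti_def Yi_def Ti_def W.Y_def Y_def)
  have 2: "FD.act f (V.cs g) = \<zero>\<^bsub>?V\<^esub>"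
    by (rule FD.act_Ideal[OF f]) (simp add: V.QR_simps)
  have "V.cs (D.act f g) = V.cs 0" using 1 2 unfolding V.QR_simps(2) by (rule trans[OF sym])
  then show ?thesis using V.cs_eq[of "D.act f g" 0] by simp
qed

lemma ev_pairing_eq: "ev_pairing h th f g = E (D.act f g)"
  by (simp add: ev_pairing_def eval_Yinv_eq)

text \<open>Evaluation at \<open>t\<^sup>-\<^sup>1\<^sup>/\<^sup>2\<close> is invariant for the dual triple, so the radical is a subrepresentation. It contains the ideal of \<open>S\<close> and does not contain \<open>1\<close>.\<close>

lemma right_radical_ev: "right_radical (ev_pairing h th) = Ideal"
proof -
  let ?R = "D.functional_radical E"
  have R: "g \<in> ?R \<longleftrightarrow> (\<forall>f. E (D.act f g) = 0)" for g by (simp add: D.functional_radical_def)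
  note closed = D.functional_radical_closed[OF D_invariant]
  have add: "f + g \<in> ?R" if "f \<in> ?R" "g \<in> ?R" for f g
    using that linear_op_add[OF D.act_lin, of f g] by (simp add: R E_invariant)
  have sm: "cst c * f \<in> ?R" if "f \<in> ?R" for c f using closed(1)[OF that, of "cst c"] by (simp add: D.act_cst)
  have Ti: "Ti f \<in> ?R" if "f \<in> ?R" for f
    using add[OF closed(2)[OF that] sm[OF that, of "- gam"]] by (simp add: Ti_def)
  have X: "XX * f \<in> ?R" if "f \<in> ?R" for f
    using closed(3)[OF Ti[OF that]] T_Ti[of f] by simp
  have Xi: "lmonom 1 (- 1) * f \<in> ?R" if "f \<in> ?R" for f
    using closed(2)[OF X[OF closed(2)[OF that]]] TXT[of f] by simp
  have "?R = Ideal \<or> ?R = UNIV"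
  proof (rule poly_quotient_irreducible)
    show "f + g \<in> ?R" if "f \<in> ?R" "g \<in> ?R" for f g using add that .
    show "opT_poly th f \<in> ?R" if "f \<in> ?R" for f using closed(2) that .
    show "subst_inv h f \<in> ?R" if "f \<in> ?R" for f
      using closed(1)[OF Ti[OF that], of "lmonom 1 (- 1)"] T_Ti[of f] by (simp add: D.act_Xinv Y_def)
    show "g * f \<in> ?R" if "f \<in> ?R" for f g
      using that
    proof (induction g arbitrary: f rule: laurent_mult_induct)
      case (add g g')
      show ?case unfolding distrib_right by (rule \<open>\<And>f g. f \<in> ?R \<Longrightarrow> g \<in> ?R \<Longrightarrow> f + g \<in> ?R\<close>[OF add(1,2)[OF add(3)]])
    next
      case (mult g g')
      show ?case unfolding mult.assoc by (rule mult(1)[OF mult(2)[OF mult(3)]])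
    qed (use sm X Xi in auto)
    show "Ideal \<subseteq> ?R" using D_act_Ideal Ideal_E by (auto simp: R)
  qed
  moreover have "1 \<notin> ?R"
  proof
    assume "1 \<in> ?R"
    then have "E (D.act 1 1) = 0" by (simp only: R)
    then show False by simp
  qed
  ultimately have "?R = Ideal" by (metis UNIV_I)
  moreover have "right_radical (ev_pairing h th) = ?R"
    unfolding right_radical_def ev_pairing_eq using R by blast
  ultimately show ?thesis by simp
qed

text \<open>The radical is stable under the operators of the polynomial representation because they can be moved to the other argument: \<open>\<pi>\<close> becomes \<open>X T\<close>, up to invariance of the evaluation, and \<open>T\<close> becomes \<open>T\<close>.\<close>

lemma left_radical_ev: "left_radical (ev_pairing h th) = Ideal"
proof -
  define R where "R = left_radical (ev_pairing h th)"
  have R: "f \<in> R \<longleftrightarrow> (\<forall>g. E (D.act f g) = 0)" for f by (simp add: R_def left_radical_def ev_pairing_eq)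
  have "R = Ideal \<or> R = UNIV"
  proof (rule poly_quotient_irreducible)
    show "f + g \<in> R" if "f \<in> R" "g \<in> R" for f g using that by (simp add: R D.act_add E_invariant)
    show "g * f \<in> R" if "f \<in> R" for f g
    proof -
      have "D.act (g * f) k = D.act f (D.act g k)" for k
        unfolding mult.commute[of g f] by (rule D.act_mult) simp
      then show ?thesis using that by (simp add: R)
    qed
    show "opT_poly th f \<in> R" if "f \<in> R" for f
      unfolding R
    proof
      fix k
      have "E (D.act (opT_poly th f) k) = th * E (D.act (subst_inv 1 f) k) + gam * E (D.act (divdiff f) k)"
        by (simp add: opT_poly_eq D.act_add D.act_cst_mult E_invariant)
      also have "\<dots> = E (D.act f (opT_poly th k))"
        using D.act_T[of k f] by (simp add: E_invariant)
      also have "\<dots> = 0" using that by (simp add: R)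
      finally show "E (D.act (opT_poly th f) k) = 0" .
    qed
    show "subst_inv h f \<in> R" if "f \<in> R" for f
      unfolding R
    proof
      fix k
      let ?P = "\<lambda>v. XX * opT_poly th v"
      have "D.act (subst_inv h f) k = D.act (subst_inv h f) (?P (?P k))" using D.PP[of k] by simp
      also have "\<dots> = ?P (D.act f (?P k))" using D.P_act[of "?P k" f] by simp
      also have "E \<dots> = E (D.act f (?P k))" using th_nz by (simp add: E_invariant)
      also have "\<dots> = 0" using that by (simp add: R)
      finally show "E (D.act (subst_inv h f) k) = 0" .
    qed
    show "Ideal \<subseteq> R" using Ideal_D_act Ideal_E by (auto simp: R)
  qed
  moreover have "1 \<notin> R"
  proof
    assume "1 \<in> R"
    then have "E (D.act 1 1) = 0" by (simp only: R)
    then show False by simp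
  qed
  ultimately show ?thesis by (auto simp: R_def)
qed

end

section \<open>The pairing for formal \<open>q\<close>\<close>

text \<open>An involution that inverts \<open>q\<^sup>1\<^sup>/\<^sup>2\<close> also inverts \<open>t = - q\<^sup>-\<^sup>n\<^sup>/\<^sup>2\<close>, as the bar in the pairing should.\<close>

locale bar_params = root_params h th n for h th :: "'k::field" and n +
  fixes \<sigma> assumes bar: "is_bar h \<sigma>"
begin

lemma bar_1 [simp]: "\<sigma> 1 = 1" and bar_add: "\<sigma> (a + b) = \<sigma> a + \<sigma> b" and bar_mult: "\<sigma> (a * b) = \<sigma> a * \<sigma> b"
  and bar_bar [simp]: "\<sigma> (\<sigma> a) = a" and bar_h: "\<sigma> h = inverse h"
  using bar by (simp_all add: is_bar_def)

lemma bar_0 [simp]: "\<sigma> 0 = 0"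
proof -
  have "\<sigma> 0 + \<sigma> 0 = \<sigma> 0" using bar_add[of 0 0] by (simp only: add_0_left)
  then show ?thesis by (simp only: add_cancel_left_left)
qed

lemma bar_uminus: "\<sigma> (- a) = - \<sigma> a"
  using bar_add[of a "- a"] by (simp add: eq_neg_iff_add_eq_0 add.commute)

lemma bar_inverse: "\<sigma> (inverse a) = inverse (\<sigma> a)"
proof (cases "a = 0")
  case False
  then have "\<sigma> (inverse a) * \<sigma> a = 1" by (simp flip: bar_mult)
  then show ?thesis by (metis inverse_unique mult.commute)
qed simp

lemma bar_power: "\<sigma> (a ^ k) = \<sigma> a ^ k"
  by (induction k) (simp_all add: bar_mult)

lemma bar_powi: "\<sigma> (a powi k) = \<sigma> a powi k"
  by (simp add: power_int_def bar_power bar_inverse)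

lemma bar_t: "\<sigma> t = inverse t"
  by (simp add: th2 bar_uminus bar_inverse bar_power bar_h power_inverse)

lemma lbar_single [simp]: "lbar \<sigma> (lmonom c m) = lmonom (\<sigma> c) (- m)"
  by (cases "c = 0") (simp_all add: lbar_def)

lemma lbar_add: "lbar \<sigma> (f + g) = lbar \<sigma> f + lbar \<sigma> g"
  unfolding lbar_def by (rule setsum_keys_plus_distrib) (simp_all add: bar_add single_add)

lemma lbar_0 [simp]: "lbar \<sigma> 0 = 0" by (simp add: lbar_def)

lemma lbar_uminus: "lbar \<sigma> (- f) = - lbar \<sigma> f"
  using lbar_add[of f "- f"] by (simp add: eq_neg_iff_add_eq_0 add.commute)

lemma lbar_diff: "lbar \<sigma> (f - g) = lbar \<sigma> f - lbar \<sigma> g"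
  using lbar_add[of f "- g"] by (simp add: lbar_uminus)

lemma lbar_lbar [simp]: "lbar \<sigma> (lbar \<sigma> f) = f"
proof (induction f rule: laurent_induct)
  case (add f g)
  then show ?case by (simp add: lbar_add)
qed simp

lemma leval_lbar:
  assumes x: "x \<noteq> 0" shows "leval (lbar \<sigma> f) x = \<sigma> (leval f (inverse (\<sigma> x)))"
proof (induction f rule: laurent_induct)
  case (add f g)
  then show ?case by (simp add: lbar_add leval_add bar_add)
next
  case (monom c m)
  then show ?case by (simp add: bar_mult bar_powi bar_inverse power_int_minus power_int_inverse)
qed

text \<open>From \<open>\<sigma>(t) = t\<inverse>\<close> it follows that \<open>\<sigma>(t\<^sup>1\<^sup>/\<^sup>2) = \<plusminus>t\<^sup>-\<^sup>1\<^sup>/\<^sup>2\<close>, and \<open>S\<close> is symmetric under \<open>x \<mapsto> - x\<close>.\<close>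

lemma bar_S: assumes x: "x \<in> S" shows "inverse (\<sigma> x) \<in> S"
proof -
  have "(\<sigma> th * th)\<^sup>2 = \<sigma> t * t" by (simp add: power_mult_distrib bar_power)
  also have "\<dots> = 1" using th_nz by (simp add: bar_t)
  finally have "\<sigma> th * th = 1 \<or> \<sigma> th * (- th) = 1" by (auto simp: power2_eq_1_iff)
  then have s: "inverse (\<sigma> th) = th \<or> inverse (\<sigma> th) = - th"
    using inverse_unique by blast
  obtain j s' where xj: "j \<in> {1..n}" "s' = 1 \<or> s' = - 1" "x = s' * (th * h ^ j)"
    by (rule S_cases[OF x]) blast
  have "inverse (\<sigma> x) = s' * (inverse (\<sigma> th) * h ^ j)"
    using xj(2) by (auto simp: xj(3) bar_mult bar_power bar_h bar_uminus power_inverse)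
  moreover have "s' * (inverse (\<sigma> th) * h ^ j) = s' * (th * h ^ j) \<or> s' * (inverse (\<sigma> th) * h ^ j) = (- s') * (th * h ^ j)"
    using s by auto
  moreover have "s' * (th * h ^ j) \<in> S" by (rule S_I'[OF xj(1,2)])
  moreover have "- s' * (th * h ^ j) \<in> S" by (rule S_I'[OF xj(1)]) (use xj(2) in auto)
  ultimately show ?thesis by metis
qed

lemma lbar_Ideal: "lbar \<sigma> f \<in> Ideal \<longleftrightarrow> f \<in> Ideal"
proof -
  have "lbar \<sigma> f \<in> Ideal" if "f \<in> Ideal" for f
    using that bar_S S_nz by (auto simp: Ideal_def leval_lbar)
  from this[of f] this[of "lbar \<sigma> f"] show ?thesis by auto
qed

abbreviation "B \<equiv> mu_pairing \<sigma> q t"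

lemma B_eq: "B f g = const_term (mu_weight q t) (f * lbar \<sigma> g)"
  by (simp add: mu_pairing_def qt.specialize_mu0)

lemma left_radical_B: "left_radical B = Ideal"
proof -
  have "(\<forall>g. B f g = 0) \<longleftrightarrow> (\<forall>g. const_term (mu_weight q t) (f * g) = 0)" for f
    unfolding B_eq by (metis lbar_lbar)
  then show ?thesis by (simp add: left_radical_def const_term_radical)
qed

lemma right_radical_B: "right_radical B = Ideal"
proof -
  have "(\<forall>f. B f g = 0) \<longleftrightarrow> lbar \<sigma> g \<in> Ideal" for g
    unfolding B_eq const_term_radical[symmetric] by (simp only: mult.commute)
  then show ?thesis by (simp add: right_radical_def lbar_Ideal)
qed

lemma B_cong: assumes "f - f' \<in> Ideal" "g - g' \<in> Ideal" shows "B f g = B f' g'"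
proof -
  have "B f g - B f' g = B (f - f') g" by (simp add: B_eq left_diff_distrib const_term_diff)
  also have "\<dots> = 0" using assms(1) by (auto simp: left_radical_def simp flip: left_radical_B)
  finally have 1: "B f g = B f' g" by simp
  have "B f' g - B f' g' = B f' (g - g')" by (simp add: B_eq lbar_diff right_diff_distrib const_term_diff)
  also have "\<dots> = 0" using assms(2) by (auto simp: right_radical_def simp flip: right_radical_B)
  finally show ?thesis using 1 by simp
qed

text \<open>Expand the second argument. By orthogonality only its leading monomial contributes.\<close>

lemma B_norm: "B (e_poly q t m) (e_poly q t m) = qt.enorm (qt.e_level m)"
proof -
  define e where "e = e_explicit q t m"
  have lb: "lbar \<sigma> e = (\<Sum>k\<in>Poly_Mapping.keys e. cst (\<sigma> (lcoeff e k)) * lmonom 1 (- k))"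
    unfolding lbar_def by (simp add: mult_single)
  have "B e e = (\<Sum>k\<in>Poly_Mapping.keys e. \<sigma> (lcoeff e k) * const_term (mu_weight q t) (e * lmonom 1 (- k)))"
    unfolding B_eq lb by (simp add: sum_distrib_left mult.left_commute[of e] const_term_sum const_term_cst_mult)
  also have "\<dots> = (\<Sum>k\<in>Poly_Mapping.keys e. if k = m then qt.enorm (qt.e_level m) else 0)"
  proof (rule sum.cong)
    fix k assume k: "k \<in> Poly_Mapping.keys e"
    then have "k = m \<or> prec k m" using qt.e_explicit_support[of m k] by (simp add: e_def in_keys_iff)
    then show "\<sigma> (lcoeff e k) * const_term (mu_weight q t) (e * lmonom 1 (- k)) = (if k = m then qt.enorm (qt.e_level m) else 0)"
      using qt.e_explicit_orth[of k m] qt.e_explicit_norm[of m] qt.e_explicit_top[of m] by (auto simp: e_def)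
  qed simp
  also have "\<dots> = qt.enorm (qt.e_level m)"
    using qt.e_explicit_top[of m] by (simp add: e_def in_keys_iff)
  finally show ?thesis by (simp add: qt.e_poly_eq e_def)
qed

lemma B_norm_nz: "B (e_poly q t m) (e_poly q t m) \<noteq> 0 \<longleftrightarrow> m \<in> {- int n + 1..int n}"
  by (simp only: B_norm enorm_nz e_level_less)

end

text \<open>The element \<open>q\<^sup>1\<^sup>/\<^sup>4\<close> is transcendental, hence \<open>q\<close> is not a root of unity.\<close>

lemma formal_root_params:
  assumes "n > 0" "th\<^sup>2 = - inverse (formal_qh ^ n)"
  shows "root_params formal_qh th n"
proof
  let ?x = "to_fract [:0, 1:] :: formal_field"
  show "formal_qh \<noteq> 0" by (simp add: formal_qh_def)
  show "(formal_qh\<^sup>2) ^ k \<noteq> 1" if "k > 0" for k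
  proof
    have pw: "to_fract p ^ i = to_fract (p ^ i)" for p :: "complex poly" and i by (induction i) simp_all
    assume "(formal_qh\<^sup>2) ^ k = 1"
    then have "to_fract ([:0, 1:] ^ (4 * k)) = to_fract (1 :: complex poly)"
      by (simp add: formal_qh_def flip: power_mult pw)
    then have "[:0, 1:] ^ (4 * k) = (1 :: complex poly)" unfolding to_fract_eq_iff .
    then have "poly ([:0, 1:] ^ (4 * k)) 0 = poly (1 :: complex poly) 0" by (rule arg_cong)
    then show False using that by (simp add: power_0_left)
  qed
  show "(1 :: formal_field) \<noteq> - 1"
  proof
    assume "(1 :: formal_field) = - 1"
    then have "to_fract (1 :: complex poly) = to_fract (- 1)" by (simp only: to_fract_1 to_fract_uminus)
    then have "(1 :: complex poly) = - 1" unfolding to_fract_eq_iff .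
    then have "poly 1 0 = poly (- 1 :: complex poly) 0" by (rule arg_cong)
    then show False by simp
  qed
qed (fact assms)+

lemma parameters_of_representation:
  fixes M :: "'v hh_module"
  assumes "h \<noteq> 0" "\<And>k::nat. k > 0 \<Longrightarrow> (h\<^sup>2) ^ k \<noteq> 1" "th \<noteq> 0"
    and M: "hh_rep h th M" "hh_fin_dim M" "carrier M \<noteq> {\<zero>\<^bsub>M\<^esub>}"
  shows "(\<exists>m::nat. th\<^sup>2 = h ^ (2 * m + 1) \<or> th\<^sup>2 = inverse (h ^ (2 * m + 1))) \<or>
         (\<exists>n::nat. n > 0 \<and> (th\<^sup>2 = - (h ^ n) \<or> th\<^sup>2 = - inverse (h ^ n)))"
proof -
  interpret H: hecke_triple M "opX M" "opXinv M" "opT M" "rep_P th M" h th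
    by (rule hh_rep_triple(1)[OF M(1) assms(1,3)])
  have "vectorspace (class_ring :: complex ring) M" using M(1) by (simp add: hh_rep_def)
  then obtain f where f: "f \<noteq> 0" "\<forall>v\<in>carrier M. H.act f v = \<zero>\<^bsub>M\<^esub>"
    using H.common_annihilator[OF _ M(2)] by blast
  then have "f \<in> H.ann" unfolding H.ann_def by blast
  then have nz: "\<exists>f\<in>H.ann. f \<noteq> 0" using f(1) by blast
  show ?thesis
    by (rule annihilator.parameter_cases[OF H.annihilator_ann[OF assms(2) nz M(3)]])
qed

lemma indecomposable_properties:
  fixes M :: "'v hh_module"
  assumes rp: "root_params h th n" and M: "fd_indecomposable_rep h th M"
  shows "hh_dim M = 2 * n \<and> hh_irreducible M \<and> hh_iso (twist_x M) M \<and> hh_iso (twist_y M) M"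
proof -
  obtain w where w: "spherical h th n M w" using indecomposable_spherical[OF rp M] by blast
  interpret S: spherical_rep M "opX M" "opXinv M" "opT M" "rep_P th M" h th n w using w by (simp add: spherical_def)
  have rep: "hh_rep h th M" using w by (simp add: spherical_def)
  have Y: "opY M v \<in> carrier M" if v: "v \<in> carrier M" for v
    unfolding hh_rep_triple(2)[OF rep S.h_nz S.th_nz v, symmetric]
    by (rule linear_op_closed[OF S.P_lin linear_op_closed[OF S.T_lin v]])
  have iso: "hh_iso N M" if N: "fd_indecomposable_rep h th N" for N :: "'v hh_module"
  proof -
    obtain w' where "spherical h th n N w'" using indecomposable_spherical[OF rp N] by blast
    then show ?thesis using w by (rule spherical_iso)
  qed
  have "fd_indecomposable_rep h th (twist_x M)"
    by (rule twist_spherical[OF w, where a = "- 1" and b = 1 and c = 1])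
      (simp_all add: twist_x_def S.sm_neg S.lin Y S.th_nz)
  moreover have "fd_indecomposable_rep h th (twist_y M)"
    by (rule twist_spherical[OF w, where a = 1 and b = "- 1" and c = 1])
      (simp_all add: twist_y_def S.sm_neg S.lin Y S.th_nz)
  ultimately show ?thesis
    using spherical_fd_indecomposable(2)[OF w] spherical_irreducible[OF w] iso by blast
qed

lemma indecomposable_unique:
  assumes rp: "root_params h th n" and M: "fd_indecomposable_rep h th M" and N: "fd_indecomposable_rep h th N"
  shows "hh_iso M N"
proof -
  obtain w where w: "spherical h th n M w" using indecomposable_spherical[OF rp M] by blast
  obtain w' where "spherical h th n N w'" using indecomposable_spherical[OF rp N] by blast
  with w show ?thesis by (rule spherical_iso)
qed

lemma iota_V2n_rep:
  fixes h th :: complex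
  assumes rp: "root_params h th n"
  shows "hh_rep h (inverse th) (twist_iota (V2n h th n))"
proof -
  interpret C: complex_root h th n by (rule complex_root.intro[OF rp])
  let ?V = "V2n h th n"
  have rep: "hh_rep h th ?V" using C.spherical_V2n by (simp add: spherical_def)
  interpret S: spherical_rep ?V "opX ?V" "opXinv ?V" "opT ?V" "rep_P th ?V" h th n "C.V.cs 1"
    using C.spherical_V2n by (simp add: spherical_def)
  have Y: "opY ?V v \<in> carrier ?V" if v: "v \<in> carrier ?V" for v
    unfolding hh_rep_triple(2)[OF rep C.h_nz C.th_nz v, symmetric]
    by (rule linear_op_closed[OF S.P_lin linear_op_closed[OF S.T_lin v]])
  show ?thesis
    by (rule twist_rep(1)[OF rep C.h_nz C.th_nz, where a = 1 and b = "- 1" and c = "- 1"])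
      (simp_all add: twist_iota_def S.sm_neg S.lin Y C.th_nz)
qed

text \<open>Replacing \<open>t\<^sup>1\<^sup>/\<^sup>2\<close> by \<open>- t\<^sup>-\<^sup>1\<^sup>/\<^sup>2\<close> exchanges the two signs of the exponent.\<close>

lemma twisted_root_params:
  fixes h th :: complex
  assumes h: "h \<noteq> 0" "\<And>k::nat. k > 0 \<Longrightarrow> (h\<^sup>2) ^ k \<noteq> 1" and n: "n > 0"
    and th: "th\<^sup>2 = - (h ^ n) \<or> th\<^sup>2 = - inverse (h ^ n)"
  shows "\<exists>th'. root_params h th' n \<and> (th' = th \<or> th' = - inverse th)"
proof -
  have rp: "root_params h u n" if "u\<^sup>2 = - inverse (h ^ n)" for u :: complex
    by unfold_locales (use h n that in auto)
  from th show ?thesis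
  proof
    assume "th\<^sup>2 = - (h ^ n)"
    then have "(- inverse th)\<^sup>2 = - inverse (h ^ n)" by (simp add: power_inverse)
    then show ?thesis using rp by blast
  qed (use rp in blast)
qed

lemma change_sign_iff:
  assumes "h \<noteq> 0" "th \<noteq> 0" "th' = th \<or> th' = - inverse th"
  shows "fd_indecomposable_rep h th M \<longleftrightarrow> fd_indecomposable_rep h th' M"
  using change_sign_of_th[of h th M] change_sign_of_th[of h "- inverse th" M] assms by auto

theorem theorem8p2:
  fixes qh :: complex
  assumes "qh \<noteq> 0"
    and q_not_root_of_unity: "\<forall>k::nat. k > 0 \<longrightarrow> (qh\<^sup>2) ^ k \<noteq> 1"
  shows
    \<comment> \<open>(i)\<close>
    "(\<forall>th. th \<noteq> 0 \<and>
        (\<exists>M :: 'v hh_module. hh_rep qh th M \<and> hh_fin_dim M \<and> carrier M \<noteq> {\<zero>\<^bsub>M\<^esub>}) \<longrightarrow>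
        (\<exists>m::nat. th\<^sup>2 = qh ^ (2 * m + 1) \<or> th\<^sup>2 = inverse (qh ^ (2 * m + 1))) \<or>
        (\<exists>n::nat. n > 0 \<and> (th\<^sup>2 = - (qh ^ n) \<or> th\<^sup>2 = - inverse (qh ^ n)))) \<and>
     (\<forall>(n::nat) th. n > 0 \<and> (th\<^sup>2 = - (qh ^ n) \<or> th\<^sup>2 = - inverse (qh ^ n)) \<longrightarrow>
        (\<exists>M :: complex laurent set hh_module. fd_indecomposable_rep qh th M) \<and>
        (\<forall>(M :: 'v hh_module) (N :: 'w hh_module).
           fd_indecomposable_rep qh th M \<and> fd_indecomposable_rep qh th N \<longrightarrow> hh_iso M N) \<and>
        (\<forall>M :: 'v hh_module. fd_indecomposable_rep qh th M \<longrightarrow>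
           hh_dim M = 2 * n \<and> hh_irreducible M \<and>
           hh_iso (twist_x M) M \<and> hh_iso (twist_y M) M)) \<and>
     (\<forall>(n::nat) th. n > 0 \<and> th\<^sup>2 = - inverse (qh ^ n) \<longrightarrow>
        e_regular (qh\<^sup>2) (th\<^sup>2) (- int n) \<and>
        hh_submodule (principal_ideal (e_poly (qh\<^sup>2) (th\<^sup>2) (- int n))) (poly_rep qh th) \<and>
        fd_indecomposable_rep qh th (V2n qh th n) \<and>
        (\<forall>M :: 'v hh_module. fd_indecomposable_rep qh th M \<longrightarrow> hh_iso M (V2n qh th n)) \<and>
        hh_rep qh (inverse th) (twist_iota (V2n qh th n)) \<and>
        \<not> (\<exists>N. hh_submodule N (poly_rep qh (inverse th)) \<and>
               hh_iso (hh_quot (poly_rep qh (inverse th)) N) (twist_iota (V2n qh th n)))) \<and>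

     \<comment> \<open>(ii), the part not involving the pairing, for complex \<open>q\<close>\<close>
     (\<forall>(n::nat) th. n > 0 \<and> th\<^sup>2 = - inverse (qh ^ n) \<longrightarrow>
        (\<forall>k. regular_at (qh\<^sup>2) (th\<^sup>2) (mu0 k)) \<and>
        (\<forall>m. e_regular (qh\<^sup>2) (th\<^sup>2) m) \<and>
        (\<forall>m. leval (e_poly (qh\<^sup>2) (th\<^sup>2) m) (inverse th) \<noteq> 0 \<longleftrightarrow> m \<in> {- int n + 1..int n})) \<and>

     \<comment> \<open>(ii) for formal \<open>q\<close>\<close>
     (\<forall>(n::nat) (th :: formal_field) \<sigma>.
        n > 0 \<and> th\<^sup>2 = - inverse (formal_qh ^ n) \<and> is_bar formal_qh \<sigma> \<longrightarrow>
        (let q = formal_qh\<^sup>2; t = th\<^sup>2; B = mu_pairing \<sigma> q t;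
             I = principal_ideal (e_poly q t (- int n))
         in (\<forall>k. regular_at q t (mu0 k)) \<and> \<sigma> t = inverse t \<and>
            (\<forall>m. e_regular q t m) \<and>
            (\<forall>m. leval (e_poly q t m) (inverse th) \<noteq> 0 \<longleftrightarrow> m \<in> {- int n + 1..int n}) \<and>
            (\<forall>m. B (e_poly q t m) (e_poly q t m) \<noteq> 0 \<longleftrightarrow> m \<in> {- int n + 1..int n}) \<and>
            left_radical B = I \<and> right_radical B = I \<and>
            (\<forall>f f' g g'. f - f' \<in> I \<and> g - g' \<in> I \<longrightarrow> B f g = B f' g'))) \<and>

     \<comment> \<open>(iii)\<close>
     (\<forall>(n::nat) th. n > 0 \<and> th\<^sup>2 = - inverse (qh ^ n) \<longrightarrow>
        (let S = disc_set qh th n; I = principal_ideal (e_poly (qh\<^sup>2) (th\<^sup>2) (- int n));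
             F = ring.func_space (class_ring :: complex ring) S
         in (\<exists>\<phi>. mod_hom class_ring (V2n qh th n) F \<phi> \<and>
                 bij_betw \<phi> (carrier (V2n qh th n)) (carrier F) \<and>
                 (\<forall>f. \<phi> (I +>\<^bsub>poly_rep qh th\<^esub> f) = discretize S f)) \<and>
            {f. \<forall>x\<in>S. leval f x = 0} = I \<and>
            left_radical (ev_pairing qh th) = I \<and> right_radical (ev_pairing qh th) = I))"
proof (intro conjI, goal_cases)
  have q: "(qh\<^sup>2) ^ k \<noteq> 1" if "k > 0" for k :: nat using q_not_root_of_unity that by blast
  have rp: "root_params qh th n" if "n > 0" "th\<^sup>2 = - inverse (qh ^ n)" for th n
    by unfold_locales (use assms(1) q that in auto)
  {
    case 1
    show ?case
    proof (intro allI impI, elim conjE exE, goal_cases)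
      case (1 th M)
      show ?case by (rule parameters_of_representation[OF assms(1) q 1])
    qed
  next
    case 2
    show ?case
    proof (intro allI impI, elim conjE, goal_cases)
      case (1 n th)
      obtain th' where rp': "root_params qh th' n" and th': "th' = th \<or> th' = - inverse th"
        using twisted_root_params[OF assms(1) q 1] by blast
      have "th \<noteq> 0" using 1 assms(1) by auto
      note iff = change_sign_iff[OF assms(1) this th']
      have "fd_indecomposable_rep qh th' (V2n qh th' n)"
        by (rule spherical_fd_indecomposable(1)[OF complex_root.spherical_V2n[OF complex_root.intro[OF rp']]])
      then show ?case unfolding iff
        using indecomposable_unique[OF rp'] indecomposable_properties[OF rp'] by blast
    qed
  next
    case 3
    show ?case
    proof (intro allI impI, elim conjE, goal_cases)
      case (1 n th)
      interpret C: complex_root qh th n by (rule complex_root.intro[OF rp[OF 1]])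
      have V: "fd_indecomposable_rep qh th (V2n qh th n)"
        by (rule spherical_fd_indecomposable(1)[OF C.spherical_V2n])
      show ?case
        unfolding C.principal_ideal_e
        by (intro conjI allI impI C.qt.e_regular C.sub_Ideal V iota_V2n_rep[OF rp[OF 1]] C.V2n_iota_not_quotient)
          (rule indecomposable_unique[OF rp[OF 1] _ V])
    qed
  next
    case 4
    show ?case
    proof (intro allI impI, elim conjE, goal_cases)
      case (1 n th)
      interpret C: complex_root qh th n by (rule complex_root.intro[OF rp[OF 1]])
      show ?case by (intro conjI allI C.qt.mu0_regular C.qt.e_regular C.e_poly_value)
    qed
  next
    case 5
    show ?case
    proof (intro allI impI, elim conjE, goal_cases)
      case (1 n th \<sigma>)
      interpret B: bar_params formal_qh th n \<sigma>
        by (intro bar_params.intro formal_root_params bar_params_axioms.intro 1)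
      show ?case
        unfolding Let_def B.principal_ideal_e
        by (intro conjI allI impI B.qt.mu0_regular B.bar_t B.qt.e_regular B.e_poly_value B.B_norm_nz
            B.left_radical_B B.right_radical_B, elim conjE) (rule B.B_cong)
    qed
  next
    case 6
    show ?case
    proof (intro allI impI, elim conjE, goal_cases)
      case (1 n th)
      interpret C: complex_root qh th n by (rule complex_root.intro[OF rp[OF 1]])
      show ?case
        unfolding Let_def C.principal_ideal_e
        by (intro conjI C.V2n_functions C.left_radical_ev C.right_radical_ev C.Ideal_def[symmetric])
    qed
  }
qed

end
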